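(* Let $\mathfrak g$ be a simple Lie algebra, $\alpha\in\Pi$ a simple root and $m=\dim\mathfrak g_\alpha(1)$. Suppose that $\mathfrak g_\alpha(1)$ has an abelian subspace of half-dimension, i.e. there is a subspace $\mathfrak a\subset\mathfrak g_\alpha(1)$ with $[\mathfrak a,\mathfrak a]=0$ and $\dim\mathfrak a=m/2$. Let $k$ be an integer with $0\le k\le m/2$. Then $$\delta_\alpha(k)=k\gamma_\alpha(1)\qquad\text{and}\qquad \delta_\alpha(m-k)=k\gamma_\alpha(1)+(m-2k)\frac{q_\alpha(1)}{2h^*r_\alpha}.$$
   Context: The ground field $\Bbbk$ is algebraically closed of characteristic $0$. $\mathfrak g$ is a simple Lie algebra with Killing form $\Phi$, Cartan subalgebra $\mathfrak t$, root system $\Delta$, positive roots $\Delta^+$, simple roots $\Pi$, highest root $\theta$. $(\ ,\ )$ is the bilinear form on $\mathfrak t^*$ induced by $\Phi|_{\mathfrak t}$. $\varphi_\alpha$ is the fundamental weight corresponding to $\alpha\in\Pi$. $h^*$ is the dual Coxeter number of $\mathfrak g$ (so $(\theta,\theta)=1/h^*$), and $r_\alpha=(\theta,\theta)/(\alpha,\alpha)$. For $\gamma=\sum_{\beta\in\Pi}n_\beta\beta$ put $\mathsf{ht}_\alpha(\gamma)=n_\alpha$ and $\Delta_\alpha(i)=\{\gamma\in\Delta\mid \mathsf{ht}_\alpha(\gamma)=i\}$. The $(\mathbb Z,\alpha)$-grading is $\mathfrak g=\bigoplus_{i}\mathfrak g_\alpha(i)$ with $\mathfrak g_\alpha(0)=\mathfrak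 t\oplus\bigoplus_{\gamma\in\Delta_\alpha(0)}\mathfrak g^\gamma$ and $\mathfrak g_\alpha(i)=\bigoplus_{\gamma\in\Delta_\alpha(i)}\mathfrak g^\gamma$ for $i\ne0$, where $\mathfrak g^\gamma$ is the root space. Each nonzero $\mathfrak g_\alpha(i)$, $i\neq 0$, is a simple $\mathfrak g_\alpha(0)$-module. $\mathcal C_\alpha(0)=\sum_j e_j'e_j\in\mathcal U(\mathfrak g_\alpha(0))$ is the Casimir element, where $\{e_j\},\{e'_j\}$ are bases of $\mathfrak g_\alpha(0)$ dual with respect to $\Phi|_{\mathfrak g_\alpha(0)}$; $\gamma_\alpha(1)$ is the scalar by which it acts on $\mathfrak g_\alpha(1)$, and $\delta_\alpha(k)$ is the maximal eigenvalue of $\mathcal C_\alpha(0)$ in $\bigwedge^k\mathfrak g_\alpha(1)$ (with $\delta_\alpha(0)=0$). The integer $q_\alpha(1)$ is defined by $\sum_{\gamma\in\Delta_\alpha(1)}\gamma=q_\alpha(1)\varphi_\alpha$. *)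

theory Defs
  imports
    Complex_Main
    "HOL-Library.Function_Algebras"
    "HOL-Library.Poly_Mapping"
    "HOL-Computational_Algebra.Polynomial"
begin

section \<open>Two auxiliary vector spaces\<close>

text \<open>Scalar-valued functions with pointwise operations; linear forms on a subspace \<open>H\<close> live
  here as functions that vanish outside \<open>H\<close>.\<close>

definition fun_scale :: "'k::field \<Rightarrow> ('v \<Rightarrow> 'k) \<Rightarrow> 'v \<Rightarrow> 'k" where
  "fun_scale c f = (\<lambda>x. c * f x)"

interpretation fun_space: vector_space fun_scale
  by standard (auto simp: fun_scale_def algebra_simps)

text \<open>The free vector space on words (lists).\<close>

definition free_scale :: "'k::field \<Rightarrow> ('v list \<Rightarrow>\<^sub>0 'k) \<Rightarrow> ('v list \<Rightarrow>\<^sub>0 'k)" where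
  "free_scale c p = Poly_Mapping.map (\<lambda>a. c * a) p"

lemma lookup_free_scale: "Poly_Mapping.lookup (free_scale c p) w = c * Poly_Mapping.lookup p w"
  by (simp add: free_scale_def Poly_Mapping.map.rep_eq when_def)

interpretation free_space: vector_space free_scale
  by standard (rule poly_mapping_eqI,
      simp add: lookup_free_scale Poly_Mapping.lookup_add algebra_simps)+

abbreviation word :: "'v list \<Rightarrow> ('v list \<Rightarrow>\<^sub>0 'k::field)" where
  "word w \<equiv> Poly_Mapping.single w 1"

definition free_extend ::
    "('v list \<Rightarrow> ('v list \<Rightarrow>\<^sub>0 'k::field)) \<Rightarrow> ('v list \<Rightarrow>\<^sub>0 'k) \<Rightarrow> ('v list \<Rightarrow>\<^sub>0 'k)" where
  "free_extend g p = (\<Sum>w\<in>Poly_Mapping.keys p. free_scale (Poly_Mapping.lookup p w) (g w))"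

section \<open>Lie algebras\<close>

locale lie_algebra = vector_space scale
  for scale :: "'k::field \<Rightarrow> 'v::ab_group_add \<Rightarrow> 'v" +
  fixes br :: "'v \<Rightarrow> 'v \<Rightarrow> 'v"
  assumes br_add_left: "br (x + y) z = br x z + br y z"
    and br_add_right: "br x (y + z) = br x y + br x z"
    and br_scale_left: "br (scale c x) y = scale c (br x y)"
    and br_scale_right: "br x (scale c y) = scale c (br x y)"
    and br_self: "br x x = 0"
    and jacobi: "br x (br y z) + br y (br z x) + br z (br x y) = 0"
begin

definition ideal :: "'v set \<Rightarrow> bool" where
  "ideal I \<longleftrightarrow> subspace I \<and> (\<forall>x. \<forall>y\<in>I. br x y \<in> I)"

definition subalgebra :: "'v set \<Rightarrow> bool" where
  "subalgebra H \<longleftrightarrow> subspace H \<and> (\<forall>x\<in>H. \<forall>y\<in>H. br x y \<in> H)"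

text \<open>Trace of an endomorphism of a finite-dimensional space; \<open>extend_basis {}\<close> is an arbitrary
  basis of the whole space.\<close>

definition trace :: "('v \<Rightarrow> 'v) \<Rightarrow> 'k" where
  "trace f = (\<Sum>b\<in>extend_basis {}. representation (extend_basis {}) (f b) b)"

definition killing :: "'v \<Rightarrow> 'v \<Rightarrow> 'k" where
  "killing x y = trace (\<lambda>z. br x (br y z))"

fun lower_central :: "'v set \<Rightarrow> nat \<Rightarrow> 'v set" where
  "lower_central H 0 = H"
| "lower_central H (Suc n) = span {br x y | x y. x \<in> H \<and> y \<in> lower_central H n}"

definition cartan_subalgebra :: "'v set \<Rightarrow> bool" where
  "cartan_subalgebra H \<longleftrightarrow> subalgebra H \<and> (\<exists>n. lower_central H n = {0}) \<and>
     {x. \<forall>h\<in>H. br x h \<in> H} = H"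

definition dual_space :: "'v set \<Rightarrow> ('v \<Rightarrow> 'k) set" where
  "dual_space H = {f. (\<forall>x. x \<notin> H \<longrightarrow> f x = 0) \<and>
     (\<forall>x\<in>H. \<forall>y\<in>H. f (x + y) = f x + f y) \<and> (\<forall>c. \<forall>x\<in>H. f (scale c x) = c * f x)}"

definition root_space :: "'v set \<Rightarrow> ('v \<Rightarrow> 'k) \<Rightarrow> 'v set" where
  "root_space H \<gamma> = {x. \<forall>h\<in>H. br h x = scale (\<gamma> h) x}"

definition roots :: "'v set \<Rightarrow> ('v \<Rightarrow> 'k) set" where
  "roots H = {\<gamma>\<in>dual_space H. \<gamma> \<noteq> 0 \<and> root_space H \<gamma> \<noteq> {0}}"

text \<open>A base (set of simple roots): a basis of the dual of \<open>H\<close> consisting of roots, such that the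
  coordinates of each root are all in \<open>\<nat>\<close> or all in \<open>-\<nat>\<close>.\<close>

definition root_base :: "'v set \<Rightarrow> ('v \<Rightarrow> 'k) set \<Rightarrow> bool" where
  "root_base H \<Pi> \<longleftrightarrow> \<Pi> \<subseteq> roots H \<and> fun_space.independent \<Pi> \<and> fun_space.span \<Pi> = dual_space H \<and>
     (\<forall>\<gamma>\<in>roots H. (\<forall>\<beta>\<in>\<Pi>. fun_space.representation \<Pi> \<gamma> \<beta> \<in> \<nat>) \<or>
                  (\<forall>\<beta>\<in>\<Pi>. - fun_space.representation \<Pi> \<gamma> \<beta> \<in> \<nat>))"

text \<open>Bases \<open>(e\<^sub>b)\<close>, \<open>(e'\<^sub>b)\<close> of a subspace \<open>U\<close> dual with respect to the Killing form. The first
  one is a set \<open>B\<close>, with \<open>e\<^sub>b = b\<close> for \<open>b \<in> B\<close>, and the second one is \<open>e'\<^sub>b = d b\<close>.\<close>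

definition dual_bases :: "'v set \<Rightarrow> 'v set \<Rightarrow> ('v \<Rightarrow> 'v) \<Rightarrow> bool" where
  "dual_bases U B d \<longleftrightarrow> B \<subseteq> U \<and> independent B \<and> span B = U \<and>
     d ` B \<subseteq> U \<and> inj_on d B \<and> independent (d ` B) \<and> span (d ` B) = U \<and>
     (\<forall>b\<in>B. \<forall>c\<in>B. killing (d b) c = (if b = c then 1 else 0))"

text \<open>The Casimir element \<open>\<Sum> e'\<^sub>b e\<^sub>b\<close> of the subalgebra \<open>U\<close>, acting on a \<open>U\<close>-module whose structure
  map is \<open>\<rho>\<close>. On modules the operator does not depend on the chosen dual bases.\<close>

definition casimir :: "'v set \<Rightarrow> ('v \<Rightarrow> 'w \<Rightarrow> 'w::comm_monoid_add) \<Rightarrow> 'w \<Rightarrow> 'w" where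
  "casimir U \<rho> x = (let (B, d) = (SOME (B, d). dual_bases U B d) in \<Sum>b\<in>B. \<rho> (d b) (\<rho> b x))"

text \<open>The exterior power \<open>\<Lambda>\<^sup>k V\<close> of a subspace \<open>V\<close> is the quotient of the free vector space
  \<open>wedge_free k V\<close> on \<open>k\<close>-tuples of vectors of \<open>V\<close> by the subspace \<open>wedge_rel k V\<close> which makes the
  class of the word \<open>[v\<^sub>1, \<dots>, v\<^sub>k]\<close> multilinear and alternating in \<open>v\<^sub>1, \<dots>, v\<^sub>k\<close>.\<close>

definition tuples :: "nat \<Rightarrow> 'v set \<Rightarrow> 'v list set" where
  "tuples k V = {w. length w = k \<and> set w \<subseteq> V}"

definition wedge_free :: "nat \<Rightarrow> 'v set \<Rightarrow> ('v list \<Rightarrow>\<^sub>0 'k) set" where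
  "wedge_free k V = free_space.span (word ` tuples k V)"

definition wedge_rel :: "nat \<Rightarrow> 'v set \<Rightarrow> ('v list \<Rightarrow>\<^sub>0 'k) set" where
  "wedge_rel k V = free_space.span
     ({word (w[i := a + b]) - word (w[i := a]) - word (w[i := b]) | w i a b.
         w \<in> tuples k V \<and> i < k \<and> a \<in> V \<and> b \<in> V} \<union>
      {word (w[i := scale c a]) - free_scale c (word (w[i := a])) | w i a c.
         w \<in> tuples k V \<and> i < k \<and> a \<in> V} \<union>
      {word w | w. w \<in> tuples k V \<and> \<not> distinct w})"

text \<open>The action \<open>x \<cdot> (v\<^sub>1 \<and> \<dots> \<and> v\<^sub>k) = \<Sum>\<^sub>i v\<^sub>1 \<and> \<dots> \<and> [x, v\<^sub>i] \<and> \<dots> \<and> v\<^sub>k\<close>, on representatives.\<close>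

definition wedge_act :: "'v \<Rightarrow> ('v list \<Rightarrow>\<^sub>0 'k) \<Rightarrow> ('v list \<Rightarrow>\<^sub>0 'k)" where
  "wedge_act x = free_extend (\<lambda>w. \<Sum>i<length w. word (w[i := br x (w ! i)]))"

text \<open>Eigenvalues of the Casimir element of \<open>U\<close> in \<open>\<Lambda>\<^sup>k V\<close>: there is a nonzero class \<open>p\<close> with
  \<open>C p = \<mu> p\<close>, both conditions being read modulo \<open>wedge_rel k V\<close>.\<close>

definition wedge_eigenvalues :: "'v set \<Rightarrow> nat \<Rightarrow> 'v set \<Rightarrow> 'k set" where
  "wedge_eigenvalues U k V = {\<mu>. \<exists>p\<in>wedge_free k V. p \<notin> wedge_rel k V \<and>
     casimir U wedge_act p - free_scale \<mu> p \<in> wedge_rel k V}"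

end

section \<open>Simple Lie algebras with a Cartan subalgebra and a base\<close>

locale simple_lie_algebra = lie_algebra scale br
  for scale :: "'k::{alg_closed_field,field_char_0} \<Rightarrow> 'v::ab_group_add \<Rightarrow> 'v"
    and br :: "'v \<Rightarrow> 'v \<Rightarrow> 'v" +
  assumes finite_dimensional: "\<exists>B. finite B \<and> span B = UNIV"
    and non_abelian: "\<exists>x y. br x y \<noteq> 0"
    and no_proper_ideal: "ideal I \<Longrightarrow> I = {0} \<or> I = UNIV"

locale based_simple_lie_algebra = simple_lie_algebra scale br
  for scale :: "'k::{alg_closed_field,field_char_0} \<Rightarrow> 'v::ab_group_add \<Rightarrow> 'v"
    and br :: "'v \<Rightarrow> 'v \<Rightarrow> 'v" +
  fixes H :: "'v set" and \<Pi> :: "('v \<Rightarrow> 'k) set"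
  assumes cartan: "cartan_subalgebra H"
    and base: "root_base H \<Pi>"
begin

text \<open>The element \<open>t\<^sub>\<mu>\<close> of \<open>H\<close> that represents \<open>\<mu>\<close> via the Killing form, and the induced form
  on the dual of \<open>H\<close>.\<close>

definition riesz :: "('v \<Rightarrow> 'k) \<Rightarrow> 'v" where
  "riesz \<mu> = (THE t. t \<in> H \<and> (\<forall>h\<in>H. killing t h = \<mu> h))"

definition form :: "('v \<Rightarrow> 'k) \<Rightarrow> ('v \<Rightarrow> 'k) \<Rightarrow> 'k" where
  "form \<mu> \<nu> = killing (riesz \<mu>) (riesz \<nu>)"

text \<open>The coefficient of \<open>\<alpha>\<close> in \<open>\<gamma>\<close>, an integer regarded as an element of the ground field.\<close>

definition ht :: "('v \<Rightarrow> 'k) \<Rightarrow> ('v \<Rightarrow> 'k) \<Rightarrow> 'k" where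
  "ht \<alpha> \<gamma> = fun_space.representation \<Pi> \<gamma> \<alpha>"

definition pos_roots :: "('v \<Rightarrow> 'k) set" where
  "pos_roots = {\<gamma>\<in>roots H. \<forall>\<beta>\<in>\<Pi>. ht \<beta> \<gamma> \<in> \<nat>}"

definition highest_root :: "'v \<Rightarrow> 'k" where
  "highest_root = (THE \<theta>. \<theta> \<in> roots H \<and> (\<forall>\<gamma>\<in>roots H. \<forall>\<beta>\<in>\<Pi>. ht \<beta> \<theta> - ht \<beta> \<gamma> \<in> \<nat>))"

definition fund_weight :: "('v \<Rightarrow> 'k) \<Rightarrow> 'v \<Rightarrow> 'k" where
  "fund_weight \<alpha> = (THE \<phi>. \<phi> \<in> dual_space H \<and>
     (\<forall>\<beta>\<in>\<Pi>. 2 * form \<phi> \<beta> / form \<beta> \<beta> = (if \<beta> = \<alpha> then 1 else 0)))"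

definition half_sum :: "'v \<Rightarrow> 'k" where
  "half_sum = fun_scale (1/2) (\<Sum>\<gamma>\<in>pos_roots. \<gamma>)"

text \<open>\<open>h\<^sup>* = 1 + (\<rho>, \<theta>\<^sup>\<or>)\<close> with \<open>\<theta>\<^sup>\<or> = 2\<theta> / (\<theta>, \<theta>)\<close>.\<close>

definition dual_coxeter :: "'k" where
  "dual_coxeter = 1 + 2 * form half_sum highest_root / form highest_root highest_root"

definition root_ratio :: "('v \<Rightarrow> 'k) \<Rightarrow> 'k" where
  "root_ratio \<alpha> = form highest_root highest_root / form \<alpha> \<alpha>"

definition roots_of_ht :: "('v \<Rightarrow> 'k) \<Rightarrow> int \<Rightarrow> ('v \<Rightarrow> 'k) set" where
  "roots_of_ht \<alpha> i = {\<gamma>\<in>roots H. ht \<alpha> \<gamma> = of_int i}"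

definition grading :: "('v \<Rightarrow> 'k) \<Rightarrow> int \<Rightarrow> 'v set" where
  "grading \<alpha> i = span ((if i = 0 then H else {}) \<union> (\<Union>\<gamma>\<in>roots_of_ht \<alpha> i. root_space H \<gamma>))"

definition gamma1 :: "('v \<Rightarrow> 'k) \<Rightarrow> 'k" where
  "gamma1 \<alpha> = (THE c. \<forall>x\<in>grading \<alpha> 1. casimir (grading \<alpha> 0) br x = scale c x)"

text \<open>The maximal eigenvalue. The ground field carries no order, but the eigenvalues are rational;
  \<open>\<mu> \<le> d\<close> means that \<open>d - \<mu>\<close> is a nonnegative rational number. For \<open>k = 0\<close> the action on the line
  spanned by the empty word is zero, so the value is \<open>0\<close>.\<close>

definition delta :: "('v \<Rightarrow> 'k) \<Rightarrow> nat \<Rightarrow> 'k" where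
  "delta \<alpha> k = (THE d. d \<in> wedge_eigenvalues (grading \<alpha> 0) k (grading \<alpha> 1) \<and>
     (\<forall>\<mu>\<in>wedge_eigenvalues (grading \<alpha> 0) k (grading \<alpha> 1). \<exists>r::rat. 0 \<le> r \<and> d = \<mu> + of_rat r))"

definition q1 :: "('v \<Rightarrow> 'k) \<Rightarrow> int" where
  "q1 \<alpha> = (THE q. (\<Sum>\<gamma>\<in>roots_of_ht \<alpha> 1. \<gamma>) = fun_scale (of_int q) (fund_weight \<alpha>))"

end

end

theory Submission
  imports Defs
begin

text \<open>
  Let \<open>V\<close> be the degree one part of the grading, \<open>m\<close> its dimension, \<open>D1\<close> its set of roots, \<open>P0\<close> the set
  of positive roots whose \<open>\<alpha>\<close>-height is zero, \<open>2\<rho>\<^sub>0\<close> the sum of \<open>P0\<close> and \<open>C\<close> the Casimir element of the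
  degree zero part.

  Upper bound in degree \<open>k\<close>. Every eigenvalue of \<open>C\<close> on \<open>\<Lambda>\<^sup>kV\<close> occurs on a highest weight vector, whose
  weight is the sum \<open>\<nu>\<close> of a \<open>k\<close>-element set \<open>S\<close> of roots in \<open>D1\<close>; the eigenvalue is then
  \<open>(\<nu>, \<nu> + 2\<rho>\<^sub>0)\<close> (\<open>eigenvalue_root_set\<close>). Expanding the form and comparing with the scalar
  \<open>\<gamma>\<^sub>\<alpha>(1)\<close> by which \<open>C\<close> acts on each single root vector, one finds that \<open>k \<gamma>\<^sub>\<alpha>(1) - (\<nu>, \<nu> + 2\<rho>\<^sub>0)\<close> is a sum
  of scalars by which operators \<open>ad e\<^sub>-\<^sub>\<beta> ad e\<^sub>\<beta>\<close> act on root vectors (\<open>eigen_defect\<close>). Root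
  strings show that these scalars are nonnegative rational numbers (\<open>cc_nonneg\<close>).

  The bound is attained. On a product \<open>v\<^sub>1 \<and> \<dots> \<and> v\<^sub>k\<close> the Casimir element acts by
  \<open>\<gamma>\<^sub>\<alpha>(1)\<close> on each factor, and there are mixed terms in which it acts on two different factors. If the
  \<open>v\<^sub>i\<close> commute, then the invariance of the Killing form makes the mixed terms vanish
  (\<open>mixed_terms_vanish\<close>), so the product is an eigenvector with eigenvalue \<open>k \<gamma>\<^sub>\<alpha>(1)\<close>. An abelian subspace
  of dimension \<open>m/2\<close> provides such vectors for every \<open>k \<le> m/2\<close>.

  Degree \<open>m - k\<close>. Let \<open>S\<close> be a \<open>k\<close>-element set that belongs to the eigenvalue \<open>k \<gamma>\<^sub>\<alpha>(1)\<close>. Equality in the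
  bound forces \<open>S\<close> to be closed under adding roots of \<open>P0\<close> (\<open>eigen_extremal\<close>). So the complement of \<open>S\<close> in
  \<open>D1\<close> is closed under subtracting them, and the product of its root vectors is a lowest weight vector of
  \<open>\<Lambda>\<^sup>m\<^sup>-\<^sup>kV\<close>. Let \<open>\<sigma>\<close> be the sum of \<open>D1\<close>. It is orthogonal to all simple roots but \<open>\<alpha>\<close>, and this implies
  that passing to complements and to the opposite positive system changes the eigenvalue expression
  by \<open>(m - 2k) (\<sigma>, \<alpha>)\<close> (\<open>eigen_complement\<close>). The same identity, read backwards, turns the upper bound in
  degree \<open>k\<close> into the upper bound in degree \<open>m - k\<close>. Finally \<open>(\<sigma>, \<alpha>)\<close> is the constant of the theorem: \<open>\<sigma> = q \<phi>\<^sub>\<alpha>\<close>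
  gives \<open>(\<sigma>, \<alpha>) = q (\<alpha>, \<alpha>) / 2\<close>, and \<open>h\<^sup>* r\<^sub>\<alpha> = 1 / (\<alpha>, \<alpha>)\<close> because the Casimir element of the whole algebra acts
  on the highest root vector both by \<open>1\<close> and by \<open>(\<theta>, \<theta> + 2\<rho>)\<close> (\<open>form_highest_root\<close>).

  The structure theory behind this rests on one principle: a commutator has trace zero on every
  subspace that is stable under both of its factors. Applied to sums of weight spaces it yields
  the nondegeneracy of the Killing form (\<open>killing_nondegenerate\<close>), one-dimensional root spaces
  (\<open>root_multiples\<close>) and the orthogonality of \<open>\<sigma>\<close> to the simple roots of \<open>\<alpha>\<close>-height zero
  (\<open>form_sum_D1_Pi\<close>).
\<close>

section \<open>Linear operators and generalised eigenspaces\<close>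

lemma lin_add: "Vector_Spaces.linear s1 s2 f \<Longrightarrow> f (x + y) = f x + f y"
  by (simp add: Vector_Spaces.linear_iff)

lemma lin_scale: "Vector_Spaces.linear s1 s2 f \<Longrightarrow> f (s1 c x) = s2 c (f x)"
  by (simp add: Vector_Spaces.linear_iff)

lemma lin_zero: "Vector_Spaces.linear s1 s2 f \<Longrightarrow> f 0 = 0"
  using lin_add[of s1 s2 f 0 0] by simp

lemma lin_neg: "Vector_Spaces.linear s1 s2 f \<Longrightarrow> f (- x) = - f x"
  using lin_add[of s1 s2 f x "-x"] lin_zero[of s1 s2 f] by (simp add: minus_unique)

lemma lin_diff: "Vector_Spaces.linear s1 s2 f \<Longrightarrow> f (x - y) = f x - f y"
  using lin_add[of s1 s2 f x "-y"] lin_neg[of s1 s2 f y] by simp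

lemma lin_sum: "Vector_Spaces.linear s1 s2 f \<Longrightarrow> f (sum g A) = (\<Sum>a\<in>A. f (g a))"
  by (induction A rule: infinite_finite_induct) (auto simp: lin_add lin_zero)

lemma linI:
  assumes "vector_space s1" "vector_space s2" "\<And>x y. f (x + y) = f x + f y"
    "\<And>c x. f (s1 c x) = s2 c (f x)"
  shows "Vector_Spaces.linear s1 s2 f"
  using assms by (simp add: Vector_Spaces.linear_iff)

lemma vector_space_field: "vector_space ((*) :: 'k::field \<Rightarrow> 'k \<Rightarrow> 'k)"
  by standard (auto simp: algebra_simps)

lemma lin_vs: assumes "Vector_Spaces.linear s1 s2 f" shows "vector_space s1" "vector_space s2"
  using assms by (auto simp: Vector_Spaces.linear_iff)

lemma lin_comp: "Vector_Spaces.linear s1 s2 f \<Longrightarrow> Vector_Spaces.linear s2 s3 g \<Longrightarrow>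
    Vector_Spaces.linear s1 s3 (\<lambda>x. g (f x))"
  by (intro linI) (auto simp: lin_add lin_scale lin_vs)

context vector_space
begin

lemma span_image_finite:
  assumes "finite A"
  shows "span (f ` A) = {\<Sum>a\<in>A. scale (c a) (f a) | c. True}"
  using assms
proof (induction A)
  case (insert a A)
  show ?case
  proof (intro equalityI subsetI)
    fix x assume "x \<in> span (f ` insert a A)"
    then obtain k c where "x - scale k (f a) = (\<Sum>b\<in>A. scale (c b) (f b))"
      using insert.IH by (auto simp: span_insert)
    moreover have "(\<Sum>b\<in>A. scale (c b) (f b)) = (\<Sum>b\<in>A. scale ((c(a := k)) b) (f b))"
      using insert by (intro sum.cong) auto
    ultimately have "x = (\<Sum>b\<in>insert a A. scale ((c(a := k)) b) (f b))"
      using insert by (simp add: algebra_simps)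
    then show "x \<in> {\<Sum>b\<in>insert a A. scale (c b) (f b) | c. True}" by blast
  next
    fix x assume "x \<in> {\<Sum>b\<in>insert a A. scale (c b) (f b) | c. True}"
    then show "x \<in> span (f ` insert a A)"
      by (blast intro: span_sum span_scale span_base)
  qed
qed auto

text \<open>Traces are taken over the whole space; composition with a projection onto \<open>U\<close>
  expresses the trace of a restriction to \<open>U\<close>.\<close>
lemma subspace_projection:
  assumes "subspace U"
  obtains P where "Vector_Spaces.linear scale scale P" "\<And>x. P x \<in> U" "\<And>x. x \<in> U \<Longrightarrow> P x = x"
proof -
  interpret vector_space_pair scale scale by unfold_locales
  obtain B where B: "B \<subseteq> U" "independent B" "U \<subseteq> span B"
    using maximal_independent_subset by blast
  have sB: "span B = U" by (rule span_subspace[OF B(1,3) assms])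
  obtain g where g: "Vector_Spaces.linear scale scale g" "\<And>x. x \<in> B \<Longrightarrow> g x = x" "range g = span ((\<lambda>x. x) ` B)"
    using linear_independent_extend_subspace[OF B(2), of "\<lambda>x. x"] by auto
  have "g x = x" if "x \<in> U" for x
  proof -
    have "subspace {x. g x = x}"
      using g(1) by (auto simp: subspace_def lin_add lin_scale lin_zero)
    then have "span B \<subseteq> {x. g x = x}" using g(2) by (intro span_minimal) auto
    then show ?thesis using that sB by auto
  qed
  moreover have "g x \<in> U" for x using g(3) sB by auto
  ultimately show ?thesis using that g(1) by blast
qed

end

context lie_algebra
begin

abbreviation "endo \<equiv> Vector_Spaces.linear scale scale"
abbreviation "functional \<equiv> Vector_Spaces.linear scale (*)"

lemma endoI: "(\<And>x y. f (x + y) = f x + f y) \<Longrightarrow> (\<And>c x. f (scale c x) = scale c (f x)) \<Longrightarrow> endo f"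
  by (rule linI) (auto intro: vector_space_axioms)

lemma functionalI: "(\<And>x y. f (x + y) = f x + f y) \<Longrightarrow> (\<And>c x. f (scale c x) = c * f x) \<Longrightarrow> functional f"
  by (rule linI) (auto intro: vector_space_axioms vector_space_field)

lemma endo_id: "endo (\<lambda>x. x)" and endo_scale: "endo (scale c)"
  by (rule endoI; simp add: scale_right_distrib)+

lemma endo_zero: "endo (\<lambda>x. 0)"
  by (rule endoI) simp_all

lemma endo_plus: "endo f \<Longrightarrow> endo g \<Longrightarrow> endo (\<lambda>x. f x + g x)"
  by (rule endoI) (auto simp: lin_add lin_scale scale_right_distrib)

lemma endo_minus: "endo f \<Longrightarrow> endo g \<Longrightarrow> endo (\<lambda>x. f x - g x)"
  by (rule endoI) (auto simp: lin_add lin_scale scale_right_diff_distrib)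

lemma endo_smult: "endo f \<Longrightarrow> endo (\<lambda>x. scale c (f x))"
  by (rule endoI) (auto simp: lin_add lin_scale scale_right_distrib)

lemma endo_comp: "endo f \<Longrightarrow> endo g \<Longrightarrow> endo (\<lambda>x. f (g x))"
  by (rule lin_comp)

lemma endo_sum: "(\<And>i. i \<in> I \<Longrightarrow> endo (f i)) \<Longrightarrow> endo (\<lambda>x. \<Sum>i\<in>I. f i x)"
  by (induction I rule: infinite_finite_induct) (auto simp: endo_zero endo_plus)

lemma endo_pow: "endo f \<Longrightarrow> endo (f ^^ n)"
  by (induction n) (auto simp: endo_id id_def endo_comp comp_def)

lemma endo_functional: "functional \<phi> \<Longrightarrow> endo (\<lambda>x. scale (\<phi> x) v)"
  by (rule endoI) (auto simp: lin_add lin_scale scale_left_distrib)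

lemma functional_representation:
  "independent B \<Longrightarrow> span B = UNIV \<Longrightarrow> functional (\<lambda>x. representation B x b)"
  by (rule functionalI) (auto simp: representation_add representation_scale)

definition gen_eig :: "('v \<Rightarrow> 'v) \<Rightarrow> 'k \<Rightarrow> 'v set" where
  "gen_eig T a = {x. \<exists>n. ((\<lambda>y. T y - scale a y) ^^ n) x = 0}"

lemma endo_shift: "endo T \<Longrightarrow> endo (\<lambda>y. T y - scale a y)"
  by (intro endo_minus endo_scale)

lemma pow_kernel_mono:
  assumes "endo f" "(f ^^ n) x = 0" "n \<le> m" shows "(f ^^ m) x = 0"
proof -
  obtain d where "m = d + n" using assms(3) by (metis le_add_diff_inverse2)
  then show ?thesis using assms by (simp add: funpow_add lin_zero[OF endo_pow])
qed

lemma subspace_gen_eig: assumes "endo T" shows "subspace (gen_eig T a)"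
proof (rule subspaceI)
  let ?N = "\<lambda>y. T y - scale a y"
  show "0 \<in> gen_eig T a" unfolding gen_eig_def by (auto intro: exI[of _ 0])
  fix x y assume "x \<in> gen_eig T a" "y \<in> gen_eig T a"
  then obtain n m where "(?N ^^ n) x = 0" "(?N ^^ m) y = 0" by (auto simp: gen_eig_def)
  then have "(?N ^^ (max n m)) x = 0" "(?N ^^ (max n m)) y = 0"
    using pow_kernel_mono[OF endo_shift[OF assms]] by (meson max.cobounded1 max.cobounded2)+
  then show "x + y \<in> gen_eig T a"
    by (auto simp: gen_eig_def lin_add[OF endo_pow[OF endo_shift[OF assms]]] intro!: exI[of _ "max n m"])
next
  fix c x assume "x \<in> gen_eig T a"
  then show "scale c x \<in> gen_eig T a"
    by (auto simp: gen_eig_def lin_scale[OF endo_pow[OF endo_shift[OF assms]]])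
qed

lemma gen_eig_stepD: "T x - scale a x \<in> gen_eig T a \<Longrightarrow> x \<in> gen_eig T a"
  unfolding gen_eig_def
proof safe
  fix n assume "((\<lambda>y. T y - scale a y) ^^ n) (T x - scale a x) = 0"
  then have "((\<lambda>y. T y - scale a y) ^^ Suc n) x = 0" by (simp only: funpow_Suc_right o_apply)
  then show "\<exists>n. ((\<lambda>y. T y - scale a y) ^^ n) x = 0" by blast
qed

lemma funpow_commute:
  assumes "\<And>x. f (g x) = g (f x)" shows "(f ^^ n) (g x) = g ((f ^^ n) x)"
  using assms by (induction n) auto

lemma gen_eig_commute:
  assumes "endo S" "\<And>x. T (S x) = S (T x)" "x \<in> gen_eig T a"
  shows "S x \<in> gen_eig T a"
proof -
  obtain n where "((\<lambda>y. T y - scale a y) ^^ n) x = 0" using assms by (auto simp: gen_eig_def)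
  moreover have "((\<lambda>y. T y - scale a y) ^^ n) (S x) = S (((\<lambda>y. T y - scale a y) ^^ n) x)"
    by (rule funpow_commute) (simp add: assms(2) lin_diff[OF assms(1)] lin_scale[OF assms(1)])
  ultimately show ?thesis using lin_zero[OF assms(1)] by (auto simp: gen_eig_def)
qed

lemma gen_eig_stepI: "endo T \<Longrightarrow> x \<in> gen_eig T a \<Longrightarrow> T x - scale b x \<in> gen_eig T a"
  by (rule gen_eig_commute) (auto intro: endo_shift simp: lin_diff lin_scale)

lemma gen_eig_shift_inj:
  assumes "endo T" "x \<in> gen_eig T b" "T x = scale a x" "a \<noteq> b"
  shows "x = 0"
proof -
  obtain n where n: "((\<lambda>y. T y - scale b y) ^^ n) x = 0" using assms by (auto simp: gen_eig_def)
  have "((\<lambda>y. T y - scale b y) ^^ n) x = scale ((a - b) ^ n) x"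
    by (induction n) (auto simp: lin_scale[OF assms(1)] assms(3) algebra_simps)
  then show ?thesis using n assms by simp
qed

lemma gen_eig_shift_pow_inj:
  assumes "endo T" "x \<in> gen_eig T b" "((\<lambda>y. T y - scale a y) ^^ n) x = 0" "a \<noteq> b"
  shows "x = 0"
  using assms(2,3)
proof (induction n arbitrary: x)
  case (Suc n)
  then have "T x - scale a x = 0"
    using Suc.IH[of "T x - scale a x"] gen_eig_stepI[OF assms(1)]
    by (simp only: funpow_Suc_right o_apply)
  then show ?case using gen_eig_shift_inj[OF assms(1) Suc.prems(1), of a] assms(4) by simp
qed simp

text \<open>On the generalised eigenspace for \<open>b\<close> the operator \<open>T - a = (b - a) + (T - b)\<close> is a
  nonzero scalar plus a locally nilpotent operator. Explicitly, if \<open>u\<close> is a preimage of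
  \<open>(T - b) w\<close> under \<open>T - a\<close>, then \<open>(w - u) / (b - a)\<close> is one of \<open>w\<close>.\<close>
lemma gen_eig_shift_surj:
  assumes T: "endo T" and U: "subspace U" "\<And>x. x \<in> U \<Longrightarrow> T x \<in> U"
    and w: "w \<in> gen_eig T b" "w \<in> U" and ab: "a \<noteq> b"
  shows "\<exists>u. u \<in> gen_eig T b \<and> u \<in> U \<and> T u - scale a u = w"
proof -
  obtain n where "((\<lambda>y. T y - scale b y) ^^ n) w = 0" using w by (auto simp: gen_eig_def)
  then show ?thesis using w
  proof (induction n arbitrary: w)
    case 0
    then have "w = 0" by simp
    then show ?case
      using subspace_0[OF subspace_gen_eig[OF T]] subspace_0[OF U(1)] lin_zero[OF T] by (intro exI[of _ 0]) auto
  next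
    case (Suc n)
    let ?w = "T w - scale b w"
    have "((\<lambda>y. T y - scale b y) ^^ n) ?w = 0" using Suc.prems(1) by (simp only: funpow_Suc_right o_apply)
    moreover have "?w \<in> gen_eig T b" "?w \<in> U"
      using Suc.prems U gen_eig_stepI[OF T] by (auto intro: subspace_diff subspace_scale)
    ultimately obtain u where u: "u \<in> gen_eig T b" "u \<in> U" "T u - scale a u = ?w" using Suc.IH by blast
    define v where "v = scale (1 / (b - a)) (w - u)"
    have "T (w - u) - scale a (w - u) = (T w - scale a w) - (T u - scale a u)"
      by (simp add: lin_diff[OF T] algebra_simps)
    also have "\<dots> = scale (b - a) w" by (simp add: u(3) algebra_simps)
    finally have 1: "T (w - u) - scale a (w - u) = scale (b - a) w" .
    have "T v - scale a v = scale (1 / (b - a)) (T (w - u) - scale a (w - u))"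
      unfolding v_def lin_scale[OF T] by (simp only: scale_right_diff_distrib scale_left_commute)
    also have "\<dots> = w" using ab by (simp add: 1)
    finally have "T v - scale a v = w" .
    moreover have "v \<in> gen_eig T b" "v \<in> U" unfolding v_def
      using u Suc.prems U subspace_gen_eig[OF T] by (auto intro!: subspace_diff subspace_scale)
    ultimately show ?case by blast
  qed
qed

text \<open>By \<open>gen_eig_shift_surj\<close> every element of the span has the form \<open>(T - a) u\<close>, with \<open>u\<close>
  in the span, up to an error in the generalised eigenspace for \<open>a\<close>. For the element
  \<open>(T - a) v\<close> this says that \<open>T - a\<close> maps \<open>u - v\<close> into that eigenspace, so that \<open>u - v\<close> itself
  lies in it.\<close>
lemma gen_eig_span_stepD:
  assumes T: "endo T" and U: "subspace U" "\<And>x. x \<in> U \<Longrightarrow> T x \<in> U" and v: "v \<in> U"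
    and Tv: "T v - scale a v \<in> span (\<Union>b. gen_eig T b \<inter> U)"
  shows "v \<in> span (\<Union>b. gen_eig T b \<inter> U)"
proof -
  let ?Z = "span (\<Union>b. gen_eig T b \<inter> U)"
  have ZU: "?Z \<subseteq> U" using U by (intro span_minimal) auto
  have *: "\<exists>u\<in>?Z. (T u - scale a u) - w \<in> gen_eig T a" if "w \<in> ?Z" for w
    using that
  proof (induction rule: span_induct_alt)
    case base
    then show ?case using subspace_0[OF subspace_gen_eig[OF T]] lin_zero[OF T] by (intro bexI[of _ 0]) (auto simp: span_zero)
  next
    case (step c x y)
    then obtain b where b: "x \<in> gen_eig T b" "x \<in> U" by auto
    have "\<exists>u\<in>?Z. (T u - scale a u) - x \<in> gen_eig T a"
    proof (cases "a = b")
      case True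
      then show ?thesis using b lin_zero[OF T] subspace_neg[OF subspace_gen_eig[OF T]]
        by (intro bexI[of _ 0]) (auto simp: span_zero)
    next
      case False
      then obtain u where "u \<in> gen_eig T b" "u \<in> U" "T u - scale a u = x"
        using gen_eig_shift_surj[OF T U b] by auto
      then show ?thesis
        using subspace_0[OF subspace_gen_eig[OF T]] by (intro bexI[of _ u]) (auto intro: span_base)
    qed
    then obtain u where u: "u \<in> ?Z" "(T u - scale a u) - x \<in> gen_eig T a" by blast
    from step obtain u' where u': "u' \<in> ?Z" "(T u' - scale a u') - y \<in> gen_eig T a" by blast
    have "scale c ((T u - scale a u) - x) + ((T u' - scale a u') - y) \<in> gen_eig T a"
      using u u' subspace_gen_eig[OF T] by (auto intro!: subspace_add subspace_scale)
    also have "scale c ((T u - scale a u) - x) + ((T u' - scale a u') - y)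
        = (T (scale c u + u') - scale a (scale c u + u')) - (scale c x + y)"
      by (simp add: lin_add[OF T] lin_scale[OF T] algebra_simps)
    finally show ?case using u(1) u'(1) by (intro bexI[of _ "scale c u + u'"]) (auto intro: span_add span_scale)
  qed
  obtain u where u: "u \<in> ?Z" "(T u - scale a u) - (T v - scale a v) \<in> gen_eig T a"
    using *[OF Tv] by blast
  have "(T u - scale a u) - (T v - scale a v) = T (u - v) - scale a (u - v)"
    by (simp add: lin_diff[OF T] algebra_simps)
  then have "u - v \<in> gen_eig T a" using u(2) gen_eig_stepD[of T "u - v"] by simp
  moreover have "u - v \<in> U" using u(1) ZU v U(1) by (auto intro: subspace_diff)
  ultimately have "u - v \<in> ?Z" by (auto intro: span_base)
  then have "u - (u - v) \<in> ?Z" using u(1) by (blast intro: span_diff)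
  then show ?thesis by simp
qed

end

sublocale simple_lie_algebra \<subseteq> finite_dimensional_vector_space scale "extend_basis {}"
proof
  show indep: "independent (extend_basis {})" by (rule independent_extend_basis) (rule independent_empty)
  obtain B where "finite B" "span B = UNIV" using finite_dimensional by blast
  then show "finite (extend_basis {})" using independent_span_bound[OF _ indep] by blast
  show "span (extend_basis {}) = UNIV" by (rule span_extend_basis) (rule independent_empty)
qed

context simple_lie_algebra
begin

text \<open>The field is algebraically closed, so a nonconstant \<open>p\<close> is \<open>(X - a) q\<close> for some \<open>a\<close>,
  and \<open>q\<close> annihilates \<open>(T - a) v\<close>.\<close>
lemma gen_eig_span_poly:
  assumes T: "endo T" and U: "subspace U" "\<And>x. x \<in> U \<Longrightarrow> T x \<in> U"
    and "v \<in> U" "p \<noteq> 0" "(\<Sum>i\<le>degree p. scale (coeff p i) ((T ^^ i) v)) = 0"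
  shows "v \<in> span (\<Union>b. gen_eig T b \<inter> U)"
  using assms(4-6)
proof (induction "degree p" arbitrary: p v rule: less_induct)
  case less
  show ?case
  proof (cases "degree p = 0")
    case True
    then have "coeff p 0 \<noteq> 0" using less.prems(2) by (metis leading_coeff_0_iff)
    then have "v = 0" using less.prems(3) True by simp
    then show ?thesis by (simp add: span_zero)
  next
    case False
    then obtain a where "poly p a = 0" using alg_closed_imp_poly_has_root by blast
    then obtain q where p: "p = [:-a, 1:] * q" using poly_eq_0_iff_dvd by (metis dvdE)
    with less.prems have q0: "q \<noteq> 0" by auto
    then have deg: "degree p = Suc (degree q)" unfolding p by (subst degree_mult_eq) auto
    let ?w = "T v - scale a v"
    have Tw: "(T ^^ i) ?w = (T ^^ Suc i) v - scale a ((T ^^ i) v)" for i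
      unfolding lin_diff[OF endo_pow[OF T]] lin_scale[OF endo_pow[OF T]] by (simp only: funpow_Suc_right o_apply)
    have cp: "coeff p i = (if i = 0 then 0 else coeff q (i - 1)) - a * coeff q i" for i
      unfolding p by (cases i) (simp_all add: coeff_pCons)
    have "(\<Sum>i\<le>degree q. scale (coeff q i) ((T ^^ i) ?w))
        = (\<Sum>i\<le>degree q. scale (coeff q i) ((T ^^ Suc i) v)) - (\<Sum>i\<le>degree q. scale (a * coeff q i) ((T ^^ i) v))"
      unfolding Tw sum_subtractf[symmetric] by (intro sum.cong) (auto simp: algebra_simps)
    also have "(\<Sum>i\<le>degree q. scale (coeff q i) ((T ^^ Suc i) v))
        = (\<Sum>i\<le>degree p. scale (if i = 0 then 0 else coeff q (i - 1)) ((T ^^ i) v))"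
      unfolding deg by (subst sum.atMost_Suc_shift) simp
    also have "(\<Sum>i\<le>degree q. scale (a * coeff q i) ((T ^^ i) v)) = (\<Sum>i\<le>degree p. scale (a * coeff q i) ((T ^^ i) v))"
      unfolding deg by (simp add: coeff_eq_0)
    also have "(\<Sum>i\<le>degree p. scale (if i = 0 then 0 else coeff q (i - 1)) ((T ^^ i) v)) - (\<Sum>i\<le>degree p. scale (a * coeff q i) ((T ^^ i) v)) = (\<Sum>i\<le>degree p. scale (coeff p i) ((T ^^ i) v))"
      unfolding sum_subtractf[symmetric] cp by (intro sum.cong) (auto simp: algebra_simps)
    also have "\<dots> = 0" by (rule less.prems)
    finally have "?w \<in> span (\<Union>b. gen_eig T b \<inter> U)"
      using less.hyps[of q ?w] deg q0 less.prems(1) U by (auto intro: subspace_diff subspace_scale)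
    then show ?thesis using gen_eig_span_stepD[OF T U less.prems(1)] by blast
  qed
qed

text \<open>In finite dimension the vectors \<open>T\<^sup>i v\<close> are linearly dependent, which is a polynomial
  that annihilates \<open>v\<close>.\<close>
lemma gen_eig_span:
  assumes T: "endo T" and U: "subspace U" "\<And>x. x \<in> U \<Longrightarrow> T x \<in> U"
  shows "span (\<Union>b. gen_eig T b \<inter> U) = U"
proof
  show "span (\<Union>b. gen_eig T b \<inter> U) \<subseteq> U" using U by (intro span_minimal) auto
  show "U \<subseteq> span (\<Union>b. gen_eig T b \<inter> U)"
  proof
    fix v assume v: "v \<in> U"
    have "\<exists>n. (T ^^ n) v \<in> span ((\<lambda>i. (T ^^ i) v) ` {..<n})"
    proof (rule ccontr)
      assume neg: "\<not> ?thesis"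
      let ?S = "\<lambda>n. (\<lambda>i. (T ^^ i) v) ` {..<n}"
      have S: "independent (?S n) \<and> card (?S n) = n" for n
      proof (induction n)
        case (Suc n)
        have 1: "(T ^^ n) v \<notin> span (?S n)" using neg by blast
        then have 2: "(T ^^ n) v \<notin> ?S n" by (rule contrapos_nn) (rule span_base)
        have 3: "?S (Suc n) = insert ((T ^^ n) v) (?S n)" by (simp only: lessThan_Suc image_insert)
        have "card (?S (Suc n)) = Suc n" unfolding 3 using 2 Suc by (subst card_insert_disjoint) simp_all
        moreover have "independent (?S (Suc n))" unfolding 3 by (rule independent_insertI[OF 1 conjunct1[OF Suc]])
        ultimately show ?case by blast
      qed (simp add: independent_empty)
      have "card (?S (Suc dimension)) \<le> dim UNIV"
        using S by (intro independent_card_le_dim) auto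
      then show False using S[of "Suc dimension"] by (simp add: dimension_def)
    qed
    then obtain n c where n: "(T ^^ n) v = (\<Sum>i<n. scale (c i) ((T ^^ i) v))"
      by (subst (asm) span_image_finite) auto
    define p where "p = monom 1 n - (\<Sum>i<n. monom (c i) i)"
    have cp: "coeff p i = (if i = n then 1 else if i < n then - c i else 0)" for i
      unfolding p_def coeff_diff coeff_sum coeff_monom by (auto simp: sum.delta)
    have p0: "p \<noteq> 0" using cp[of n] by auto
    have "degree p = n" using cp by (intro antisym degree_le le_degree) auto
    then have "(\<Sum>i\<le>degree p. scale (coeff p i) ((T ^^ i) v)) = (T ^^ n) v - (\<Sum>i<n. scale (c i) ((T ^^ i) v))"
      by (simp add: lessThan_Suc_atMost[symmetric] cp sum_negf)
    then show "v \<in> span (\<Union>b. gen_eig T b \<inter> U)"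
      using gen_eig_span_poly[OF T U v p0] n by simp
  qed
qed

section \<open>Traces\<close>

declare independent_Basis [simp] span_Basis [simp] finite_Basis [simp]

text \<open>The operator is \<open>\<Sum> \<phi>\<^sub>i \<otimes> v\<^sub>i\<close>, whose trace is visibly independent of bases; the
  properties of the trace that involve a second basis or a composition reduce to this formula.\<close>
lemma trace_finite_rank:
  assumes "finite I" "\<And>x. f x = (\<Sum>i\<in>I. scale (\<phi> i x) (v i))" "\<And>i. i \<in> I \<Longrightarrow> functional (\<phi> i)"
  shows "trace f = (\<Sum>i\<in>I. \<phi> i (v i))"
proof -
  let ?B = "extend_basis {}" and ?r = "representation (extend_basis {})"
  have "trace f = (\<Sum>b\<in>?B. \<Sum>i\<in>I. \<phi> i b * ?r (v i) b)"
    unfolding trace_def assms(2)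
    by (intro sum.cong refl) (simp add: representation_sum representation_scale independent_Basis)
  also have "\<dots> = (\<Sum>i\<in>I. \<Sum>b\<in>?B. ?r (v i) b * \<phi> i b)"
    by (subst sum.swap) (simp add: mult.commute)
  also have "\<dots> = (\<Sum>i\<in>I. \<phi> i (\<Sum>b\<in>?B. scale (?r (v i) b) b))"
    by (intro sum.cong refl) (simp add: lin_sum[OF assms(3)] lin_scale[OF assms(3)])
  also have "\<dots> = (\<Sum>i\<in>I. \<phi> i (v i))"
    by (intro sum.cong refl) (simp add: sum_representation_eq independent_Basis finite_Basis)
  finally show ?thesis .
qed

lemma endo_expand:
  assumes "endo f" "independent B" "span B = UNIV"
  shows "f x = (\<Sum>b\<in>B. scale (representation B x b) (f b))"
proof -
  have "finite B" by (rule finiteI_independent[OF assms(2)])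
  then have "f x = f (\<Sum>b\<in>B. scale (representation B x b) b)"
    using assms by (simp add: sum_representation_eq)
  then show ?thesis by (simp add: lin_sum[OF assms(1)] lin_scale[OF assms(1)])
qed

text \<open>With dual coordinates \<open>b\<^sup>*\<close> the operator \<open>f g\<close> is \<open>\<Sum> (b\<^sup>* g) \<otimes> f b\<close>, which has the trace
  \<open>\<Sum> b\<^sup>* (g (f b))\<close>.\<close>
lemma trace_comp_commute:
  assumes f: "endo f" and g: "endo g" shows "trace (\<lambda>x. f (g x)) = trace (\<lambda>x. g (f x))"
proof -
  let ?B = "extend_basis {}" and ?r = "representation (extend_basis {})"
  have "trace (\<lambda>x. f (g x)) = (\<Sum>b\<in>?B. ?r (g (f b)) b)"
    by (rule trace_finite_rank[OF finite_Basis endo_expand[OF f independent_Basis span_Basis]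
          lin_comp[OF g functional_representation[OF independent_Basis span_Basis]]])
  then show ?thesis by (simp add: trace_def)
qed

lemma trace_plus: "endo f \<Longrightarrow> endo g \<Longrightarrow> trace (\<lambda>x. f x + g x) = trace f + trace g"
  unfolding trace_def by (simp add: representation_add independent_Basis sum.distrib)

lemma trace_minus: "endo f \<Longrightarrow> endo g \<Longrightarrow> trace (\<lambda>x. f x - g x) = trace f - trace g"
  unfolding trace_def by (simp add: representation_diff independent_Basis sum_subtractf)

lemma trace_scale: "endo f \<Longrightarrow> trace (\<lambda>x. scale c (f x)) = c * trace f"
  unfolding trace_def by (simp add: representation_scale independent_Basis sum_distrib_left)

lemma trace_zero [simp]: "trace (\<lambda>x. 0) = 0"
  unfolding trace_def by (simp add: representation_zero)

lemma trace_sum: "(\<And>i. i \<in> I \<Longrightarrow> endo (f i)) \<Longrightarrow> trace (\<lambda>x. \<Sum>i\<in>I. f i x) = (\<Sum>i\<in>I. trace (f i))"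
  by (induction I rule: infinite_finite_induct) (auto simp: trace_plus endo_sum)

lemma trace_idempotent:
  assumes P: "endo P" "\<And>x. P x \<in> U" "\<And>x. x \<in> U \<Longrightarrow> P x = x" and U: "subspace U"
  shows "trace P = of_nat (dim U)"
proof -
  obtain B where B: "B \<subseteq> U" "independent B" "U \<subseteq> span B" "card B = dim U"
    using basis_exists by blast
  have fB: "finite B" by (rule finiteI_independent[OF B(2)])
  have sB: "span B = U" by (rule span_subspace[OF B(1,3) U])
  have "trace P = (\<Sum>b\<in>B. representation B (P b) b)"
  proof (rule trace_finite_rank[where \<phi> = "\<lambda>b x. representation B (P x) b" and v = "\<lambda>b. b", OF fB])
    show "P x = (\<Sum>b\<in>B. scale (representation B (P x) b) b)" for x
      using sum_representation_eq[OF B(2) _ fB, of "P x"] P(2) sB by simp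
    show "functional (\<lambda>x. representation B (P x) b)" for b
      by (rule functionalI) (use P sB B in \<open>auto simp: lin_add lin_scale representation_add representation_scale\<close>)
  qed
  also have "\<dots> = (\<Sum>b\<in>B. 1)"
    by (intro sum.cong refl) (use B P in \<open>auto simp: representation_basis subset_iff\<close>)
  finally show ?thesis using B by simp
qed

text \<open>Let \<open>P\<^sub>i\<close> be a projection onto the range of \<open>N\<^sup>i\<close>. Since \<open>N\<close> maps this range into the
  next one, cyclicity of the trace gives
  \<open>tr (N P\<^sub>i) = tr (P\<^sub>i\<^sub>+\<^sub>1 N P\<^sub>i) = tr (N P\<^sub>i P\<^sub>i\<^sub>+\<^sub>1) = tr (N P\<^sub>i\<^sub>+\<^sub>1)\<close>. The first of these numbers is
  \<open>tr N\<close> and the last one is \<open>0\<close>.\<close>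
lemma trace_nilpotent:
  assumes N: "endo N" and nil: "\<And>x. (N ^^ n) x = 0"
  shows "trace N = 0"
proof -
  have sub: "subspace (range (N ^^ i))" for i
  proof (rule subspaceI)
    have eN: "endo (N ^^ i)" by (rule endo_pow[OF N])
    show "0 \<in> range (N ^^ i)" by (rule range_eqI[of _ _ 0]) (simp add: lin_zero[OF eN])
    fix x y :: 'v and c :: 'k
    assume "x \<in> range (N ^^ i)"
    then obtain u where u: "x = (N ^^ i) u" by blast
    show "scale c x \<in> range (N ^^ i)" by (rule range_eqI[of _ _ "scale c u"]) (simp add: u lin_scale[OF eN])
    assume "y \<in> range (N ^^ i)"
    then obtain w where w: "y = (N ^^ i) w" by blast
    show "x + y \<in> range (N ^^ i)" by (rule range_eqI[of _ _ "u + w"]) (simp add: u w lin_add[OF eN])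
  qed
  have "\<exists>P. endo P \<and> (\<forall>x. P x \<in> range (N ^^ i)) \<and> (\<forall>x\<in>range (N ^^ i). P x = x)" for i
    using subspace_projection[OF sub[of i]] by metis
  then obtain P where P: "\<And>i. endo (P i)" "\<And>i x. P i x \<in> range (N ^^ i)" "\<And>i x. x \<in> range (N ^^ i) \<Longrightarrow> P i x = x"
    by metis
  have "trace (\<lambda>x. N (P i x)) = trace N" for i
  proof (induction i)
    case 0
    then show ?case by (simp add: P(3))
  next
    case (Suc i)
    have "P (Suc i) (N (P i x)) = N (P i x)" for x
    proof (rule P(3))
      obtain y where "P i x = (N ^^ i) y" using P(2) by blast
      then have "N (P i x) = (N ^^ Suc i) y" by simp
      then show "N (P i x) \<in> range (N ^^ Suc i)" by blast
    qed
    then have "trace (\<lambda>x. N (P i x)) = trace (\<lambda>x. P (Suc i) (N (P i x)))" by simp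
    also have "\<dots> = trace (\<lambda>x. N (P i (P (Suc i) x)))"
      using trace_comp_commute[OF P(1) endo_comp[OF N P(1)]] by simp
    also have "(\<lambda>x. N (P i (P (Suc i) x))) = (\<lambda>x. N (P (Suc i) x))"
    proof
      fix x
      obtain y where "P (Suc i) x = (N ^^ Suc i) y" using P(2) by blast
      then have "P (Suc i) x = (N ^^ i) (N y)" by (simp add: funpow_swap1)
      then show "N (P i (P (Suc i) x)) = N (P (Suc i) x)" by (metis P(3) rangeI)
    qed
    finally show ?case using Suc by simp
  qed
  from this[of n] have "trace N = trace (\<lambda>x. N (P n x))" by simp
  also have "(\<lambda>x. N (P n x)) = (\<lambda>x. 0)"
    using P(2)[of n] nil lin_zero[OF N] by (metis rangeE)
  finally show ?thesis by simp
qed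

text \<open>When \<open>f\<close> and \<open>g\<close> preserve the image of \<open>P\<close>, one has \<open>f g P = (f P) (g P)\<close> and
  \<open>g f P = (g P) (f P)\<close>, and the trace is cyclic.\<close>
lemma trace_commutator_proj:
  assumes f: "endo f" and g: "endo g" and P: "endo P"
    and fP: "\<And>x. P (f (P x)) = f (P x)" and gP: "\<And>x. P (g (P x)) = g (P x)"
  shows "trace (\<lambda>x. f (g (P x)) - g (f (P x))) = 0"
proof -
  have "trace (\<lambda>x. f (g (P x))) = trace (\<lambda>x. f (P (g (P x))))" by (simp add: gP)
  also have "\<dots> = trace (\<lambda>x. g (P (f (P x))))"
    using trace_comp_commute[OF endo_comp[OF f P] endo_comp[OF g P]] .
  also have "\<dots> = trace (\<lambda>x. g (f (P x)))" by (simp add: fP)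
  finally show ?thesis using trace_minus[OF endo_comp[OF f endo_comp[OF g P]] endo_comp[OF g endo_comp[OF f P]]] by simp
qed

end

section \<open>Bracket and Killing form\<close>

context lie_algebra
begin

lemma endo_br: "endo (br x)"
  by (rule endoI) (simp_all add: br_add_right br_scale_right)

lemma endo_br_left: "endo (\<lambda>x. br x y)"
  by (rule endoI) (simp_all add: br_add_left br_scale_left)

lemmas br_linear =
  lin_zero[OF endo_br] lin_neg[OF endo_br] lin_diff[OF endo_br] lin_sum[OF endo_br]
  lin_zero[OF endo_br_left] lin_neg[OF endo_br_left] lin_diff[OF endo_br_left] lin_sum[OF endo_br_left]
  br_add_left br_add_right br_scale_left br_scale_right

lemma br_skew: "br y x = - br x y"
proof -
  have "br x y + br y x = 0"
    using br_self[of "x + y"] br_self[of x] br_self[of y] unfolding br_add_left br_add_right by (simp add: add.commute)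
  then show ?thesis by (simp add: eq_neg_iff_add_eq_0 add.commute)
qed

lemma br_br: "br x (br y z) = br (br x y) z + br y (br x z)"
proof -
  have "br x (br y z) + br y (br z x) + br z (br x y) = 0" by (rule jacobi)
  moreover have "br y (br z x) = - br y (br x z)" by (subst br_skew) (rule br_linear)
  moreover have "br z (br x y) = - br (br x y) z" by (rule br_skew)
  ultimately show ?thesis by (simp add: algebra_simps)
qed

lemma br_br_left: "br (br x y) z = br x (br y z) - br y (br x z)"
  using br_br[of x y z] by simp

end

context simple_lie_algebra
begin

lemma endo_br_br: "endo (\<lambda>z. br x (br y z))"
  by (rule endo_comp[OF endo_br endo_br])

lemma killing_sym: "killing x y = killing y x"
  unfolding killing_def by (rule trace_comp_commute[OF endo_br endo_br])

lemma killing_add_left: "killing (x + y) z = killing x z + killing y z"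
  unfolding killing_def br_add_left by (rule trace_plus) (rule endo_br_br)+

lemma killing_scale_left: "killing (scale c x) z = c * killing x z"
  unfolding killing_def br_scale_left by (rule trace_scale) (rule endo_br_br)

lemma functional_killing_left: "functional (\<lambda>x. killing x z)"
  by (rule functionalI) (simp_all add: killing_add_left killing_scale_left)

lemma functional_killing: "functional (killing z)"
  by (rule functionalI) (simp_all add: killing_sym[of z] killing_add_left killing_scale_left)

lemmas killing_linear =
  lin_zero[OF functional_killing] lin_neg[OF functional_killing] lin_diff[OF functional_killing]
  lin_sum[OF functional_killing] lin_add[OF functional_killing] lin_scale[OF functional_killing]
  lin_zero[OF functional_killing_left] lin_neg[OF functional_killing_left]
  lin_diff[OF functional_killing_left] lin_sum[OF functional_killing_left]
  killing_add_left killing_scale_left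

lemma trace_br_commutator:
  assumes f: "endo f"
  shows "trace (\<lambda>z. br (br x y) (f z)) = trace (\<lambda>z. br x (br y (f z))) - trace (\<lambda>z. br y (br x (f z)))"
  unfolding br_br_left by (rule trace_minus) (rule endo_comp[OF endo_br_br f])+

lemma killing_invariant: "killing (br x y) z = killing x (br y z)"
proof -
  have "killing (br x y) z = trace (\<lambda>u. br x (br y (br z u))) - trace (\<lambda>u. br y (br x (br z u)))"
    unfolding killing_def by (rule trace_br_commutator[OF endo_br])
  also have "trace (\<lambda>u. br y (br x (br z u))) = trace (\<lambda>u. br x (br z (br y u)))"
    by (rule trace_comp_commute[OF endo_br endo_br_br])
  also have "trace (\<lambda>u. br x (br y (br z u))) - trace (\<lambda>u. br x (br z (br y u))) = killing x (br y z)"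
    unfolding killing_def br_br_left br_linear
    by (rule trace_minus[symmetric]) (rule endo_comp[OF endo_br_br endo_br])+
  finally show ?thesis .
qed

lemma killing_invariant': "killing (br y x) z = - killing x (br y z)"
  by (simp add: br_skew[of y x] killing_linear killing_invariant)

text \<open>The maximum of the exponents over a basis works for all vectors.\<close>
lemma trace_locally_nilpotent:
  assumes N: "endo N" and nil: "\<And>x. \<exists>n. (N ^^ n) x = 0"
  shows "trace N = 0"
proof -
  let ?B = "extend_basis {}"
  obtain n where n: "\<And>x. (N ^^ n x) x = 0" using nil by metis
  define m where "m = Max (n ` ?B)"
  have "(N ^^ m) b = 0" if "b \<in> ?B" for b
  proof -
    have "n b \<le> m" using that by (simp add: m_def)
    then show ?thesis using pow_kernel_mono[OF N n] by blast
  qed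
  then have "(N ^^ m) x = 0" for x
    using endo_expand[OF endo_pow[OF N, of m] independent_Basis span_Basis, of x] by simp
  then show ?thesis by (rule trace_nilpotent[OF N])
qed

lemma killing_radical_ideal: "ideal {x. \<forall>y. killing x y = 0}"
  unfolding ideal_def by (auto simp: subspace_def killing_linear killing_invariant')

text \<open>The derived algebra is a nonzero ideal.\<close>
lemma commutators_span: "span {br x y | x y. True} = UNIV"
proof -
  have "ideal (span {br x y | x y. True})"
    unfolding ideal_def by (auto intro: span_base)
  moreover have "span {br x y | x y. True} \<noteq> {0}"
  proof
    assume *: "span {br x y | x y. True} = {0}"
    obtain x y where "br x y \<noteq> 0" using non_abelian by blast
    moreover have "br x y \<in> span {br x y | x y. True}" by (rule span_base) blast
    ultimately show False using * by auto
  qed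
  ultimately show ?thesis using no_proper_ideal by blast
qed

text \<open>Because \<open>N\<close> and \<open>M\<close> commute, both \<open>N x\<close> and \<open>M x\<close> are killed by powers with a smaller
  sum of exponents.\<close>
lemma commuting_nilpotent_sum:
  assumes N: "endo N" and M: "endo M" and NM: "\<And>x. N (M x) = M (N x)"
    and "(N ^^ n) x = 0" "(M ^^ m) x = 0"
  shows "\<exists>k. ((\<lambda>x. N x + M x) ^^ k) x = 0"
  using assms(4,5)
proof (induction "n + m" arbitrary: n m x rule: less_induct)
  case less
  let ?S = "\<lambda>x. N x + M x"
  have S: "endo ?S" by (rule endo_plus[OF N M])
  show ?case
  proof (cases "n = 0 \<or> m = 0")
    case True
    then have "x = 0" using less.prems by auto
    then show ?thesis by (intro exI[of _ 0]) simp
  next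
    case False
    then obtain n' m' where nm: "n = Suc n'" "m = Suc m'" by (meson not0_implies_Suc)
    have "(N ^^ n') (N x) = 0" using less.prems(1) nm by (simp only: funpow_Suc_right o_apply)
    moreover have "(M ^^ m) (N x) = 0"
      using funpow_commute[of M N m x] NM less.prems(2) lin_zero[OF N] by simp
    ultimately obtain k where k: "(?S ^^ k) (N x) = 0" using less.hyps[of n' m "N x"] nm by auto
    have "(M ^^ m') (M x) = 0" using less.prems(2) nm by (simp only: funpow_Suc_right o_apply)
    moreover have "(N ^^ n) (M x) = 0"
      using funpow_commute[of N M n x] NM less.prems(1) lin_zero[OF M] by simp
    ultimately obtain l where l: "(?S ^^ l) (M x) = 0" using less.hyps[of n m' "M x"] nm by auto
    have "(?S ^^ max k l) (N x + M x) = 0"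
      using pow_kernel_mono[OF S k, of "max k l"] pow_kernel_mono[OF S l, of "max k l"]
      by (simp add: lin_add[OF endo_pow[OF S]])
    then have "(?S ^^ Suc (max k l)) x = 0" by (simp only: funpow_Suc_right o_apply)
    then show ?thesis by blast
  qed
qed

text \<open>By the Leibniz rule \<open>ad h - (a + b)\<close> maps \<open>[x, y]\<close> to
  \<open>[(ad h - a) x, y] + [x, (ad h - b) y]\<close>, where both terms have a smaller sum of exponents.\<close>
lemma gen_eig_br:
  assumes "x \<in> gen_eig (br h) a" "y \<in> gen_eig (br h) b"
  shows "br x y \<in> gen_eig (br h) (a + b)"
proof -
  obtain n m where "((\<lambda>y. br h y - scale a y) ^^ n) x = 0" "((\<lambda>z. br h z - scale b z) ^^ m) y = 0"
    using assms by (auto simp: gen_eig_def)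
  then show ?thesis
  proof (induction "n + m" arbitrary: n m x y rule: less_induct)
    case less
    let ?A = "\<lambda>y. br h y - scale a y" and ?B = "\<lambda>y. br h y - scale b y"
    show ?case
    proof (cases "n = 0 \<or> m = 0")
      case True
      then have "br x y = 0" using less.prems by (auto simp: br_linear)
      then show ?thesis using subspace_0[OF subspace_gen_eig[OF endo_br]] by simp
    next
      case False
      then obtain n' m' where nm: "n = Suc n'" "m = Suc m'" by (meson not0_implies_Suc)
      have "(?A ^^ n') (?A x) = 0" using less.prems(1) nm by (simp only: funpow_Suc_right o_apply)
      then have 1: "br (?A x) y \<in> gen_eig (br h) (a + b)"
        using less.hyps[of n' m "?A x" y] nm less.prems(2) by auto
      have "(?B ^^ m') (?B y) = 0" using less.prems(2) nm by (simp only: funpow_Suc_right o_apply)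
      then have 2: "br x (?B y) \<in> gen_eig (br h) (a + b)"
        using less.hyps[of n m' x "?B y"] nm less.prems(1) by auto
      have "br (?A x) y + br x (?B y) = br h (br x y) - scale (a + b) (br x y)"
        unfolding br_br[of h x y] by (simp add: br_linear algebra_simps)
      then have "br h (br x y) - scale (a + b) (br x y) \<in> gen_eig (br h) (a + b)"
        using subspace_add[OF subspace_gen_eig[OF endo_br] 1 2] by simp
      then show ?thesis by (rule gen_eig_stepD)
    qed
  qed
qed

end

section \<open>Generalised weight spaces\<close>

context based_simple_lie_algebra
begin

lemma subspace_H: "subspace H" and H_br_closed: "x \<in> H \<Longrightarrow> y \<in> H \<Longrightarrow> br x y \<in> H"
  and H_self_normalizing: "(\<And>h. h \<in> H \<Longrightarrow> br x h \<in> H) \<Longrightarrow> x \<in> H"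
  using cartan by (auto simp: cartan_subalgebra_def subalgebra_def)

lemma Pi_roots: "\<Pi> \<subseteq> roots H" and Pi_independent: "fun_space.independent \<Pi>"
  and Pi_span: "fun_space.span \<Pi> = dual_space H"
  using base by (auto simp: root_base_def)

lemma subspace_dual: "fun_space.subspace (dual_space H)"
  using Pi_span fun_space.subspace_span by metis

lemma dual_add: "f \<in> dual_space H \<Longrightarrow> g \<in> dual_space H \<Longrightarrow> f + g \<in> dual_space H"
  and dual_scale: "f \<in> dual_space H \<Longrightarrow> fun_scale c f \<in> dual_space H"
  and dual_zero: "0 \<in> dual_space H"
  and dual_neg: "f \<in> dual_space H \<Longrightarrow> - f \<in> dual_space H"
  and dual_diff: "f \<in> dual_space H \<Longrightarrow> g \<in> dual_space H \<Longrightarrow> f - g \<in> dual_space H"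
  and dual_sum: "(\<And>i. i \<in> I \<Longrightarrow> F i \<in> dual_space H) \<Longrightarrow> sum F I \<in> dual_space H"
  using subspace_dual
  by (auto intro: fun_space.subspace_add fun_space.subspace_scale fun_space.subspace_0 fun_space.subspace_neg
      fun_space.subspace_diff fun_space.subspace_sum)

lemma dual_apply:
  assumes "f \<in> dual_space H"
  shows "x \<in> H \<Longrightarrow> y \<in> H \<Longrightarrow> f (x + y) = f x + f y" "x \<in> H \<Longrightarrow> f (scale c x) = c * f x"
    "x \<notin> H \<Longrightarrow> f x = 0"
  using assms by (auto simp: dual_space_def)

lemma dual_apply_sum:
  assumes "f \<in> dual_space H" "\<And>i. i \<in> I \<Longrightarrow> x i \<in> H"
  shows "f (\<Sum>i\<in>I. x i) = (\<Sum>i\<in>I. f (x i))"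
  using assms(2)
proof (induction I rule: infinite_finite_induct)
  case (insert i I)
  then show ?case using dual_apply(1)[OF assms(1), of "x i" "sum x I"]
    by (simp add: subspace_sum[OF subspace_H])
qed (use dual_apply(2)[OF assms(1), of 0 0] subspace_0[OF subspace_H] in simp_all)

lemma roots_dual: "\<gamma> \<in> roots H \<Longrightarrow> \<gamma> \<in> dual_space H"
  by (simp add: roots_def)

lemma Pi_dual: "\<beta> \<in> \<Pi> \<Longrightarrow> \<beta> \<in> dual_space H"
  using Pi_roots roots_dual by blast

lemma dual_restrict: "functional f \<Longrightarrow> (\<lambda>x. if x \<in> H then f x else 0) \<in> dual_space H"
  using subspace_H by (auto simp: dual_space_def lin_add lin_scale subspace_add subspace_scale)

lemma dual_eqI:
  assumes "f \<in> dual_space H" "g \<in> dual_space H" "\<And>x. x \<in> H \<Longrightarrow> f x = g x"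
  shows "f = g"
proof
  fix x show "f x = g x" using assms by (cases "x \<in> H") (auto simp: dual_apply(3))
qed

text \<open>The base spans the dual of \<open>H\<close>, and a nonzero vector of \<open>H\<close> is detected by a
  coordinate form.\<close>
lemma Pi_separates:
  assumes "z \<in> H" "\<And>\<beta>. \<beta> \<in> \<Pi> \<Longrightarrow> \<beta> z = 0" shows "z = 0"
proof (rule ccontr)
  assume z: "z \<noteq> 0"
  have "fun_space.subspace {f. f z = 0}"
    by (auto simp: fun_space.subspace_def fun_scale_def)
  then have "fun_space.span \<Pi> \<subseteq> {f. f z = 0}"
    using assms(2) by (intro fun_space.span_minimal) auto
  then have *: "f z = 0" if "f \<in> dual_space H" for f using that Pi_span by auto
  have ind: "independent {z}" using z by simp
  let ?B = "extend_basis {z}"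
  have B: "independent ?B" "span ?B = UNIV" "z \<in> ?B"
    using independent_extend_basis[OF ind] span_extend_basis[OF ind] extend_basis_superset[OF ind] by auto
  have "representation ?B z z = 0"
    using *[OF dual_restrict[OF functional_representation[OF B(1,2), of z]]] assms(1) by simp
  then show False using B by (simp add: representation_basis)
qed

text \<open>On a root vector for \<open>\<beta>\<close> the element \<open>[x, y]\<close> acts as a commutator of two scalars, so
  \<open>\<beta>\<close> vanishes on it; the roots in the base separate the points of \<open>H\<close>.\<close>
lemma H_abelian: assumes "x \<in> H" "y \<in> H" shows "br x y = 0"
proof (rule Pi_separates)
  show "br x y \<in> H" using assms by (rule H_br_closed)
  fix \<beta> assume "\<beta> \<in> \<Pi>"
  then have "\<beta> \<in> roots H" using Pi_roots by blast
  then obtain v where v: "v \<in> root_space H \<beta>" "v \<noteq> 0"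
  proof -
    have "0 \<in> root_space H \<beta>" by (simp add: root_space_def br_linear)
    then show ?thesis using that \<open>\<beta> \<in> roots H\<close> by (auto simp: roots_def)
  qed
  have h: "br h v = scale (\<beta> h) v" if "h \<in> H" for h using v that by (simp add: root_space_def)
  have "scale (\<beta> (br x y)) v = br (br x y) v" using assms by (simp add: h H_br_closed)
  also have "\<dots> = 0" unfolding br_br_left using assms by (simp add: h br_linear mult.commute)
  finally show "\<beta> (br x y) = 0" using v by simp
qed

lemma H_commute: "h \<in> H \<Longrightarrow> h' \<in> H \<Longrightarrow> br h (br h' x) = br h' (br h x)"
  using br_br[of h h' x] H_abelian[of h h'] by (simp add: br_linear)

definition bH :: "'v set" where
  "bH = (SOME B. B \<subseteq> H \<and> independent B \<and> span B = H)"

lemma bH: "bH \<subseteq> H" "independent bH" "span bH = H" "finite bH"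
proof -
  obtain B where "B \<subseteq> H" "independent B" "H \<subseteq> span B" using maximal_independent_subset by blast
  then have "\<exists>B. B \<subseteq> H \<and> independent B \<and> span B = H"
    using span_subspace[OF _ _ subspace_H] by blast
  then show *: "bH \<subseteq> H" "independent bH" "span bH = H"
    unfolding bH_def by (metis (mono_tags, lifting) someI_ex)+
  show "finite bH" using *(2) by (rule finiteI_independent)
qed

text \<open>The generalised weight space. That \<open>H\<close> acts on it by scalars is a theorem,
  \<open>H_acts_diagonally\<close>, whose proof uses that the Killing form is nondegenerate.\<close>
definition G :: "('v \<Rightarrow> 'k) \<Rightarrow> 'v set" where
  "G \<gamma> = (\<Inter>h\<in>H. gen_eig (br h) (\<gamma> h))"

lemma subspace_G: "subspace (G \<gamma>)"
  unfolding G_def by (intro subspace_Int subspace_gen_eig endo_br)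

lemma gen_eig_H_stable: "h \<in> H \<Longrightarrow> h' \<in> H \<Longrightarrow> x \<in> gen_eig (br h) a \<Longrightarrow> br h' x \<in> gen_eig (br h) a"
  by (rule gen_eig_commute[OF endo_br]) (simp_all add: H_commute)

lemma G_stable: "h \<in> H \<Longrightarrow> x \<in> G \<gamma> \<Longrightarrow> br h x \<in> G \<gamma>"
  unfolding G_def using gen_eig_H_stable by blast

lemma br_G: "x \<in> G \<gamma> \<Longrightarrow> y \<in> G \<delta> \<Longrightarrow> br x y \<in> G (\<gamma> + \<delta>)"
  unfolding G_def using gen_eig_br by fastforce

text \<open>The operator \<open>ad (h + h') - (a + b)\<close> is the sum of the commuting operators \<open>ad h - a\<close>
  and \<open>ad h' - b\<close>.\<close>
lemma gen_eig_plus: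
  assumes "h \<in> H" "h' \<in> H" "x \<in> gen_eig (br h) a" "x \<in> gen_eig (br h') b"
  shows "x \<in> gen_eig (br (h + h')) (a + b)"
proof -
  let ?N = "\<lambda>y. br h y - scale a y" and ?M = "\<lambda>y. br h' y - scale b y"
  obtain n m where "(?N ^^ n) x = 0" "(?M ^^ m) x = 0" using assms by (auto simp: gen_eig_def)
  moreover have "?N (?M y) = ?M (?N y)" for y
    using H_commute[OF assms(1,2)] by (simp add: br_linear algebra_simps)
  ultimately obtain k where k: "((\<lambda>x. ?N x + ?M x) ^^ k) x = 0"
    using commuting_nilpotent_sum[OF endo_shift[OF endo_br] endo_shift[OF endo_br]] by blast
  have "(\<lambda>x. ?N x + ?M x) = (\<lambda>y. br (h + h') y - scale (a + b) y)"
    by (rule ext) (simp add: br_linear algebra_simps)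
  then show ?thesis using k by (auto simp: gen_eig_def)
qed

lemma gen_eig_scale:
  assumes "x \<in> gen_eig (br h) a" shows "x \<in> gen_eig (br (scale c h)) (c * a)"
proof -
  obtain n where n: "((\<lambda>y. br h y - scale a y) ^^ n) x = 0" using assms by (auto simp: gen_eig_def)
  have "((\<lambda>y. br (scale c h) y - scale (c * a) y) ^^ n) x = scale (c ^ n) (((\<lambda>y. br h y - scale a y) ^^ n) x)"
    by (induction n) (simp_all add: br_linear algebra_simps)
  then show ?thesis using n by (auto simp: gen_eig_def)
qed

lemma G_basis:
  assumes "\<gamma> \<in> dual_space H" "x \<in> (\<Inter>h\<in>bH. gen_eig (br h) (\<gamma> h))" shows "x \<in> G \<gamma>"
proof -
  have "h \<in> H \<and> x \<in> gen_eig (br h) (\<gamma> h)" if "h \<in> span bH" for h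
    using that
  proof (induction rule: span_induct_alt)
    case base
    have "\<gamma> 0 = 0" using dual_apply(2)[OF assms(1), of 0 0] subspace_0[OF subspace_H] by simp
    moreover have "x \<in> gen_eig (br 0) 0" unfolding gen_eig_def by (auto simp: br_linear intro!: exI[of _ 1])
    ultimately show ?case using subspace_0[OF subspace_H] by simp
  next
    case (step c h y)
    then have hH: "h \<in> H" "scale c h \<in> H" using bH(1) subspace_scale[OF subspace_H] by auto
    have "x \<in> gen_eig (br (scale c h)) (c * \<gamma> h)" using step assms(2) by (intro gen_eig_scale) auto
    then have "x \<in> gen_eig (br (scale c h + y)) (c * \<gamma> h + \<gamma> y)" using step hH by (intro gen_eig_plus) auto
    then show ?case using dual_apply[OF assms(1)] hH step by (simp add: subspace_add[OF subspace_H])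
  qed
  then show ?thesis using bH(3) by (auto simp: G_def)
qed

text \<open>The joint generalised eigenspaces for \<open>F\<close> are stable under one more element of \<open>H\<close>, so
  \<open>gen_eig_span\<close> decomposes them further.\<close>
lemma weight_span_finite:
  assumes "finite F" "F \<subseteq> H"
  shows "span (\<Union>\<gamma>. \<Inter>h\<in>F. gen_eig (br h) (\<gamma> h)) = UNIV"
  using assms
proof (induction F)
  case (insert h F)
  let ?W = "\<lambda>\<gamma>. \<Inter>h\<in>F. gen_eig (br h) (\<gamma> h)"
  let ?S = "span (\<Union>\<gamma>. \<Inter>h\<in>insert h F. gen_eig (br h) (\<gamma> h))"
  have "?W \<gamma> \<subseteq> ?S" for \<gamma> :: "'v \<Rightarrow> 'k"
  proof -
    have "subspace (?W \<gamma>)" by (intro subspace_Int subspace_gen_eig endo_br)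
    moreover have "br h x \<in> ?W \<gamma>" if "x \<in> ?W \<gamma>" for x
      using that insert.prems gen_eig_H_stable by auto
    ultimately have "?W \<gamma> = span (\<Union>b. gen_eig (br h) b \<inter> ?W \<gamma>)" using gen_eig_span[OF endo_br, of "?W \<gamma>" h] by blast
    also have "\<dots> \<subseteq> ?S"
    proof (rule span_mono, safe)
      fix b x assume x: "x \<in> gen_eig (br h) b" "x \<in> ?W \<gamma>"
      have "x \<in> (\<Inter>h'\<in>insert h F. gen_eig (br h') ((\<gamma>(h := b)) h'))" using x insert.hyps by auto
      then show "x \<in> (\<Union>\<gamma>. \<Inter>h\<in>insert h F. gen_eig (br h) (\<gamma> h))" by blast
    qed
    finally show ?thesis .
  qed
  then have "span (\<Union>\<gamma>. ?W \<gamma>) \<subseteq> ?S" by (intro span_minimal) auto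
  then show ?case using insert by auto
qed simp

text \<open>A choice of eigenvalues for a basis of \<open>H\<close> extends to a linear form on \<open>H\<close>.\<close>
lemma G_span: "span (\<Union>\<gamma>\<in>dual_space H. G \<gamma>) = UNIV"
proof -
  have "(\<Union>\<gamma>. \<Inter>h\<in>bH. gen_eig (br h) (\<gamma> h)) \<subseteq> (\<Union>\<gamma>\<in>dual_space H. G \<gamma>)"
  proof safe
    fix x \<gamma> assume x: "x \<in> (\<Inter>h\<in>bH. gen_eig (br h) (\<gamma> h))"
    let ?B = "extend_basis bH"
    have B: "independent ?B" "span ?B = UNIV" "bH \<subseteq> ?B"
      using independent_extend_basis[OF bH(2)] span_extend_basis[OF bH(2)] extend_basis_superset[OF bH(2)] by auto
    define f where "f = (\<lambda>x. \<Sum>b\<in>bH. representation ?B x b * \<gamma> b)"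
    have f: "functional f" unfolding f_def
      by (rule functionalI) (use B in \<open>simp_all add: representation_add representation_scale sum.distrib sum_distrib_left algebra_simps\<close>)
    have fb: "f b = \<gamma> b" if "b \<in> bH" for b
    proof -
      have "f b = (\<Sum>b'\<in>bH. if b' = b then \<gamma> b' else 0)" unfolding f_def
        using B that by (intro sum.cong) (auto simp: representation_basis)
      then show ?thesis using that bH(4) by simp
    qed
    let ?g = "\<lambda>x. if x \<in> H then f x else 0"
    have "?g \<in> dual_space H" by (rule dual_restrict[OF f])
    moreover have "x \<in> (\<Inter>h\<in>bH. gen_eig (br h) (?g h))" using x fb bH(1) by auto
    ultimately show "x \<in> (\<Union>\<gamma>\<in>dual_space H. G \<gamma>)" using G_basis by blast
  qed
  from span_mono[OF this] show ?thesis by (simp only: weight_span_finite[OF bH(4,1)] top.extremum_unique)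
qed

text \<open>A power of \<open>ad h - \<delta>(h)\<close> kills the component for \<open>\<delta>\<close>. It is injective on the space of
  a weight \<open>\<epsilon>\<close> with \<open>\<epsilon>(h) \<noteq> \<delta>(h)\<close>, and by induction it kills the component for \<open>\<epsilon>\<close> too.\<close>
lemma G_indep:
  assumes "finite F" "F \<subseteq> dual_space H" "\<And>\<gamma>. \<gamma> \<in> F \<Longrightarrow> x \<gamma> \<in> G \<gamma>" "(\<Sum>\<gamma>\<in>F. x \<gamma>) = 0" "\<gamma> \<in> F"
  shows "x \<gamma> = 0"
  using assms
proof (induction F arbitrary: x \<gamma> rule: finite_induct)
  case (insert \<delta> F)
  have F0: "x \<epsilon> = 0" if \<epsilon>: "\<epsilon> \<in> F" for \<epsilon>
  proof -
    have "\<epsilon> \<noteq> \<delta>" using \<epsilon> insert.hyps by auto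
    then obtain h where h: "h \<in> H" "\<epsilon> h \<noteq> \<delta> h"
      using dual_eqI[of \<epsilon> \<delta>] insert.prems(1) \<epsilon> by blast
    let ?N = "\<lambda>y. br h y - scale (\<delta> h) y"
    have N: "endo (?N ^^ n)" for n by (intro endo_pow endo_shift endo_br)
    obtain n where n: "(?N ^^ n) (x \<delta>) = 0"
      using insert.prems(2)[of \<delta>] h by (auto simp: G_def gen_eig_def)
    have stab: "(?N ^^ n) y \<in> G \<gamma>" if "y \<in> G \<gamma>" for y n \<gamma>
      using that by (induction n) (auto intro!: subspace_diff[OF subspace_G] subspace_scale[OF subspace_G] G_stable h)
    have "(\<Sum>\<gamma>\<in>insert \<delta> F. (?N ^^ n) (x \<gamma>)) = 0"
      using lin_sum[OF N, of n x "insert \<delta> F"] insert.prems(3) lin_zero[OF N, of n] by simp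
    then have "(\<Sum>\<gamma>\<in>F. (?N ^^ n) (x \<gamma>)) = 0" using insert.hyps n by simp
    then have "(?N ^^ n) (x \<epsilon>) = 0"
      using insert.prems(1,2) \<epsilon> stab by (intro insert.IH[of "\<lambda>\<gamma>. (?N ^^ n) (x \<gamma>)"]) auto
    moreover have "x \<epsilon> \<in> gen_eig (br h) (\<epsilon> h)" using insert.prems(2)[of \<epsilon>] \<epsilon> h by (auto simp: G_def)
    ultimately show "x \<epsilon> = 0" using gen_eig_shift_pow_inj[OF endo_br] h(2) by metis
  qed
  then have "x \<delta> = 0" using insert.prems(3) insert.hyps by simp
  then show ?case using insert.prems(4) F0 by auto
qed simp

definition weights :: "('v \<Rightarrow> 'k) set" where
  "weights = {\<gamma>\<in>dual_space H. G \<gamma> \<noteq> {0}}"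

lemma weights_dual: "\<gamma> \<in> weights \<Longrightarrow> \<gamma> \<in> dual_space H"
  by (simp add: weights_def)

lemma G_trivial: "\<gamma> \<in> dual_space H \<Longrightarrow> \<gamma> \<notin> weights \<Longrightarrow> x \<in> G \<gamma> \<Longrightarrow> x = 0"
  by (auto simp: weights_def)

text \<open>Nonzero vectors of different weights are linearly independent.\<close>
lemma finite_weights: "finite weights"
proof (rule ccontr)
  assume "infinite weights"
  then obtain F where F: "finite F" "card F = Suc dimension" "F \<subseteq> weights"
    using infinite_arbitrarily_large by blast
  have "\<exists>x. x \<in> G \<gamma> \<and> x \<noteq> 0" if "\<gamma> \<in> F" for \<gamma>
    using that F(3) subspace_0[OF subspace_G] by (auto simp: weights_def)
  then obtain x where x: "\<And>\<gamma>. \<gamma> \<in> F \<Longrightarrow> x \<gamma> \<in> G \<gamma>" "\<And>\<gamma>. \<gamma> \<in> F \<Longrightarrow> x \<gamma> \<noteq> 0" by metis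
  have FD: "F \<subseteq> dual_space H" using F(3) weights_dual by auto
  have lin0: "c \<gamma> = 0" if "(\<Sum>\<gamma>\<in>F. scale (c \<gamma>) (x \<gamma>)) = 0" "\<gamma> \<in> F" for c \<gamma>
    using G_indep[OF F(1) FD _ that, of] x that(2) subspace_scale[OF subspace_G] by auto
  have inj: "inj_on x F"
  proof (rule inj_onI)
    fix \<gamma> \<delta> assume *: "\<gamma> \<in> F" "\<delta> \<in> F" "x \<gamma> = x \<delta>"
    show "\<gamma> = \<delta>"
    proof (rule ccontr)
      assume ne: "\<gamma> \<noteq> \<delta>"
      let ?c = "\<lambda>\<epsilon>. if \<epsilon> = \<gamma> then 1 else if \<epsilon> = \<delta> then -1 else (0::'k)"
      have "(\<Sum>\<epsilon>\<in>F. scale (?c \<epsilon>) (x \<epsilon>)) = (\<Sum>\<epsilon>\<in>{\<gamma>, \<delta>}. scale (?c \<epsilon>) (x \<epsilon>))"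
        using * F(1) by (intro sum.mono_neutral_right) auto
      also have "\<dots> = 0" using ne * by simp
      finally show False using lin0[of ?c \<gamma>] * by simp
    qed
  qed
  have "independent (x ` F)"
    using F(1) lin0 inj by (intro independent_if_scalars_zero) (auto simp: sum.reindex)
  then have "card (x ` F) \<le> dim UNIV" by (intro independent_card_le_dim) auto
  then show False using F(2) inj by (simp add: card_image dimension_def)
qed

lemma weights_span: "span (\<Union>\<gamma>\<in>weights. G \<gamma>) = UNIV"
proof -
  have "G \<gamma> \<subseteq> span (\<Union>\<gamma>\<in>weights. G \<gamma>)" if "\<gamma> \<in> dual_space H" for \<gamma>
  proof (cases "\<gamma> \<in> weights")
    case True then show ?thesis by (auto intro: span_base)
  next
    case False then show ?thesis using G_trivial[OF that False] span_zero by auto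
  qed
  then have "span (\<Union>\<gamma>\<in>dual_space H. G \<gamma>) \<subseteq> span (\<Union>\<gamma>\<in>weights. G \<gamma>)" by (intro span_minimal) auto
  then show ?thesis using G_span by auto
qed

lemma weight_decomposition_exists: "\<exists>u. (\<forall>\<gamma>\<in>weights. u \<gamma> \<in> G \<gamma>) \<and> x = (\<Sum>\<gamma>\<in>weights. u \<gamma>)"
proof -
  have "x \<in> span (\<Union>\<gamma>\<in>weights. G \<gamma>)" using weights_span by simp
  then show ?thesis
  proof (induction rule: span_induct_alt)
    case base
    then show ?case by (intro exI[of _ "\<lambda>_. 0"]) (auto simp: subspace_0[OF subspace_G])
  next
    case (step c y z)
    then obtain \<gamma> u where u: "y \<in> G \<gamma>" "\<gamma> \<in> weights" "\<forall>\<gamma>\<in>weights. u \<gamma> \<in> G \<gamma>" "z = (\<Sum>\<gamma>\<in>weights. u \<gamma>)" by auto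
    let ?u = "\<lambda>\<epsilon>. (if \<epsilon> = \<gamma> then scale c y else 0) + u \<epsilon>"
    have "scale c y + z = (\<Sum>\<gamma>\<in>weights. ?u \<gamma>)"
      using u finite_weights by (simp add: sum.distrib)
    moreover have "\<forall>\<gamma>\<in>weights. ?u \<gamma> \<in> G \<gamma>"
      using u by (auto intro!: subspace_add[OF subspace_G] subspace_scale[OF subspace_G])
    ultimately show ?case by (intro exI[of _ ?u] conjI)
  qed
qed

text \<open>The component of weight \<open>\<gamma>\<close>. The value \<open>0\<close> off the set of weights makes \<open>proj_on\<close>
  valid for all linear forms.\<close>
definition proj :: "('v \<Rightarrow> 'k) \<Rightarrow> 'v \<Rightarrow> 'v" where
  "proj \<gamma> x = (if \<gamma> \<in> weights then
     (SOME u. (\<forall>\<gamma>\<in>weights. u \<gamma> \<in> G \<gamma>) \<and> x = (\<Sum>\<gamma>\<in>weights. u \<gamma>)) \<gamma> else 0)"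

lemma proj_in: "proj \<gamma> x \<in> G \<gamma>" and proj_sum: "(\<Sum>\<gamma>\<in>weights. proj \<gamma> x) = x"
proof -
  let ?u = "SOME u. (\<forall>\<gamma>\<in>weights. u \<gamma> \<in> G \<gamma>) \<and> x = (\<Sum>\<gamma>\<in>weights. u \<gamma>)"
  have *: "(\<forall>\<gamma>\<in>weights. ?u \<gamma> \<in> G \<gamma>) \<and> x = (\<Sum>\<gamma>\<in>weights. ?u \<gamma>)"
    by (rule someI_ex[OF weight_decomposition_exists])
  show "proj \<gamma> x \<in> G \<gamma>" using * subspace_0[OF subspace_G] by (auto simp: proj_def)
  have "(\<Sum>\<gamma>\<in>weights. proj \<gamma> x) = (\<Sum>\<gamma>\<in>weights. ?u \<gamma>)" by (simp add: proj_def)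
  then show "(\<Sum>\<gamma>\<in>weights. proj \<gamma> x) = x" using * by simp
qed

lemma proj_eqI:
  assumes "\<And>\<gamma>. \<gamma> \<in> weights \<Longrightarrow> u \<gamma> \<in> G \<gamma>" "x = (\<Sum>\<gamma>\<in>weights. u \<gamma>)" "\<gamma> \<in> weights"
  shows "proj \<gamma> x = u \<gamma>"
proof -
  have "(\<Sum>\<gamma>\<in>weights. proj \<gamma> x - u \<gamma>) = 0"
    using assms(2) by (simp add: sum_subtractf proj_sum)
  then have "proj \<gamma> x - u \<gamma> = 0"
    using assms(1,3) proj_in by (intro G_indep[OF finite_weights, of "\<lambda>\<gamma>. proj \<gamma> x - u \<gamma>"])
       (auto intro: weights_dual subspace_diff[OF subspace_G])
  then show ?thesis by simp
qed

lemma endo_proj: "endo (proj \<gamma>)"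
proof (cases "\<gamma> \<in> weights")
  case True
  show ?thesis
  proof (rule endoI)
    show "proj \<gamma> (x + y) = proj \<gamma> x + proj \<gamma> y" for x y
      by (rule proj_eqI[OF _ _ True, of "\<lambda>\<gamma>. proj \<gamma> x + proj \<gamma> y"])
        (auto simp: proj_in sum.distrib proj_sum intro: subspace_add[OF subspace_G])
    show "proj \<gamma> (scale c x) = scale c (proj \<gamma> x)" for c x
      by (rule proj_eqI[OF _ _ True, of "\<lambda>\<gamma>. scale c (proj \<gamma> x)"])
        (auto simp: proj_in scale_sum_right[symmetric] proj_sum intro: subspace_scale[OF subspace_G])
  qed
qed (simp add: proj_def[abs_def] endo_zero)

lemma proj_on:
  assumes "x \<in> G \<delta>" "\<delta> \<in> dual_space H"
  shows "proj \<gamma> x = (if \<gamma> = \<delta> then x else 0)"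
proof (cases "\<delta> \<in> weights")
  case False
  then have "x = 0" using G_trivial assms by blast
  then show ?thesis by (simp add: lin_zero[OF endo_proj])
next
  case True
  show ?thesis
  proof (cases "\<gamma> \<in> weights")
    case g: True
    show ?thesis
      using True finite_weights subspace_0[OF subspace_G] assms(1)
      by (intro proj_eqI[OF _ _ g, of "\<lambda>\<gamma>. if \<gamma> = \<delta> then x else 0"]) auto
  next
    case False then show ?thesis using True by (auto simp: proj_def)
  qed
qed

lemma proj_trace: "\<gamma> \<in> dual_space H \<Longrightarrow> trace (proj \<gamma>) = of_nat (dim (G \<gamma>))"
  by (rule trace_idempotent[OF endo_proj proj_in _ subspace_G]) (simp add: proj_on)

lemma endo_sum_proj: "endo (\<lambda>x. \<Sum>\<gamma>\<in>F. proj \<gamma> x)"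
  by (rule endo_sum) (rule endo_proj)

text \<open>On \<open>G \<gamma>\<close> the operator \<open>ad h - \<gamma>(h)\<close> is nilpotent and commutes with \<open>ad h'\<close>, so its
  product with \<open>ad h'\<close> is nilpotent and has trace zero there.\<close>
lemma trace_H_proj:
  assumes "h \<in> H" "\<gamma> \<in> dual_space H"
  shows "trace (\<lambda>x. br h (proj \<gamma> x)) = of_nat (dim (G \<gamma>)) * \<gamma> h"
    and "h' \<in> H \<Longrightarrow> trace (\<lambda>x. br h (br h' (proj \<gamma> x))) = of_nat (dim (G \<gamma>)) * \<gamma> h * \<gamma> h'"
proof -
  have nil: "trace (\<lambda>x. br h (f (proj \<gamma> x)) - scale (\<gamma> h) (f (proj \<gamma> x))) = 0"
    if h: "h \<in> H" and f: "endo f" "\<And>x. br h (f x) = f (br h x)" "\<And>x. x \<in> G \<gamma> \<Longrightarrow> f x \<in> G \<gamma>" for h f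
  proof (rule trace_locally_nilpotent)
    let ?N = "\<lambda>x. br h (f (proj \<gamma> x)) - scale (\<gamma> h) (f (proj \<gamma> x))"
    let ?S = "\<lambda>y. br h y - scale (\<gamma> h) y"
    show "endo ?N"
      by (intro endo_minus endo_smult endo_comp[OF endo_br endo_comp[OF f(1) endo_proj]] endo_comp[OF f(1) endo_proj])
    fix x
    have SG: "?S y \<in> G \<gamma>" if "y \<in> G \<gamma>" for y
      using that by (auto intro!: subspace_diff[OF subspace_G] subspace_scale[OF subspace_G] G_stable h)
    have Sf: "?S (f y) = f (?S y)" for y by (simp add: f(2) lin_diff[OF f(1)] lin_scale[OF f(1)])
    have pow: "(?S ^^ k) y \<in> G \<gamma>" if "y \<in> G \<gamma>" for k y using that SG by (induction k) auto
    have fpow: "(f ^^ k) y \<in> G \<gamma>" if "y \<in> G \<gamma>" for k y using that f(3) by (induction k) auto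
    have *: "(?N ^^ k) y = (f ^^ k) ((?S ^^ k) y)" if "y \<in> G \<gamma>" for k y
      using that
    proof (induction k)
      case (Suc k)
      have "(f ^^ k) ((?S ^^ k) y) \<in> G \<gamma>" using pow fpow Suc.prems by blast
      then have "proj \<gamma> ((f ^^ k) ((?S ^^ k) y)) = (f ^^ k) ((?S ^^ k) y)" using proj_on assms(2) by simp
      then have "(?N ^^ Suc k) y = ?S (f ((f ^^ k) ((?S ^^ k) y)))" using Suc by simp
      also have "\<dots> = f (?S ((f ^^ k) ((?S ^^ k) y)))" by (rule Sf)
      also have "?S ((f ^^ k) ((?S ^^ k) y)) = (f ^^ k) (?S ((?S ^^ k) y))"
        by (rule funpow_commute[symmetric]) (rule Sf[symmetric])
      finally show ?case by simp
    qed simp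
    have G: "proj \<gamma> x \<in> G \<gamma>" by (rule proj_in)
    then obtain k where k: "(?S ^^ k) (proj \<gamma> x) = 0" using h by (auto simp: G_def gen_eig_def)
    have "(?N ^^ Suc k) x = (?N ^^ Suc k) (proj \<gamma> x)"
      unfolding funpow_Suc_right o_apply by (simp add: proj_on[OF G assms(2)])
    also have "\<dots> = 0"
      using *[OF G, of "Suc k"] k lin_zero[OF endo_pow[OF f(1)]] by (simp add: br_linear lin_zero[OF f(1)])
    finally show "\<exists>n. (?N ^^ n) x = 0" by blast
  qed
  have step: "trace (\<lambda>x. br h (f (proj \<gamma> x))) = \<gamma> h * trace (\<lambda>x. f (proj \<gamma> x))"
    if h: "h \<in> H" and f: "endo f" "\<And>x. br h (f x) = f (br h x)" "\<And>x. x \<in> G \<gamma> \<Longrightarrow> f x \<in> G \<gamma>" for h f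
    using nil[OF that] trace_minus[OF endo_comp[OF endo_br endo_comp[OF f(1) endo_proj]] endo_smult[OF endo_comp[OF f(1) endo_proj]]]
      trace_scale[OF endo_comp[OF f(1) endo_proj]] by simp
  show 1: "trace (\<lambda>x. br h (proj \<gamma> x)) = of_nat (dim (G \<gamma>)) * \<gamma> h"
    using step[OF assms(1) endo_id] proj_trace[OF assms(2)] by (simp add: mult.commute)
  assume h': "h' \<in> H"
  have 2: "trace (\<lambda>x. br h' (proj \<gamma> x)) = of_nat (dim (G \<gamma>)) * \<gamma> h'"
    using step[OF h' endo_id] proj_trace[OF assms(2)] by (simp add: mult.commute)
  show "trace (\<lambda>x. br h (br h' (proj \<gamma> x))) = of_nat (dim (G \<gamma>)) * \<gamma> h * \<gamma> h'"
    using step[OF assms(1) endo_br[of h']] H_commute[OF assms(1) h'] G_stable[OF h'] 2 by simp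
qed

lemma endo_decompose_trace:
  assumes "endo f" shows "trace f = (\<Sum>\<gamma>\<in>weights. trace (\<lambda>x. f (proj \<gamma> x)))"
proof -
  have "f = (\<lambda>x. \<Sum>\<gamma>\<in>weights. f (proj \<gamma> x))"
    by (rule ext) (simp add: lin_sum[OF assms, symmetric] proj_sum)
  then have "trace f = trace (\<lambda>x. \<Sum>\<gamma>\<in>weights. f (proj \<gamma> x))" by simp
  also have "\<dots> = (\<Sum>\<gamma>\<in>weights. trace (\<lambda>x. f (proj \<gamma> x)))"
    by (rule trace_sum) (rule endo_comp[OF assms endo_proj])
  finally show ?thesis .
qed

lemma killing_H:
  assumes "h \<in> H" "h' \<in> H"
  shows "killing h h' = (\<Sum>\<gamma>\<in>weights. of_nat (dim (G \<gamma>)) * \<gamma> h * \<gamma> h')"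
  unfolding killing_def endo_decompose_trace[OF endo_br_br]
  using assms by (intro sum.cong refl trace_H_proj weights_dual)

text \<open>Apply \<open>ad h - \<gamma>(h)\<close> to a vector outside \<open>Z\<close> as long as the result stays outside \<open>Z\<close>;
  the last vector is an eigenvector of \<open>ad h\<close> modulo \<open>Z\<close>. Treating the elements of \<open>F\<close> one
  after the other does not destroy what has been achieved, since the operators commute and
  preserve \<open>Z\<close>.\<close>
lemma G_eigenvector_mod:
  assumes Z: "subspace Z" "\<And>h x. h \<in> H \<Longrightarrow> x \<in> Z \<Longrightarrow> br h x \<in> Z" and x: "x \<in> G \<gamma>" "x \<notin> Z"
    and "finite F" "F \<subseteq> H"
  shows "\<exists>y\<in>G \<gamma>. y \<notin> Z \<and> (\<forall>h\<in>F. br h y - scale (\<gamma> h) y \<in> Z)"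
  using assms(5,6)
proof (induction F)
  case (insert h F)
  then obtain y where y: "y \<in> G \<gamma>" "y \<notin> Z" "\<forall>h\<in>F. br h y - scale (\<gamma> h) y \<in> Z" by auto
  let ?S = "\<lambda>y. br h y - scale (\<gamma> h) y"
  have h: "h \<in> H" using insert.prems by auto
  obtain n where "(?S ^^ n) y = 0" using y(1) h by (auto simp: G_def gen_eig_def)
  then have n: "(?S ^^ n) y \<in> Z" using subspace_0[OF Z(1)] by simp
  define k where "k = (LEAST n. (?S ^^ n) y \<in> Z)"
  have k: "(?S ^^ k) y \<in> Z" unfolding k_def using n by (rule LeastI)
  then have "k \<noteq> 0" using y(2) by (intro notI) simp
  then obtain j where j: "k = Suc j" by (meson not0_implies_Suc)
  have jZ: "(?S ^^ j) y \<notin> Z" using not_less_Least[of j "\<lambda>n. (?S ^^ n) y \<in> Z"] j k_def by auto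
  have SG: "?S y \<in> G \<gamma>" if "y \<in> G \<gamma>" for y
    using that by (auto intro!: subspace_diff[OF subspace_G] subspace_scale[OF subspace_G] G_stable h)
  have jG: "(?S ^^ i) y \<in> G \<gamma>" for i using y(1) SG by (induction i) auto
  have SZ: "?S z \<in> Z" if "z \<in> Z" for z
    using that Z h by (auto intro!: subspace_diff subspace_scale)
  have powZ: "(?S ^^ i) z \<in> Z" if "z \<in> Z" for z i using that SZ by (induction i) auto
  have "br h' ((?S ^^ j) y) - scale (\<gamma> h') ((?S ^^ j) y) \<in> Z" if h': "h' \<in> F" for h'
  proof -
    let ?S' = "\<lambda>y. br h' y - scale (\<gamma> h') y"
    have "h' \<in> H" using h' insert.prems by auto
    then have "?S (?S' x) = ?S' (?S x)" for x
      using H_commute[OF h \<open>h' \<in> H\<close>] by (simp add: br_linear algebra_simps)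
    then have "?S' ((?S ^^ j) y) = (?S ^^ j) (?S' y)" by (intro funpow_commute[symmetric])
    then show ?thesis using powZ y(3) h' by simp
  qed
  then show ?case using jZ jG k j by (intro bexI[of _ "(?S ^^ j) y"]) auto
qed (use x in auto)

lemma H_subset_G0: "H \<subseteq> G 0"
proof
  fix x assume "x \<in> H"
  then show "x \<in> G 0"
    unfolding G_def gen_eig_def by (auto intro!: exI[of _ 1] simp: H_abelian)
qed

text \<open>If \<open>G 0\<close> were larger than \<open>H\<close>, it would contain a vector outside \<open>H\<close> that is a joint
  eigenvector modulo \<open>H\<close>. Such a vector normalises \<open>H\<close>, and \<open>H\<close> is its own normaliser.\<close>
lemma G_zero: "G 0 = H"
proof
  show "G 0 \<subseteq> H"
  proof
    fix x assume x: "x \<in> G 0"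
    show "x \<in> H"
    proof (rule ccontr)
      assume "x \<notin> H"
      then obtain y where y: "y \<in> G 0" "y \<notin> H" "\<forall>h\<in>bH. br h y \<in> H"
        using G_eigenvector_mod[OF subspace_H H_br_closed x _ bH(4,1)] by auto
      have "br y h \<in> H" if "h \<in> span bH" for h
        using that
      proof (induction rule: span_induct_alt)
        case (step c b z)
        then have "br y b \<in> H" using y(3) br_skew[of y b] subspace_neg[OF subspace_H] by auto
        then show ?case using step subspace_H by (auto simp: br_linear intro!: subspace_add subspace_scale)
      qed (simp add: br_linear subspace_0[OF subspace_H])
      then show False using H_self_normalizing[of y] y(2) bH(3) by auto
    qed
  qed
qed (rule H_subset_G0)

lemma root_space_subset_G: "root_space H \<gamma> \<subseteq> G \<gamma>"
  unfolding G_def gen_eig_def root_space_def by (auto intro!: exI[of _ 1])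

lemma weights_root_vector:
  assumes "\<gamma> \<in> weights" obtains x where "x \<in> root_space H \<gamma>" "x \<noteq> 0"
proof -
  obtain x where "x \<in> G \<gamma>" "x \<noteq> 0" using assms subspace_0[OF subspace_G] by (auto simp: weights_def)
  then obtain y where y: "y \<in> G \<gamma>" "y \<noteq> 0" "\<forall>h\<in>bH. br h y = scale (\<gamma> h) y"
    using G_eigenvector_mod[of "{0}" x \<gamma> bH] bH(1,4) by (auto simp: br_linear)
  have "h \<in> H \<and> br h y = scale (\<gamma> h) y" if "h \<in> span bH" for h
    using that
  proof (induction rule: span_induct_alt)
    case base
    then show ?case using dual_apply(2)[OF weights_dual[OF assms], of 0 0] subspace_0[OF subspace_H] by (simp add: br_linear)
  next
    case (step c h z)
    then show ?case using y(3) bH(1) dual_apply[OF weights_dual[OF assms]] subspace_H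
      by (auto simp: br_linear scale_left_distrib subspace_add subspace_scale subset_iff)
  qed
  then have "y \<in> root_space H \<gamma>" using bH(3) by (auto simp: root_space_def)
  then show ?thesis using that y by blast
qed

lemma weights_eq_roots: "weights - {0} = roots H"
proof (intro equalityI subsetI)
  fix \<gamma> assume "\<gamma> \<in> weights - {0}"
  then show "\<gamma> \<in> roots H" using weights_root_vector[of \<gamma>] by (auto simp: roots_def weights_dual)
next
  fix \<gamma> assume "\<gamma> \<in> roots H"
  then have "root_space H \<gamma> \<noteq> {0}" "\<gamma> \<in> dual_space H" "\<gamma> \<noteq> 0" by (auto simp: roots_def)
  moreover have "0 \<in> root_space H \<gamma>" by (simp add: root_space_def br_linear)
  ultimately show "\<gamma> \<in> weights - {0}" using root_space_subset_G[of \<gamma>] by (auto simp: weights_def)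
qed

lemma roots_weights: "\<gamma> \<in> roots H \<Longrightarrow> \<gamma> \<in> weights"
  using weights_eq_roots by blast

lemma finite_roots: "finite (roots H)"
  using finite_weights weights_eq_roots by (metis finite_Diff)

lemma roots_separate:
  assumes "z \<in> H" "\<And>\<gamma>. \<gamma> \<in> weights \<Longrightarrow> \<gamma> z = 0" shows "z = 0"
  using assms Pi_roots roots_weights by (intro Pi_separates) blast+

text \<open>The sum of the spaces \<open>G \<epsilon>\<close> with \<open>\<epsilon> \<in> F\<close> is stable under \<open>x\<close> and \<open>y\<close>, so \<open>[x, y]\<close> has
  trace zero on it.\<close>
lemma weights_closed_trace:
  assumes F: "F \<subseteq> weights" and \<gamma>: "\<gamma> \<in> dual_space H" and x: "x \<in> G \<gamma>" and y: "y \<in> G (- \<gamma>)"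
    and up: "\<And>\<epsilon>. \<epsilon> \<in> F \<Longrightarrow> \<epsilon> + \<gamma> \<in> weights \<Longrightarrow> \<epsilon> + \<gamma> \<in> F"
    and down: "\<And>\<epsilon>. \<epsilon> \<in> F \<Longrightarrow> \<epsilon> - \<gamma> \<in> weights \<Longrightarrow> \<epsilon> - \<gamma> \<in> F"
  shows "(\<Sum>\<epsilon>\<in>F. of_nat (dim (G \<epsilon>)) * \<epsilon> (br x y)) = 0"
proof -
  let ?P = "\<lambda>z. \<Sum>\<epsilon>\<in>F. proj \<epsilon> z"
  have fF: "finite F" using F finite_weights by (rule finite_subset)
  have FD: "\<epsilon> \<in> dual_space H" if "\<epsilon> \<in> F" for \<epsilon> using that F weights_dual by auto
  have stab: "?P (br u (?P z)) = br u (?P z)"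
    if u: "u \<in> G \<kappa>" "\<kappa> \<in> dual_space H" "\<And>\<epsilon>. \<epsilon> \<in> F \<Longrightarrow> \<epsilon> + \<kappa> \<in> weights \<Longrightarrow> \<epsilon> + \<kappa> \<in> F" for u \<kappa> z
  proof -
    have 1: "?P (br u (proj \<epsilon> z)) = br u (proj \<epsilon> z)" if \<epsilon>: "\<epsilon> \<in> F" for \<epsilon>
    proof -
      have b: "br u (proj \<epsilon> z) \<in> G (\<kappa> + \<epsilon>)" using u(1) proj_in by (rule br_G)
      have d: "\<kappa> + \<epsilon> \<in> dual_space H" using u(2) FD[OF \<epsilon>] by (rule dual_add)
      show ?thesis
      proof (cases "\<kappa> + \<epsilon> \<in> F")
        case True then show ?thesis using fF by (simp add: proj_on[OF b d])
      next
        case False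
        then have "\<kappa> + \<epsilon> \<notin> weights" using u(3)[OF \<epsilon>] by (auto simp: add.commute)
        then have "br u (proj \<epsilon> z) = 0" using G_trivial[OF d _ b] by blast
        then show ?thesis by (simp add: lin_zero[OF endo_proj])
      qed
    qed
    have "?P (br u (?P z)) = (\<Sum>\<epsilon>\<in>F. ?P (br u (proj \<epsilon> z)))"
      unfolding br_linear lin_sum[OF endo_sum_proj] ..
    then show ?thesis using 1 by (simp add: br_linear)
  qed
  have "trace (\<lambda>z. br x (br y (?P z)) - br y (br x (?P z))) = 0"
    by (rule trace_commutator_proj[OF endo_br endo_br endo_sum_proj])
      (use stab[OF x \<gamma>] stab[OF y dual_neg[OF \<gamma>]] up down in auto)
  then have "trace (\<lambda>z. br (br x y) (?P z)) = 0" by (simp add: br_br_left)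
  also have "(\<lambda>z. br (br x y) (?P z)) = (\<lambda>z. \<Sum>\<epsilon>\<in>F. br (br x y) (proj \<epsilon> z))" by (simp add: br_linear)
  also have "trace \<dots> = (\<Sum>\<epsilon>\<in>F. trace (\<lambda>z. br (br x y) (proj \<epsilon> z)))"
    by (rule trace_sum) (rule endo_comp[OF endo_br endo_proj])
  also have "\<dots> = (\<Sum>\<epsilon>\<in>F. of_nat (dim (G \<epsilon>)) * \<epsilon> (br x y))"
    using br_G[OF x y] FD by (intro sum.cong refl trace_H_proj) (auto simp: G_zero)
  finally show ?thesis .
qed

lemma dim_G_pos: "\<gamma> \<in> weights \<Longrightarrow> dim (G \<gamma>) > 0"
  using subspace_0[OF subspace_G] by (auto simp: weights_def)

text \<open>The set of all weights \<open>\<delta> + n \<gamma>\<close> with integral \<open>n\<close> is closed under adding and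
  subtracting \<open>\<gamma>\<close>. By \<open>weights_closed_trace\<close> the element \<open>h = [x, y]\<close> satisfies
  \<open>\<Sum> d\<^sub>n (\<delta>(h) + n \<gamma>(h)) = 0\<close>, where \<open>d\<^sub>n\<close> are the dimensions of the weight spaces, and \<open>\<Sum> d\<^sub>n\<close>
  is positive.\<close>
lemma weight_rational_multiple:
  assumes \<gamma>: "\<gamma> \<in> dual_space H" and x: "x \<in> G \<gamma>" and y: "y \<in> G (- \<gamma>)" and \<delta>: "\<delta> \<in> weights"
  shows "\<exists>q::rat. \<delta> (br x y) = of_rat q * \<gamma> (br x y)"
proof -
  let ?h = "br x y"
  define F where "F = {\<epsilon>\<in>weights. \<exists>n::int. \<epsilon> = \<delta> + fun_scale (of_int n) \<gamma>}"
  have fF: "finite F" using finite_weights by (simp add: F_def)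
  have "\<forall>\<epsilon>\<in>F. \<exists>n::int. \<epsilon> = \<delta> + fun_scale (of_int n) \<gamma>" by (simp add: F_def)
  from bchoice[OF this] obtain n :: "('v \<Rightarrow> 'k) \<Rightarrow> int"
    where n: "\<And>\<epsilon>. \<epsilon> \<in> F \<Longrightarrow> \<epsilon> = \<delta> + fun_scale (of_int (n \<epsilon>)) \<gamma>" by blast
  have "(\<Sum>\<epsilon>\<in>F. of_nat (dim (G \<epsilon>)) * \<epsilon> ?h) = 0"
  proof (rule weights_closed_trace[OF _ \<gamma> x y])
    show "\<epsilon> + \<gamma> \<in> F" if e: "\<epsilon> \<in> F" "\<epsilon> + \<gamma> \<in> weights" for \<epsilon>
    proof -
      have "\<epsilon> + \<gamma> = \<delta> + fun_scale (of_int (n \<epsilon> + 1)) \<gamma>"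
        using n[OF e(1)] by (auto simp: fun_eq_iff fun_scale_def algebra_simps)
      then show ?thesis using e unfolding F_def by blast
    qed
    show "\<epsilon> - \<gamma> \<in> F" if e: "\<epsilon> \<in> F" "\<epsilon> - \<gamma> \<in> weights" for \<epsilon>
    proof -
      have "\<epsilon> - \<gamma> = \<delta> + fun_scale (of_int (n \<epsilon> - 1)) \<gamma>"
        using n[OF e(1)] by (auto simp: fun_eq_iff fun_scale_def algebra_simps)
      then show ?thesis using e unfolding F_def by blast
    qed
  qed (auto simp: F_def)
  moreover have "(\<Sum>\<epsilon>\<in>F. of_nat (dim (G \<epsilon>)) * \<epsilon> ?h)
      = (\<Sum>\<epsilon>\<in>F. of_nat (dim (G \<epsilon>)) * (\<delta> ?h + of_int (n \<epsilon>) * \<gamma> ?h))"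
    by (intro sum.cong refl) (subst n, auto simp: fun_scale_def)
  ultimately have *: "of_nat (\<Sum>\<epsilon>\<in>F. dim (G \<epsilon>)) * \<delta> ?h + of_int (\<Sum>\<epsilon>\<in>F. int (dim (G \<epsilon>)) * n \<epsilon>) * \<gamma> ?h = 0"
    by (simp add: sum.distrib sum_distrib_right sum_distrib_left algebra_simps)
  let ?D = "\<Sum>\<epsilon>\<in>F. dim (G \<epsilon>)" and ?N = "\<Sum>\<epsilon>\<in>F. int (dim (G \<epsilon>)) * n \<epsilon>"
  have "\<delta> \<in> F" using \<delta> by (auto simp: F_def fun_scale_def fun_eq_iff intro!: exI[of _ 0])
  then have "?D > 0" using dim_G_pos[OF \<delta>] fF by (meson sum_pos2 le0)
  then have D: "of_nat ?D \<noteq> (0::'k)" by (simp del: of_nat_sum)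
  have "\<delta> ?h = of_rat (- of_int ?N / of_nat ?D) * \<gamma> ?h"
    using * D by (simp add: of_rat_divide of_rat_minus field_simps eq_neg_iff_add_eq_0 del: of_nat_sum of_int_sum)
  then show ?thesis by blast
qed

text \<open>By \<open>weight_rational_multiple\<close> the sum \<open>\<Phi>(h, h) = \<Sum> dim (G \<delta>) \<delta>(h)\<^sup>2\<close> is \<open>\<gamma>(h)\<^sup>2\<close> times a
  sum of rational squares, to which \<open>\<delta> = \<gamma>\<close> contributes a positive number. If \<open>\<gamma>(h)\<close> were
  zero, all weights would vanish on \<open>h\<close>.\<close>
lemma killing_commutator:
  assumes \<gamma>: "\<gamma> \<in> weights" and x: "x \<in> G \<gamma>" and y: "y \<in> G (- \<gamma>)" and n0: "br x y \<noteq> 0"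
  shows "\<gamma> (br x y) \<noteq> 0" "\<exists>r::rat. 0 < r \<and> killing (br x y) (br x y) = of_rat r * (\<gamma> (br x y))\<^sup>2"
proof -
  let ?h = "br x y"
  have h: "?h \<in> H" using br_G[OF x y] by (simp add: G_zero)
  obtain q :: "('v \<Rightarrow> 'k) \<Rightarrow> rat" where q: "\<And>\<delta>. \<delta> \<in> weights \<Longrightarrow> \<delta> ?h = of_rat (q \<delta>) * \<gamma> ?h"
    using weight_rational_multiple[OF weights_dual[OF \<gamma>] x y] by metis
  show g0: "\<gamma> ?h \<noteq> 0"
  proof
    assume "\<gamma> ?h = 0"
    then have "\<delta> ?h = 0" if "\<delta> \<in> weights" for \<delta> using q[OF that] by simp
    then show False using roots_separate[OF h] n0 by blast
  qed
  have "killing ?h ?h = (\<Sum>\<delta>\<in>weights. of_nat (dim (G \<delta>)) * (of_rat (q \<delta>) * \<gamma> ?h) * (of_rat (q \<delta>) * \<gamma> ?h))"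
    unfolding killing_H[OF h h] by (intro sum.cong refl) (simp only: q)
  also have "\<dots> = of_rat (\<Sum>\<delta>\<in>weights. of_nat (dim (G \<delta>)) * (q \<delta>)\<^sup>2) * (\<gamma> ?h)\<^sup>2"
    by (simp add: of_rat_sum of_rat_mult of_rat_power sum_distrib_right sum_distrib_left power2_eq_square mult_ac)
  finally have 1: "killing ?h ?h = of_rat (\<Sum>\<delta>\<in>weights. of_nat (dim (G \<delta>)) * (q \<delta>)\<^sup>2) * (\<gamma> ?h)\<^sup>2" .
  have "of_rat (q \<gamma>) = (1::'k)" using q[OF \<gamma>] g0 by simp
  then have "q \<gamma> = 1" by (metis of_rat_1 of_rat_eq_iff)
  then have "0 < of_nat (dim (G \<gamma>)) * (q \<gamma>)\<^sup>2" using dim_G_pos[OF \<gamma>] by simp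
  then have "0 < (\<Sum>\<delta>\<in>weights. of_nat (dim (G \<delta>)) * (q \<delta>)\<^sup>2)"
    using \<gamma> finite_weights by (intro sum_pos2[of _ \<gamma>]) auto
  then show "\<exists>r::rat. 0 < r \<and> killing ?h ?h = of_rat r * (\<gamma> ?h)\<^sup>2" using 1 by blast
qed

text \<open>The radical of the form is an ideal. If it were the whole algebra, then by
  \<open>killing_commutator\<close> all brackets of opposite weight vectors would vanish, and no bracket
  would have a component in \<open>G 0 = H\<close>. Since the brackets span the algebra, \<open>H\<close> would be zero;
  but the normaliser of zero is the whole algebra, and \<open>H\<close> is its own normaliser.\<close>
lemma killing_nondegenerate:
  assumes "\<And>y. killing x y = 0" shows "x = 0"
proof -
  have "{x. \<forall>y. killing x y = 0} \<noteq> UNIV"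
  proof
    assume "{x. \<forall>y. killing x y = 0} = UNIV"
    then have K0: "killing x y = 0" for x y by auto
    have b0: "proj 0 (br u v) = 0" if u: "u \<in> G \<gamma>" "\<gamma> \<in> weights" and v: "v \<in> G \<delta>" "\<delta> \<in> weights" for u v \<gamma> \<delta>
    proof (cases "\<gamma> + \<delta> = 0")
      case True
      then have d: "\<delta> = - \<gamma>" by (simp add: eq_neg_iff_add_eq_0 add.commute)
      have "br u v = 0"
      proof (rule ccontr)
        assume n: "br u v \<noteq> 0"
        obtain r :: rat where "0 < r" "killing (br u v) (br u v) = of_rat r * (\<gamma> (br u v))\<^sup>2"
          using killing_commutator(2)[OF u(2,1) _ n] v d by blast
        then show False using killing_commutator(1)[OF u(2,1) _ n] v d K0 by auto
      qed
      then show ?thesis by (simp add: lin_zero[OF endo_proj])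
    next
      case False
      then show ?thesis
        using proj_on[OF br_G[OF u(1) v(1)] dual_add] u v weights_dual by auto
    qed
    have b1: "proj 0 (br u v) = 0" for u v
    proof -
      have "br u v = br (\<Sum>\<gamma>\<in>weights. proj \<gamma> u) (\<Sum>\<delta>\<in>weights. proj \<delta> v)" by (simp add: proj_sum)
      also have "\<dots> = (\<Sum>\<delta>\<in>weights. \<Sum>\<gamma>\<in>weights. br (proj \<gamma> u) (proj \<delta> v))" by (simp add: br_linear)
      finally show ?thesis by (simp add: lin_sum[OF endo_proj] b0[OF proj_in _ proj_in])
    qed
    have "subspace {z. proj 0 z = 0}"
      by (auto simp: subspace_def lin_zero[OF endo_proj] lin_add[OF endo_proj] lin_scale[OF endo_proj])
    then have "span {br x y | x y. True} \<subseteq> {z. proj 0 z = 0}" using b1 by (intro span_minimal) auto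
    then have p0: "proj 0 z = 0" for z using commutators_span by auto
    have "h = 0" if "h \<in> H" for h
      using proj_on[of h 0 0] that G_zero dual_zero p0[of h] by simp
    then have "H = {0}" using subspace_0[OF subspace_H] by auto
    then have "x \<in> H" for x using H_self_normalizing[of x] by (auto simp: br_linear)
    then have "br x y \<in> H" for x y by blast
    then show False using non_abelian \<open>H = {0}\<close> by blast
  qed
  then have "{x. \<forall>y. killing x y = 0} = {0}" using no_proper_ideal[OF killing_radical_ideal] by blast
  then show ?thesis using assms by blast
qed

end

section \<open>Root space decomposition\<close>

context simple_lie_algebra
begin

text \<open>With a basis \<open>B\<close> of \<open>U\<close> the endomorphism \<open>x \<mapsto> \<Sum> \<Phi>(x, b) b\<close> of \<open>U\<close> is injective, hence
  surjective.\<close>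
lemma riesz_exists:
  assumes U: "subspace U" and nondeg: "\<And>x. x \<in> U \<Longrightarrow> (\<And>y. y \<in> U \<Longrightarrow> killing x y = 0) \<Longrightarrow> x = 0"
    and \<phi>: "functional \<phi>"
  shows "\<exists>t\<in>U. \<forall>y\<in>U. killing t y = \<phi> y"
proof -
  interpret pair: finite_dimensional_vector_space_pair_1 scale "extend_basis {}" scale by unfold_locales
  obtain B where B: "B \<subseteq> U" "independent B" "U \<subseteq> span B" using maximal_independent_subset by blast
  have fB: "finite B" by (rule finiteI_independent[OF B(2)])
  have sB: "span B = U" by (rule span_subspace[OF B(1,3) U])
  have func_eqI: "f y = g y" if fg: "functional f" "functional g" "\<And>b. b \<in> B \<Longrightarrow> f b = g b" and "y \<in> U" for f g y
  proof -
    have "y \<in> span B" using \<open>y \<in> U\<close> sB by simp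
    then show ?thesis
      by (induction rule: span_induct_alt) (simp_all add: lin_zero[OF fg(1)] lin_zero[OF fg(2)] lin_add[OF fg(1)]
        lin_add[OF fg(2)] lin_scale[OF fg(1)] lin_scale[OF fg(2)] fg(3))
  qed
  define T where "T = (\<lambda>x. \<Sum>b\<in>B. scale (killing x b) b)"
  have T: "endo T" unfolding T_def by (intro endo_sum endo_functional functional_killing_left)
  have indep: "c b = c' b" if "(\<Sum>b\<in>B. scale (c b) b) = (\<Sum>b\<in>B. scale (c' b) b)" "b \<in> B" for c c' b
  proof -
    have "(\<Sum>b\<in>B. scale (c b - c' b) b) = 0" using that(1) by (simp add: scale_left_diff_distrib sum_subtractf)
    then have "c b - c' b = 0" by (rule independentD[OF B(2) fB subset_refl]) (rule that(2))
    then show ?thesis by simp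
  qed
  have TU: "T ` U \<subseteq> U" unfolding T_def using B(1) U by (auto intro!: subspace_sum subspace_scale)
  have inj: "inj_on T (span U)"
  proof (rule inj_onI)
    fix x x' assume *: "x \<in> span U" "x' \<in> span U" "T x = T x'"
    then have xU: "x \<in> U" "x' \<in> U" using U by (simp_all add: span_eq_iff[THEN iffD2])
    have f0: "functional (\<lambda>_. 0)" by (rule functionalI) simp_all
    have k0: "killing (x - x') b = 0" if "b \<in> B" for b
      using indep[of "killing x" "killing x'" b] *(3) that by (simp add: T_def killing_linear)
    have "killing (x - x') y = 0" if "y \<in> U" for y
      by (rule func_eqI[OF functional_killing f0 k0 that])
    then have "x - x' = 0" using nondeg[of "x - x'"] xU U subspace_diff by blast
    then show "x = x'" by simp
  qed
  have "dim (T ` U) = dim U" by (rule pair.dim_image_eq[OF T inj])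
  moreover have "subspace (T ` U)"
    using module_hom.subspace_image[OF iffD2[OF module_hom_iff_linear T] U] .
  ultimately have "T ` U = U" using subspace_dim_equal[of "T ` U" U] U TU by simp
  moreover have "(\<Sum>b\<in>B. scale (\<phi> b) b) \<in> U" using B(1) U by (auto intro!: subspace_sum subspace_scale)
  ultimately obtain t where t: "t \<in> U" "T t = (\<Sum>b\<in>B. scale (\<phi> b) b)" by (metis imageE)
  have "killing t y = \<phi> y" if "y \<in> U" for y
    by (rule func_eqI[OF functional_killing \<phi> _ that]) (use indep[of "killing t" \<phi>] t(2) in \<open>simp add: T_def\<close>)
  then show ?thesis using t(1) by blast
qed

end

context based_simple_lie_algebra
begin

text \<open>Represent the form \<open>y \<mapsto> tr (D ad y)\<close> as \<open>\<Phi>(s, y)\<close> and put \<open>E = D - ad s\<close>, so that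
  \<open>tr (E ad y) = 0\<close> for all \<open>y\<close>. Then
  \<open>\<Phi>(E x, y) = tr ([E, ad x] ad y) = tr (E ad [x, y]) = 0\<close>.\<close>
lemma derivation_inner:
  assumes D: "endo D" and der: "\<And>x y. D (br x y) = br (D x) y + br x (D y)"
  shows "\<exists>s. \<forall>x. D x = br s x"
proof -
  have "functional (\<lambda>y. trace (\<lambda>z. D (br y z)))"
  proof (rule functionalI)
    show "trace (\<lambda>z. D (br (x + y) z)) = trace (\<lambda>z. D (br x z)) + trace (\<lambda>z. D (br y z))" for x y
      unfolding br_add_left lin_add[OF D] by (rule trace_plus) (rule endo_comp[OF D endo_br])+
    show "trace (\<lambda>z. D (br (scale c x) z)) = c * trace (\<lambda>z. D (br x z))" for c x
      unfolding br_scale_left lin_scale[OF D] by (rule trace_scale) (rule endo_comp[OF D endo_br])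
  qed
  then obtain s where s: "\<And>y. killing s y = trace (\<lambda>z. D (br y z))"
    using riesz_exists[OF subspace_UNIV, of "\<lambda>y. trace (\<lambda>z. D (br y z))"] killing_nondegenerate by auto
  let ?E = "\<lambda>x. D x - br s x"
  have E: "endo ?E" by (rule endo_minus[OF D endo_br])
  have E0: "trace (\<lambda>z. ?E (br y z)) = 0" for y
    using trace_minus[OF endo_comp[OF D endo_br] endo_br_br, of y s y] s[of y] by (simp add: killing_def)
  have "?E x = 0" for x
  proof (rule killing_nondegenerate)
    fix y
    have "br (?E x) z = ?E (br x z) - br x (?E z)" for z
      by (simp add: der br_br[of s x z] br_linear)
    then have "killing (?E x) y = trace (\<lambda>z. ?E (br x (br y z)) - br x (?E (br y z)))"
      unfolding killing_def by simp
    also have "\<dots> = trace (\<lambda>z. ?E (br x (br y z))) - trace (\<lambda>z. br x (?E (br y z)))"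
      by (rule trace_minus[OF endo_comp[OF E endo_br_br] endo_comp[OF endo_br endo_comp[OF E endo_br]]])
    also have "trace (\<lambda>z. br x (?E (br y z))) = trace (\<lambda>z. ?E (br y (br x z)))"
      by (rule trace_comp_commute[OF endo_br endo_comp[OF E endo_br]])
    also have "trace (\<lambda>z. ?E (br x (br y z))) - trace (\<lambda>z. ?E (br y (br x z)))
        = trace (\<lambda>z. ?E (br x (br y z)) - ?E (br y (br x z)))"
      by (rule trace_minus[symmetric]) (rule endo_comp[OF E endo_br_br])+
    also have "\<dots> = trace (\<lambda>z. ?E (br (br x y) z))" by (simp add: br_br_left lin_diff[OF E])
    also have "\<dots> = 0" by (rule E0)
    finally show "killing (?E x) y = 0" .
  qed
  then show ?thesis by (intro exI[of _ s] allI) simp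
qed

text \<open>The operator \<open>D\<close> that multiplies each \<open>G \<gamma>\<close> by \<open>\<gamma>(h)\<close> is a derivation, because weights
  add up under the bracket; it is the semisimple part of \<open>ad h\<close>. So \<open>D = ad s\<close> for some \<open>s\<close>.
  Since \<open>D\<close> kills \<open>H\<close>, the element \<open>s\<close> lies in \<open>H\<close>, and root vectors show that every root has
  the same value at \<open>s\<close> and \<open>h\<close>.\<close>
lemma H_acts_diagonally:
  assumes h: "h \<in> H" and \<gamma>: "\<gamma> \<in> dual_space H" and x: "x \<in> G \<gamma>"
  shows "br h x = scale (\<gamma> h) x"
proof -
  define D where "D = (\<lambda>x. \<Sum>\<gamma>\<in>weights. scale (\<gamma> h) (proj \<gamma> x))"
  have D: "endo D" unfolding D_def by (intro endo_sum endo_smult endo_proj)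
  have DG: "D x = scale (\<delta> h) x" if "x \<in> G \<delta>" "\<delta> \<in> dual_space H" for x \<delta>
  proof (cases "\<delta> \<in> weights")
    case False
    then have "x = 0" using G_trivial that by blast
    then show ?thesis by (simp add: lin_zero[OF D])
  next
    case True
    then have "D x = (\<Sum>\<gamma>\<in>weights. if \<gamma> = \<delta> then scale (\<gamma> h) x else 0)"
      unfolding D_def using proj_on[OF that] by (intro sum.cong) auto
    then show ?thesis using True finite_weights by simp
  qed
  have der0: "D (br x y) = br (D x) y + br x (D y)"
    if "x \<in> G \<gamma>" "y \<in> G \<delta>" "\<gamma> \<in> dual_space H" "\<delta> \<in> dual_space H" for x y \<gamma> \<delta>
    using DG[OF br_G[OF that(1,2)] dual_add[OF that(3,4)]] DG[OF that(1,3)] DG[OF that(2,4)]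
    by (simp add: br_linear scale_left_distrib)
  have "D (br x y) = br (D x) y + br x (D y)" for x y
  proof -
    have "D (br x y) = D (br (\<Sum>\<gamma>\<in>weights. proj \<gamma> x) (\<Sum>\<delta>\<in>weights. proj \<delta> y))" by (simp add: proj_sum)
    also have "\<dots> = (\<Sum>\<delta>\<in>weights. \<Sum>\<gamma>\<in>weights. D (br (proj \<gamma> x) (proj \<delta> y)))"
      unfolding lin_sum[OF endo_br_left] lin_sum[OF endo_br] lin_sum[OF D] ..
    also have "\<dots> = (\<Sum>\<delta>\<in>weights. \<Sum>\<gamma>\<in>weights. br (D (proj \<gamma> x)) (proj \<delta> y) + br (proj \<gamma> x) (D (proj \<delta> y)))"
      by (intro sum.cong refl der0[OF proj_in proj_in]) (auto intro: weights_dual)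
    also have "\<dots> = br (D (\<Sum>\<gamma>\<in>weights. proj \<gamma> x)) (\<Sum>\<delta>\<in>weights. proj \<delta> y)
        + br (\<Sum>\<gamma>\<in>weights. proj \<gamma> x) (D (\<Sum>\<delta>\<in>weights. proj \<delta> y))"
      unfolding lin_sum[OF D] lin_sum[OF endo_br_left] lin_sum[OF endo_br] sum.distrib ..
    finally show ?thesis by (simp add: proj_sum)
  qed
  then obtain s where s: "\<And>x. D x = br s x" using derivation_inner[OF D] by blast
  have "br s h' = 0" if "h' \<in> H" for h'
    using DG[of h' 0] that G_zero dual_zero s[of h'] by simp
  then have sH: "s \<in> H" using H_self_normalizing[of s] subspace_0[OF subspace_H] by simp
  have "s - h = 0"
  proof (rule roots_separate)
    show "s - h \<in> H" using sH h subspace_H by (simp add: subspace_diff)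
    fix \<delta> assume \<delta>: "\<delta> \<in> weights"
    then obtain v where v: "v \<in> root_space H \<delta>" "v \<noteq> 0" by (rule weights_root_vector)
    have "scale (\<delta> s) v = br s v" using v sH by (simp add: root_space_def)
    also have "\<dots> = scale (\<delta> h) v" using DG[of v \<delta>] v(1) root_space_subset_G weights_dual[OF \<delta>] s by auto
    finally have "\<delta> s = \<delta> h" using v by simp
    moreover have "\<delta> s = \<delta> (s - h) + \<delta> h"
      using dual_apply(1)[OF weights_dual[OF \<delta>], of "s - h" h] sH h subspace_H by (simp add: subspace_diff)
    ultimately show "\<delta> (s - h) = 0" by simp
  qed
  then show ?thesis using DG[OF x \<gamma>] s by simp
qed

lemma root_space_eq_G: "\<gamma> \<in> dual_space H \<Longrightarrow> root_space H \<gamma> = G \<gamma>"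
  using root_space_subset_G H_acts_diagonally by (auto simp: root_space_def)

text \<open>The operator \<open>ad x ad y\<close> shifts weights by \<open>\<gamma> + \<delta>\<close>, so its diagonal blocks are zero.\<close>
lemma killing_orthogonal:
  assumes "x \<in> G \<gamma>" "y \<in> G \<delta>" "\<gamma> \<in> dual_space H" "\<delta> \<in> dual_space H" "\<gamma> + \<delta> \<noteq> 0"
  shows "killing x y = 0"
proof -
  have "trace (\<lambda>z. br x (br y (proj \<epsilon> z))) = 0" if \<epsilon>: "\<epsilon> \<in> weights" for \<epsilon>
  proof -
    have "proj \<epsilon> (br x (br y (proj \<epsilon> z))) = 0" for z
    proof -
      have "br x (br y (proj \<epsilon> z)) \<in> G (\<gamma> + (\<delta> + \<epsilon>))" using assms proj_in by (intro br_G)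
      moreover have "\<epsilon> \<noteq> \<gamma> + (\<delta> + \<epsilon>)" using assms(5) by (simp add: add.assoc[symmetric])
      ultimately show ?thesis
        using proj_on[of _ "\<gamma> + (\<delta> + \<epsilon>)" \<epsilon>] assms \<epsilon> by (auto intro: dual_add weights_dual)
    qed
    moreover have "trace (\<lambda>z. br x (br y (proj \<epsilon> z))) = trace (\<lambda>z. br x (br y (proj \<epsilon> (proj \<epsilon> z))))"
      by (simp add: proj_on[OF proj_in weights_dual[OF \<epsilon>]])
    moreover have "\<dots> = trace (\<lambda>z. proj \<epsilon> (br x (br y (proj \<epsilon> z))))"
      by (rule trace_comp_commute[OF endo_comp[OF endo_br_br endo_proj] endo_proj])
    ultimately show ?thesis by simp
  qed
  then show ?thesis
    unfolding killing_def endo_decompose_trace[OF endo_br_br] by simp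
qed

lemma killing_proj:
  assumes "x \<in> G \<gamma>" "\<gamma> \<in> dual_space H" shows "killing x y = killing x (proj (- \<gamma>) y)"
proof -
  have 0: "killing x (proj \<delta> y) = 0" if "\<delta> \<in> weights" "\<delta> \<noteq> - \<gamma>" for \<delta>
    using that by (intro killing_orthogonal[OF assms(1) proj_in assms(2) weights_dual])
      (auto simp: eq_neg_iff_add_eq_0 add.commute)
  have "killing x y = (\<Sum>\<delta>\<in>weights. killing x (proj \<delta> y))"
    unfolding lin_sum[OF functional_killing, symmetric] proj_sum ..
  also have "\<dots> = (\<Sum>\<delta>\<in>weights. if \<delta> = - \<gamma> then killing x (proj (- \<gamma>) y) else 0)"
    by (intro sum.cong refl) (auto simp: 0)
  also have "\<dots> = killing x (proj (- \<gamma>) y)"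
    using finite_weights by (auto simp: proj_def killing_linear)
  finally show ?thesis .
qed

lemma killing_G_nondegenerate:
  assumes "x \<in> G \<gamma>" "\<gamma> \<in> dual_space H" "\<And>y. y \<in> G (- \<gamma>) \<Longrightarrow> killing x y = 0" shows "x = 0"
  by (rule killing_nondegenerate) (subst killing_proj[OF assms(1,2)], rule assms(3)[OF proj_in])

lemma killing_H_nondegenerate:
  assumes "x \<in> H" "\<And>y. y \<in> H \<Longrightarrow> killing x y = 0" shows "x = 0"
  using killing_G_nondegenerate[of x 0] assms G_zero dual_zero by simp

lemma riesz:
  assumes "\<mu> \<in> dual_space H"
  shows "riesz \<mu> \<in> H" "h \<in> H \<Longrightarrow> killing (riesz \<mu>) h = \<mu> h"
proof -
  obtain P where P: "endo P" "\<And>x. P x \<in> H" "\<And>x. x \<in> H \<Longrightarrow> P x = x"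
    using subspace_projection[OF subspace_H] by blast
  have "functional (\<lambda>x. \<mu> (P x))"
    by (rule functionalI) (use P dual_apply[OF assms] in \<open>simp_all add: lin_add[OF P(1)] lin_scale[OF P(1)]\<close>)
  then obtain r where r: "r \<in> H" "\<And>h. h \<in> H \<Longrightarrow> killing r h = \<mu> (P h)"
    using riesz_exists[OF subspace_H killing_H_nondegenerate] by meson
  have uniq: "t = t'" if "t \<in> H" "\<forall>h\<in>H. killing t h = \<mu> h" "t' \<in> H" "\<forall>h\<in>H. killing t' h = \<mu> h" for t t'
  proof -
    have "t - t' = 0" using that subspace_diff[OF subspace_H]
      by (intro killing_H_nondegenerate) (auto simp: killing_linear)
    then show ?thesis by simp
  qed
  have ex: "\<exists>!t. t \<in> H \<and> (\<forall>h\<in>H. killing t h = \<mu> h)"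
    using r P(3) uniq by (intro ex1I[of _ r]) auto
  from theI'[OF ex] show "riesz \<mu> \<in> H" "h \<in> H \<Longrightarrow> killing (riesz \<mu>) h = \<mu> h" by (auto simp: riesz_def)
qed

lemma form_apply: "\<mu> \<in> dual_space H \<Longrightarrow> \<nu> \<in> dual_space H \<Longrightarrow> form \<mu> \<nu> = \<mu> (riesz \<nu>)"
  by (simp add: form_def riesz)

lemma form_sym: "form \<mu> \<nu> = form \<nu> \<mu>"
  by (simp add: form_def killing_sym)

lemma form_add_left: "\<mu> \<in> dual_space H \<Longrightarrow> \<mu>' \<in> dual_space H \<Longrightarrow> \<nu> \<in> dual_space H \<Longrightarrow>
    form (\<mu> + \<mu>') \<nu> = form \<mu> \<nu> + form \<mu>' \<nu>"
  by (simp add: form_apply dual_add)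

lemma form_scale_left: "\<mu> \<in> dual_space H \<Longrightarrow> \<nu> \<in> dual_space H \<Longrightarrow> form (fun_scale c \<mu>) \<nu> = c * form \<mu> \<nu>"
  by (simp add: form_apply dual_scale) (simp add: fun_scale_def)

lemma form_neg_left: "\<mu> \<in> dual_space H \<Longrightarrow> \<nu> \<in> dual_space H \<Longrightarrow> form (- \<mu>) \<nu> = - form \<mu> \<nu>"
  by (simp add: form_apply dual_neg)

lemma form_diff_left: "\<mu> \<in> dual_space H \<Longrightarrow> \<mu>' \<in> dual_space H \<Longrightarrow> \<nu> \<in> dual_space H \<Longrightarrow>
    form (\<mu> - \<mu>') \<nu> = form \<mu> \<nu> - form \<mu>' \<nu>"
  by (simp add: form_apply dual_diff)

lemma form_zero_left: "\<nu> \<in> dual_space H \<Longrightarrow> form 0 \<nu> = 0"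
  by (simp add: form_apply dual_zero)

lemma form_sum_left: "(\<And>i. i \<in> I \<Longrightarrow> \<mu> i \<in> dual_space H) \<Longrightarrow> \<nu> \<in> dual_space H \<Longrightarrow>
    form (\<Sum>i\<in>I. \<mu> i) \<nu> = (\<Sum>i\<in>I. form (\<mu> i) \<nu>)"
  by (induction I rule: infinite_finite_induct) (auto simp: form_zero_left form_add_left dual_sum)

lemma form_diff_right: "\<mu> \<in> dual_space H \<Longrightarrow> \<mu>' \<in> dual_space H \<Longrightarrow> \<nu> \<in> dual_space H \<Longrightarrow>
    form \<nu> (\<mu> - \<mu>') = form \<nu> \<mu> - form \<nu> \<mu>'"
  by (simp add: form_sym[of \<nu>] form_diff_left)

lemma form_sum_right: "(\<And>i. i \<in> I \<Longrightarrow> \<mu> i \<in> dual_space H) \<Longrightarrow> \<nu> \<in> dual_space H \<Longrightarrow>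
    form \<nu> (\<Sum>i\<in>I. \<mu> i) = (\<Sum>i\<in>I. form \<nu> (\<mu> i))"
  by (simp add: form_sym[of \<nu>] form_sum_left)

lemma riesz_eq_0: assumes "\<mu> \<in> dual_space H" "riesz \<mu> = 0" shows "\<mu> = 0"
  using riesz(2)[OF assms(1)] assms(2) by (intro dual_eqI[OF assms(1) dual_zero]) (simp add: killing_linear)

lemma form_nondegenerate:
  assumes \<mu>: "\<mu> \<in> dual_space H" and "\<And>\<beta>. \<beta> \<in> \<Pi> \<Longrightarrow> form \<mu> \<beta> = 0" shows "\<mu> = 0"
  by (rule riesz_eq_0[OF \<mu>], rule Pi_separates)
    (use assms in \<open>auto simp: riesz form_apply[symmetric] form_sym[of _ \<mu>] Pi_dual\<close>)

text \<open>For \<open>h \<in> H\<close> invariance gives \<open>\<Phi>([x, y], h) = \<Phi>(x, [y, h]) = \<gamma>(h) \<Phi>(x, y)\<close>.\<close>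
lemma br_opposite:
  assumes "\<gamma> \<in> dual_space H" "x \<in> G \<gamma>" "y \<in> G (- \<gamma>)"
  shows "br x y = scale (killing x y) (riesz \<gamma>)"
proof -
  let ?d = "br x y - scale (killing x y) (riesz \<gamma>)"
  have xy: "br x y \<in> H" using br_G[OF assms(2,3)] by (simp add: G_zero)
  have "?d = 0"
  proof (rule killing_H_nondegenerate)
    show "?d \<in> H" using xy riesz(1)[OF assms(1)] subspace_H by (simp add: subspace_diff subspace_scale)
    fix h assume h: "h \<in> H"
    have "br y h = scale (\<gamma> h) y"
      using H_acts_diagonally[OF h dual_neg[OF assms(1)] assms(3)] br_skew[of h y] by simp
    then show "killing ?d h = 0"
      using riesz(2)[OF assms(1) h] by (simp add: killing_linear killing_invariant mult.commute)
  qed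
  then show ?thesis by simp
qed

lemma root_dual_vector:
  assumes "\<gamma> \<in> dual_space H" "x \<in> G \<gamma>" "x \<noteq> 0" obtains y where "y \<in> G (- \<gamma>)" "killing x y = 1"
proof -
  obtain y where y: "y \<in> G (- \<gamma>)" "killing x y \<noteq> 0" using killing_G_nondegenerate[OF assms(2,1)] assms(3) by blast
  then have "killing x (scale (1 / killing x y) y) = 1" "scale (1 / killing x y) y \<in> G (- \<gamma>)"
    by (auto simp: killing_linear intro: subspace_scale[OF subspace_G])
  then show ?thesis using that by blast
qed

lemma roots_neg: assumes "\<gamma> \<in> roots H" shows "- \<gamma> \<in> roots H"
proof -
  have g: "\<gamma> \<in> dual_space H" "\<gamma> \<noteq> 0" using assms by (auto simp: roots_def)
  obtain x where x: "x \<in> G \<gamma>" "x \<noteq> 0"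
    using roots_weights[OF assms] subspace_0[OF subspace_G] by (auto simp: weights_def)
  obtain y where "y \<in> G (- \<gamma>)" "killing x y = 1" using root_dual_vector[OF g(1) x] .
  then have "G (- \<gamma>) \<noteq> {0}" by (auto simp: killing_linear)
  then have "- \<gamma> \<in> weights - {0}" using g dual_neg by (simp add: weights_def)
  then show ?thesis using weights_eq_roots by blast
qed

lemma roots_nonzero: "\<gamma> \<in> roots H \<Longrightarrow> \<gamma> \<noteq> 0"
  by (simp add: roots_def)

lemma roots_neg_iff [simp]: "- \<gamma> \<in> roots H \<longleftrightarrow> \<gamma> \<in> roots H"
  using roots_neg[of \<gamma>] roots_neg[of "- \<gamma>"] by auto

lemma riesz_commutator:
  assumes "\<gamma> \<in> roots H" obtains x y where "x \<in> G \<gamma>" "y \<in> G (- \<gamma>)" "killing x y = 1" "br x y = riesz \<gamma>"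
proof -
  have g: "\<gamma> \<in> dual_space H" using assms by (rule roots_dual)
  obtain x where x: "x \<in> G \<gamma>" "x \<noteq> 0"
    using roots_weights[OF assms] subspace_0[OF subspace_G] by (auto simp: weights_def)
  obtain y where y: "y \<in> G (- \<gamma>)" "killing x y = 1" using root_dual_vector[OF g x] .
  then show ?thesis using that[OF x(1) y] br_opposite[OF g x(1) y(1)] by simp
qed

text \<open>The vector that represents \<open>\<gamma>\<close> is a commutator of opposite root vectors, so
  \<open>killing_commutator\<close> reads \<open>(\<gamma>, \<gamma>) = r (\<gamma>, \<gamma>)\<^sup>2\<close> with a positive rational number \<open>r\<close>.\<close>
lemma form_root_positive:
  assumes "\<gamma> \<in> roots H" shows "\<exists>r::rat. 0 < r \<and> form \<gamma> \<gamma> = of_rat r"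
proof -
  have g: "\<gamma> \<in> dual_space H" "\<gamma> \<noteq> 0" using assms by (auto simp: roots_def)
  obtain x y where xy: "x \<in> G \<gamma>" "y \<in> G (- \<gamma>)" "br x y = riesz \<gamma>" using riesz_commutator[OF assms] .
  have n0: "br x y \<noteq> 0" using riesz_eq_0[OF g(1)] g(2) xy(3) by auto
  obtain r :: rat where r: "0 < r" "killing (riesz \<gamma>) (riesz \<gamma>) = of_rat r * (\<gamma> (riesz \<gamma>))\<^sup>2"
    using killing_commutator(2)[OF roots_weights[OF assms] xy(1,2) n0] xy(3) by auto
  have f0: "form \<gamma> \<gamma> \<noteq> 0"
    using killing_commutator(1)[OF roots_weights[OF assms] xy(1,2) n0] xy(3) form_apply[OF g(1) g(1)] by simp
  have "form \<gamma> \<gamma> = of_rat r * (form \<gamma> \<gamma>)\<^sup>2" using r(2) form_apply[OF g(1) g(1)] by (simp add: form_def)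
  then have "form \<gamma> \<gamma> = of_rat (1 / r)" using f0 r(1) by (simp add: of_rat_divide power2_eq_square field_simps)
  then show ?thesis using r(1) by (intro exI[of _ "1 / r"]) simp
qed

lemma form_root_nonzero: "\<gamma> \<in> roots H \<Longrightarrow> form \<gamma> \<gamma> \<noteq> 0"
  using form_root_positive[of \<gamma>] by force

section \<open>Root vectors and root strings\<close>

text \<open>Let \<open>e\<close> and \<open>f\<close> be opposite root vectors such that \<open>[e, f]\<close> represents \<open>\<beta>\<close>. The line
  of \<open>f\<close>, the subalgebra \<open>H\<close> and the spaces \<open>G (n \<beta>)\<close> with \<open>n > 0\<close> span a subspace that is
  stable under \<open>e\<close> and \<open>f\<close>. The trace of \<open>[e, f]\<close> on it is \<open>(\<Sum> n dim (G (n \<beta>)) - 1) (\<beta>, \<beta>)\<close>.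
  This is zero, so \<open>\<Sum> n dim (G (n \<beta>)) = 1\<close>, which leaves no room beyond a one-dimensional
  space for \<open>n = 1\<close>.\<close>
lemma root_multiples:
  assumes \<beta>: "\<beta> \<in> roots H"
  shows "dim (G \<beta>) = 1" "\<And>n::nat. n > 0 \<Longrightarrow> fun_scale (of_nat n) \<beta> \<in> roots H \<Longrightarrow> fun_scale (of_nat n) \<beta> = \<beta>"
proof -
  have b: "\<beta> \<in> dual_space H" "\<beta> \<noteq> 0" "- \<beta> \<noteq> 0" "- \<beta> \<in> dual_space H"
    using \<beta> by (auto simp: roots_def intro: dual_neg)
  obtain e f where ef: "e \<in> G \<beta>" "f \<in> G (- \<beta>)" "killing e f = 1" "br e f = riesz \<beta>"
    using riesz_commutator[OF \<beta>] .
  let ?t = "riesz \<beta>"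
  have t: "?t \<in> H" by (rule riesz(1)[OF b(1)])
  have bt: "\<beta> ?t \<noteq> 0" using form_root_nonzero[OF \<beta>] form_apply[OF b(1) b(1)] by simp
  define F where "F = {\<epsilon>\<in>weights. \<exists>n::nat. n > 0 \<and> \<epsilon> = fun_scale (of_nat n) \<beta>}"
  have fF: "finite F" using finite_weights by (simp add: F_def)
  have "\<forall>\<epsilon>\<in>F. \<exists>n::nat. n > 0 \<and> \<epsilon> = fun_scale (of_nat n) \<beta>" by (simp add: F_def)
  from bchoice[OF this] obtain n :: "('v \<Rightarrow> 'k) \<Rightarrow> nat"
    where n: "\<And>\<epsilon>. \<epsilon> \<in> F \<Longrightarrow> n \<epsilon> > 0 \<and> \<epsilon> = fun_scale (of_nat (n \<epsilon>)) \<beta>" by blast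
  have FD: "\<epsilon> \<in> dual_space H" if "\<epsilon> \<in> F" for \<epsilon> using that by (simp add: F_def weights_dual)
  have scale_inj: "fun_scale c \<beta> = fun_scale d \<beta> \<longleftrightarrow> c = d" for c d
  proof -
    obtain z where "\<beta> z \<noteq> 0" using b(2) by (auto simp: fun_eq_iff)
    then show ?thesis by (auto simp: fun_scale_def fun_eq_iff)
  qed
  have b1: "fun_scale 1 \<beta> = \<beta>" by (simp add: fun_scale_def)
  have bm: "- \<beta> = fun_scale (-1) \<beta>" by (simp add: fun_scale_def fun_eq_iff)
  have b0: "0 = fun_scale 0 \<beta>" by (simp add: fun_scale_def fun_eq_iff)
  have ne0: "\<epsilon> \<noteq> 0" if eF: "\<epsilon> \<in> F" for \<epsilon>
  proof -
    obtain k :: nat where k: "k > 0" "\<epsilon> = fun_scale (of_nat k) \<beta>" using n[OF eF] by blast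
    then show ?thesis using b0 scale_inj[of "of_nat k" 0] by simp
  qed
  have nem: "\<epsilon> \<noteq> - \<beta>" if eF: "\<epsilon> \<in> F" for \<epsilon>
  proof
    assume e: "\<epsilon> = - \<beta>"
    obtain k :: nat where k: "k > 0" "\<epsilon> = fun_scale (of_nat k) \<beta>" using n[OF eF] by blast
    have "fun_scale (of_nat k) \<beta> = fun_scale (-1) \<beta>" by (rule trans[OF trans[OF k(2)[symmetric] e] bm])
    then have "of_nat k = (- 1 :: 'k)" by (simp only: scale_inj)
    then have "of_nat (Suc k) = (0::'k)" by simp
    then show False by (simp del: of_nat_Suc)
  qed
  \<comment> \<open>The projection onto the subspace. Its component along \<open>f\<close> is \<open>\<Phi>(e, z) f\<close>, because
    \<open>\<Phi>(e, f) = 1\<close> and \<open>e\<close> is orthogonal to every weight space other than \<open>G (- \<beta>)\<close>.\<close>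
  define P where "P = (\<lambda>z. (proj 0 z + (\<Sum>\<epsilon>\<in>F. proj \<epsilon> z)) + scale (killing e z) f)"
  have endo1: "endo (\<lambda>z. proj 0 z + (\<Sum>\<epsilon>\<in>F. proj \<epsilon> z))" by (intro endo_plus endo_proj endo_sum_proj)
  have endo2: "endo (\<lambda>z. scale (killing e z) f)" by (rule endo_functional[OF functional_killing])
  have P: "endo P" unfolding P_def by (rule endo_plus[OF endo1 endo2])
  let ?Z = "{z. P z = z}"
  have Z: "subspace ?Z" by (auto simp: subspace_def lin_zero[OF P] lin_add[OF P] lin_scale[OF P])
  have sumF: "(\<Sum>\<epsilon>\<in>F. proj \<epsilon> z) = (if \<delta> \<in> F then z else 0)" if "z \<in> G \<delta>" "\<delta> \<in> dual_space H" for z \<delta>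
    using fF by (simp add: proj_on[OF that])
  have ZH: "z \<in> ?Z" if "z \<in> H" for z
  proof -
    have z0: "z \<in> G 0" using that by (simp add: G_zero)
    moreover have "killing e z = 0" using killing_orthogonal[OF ef(1) z0 b(1) dual_zero] b(2) by simp
    ultimately show ?thesis
      using proj_on[OF z0 dual_zero] sumF[OF z0 dual_zero] ne0 by (auto simp: P_def)
  qed
  have ZF: "z \<in> ?Z" if "z \<in> G \<epsilon>" "\<epsilon> \<in> F" for z \<epsilon>
  proof -
    have "killing e z = 0"
      using killing_orthogonal[OF ef(1) that(1) b(1) FD[OF that(2)]] nem[OF that(2)] by (simp add: add_eq_0_iff)
    then show ?thesis
      using proj_on[OF that(1) FD[OF that(2)], of 0] ne0[OF that(2)] sumF[OF that(1) FD[OF that(2)]] that(2)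
      by (auto simp: P_def)
  qed
  have Zf: "f \<in> ?Z"
    using proj_on[OF ef(2) b(4), of 0] b(3) sumF[OF ef(2) b(4)] nem ef(3) by (auto simp: P_def)
  have Pz: "P z = (proj 0 z + (\<Sum>\<epsilon>\<in>F. proj \<epsilon> z)) + scale (killing e z) f" for z by (simp add: P_def)
  have stab: "br u (P z) \<in> ?Z"
    if "\<And>h. h \<in> H \<Longrightarrow> br u h \<in> ?Z" "\<And>\<epsilon> x. \<epsilon> \<in> F \<Longrightarrow> x \<in> G \<epsilon> \<Longrightarrow> br u x \<in> ?Z" "br u f \<in> ?Z" for u z
  proof -
    have "proj 0 z \<in> H" using proj_in[of 0 z] by (simp add: G_zero)
    then have "br u (proj 0 z) \<in> ?Z" by (rule that(1))
    moreover have "(\<Sum>\<epsilon>\<in>F. br u (proj \<epsilon> z)) \<in> ?Z" using that(2) proj_in by (intro subspace_sum[OF Z]) blast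
    moreover have "scale (killing e z) (br u f) \<in> ?Z" using that(3) by (rule subspace_scale[OF Z])
    ultimately have "br u (proj 0 z) + (\<Sum>\<epsilon>\<in>F. br u (proj \<epsilon> z)) + scale (killing e z) (br u f) \<in> ?Z"
      by (intro subspace_add[OF Z])
    moreover have "br u (P z) = br u (proj 0 z) + (\<Sum>\<epsilon>\<in>F. br u (proj \<epsilon> z)) + scale (killing e z) (br u f)"
      by (simp only: Pz br_linear)
    ultimately show ?thesis by (simp only:)
  qed
  have bF: "\<beta> \<in> F" using b1 roots_weights[OF \<beta>] by (auto simp: F_def intro!: exI[of _ 1])
  have eP: "br e (P z) \<in> ?Z" for z
  proof (rule stab)
    fix h assume h: "h \<in> H"
    have "br e h = scale (- \<beta> h) e" using br_skew[of h e] H_acts_diagonally[OF h b(1) ef(1)] by simp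
    then show "br e h \<in> ?Z" using subspace_scale[OF Z ZF[OF ef(1) bF], of "- \<beta> h"] by (simp only:)
  next
    fix \<epsilon> x assume e: "\<epsilon> \<in> F" and x: "x \<in> G \<epsilon>"
    have ex: "br e x \<in> G (\<beta> + \<epsilon>)" by (rule br_G[OF ef(1) x])
    have s: "\<beta> + \<epsilon> = fun_scale (of_nat (Suc (n \<epsilon>))) \<beta>"
      by (subst conjunct2[OF n[OF e]]) (simp add: fun_scale_def fun_eq_iff algebra_simps)
    show "br e x \<in> ?Z"
    proof (cases "\<beta> + \<epsilon> \<in> weights")
      case True
      then have "\<beta> + \<epsilon> \<in> F" unfolding F_def using s by blast
      then show ?thesis using ZF ex by blast
    next
      case False
      then have "br e x = 0" using G_trivial[OF dual_add[OF b(1) FD[OF e]] _ ex] by blast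
      then show ?thesis using subspace_0[OF Z] by simp
    qed
  qed (use ef(4) t ZH in simp)
  have fP: "br f (P z) \<in> ?Z" for z
  proof (rule stab)
    fix h assume h: "h \<in> H"
    have "br f h = scale (\<beta> h) f" using br_skew[of h f] H_acts_diagonally[OF h b(4) ef(2)] by simp
    then show "br f h \<in> ?Z" using subspace_scale[OF Z Zf] by simp
  next
    fix \<epsilon> x assume e: "\<epsilon> \<in> F" and x: "x \<in> G \<epsilon>"
    have fx: "br f x \<in> G (- \<beta> + \<epsilon>)" by (rule br_G[OF ef(2) x])
    obtain k where k: "n \<epsilon> = Suc k" using n[OF e] by (metis gr0_implies_Suc)
    have s: "- \<beta> + \<epsilon> = fun_scale (of_nat k) \<beta>"
      by (subst conjunct2[OF n[OF e]]) (simp add: k fun_scale_def fun_eq_iff algebra_simps)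
    show "br f x \<in> ?Z"
    proof (cases "k = 0")
      case True
      then have "- \<beta> + \<epsilon> = 0" using s by (simp add: fun_scale_def fun_eq_iff)
      then show ?thesis using fx ZH by (simp add: G_zero)
    next
      case k0: False
      show ?thesis
      proof (cases "- \<beta> + \<epsilon> \<in> weights")
        case True
        then have "- \<beta> + \<epsilon> \<in> F" unfolding F_def using s k0 by blast
        then show ?thesis using ZF fx by blast
      next
        case False
        then have "br f x = 0" using G_trivial[OF dual_add[OF b(4) FD[OF e]] _ fx] by blast
        then show ?thesis using subspace_0[OF Z] by simp
      qed
    qed
  qed (use br_self subspace_0[OF Z] in simp)
  have "trace (\<lambda>z. br e (br f (P z)) - br f (br e (P z))) = 0"
    using eP fP by (intro trace_commutator_proj[OF endo_br endo_br P]) auto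
  then have T0: "trace (\<lambda>z. br ?t (P z)) = 0" using ef(4) by (simp add: br_br_left[symmetric])
  have "trace (\<lambda>z. br ?t (P z)) = trace (\<lambda>z. (br ?t (proj 0 z) + (\<Sum>\<epsilon>\<in>F. br ?t (proj \<epsilon> z))) + scale (killing e z) (br ?t f))"
    by (simp add: Pz br_linear)
  also have "\<dots> = trace (\<lambda>z. br ?t (proj 0 z) + (\<Sum>\<epsilon>\<in>F. br ?t (proj \<epsilon> z))) + trace (\<lambda>z. scale (killing e z) (br ?t f))"
    by (intro trace_plus endo_plus endo_sum endo_comp[OF endo_br endo_proj] endo_functional functional_killing)
  also have "trace (\<lambda>z. br ?t (proj 0 z) + (\<Sum>\<epsilon>\<in>F. br ?t (proj \<epsilon> z)))
      = trace (\<lambda>z. br ?t (proj 0 z)) + trace (\<lambda>z. \<Sum>\<epsilon>\<in>F. br ?t (proj \<epsilon> z))"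
    by (intro trace_plus endo_sum endo_comp[OF endo_br endo_proj])
  also have "trace (\<lambda>z. br ?t (proj 0 z)) = 0" using trace_H_proj(1)[OF t dual_zero] by simp
  also have "trace (\<lambda>z. \<Sum>\<epsilon>\<in>F. br ?t (proj \<epsilon> z)) = (\<Sum>\<epsilon>\<in>F. trace (\<lambda>z. br ?t (proj \<epsilon> z)))"
    by (rule trace_sum) (rule endo_comp[OF endo_br endo_proj])
  also have "\<dots> = (\<Sum>\<epsilon>\<in>F. of_nat (dim (G \<epsilon>)) * (of_nat (n \<epsilon>) * \<beta> ?t))"
  proof (rule sum.cong[OF refl])
    fix \<epsilon> assume e: "\<epsilon> \<in> F"
    have "\<epsilon> ?t = of_nat (n \<epsilon>) * \<beta> ?t" by (subst conjunct2[OF n[OF e]]) (simp add: fun_scale_def)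
    then show "trace (\<lambda>z. br ?t (proj \<epsilon> z)) = of_nat (dim (G \<epsilon>)) * (of_nat (n \<epsilon>) * \<beta> ?t)"
      using trace_H_proj(1)[OF t FD[OF e]] by simp
  qed
  also have "\<dots> = of_nat (\<Sum>\<epsilon>\<in>F. dim (G \<epsilon>) * n \<epsilon>) * \<beta> ?t" by (simp add: sum_distrib_right mult.assoc)
  also have "trace (\<lambda>z. scale (killing e z) (br ?t f)) = killing e (br ?t f)"
    using trace_finite_rank[of "{()}" "\<lambda>z. scale (killing e z) (br ?t f)" "\<lambda>_. killing e" "\<lambda>_. br ?t f"] functional_killing by simp
  also have "\<dots> = - \<beta> ?t" using H_acts_diagonally[OF t b(4) ef(2)] ef(3) by (simp add: killing_linear)
  finally have "of_nat (\<Sum>\<epsilon>\<in>F. dim (G \<epsilon>) * n \<epsilon>) * \<beta> ?t = of_nat 1 * \<beta> ?t" using T0 by (simp del: of_nat_sum)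
  then have "of_nat (\<Sum>\<epsilon>\<in>F. dim (G \<epsilon>) * n \<epsilon>) = (of_nat 1 :: 'k)" using bt mult_right_cancel by blast
  then have sum1: "(\<Sum>\<epsilon>\<in>F. dim (G \<epsilon>) * n \<epsilon>) = 1" by (simp only: of_nat_eq_iff)
  have pos: "dim (G \<epsilon>) * n \<epsilon> \<ge> 1" if "\<epsilon> \<in> F" for \<epsilon>
    using n[OF that] dim_G_pos[of \<epsilon>] that by (simp add: F_def)
  have "F = {\<beta>}"
  proof (rule ccontr)
    assume "F \<noteq> {\<beta>}"
    then obtain \<epsilon> where e: "\<epsilon> \<in> F" "\<epsilon> \<noteq> \<beta>" using bF by auto
    have "(\<Sum>\<epsilon>\<in>{\<beta>, \<epsilon>}. dim (G \<epsilon>) * n \<epsilon>) \<le> (\<Sum>\<epsilon>\<in>F. dim (G \<epsilon>) * n \<epsilon>)"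
      using fF e bF by (intro sum_mono2) auto
    then show False using sum1 pos[OF e(1)] pos[OF bF] e(2) by simp
  qed
  then show "dim (G \<beta>) = 1" using sum1 by simp
  show "fun_scale (of_nat k) \<beta> = \<beta>" if "k > 0" "fun_scale (of_nat k) \<beta> \<in> roots H" for k :: nat
    using that roots_weights \<open>F = {\<beta>}\<close> unfolding F_def by blast
qed

lemma root_int_multiple:
  assumes "\<beta> \<in> roots H" "fun_scale (of_int n) \<beta> \<in> roots H"
  shows "fun_scale (of_int n) \<beta> = \<beta> \<or> fun_scale (of_int n) \<beta> = - \<beta>"
proof (cases n)
  case (nonneg k)
  then have "k > 0" using roots_nonzero[OF assms(2)] by (auto simp: fun_scale_def fun_eq_iff intro!: Nat.gr0I)
  then show ?thesis using root_multiples(2)[OF assms(1), of k] assms(2) nonneg by simp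
next
  case (neg k)
  have *: "fun_scale (of_int n) \<beta> = - fun_scale (of_nat (Suc k)) \<beta>"
  proof -
    have "of_int n = (- of_nat (Suc k) :: 'k)" using neg by simp
    then show ?thesis by (simp add: fun_scale_def fun_eq_iff del: of_nat_Suc)
  qed
  then show ?thesis using root_multiples(2)[OF assms(1), of "Suc k"] assms(2) by simp
qed

definition square_root :: "'k \<Rightarrow> 'k" where
  "square_root c = (SOME z. z ^ 2 = c)"

lemma square_root: "square_root c ^ 2 = c"
  unfolding square_root_def by (rule someI_ex) (rule nth_root_exists, simp)

definition ev0 :: "('v \<Rightarrow> 'k) \<Rightarrow> 'v" where
  "ev0 \<gamma> = (SOME x. x \<in> G \<gamma> \<and> x \<noteq> 0)"

text \<open>The divisor is a square root of a number that is symmetric in \<open>\<gamma>\<close> and \<open>- \<gamma>\<close>. So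
  opposite root vectors are divided by the same scalar, and \<open>\<Phi>(e\<^sub>\<gamma>, e\<^sub>-\<^sub>\<gamma>) = 1\<close> holds for all
  roots without reference to a positive system.\<close>
definition ev :: "('v \<Rightarrow> 'k) \<Rightarrow> 'v" where
  "ev \<gamma> = scale (1 / square_root (killing (ev0 \<gamma>) (ev0 (- \<gamma>)))) (ev0 \<gamma>)"

lemma ev0: assumes "\<gamma> \<in> roots H" shows "ev0 \<gamma> \<in> G \<gamma>" "ev0 \<gamma> \<noteq> 0"
proof -
  have "\<exists>x. x \<in> G \<gamma> \<and> x \<noteq> 0" using roots_weights[OF assms] subspace_0[OF subspace_G] by (auto simp: weights_def)
  from someI_ex[OF this] show "ev0 \<gamma> \<in> G \<gamma>" "ev0 \<gamma> \<noteq> 0" by (auto simp: ev0_def)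
qed

lemma G_line:
  assumes "\<gamma> \<in> roots H" "x \<in> G \<gamma>" "x \<noteq> 0" "y \<in> G \<gamma>" shows "\<exists>c. y = scale c x"
proof -
  have "independent {x}" using assms(3) by simp
  moreover have "card {x} = dim (G \<gamma>)" using root_multiples(1)[OF assms(1)] by simp
  ultimately have "G \<gamma> \<subseteq> span {x}" using card_eq_dim[of "{x}" "G \<gamma>"] assms(2) by simp
  then show ?thesis using assms(4) by (auto simp: span_singleton)
qed

lemma ev_in: "\<gamma> \<in> roots H \<Longrightarrow> ev \<gamma> \<in> G \<gamma>"
  unfolding ev_def by (intro subspace_scale[OF subspace_G] ev0)

lemma ev_normalized: assumes "\<gamma> \<in> roots H" shows "killing (ev \<gamma>) (ev (- \<gamma>)) = 1"
proof -
  let ?c = "killing (ev0 \<gamma>) (ev0 (- \<gamma>))"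
  have "?c \<noteq> 0"
  proof
    assume c: "?c = 0"
    obtain y where y: "y \<in> G (- \<gamma>)" "killing (ev0 \<gamma>) y = 1"
      using root_dual_vector[OF roots_dual[OF assms] ev0[OF assms]] .
    obtain d where "y = scale d (ev0 (- \<gamma>))"
      using G_line[OF roots_neg[OF assms] ev0[OF roots_neg[OF assms]] y(1)] by blast
    then show False using y(2) c by (simp add: killing_linear)
  qed
  moreover have "killing (ev0 (- \<gamma>)) (ev0 (- (- \<gamma>))) = ?c" by (simp add: killing_sym)
  ultimately show ?thesis using square_root[of ?c]
    by (simp add: ev_def killing_linear power2_eq_square field_simps)
qed

lemma ev_nonzero: "\<gamma> \<in> roots H \<Longrightarrow> ev \<gamma> \<noteq> 0"
  using ev_normalized[of \<gamma>] by (auto simp: killing_linear)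

lemma G_expand: assumes "\<gamma> \<in> roots H" "x \<in> G \<gamma>" shows "x = scale (killing x (ev (- \<gamma>))) (ev \<gamma>)"
proof -
  obtain c where "x = scale c (ev \<gamma>)"
    using G_line[OF assms(1) ev_in[OF assms(1)] ev_nonzero[OF assms(1)] assms(2)] by blast
  then show ?thesis using ev_normalized[OF assms(1)] by (simp add: killing_linear)
qed

lemma br_H_ev: "h \<in> H \<Longrightarrow> \<gamma> \<in> roots H \<Longrightarrow> br h (ev \<gamma>) = scale (\<gamma> h) (ev \<gamma>)"
  by (rule H_acts_diagonally[OF _ roots_dual ev_in])

lemma br_ev_neg: "\<gamma> \<in> roots H \<Longrightarrow> br (ev \<gamma>) (ev (- \<gamma>)) = riesz \<gamma>"
  using br_opposite[OF roots_dual ev_in ev_in[OF roots_neg]] ev_normalized by simp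

lemma br_ev_in: "\<beta> \<in> roots H \<Longrightarrow> \<gamma> \<in> roots H \<Longrightarrow> br (ev \<beta>) (ev \<gamma>) \<in> G (\<beta> + \<gamma>)"
  by (intro br_G ev_in)

lemma br_ev_zero:
  assumes "\<beta> \<in> roots H" "\<gamma> \<in> roots H" "\<beta> + \<gamma> \<notin> roots H" "\<beta> + \<gamma> \<noteq> 0" shows "br (ev \<beta>) (ev \<gamma>) = 0"
  using G_trivial[OF dual_add[OF roots_dual[OF assms(1)] roots_dual[OF assms(2)]] _ br_ev_in[OF assms(1,2)]]
    assms(3,4) weights_eq_roots by blast

text \<open>The scalar by which \<open>ad e\<^sub>-\<^sub>\<beta> ad e\<^sub>\<beta>\<close> acts on \<open>e\<^sub>\<gamma>\<close>. It is a product of two structure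
  constants; these products are what enters Casimir eigenvalues, and in contrast to single
  structure constants they have a definite sign.\<close>
definition cc :: "('v \<Rightarrow> 'k) \<Rightarrow> ('v \<Rightarrow> 'k) \<Rightarrow> 'k" where
  "cc \<beta> \<gamma> = killing (br (ev (- \<beta>)) (br (ev \<beta>) (ev \<gamma>))) (ev (- \<gamma>))"

lemma cc: assumes "\<beta> \<in> roots H" "\<gamma> \<in> roots H"
  shows "br (ev (- \<beta>)) (br (ev \<beta>) (ev \<gamma>)) = scale (cc \<beta> \<gamma>) (ev \<gamma>)"
proof -
  have "br (ev (- \<beta>)) (br (ev \<beta>) (ev \<gamma>)) \<in> G (- \<beta> + (\<beta> + \<gamma>))"
    using assms by (intro br_G ev_in) simp_all
  then show ?thesis using G_expand[OF assms(2)] by (simp add: cc_def)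
qed

text \<open>The bracket \<open>[e\<^sub>\<beta>, e\<^sub>-\<^sub>\<beta>]\<close> represents \<open>\<beta>\<close> and acts on \<open>e\<^sub>\<gamma>\<close> by \<open>(\<gamma>, \<beta>)\<close>.\<close>
lemma cc_neg_left:
  assumes "\<beta> \<in> roots H" "\<gamma> \<in> roots H" shows "cc (- \<beta>) \<gamma> = cc \<beta> \<gamma> + form \<gamma> \<beta>"
proof -
  have "scale (form \<gamma> \<beta>) (ev \<gamma>) = br (br (ev \<beta>) (ev (- \<beta>))) (ev \<gamma>)"
    using assms by (simp add: br_ev_neg br_H_ev riesz(1) roots_dual form_apply)
  also have "\<dots> = scale (cc (- \<beta>) \<gamma>) (ev \<gamma>) - scale (cc \<beta> \<gamma>) (ev \<gamma>)"
    unfolding br_br_left using cc[OF assms] cc[OF roots_neg[OF assms(1)] assms(2)] by simp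
  also have "\<dots> = scale (cc (- \<beta>) \<gamma> - cc \<beta> \<gamma>) (ev \<gamma>)" by (simp add: scale_left_diff_distrib)
  finally show ?thesis using ev_nonzero[OF assms(2)] by simp
qed

text \<open>Both sides are the product of the structure constants for the step from \<open>\<delta>\<close> down to
  \<open>\<delta> - \<beta>\<close> and for the step back.\<close>
lemma cc_shift:
  assumes "\<beta> \<in> roots H" "\<delta> \<in> roots H" "\<delta> - \<beta> \<in> roots H" shows "cc (- \<beta>) \<delta> = cc \<beta> (\<delta> - \<beta>)"
proof -
  have "br (ev (- \<beta>)) (ev \<delta>) \<in> G (\<delta> - \<beta>)" using br_ev_in[OF roots_neg[OF assms(1)] assms(2)] by simp
  then obtain N where N: "br (ev (- \<beta>)) (ev \<delta>) = scale N (ev (\<delta> - \<beta>))" using G_expand[OF assms(3)] by blast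
  have "br (ev \<beta>) (ev (\<delta> - \<beta>)) \<in> G \<delta>" using br_ev_in[OF assms(1,3)] by simp
  then obtain M where M: "br (ev \<beta>) (ev (\<delta> - \<beta>)) = scale M (ev \<delta>)" using G_expand[OF assms(2)] by blast
  have "cc (- \<beta>) \<delta> = N * M" using N M ev_normalized[OF assms(2)] by (simp add: cc_def br_linear killing_linear)
  moreover have "cc \<beta> (\<delta> - \<beta>) = N * M"
    using N M ev_normalized[OF assms(3)] by (simp add: cc_def br_linear killing_linear)
  ultimately show ?thesis by simp
qed

text \<open>Invariance relates the structure constants of the triple \<open>\<gamma> = (\<gamma> - \<delta>) + \<delta>\<close> in its
  different readings: both sides are minus the product of \<open>\<Phi>([e\<^sub>\<gamma>\<^sub>-\<^sub>\<delta>, e\<^sub>\<delta>], e\<^sub>-\<^sub>\<gamma>)\<close> and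
  \<open>\<Phi>([e\<^sub>\<delta>\<^sub>-\<^sub>\<gamma>, e\<^sub>-\<^sub>\<delta>], e\<^sub>\<gamma>)\<close>.\<close>
lemma cc_difference:
  assumes "\<gamma> \<in> roots H" "\<delta> \<in> roots H" "\<gamma> - \<delta> \<in> roots H" shows "cc (- \<delta>) \<gamma> = cc (\<gamma> - \<delta>) \<delta>"
proof -
  let ?\<beta> = "\<gamma> - \<delta>"
  let ?A = "br (ev ?\<beta>) (ev \<delta>)" and ?B = "br (ev (- ?\<beta>)) (ev (- \<delta>))"
  let ?C = "br (ev (- \<delta>)) (ev \<gamma>)" and ?D = "br (ev \<delta>) (ev (- \<gamma>))"
  have m: "- \<gamma> \<in> roots H" "- \<delta> \<in> roots H" "- ?\<beta> \<in> roots H" using assms roots_neg by blast+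
  have "?A \<in> G \<gamma>" using br_ev_in[OF assms(3,2)] by simp
  then have A: "?A = scale (killing ?A (ev (- \<gamma>))) (ev \<gamma>)" by (rule G_expand[OF assms(1)])
  have "?B \<in> G (- \<gamma>)" using br_ev_in[OF m(3,2)] by simp
  then have B: "?B = scale (killing ?B (ev \<gamma>)) (ev (- \<gamma>))" using G_expand[OF m(1)] by simp
  have "?C \<in> G ?\<beta>" using br_ev_in[OF m(2) assms(1)] by simp
  then have C: "?C = scale (killing ?C (ev (- ?\<beta>))) (ev ?\<beta>)" by (rule G_expand[OF assms(3)])
  have "?D \<in> G (- ?\<beta>)" using br_ev_in[OF assms(2) m(1)] by simp
  then have D: "?D = scale (killing ?D (ev ?\<beta>)) (ev (- ?\<beta>))" using G_expand[OF m(3)] by simp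
  have "cc ?\<beta> \<delta> = - killing ?A ?B" by (simp add: cc_def killing_invariant')
  also have "\<dots> = - (killing ?A (ev (- \<gamma>)) * killing ?B (ev \<gamma>))"
    by (subst A, subst B) (simp add: killing_linear ev_normalized[OF assms(1)])
  also have "killing ?A (ev (- \<gamma>)) = killing ?D (ev ?\<beta>)"
    by (subst killing_invariant) (rule killing_sym)
  also have "killing ?B (ev \<gamma>) = killing ?C (ev (- ?\<beta>))"
    by (subst killing_invariant) (rule killing_sym)
  also have "- (killing ?D (ev ?\<beta>) * killing ?C (ev (- ?\<beta>))) = - killing ?C ?D"
    using arg_cong2[OF C D, of killing] unfolding killing_linear ev_normalized[OF assms(3)] by simp
  also have "\<dots> = cc (- \<delta>) \<gamma>" by (simp add: cc_def killing_invariant')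
  finally show ?thesis by (rule sym)
qed

lemma cc_zero:
  assumes "\<beta> \<in> roots H" "\<gamma> \<in> roots H" "\<beta> + \<gamma> \<notin> roots H" "\<beta> + \<gamma> \<noteq> 0" shows "cc \<beta> \<gamma> = 0"
  using br_ev_zero[OF assms] by (simp add: cc_def br_linear killing_linear)

text \<open>Here \<open>q\<close> and \<open>p\<close> count the steps by \<open>\<beta>\<close> that lead upwards and downwards from \<open>\<gamma>\<close>
  within the roots. By \<open>cc_shift\<close> and \<open>cc_neg_left\<close> the scalar \<open>cc \<beta>\<close> grows by \<open>(\<delta>, \<beta>)\<close> with
  the step from \<open>\<delta>\<close> down to \<open>\<delta> - \<beta>\<close>. It is zero at the top of the string, which determines it
  along the string, and the condition at the bottom, where \<open>e\<^sub>-\<^sub>\<beta>\<close> acts by zero, determines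
  \<open>(\<gamma>, \<beta>)\<close>.\<close>
lemma root_string:
  assumes \<beta>: "\<beta> \<in> roots H" and \<gamma>: "\<gamma> \<in> roots H" and ne: "\<gamma> \<noteq> \<beta>" "\<gamma> \<noteq> - \<beta>"
  obtains p q :: nat where "2 * form \<gamma> \<beta> = (of_nat p - of_nat q) * form \<beta> \<beta>"
    "2 * cc \<beta> \<gamma> = of_nat (q * Suc p) * form \<beta> \<beta>"
    "q > 0 \<longleftrightarrow> \<gamma> + \<beta> \<in> roots H" "p > 0 \<longleftrightarrow> \<gamma> - \<beta> \<in> roots H"
proof -
  define s where "s n = \<gamma> + fun_scale (of_int n) \<beta>" for n :: int
  have s_plus: "s n + \<beta> = s (n + 1)" and s_minus: "s n - \<beta> = s (n - 1)" for n
    by (simp_all add: s_def fun_scale_def fun_eq_iff algebra_simps)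
  have s0: "s 0 = \<gamma>" by (simp add: s_def fun_scale_def fun_eq_iff)
  have s_ne0: "s n \<noteq> 0" for n
  proof
    assume "s n = 0"
    then have "\<gamma> = fun_scale (of_int (- n)) \<beta>" by (simp add: s_def fun_scale_def fun_eq_iff eq_neg_iff_add_eq_0)
    then show False using root_int_multiple[OF \<beta>, of "- n"] \<gamma> ne by auto
  qed
  have s_inj: "inj s"
  proof (rule injI)
    fix a b assume "s a = s b"
    moreover obtain z where "\<beta> z \<noteq> 0" using roots_nonzero[OF \<beta>] by (auto simp: fun_eq_iff)
    ultimately show "a = b" by (auto simp: s_def fun_scale_def fun_eq_iff)
  qed
  \<comment> \<open>The string is injective and the set of roots is finite, so the string leaves it in
    both directions.\<close>
  have leaves: "\<exists>j::nat. s (f j) \<notin> roots H" if "inj f" for f :: "nat \<Rightarrow> int"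
  proof (rule ccontr)
    assume "\<not> ?thesis"
    then have "range (\<lambda>j. s (f j)) \<subseteq> roots H" by auto
    then have "finite (range (\<lambda>j. s (f j)))" using finite_roots by (rule finite_subset)
    moreover have "inj (\<lambda>j. s (f j))" using s_inj that by (auto simp: inj_def)
    ultimately show False by (simp add: finite_image_iff)
  qed
  define q where "q = (LEAST j::nat. s (int j + 1) \<notin> roots H)"
  define p where "p = (LEAST j::nat. s (- int j - 1) \<notin> roots H)"
  have q: "s (int q + 1) \<notin> roots H" unfolding q_def by (rule LeastI_ex) (rule leaves, simp add: inj_def)
  have p: "s (- int p - 1) \<notin> roots H" unfolding p_def by (rule LeastI_ex) (rule leaves, simp add: inj_def)
  have q': "s (int j + 1) \<in> roots H" if "j < q" for j using not_less_Least[of j] that unfolding q_def by blast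
  have p': "s (- int j - 1) \<in> roots H" if "j < p" for j using not_less_Least[of j] that unfolding p_def by blast
  have mid: "s n \<in> roots H" if "- int p \<le> n" "n \<le> int q" for n
  proof -
    consider "n = 0" | "n > 0" | "n < 0" by linarith
    then show ?thesis
    proof cases
      case 1 then show ?thesis using s0 \<gamma> by simp
    next
      case 2 then show ?thesis using q'[of "nat (n - 1)"] that by simp
    next
      case 3 then show ?thesis using p'[of "nat (- n - 1)"] that by simp
    qed
  qed
  let ?g = "form \<gamma> \<beta>" and ?b = "form \<beta> \<beta>"
  have fs: "form (s n) \<beta> = ?g + of_int n * ?b" for n
    unfolding s_def using roots_dual[OF \<gamma>] roots_dual[OF \<beta>] by (simp add: form_add_left form_scale_left dual_scale)
  \<comment> \<open>Twice the sum of \<open>(\<gamma> + n \<beta>, \<beta>)\<close> over \<open>n = q, q - 1, \<dots>, q - j + 1\<close>.\<close>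
  have C: "2 * cc \<beta> (s (int q - int j)) = 2 * of_nat j * (?g + of_nat q * ?b) - of_nat j * (of_nat j - 1) * ?b"
    if "j \<le> p + q" for j
    using that
  proof (induction j)
    case 0
    have "\<beta> + s (int q) = s (int q + 1)" using s_plus[of "int q"] by (simp add: add.commute)
    then show ?case using cc_zero[OF \<beta> mid[of "int q"]] q s_ne0 by simp
  next
    case (Suc j)
    let ?\<delta> = "s (int q - int j)"
    have \<delta>: "?\<delta> \<in> roots H" "?\<delta> - \<beta> \<in> roots H" using Suc.prems mid by (auto simp: s_minus)
    have "cc \<beta> (?\<delta> - \<beta>) = cc \<beta> ?\<delta> + form ?\<delta> \<beta>"
      using cc_shift[OF \<beta> \<delta>] cc_neg_left[OF \<beta> \<delta>(1)] by simp
    moreover have "?\<delta> - \<beta> = s (int q - int (Suc j))" by (simp add: s_minus algebra_simps)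
    ultimately have "2 * cc \<beta> (s (int q - int (Suc j))) = 2 * cc \<beta> ?\<delta> + 2 * (?g + (of_nat q - of_nat j) * ?b)"
      by (simp add: fs)
    then show ?case using Suc by (simp add: algebra_simps)
  qed
  let ?\<delta> = "s (- int p)"
  have \<delta>: "?\<delta> \<in> roots H" by (rule mid) auto
  have "- \<beta> + ?\<delta> = s (- int p - 1)" using s_minus[of "- int p"] by simp
  then have "cc (- \<beta>) ?\<delta> = 0" using cc_zero[OF roots_neg[OF \<beta>] \<delta>] p s_ne0 by simp
  then have "cc \<beta> ?\<delta> + (?g - of_nat p * ?b) = 0" using cc_neg_left[OF \<beta> \<delta>] fs[of "- int p"] by simp
  then have 0: "2 * cc \<beta> ?\<delta> + 2 * (?g - of_nat p * ?b) = 0" by (simp only: distrib_left[symmetric] mult_zero_right)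
  have "2 * cc \<beta> ?\<delta> = 2 * of_nat (p + q) * (?g + of_nat q * ?b) - of_nat (p + q) * (of_nat (p + q) - 1) * ?b"
    using C[of "p + q"] by simp
  moreover have "of_nat (p + q + 1) * (2 * ?g - (of_nat p - of_nat q) * ?b)
      = 2 * of_nat (p + q) * (?g + of_nat q * ?b) - of_nat (p + q) * (of_nat (p + q) - 1) * ?b + 2 * (?g - of_nat p * ?b)"
    by (simp add: algebra_simps)
  ultimately have "of_nat (p + q + 1) * (2 * ?g - (of_nat p - of_nat q) * ?b) = 0"
    using 0 by (simp only:)
  moreover have "of_nat (p + q + 1) \<noteq> (0::'k)" unfolding of_nat_eq_0_iff by simp
  ultimately have 1: "2 * ?g = (of_nat p - of_nat q) * ?b" by simp
  have "2 * cc \<beta> \<gamma> = of_nat q * (2 * ?g) + (2 * of_nat q * of_nat q - of_nat q * (of_nat q - 1)) * ?b"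
    using C[of q] s0 by (simp add: algebra_simps)
  also have "\<dots> = of_nat (q * Suc p) * ?b" unfolding 1 by (simp add: algebra_simps)
  finally have 2: "2 * cc \<beta> \<gamma> = of_nat (q * Suc p) * ?b" .
  have 3: "q > 0 \<longleftrightarrow> \<gamma> + \<beta> \<in> roots H"
  proof
    assume "q > 0" then show "\<gamma> + \<beta> \<in> roots H" using mid[of 1] s_plus[of 0] s0 by simp
  next
    assume "\<gamma> + \<beta> \<in> roots H" then show "q > 0" using q s_plus[of 0] s0 by (intro Nat.gr0I) auto
  qed
  have 4: "p > 0 \<longleftrightarrow> \<gamma> - \<beta> \<in> roots H"
  proof
    assume "p > 0" then show "\<gamma> - \<beta> \<in> roots H" using mid[of "-1"] s_minus[of 0] s0 by simp
  next
    assume "\<gamma> - \<beta> \<in> roots H" then show "p > 0" using p s_minus[of 0] s0 by (intro Nat.gr0I) auto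
  qed
  show ?thesis by (rule that[OF 1 2 3 4])
qed

end

section \<open>Heights and the highest root\<close>

text \<open>The ground field carries no order; membership of a difference in this set takes the
  place of an inequality.\<close>
definition nonneg_rats :: "'k::field_char_0 set" where
  "nonneg_rats = {of_rat r | r. 0 \<le> r}"

lemma nonneg_rats_add: assumes "x \<in> nonneg_rats" "y \<in> nonneg_rats" shows "x + y \<in> nonneg_rats"
proof -
  obtain r s where "0 \<le> r" "x = of_rat r" "0 \<le> s" "y = of_rat s" using assms by (auto simp: nonneg_rats_def)
  then have "0 \<le> r + s" "x + y = of_rat (r + s)" by (simp_all add: of_rat_add)
  then show ?thesis unfolding nonneg_rats_def by blast
qed

lemma nonneg_rats_mult: assumes "x \<in> nonneg_rats" "y \<in> nonneg_rats" shows "x * y \<in> nonneg_rats"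
proof -
  obtain r s where "0 \<le> r" "x = of_rat r" "0 \<le> s" "y = of_rat s" using assms by (auto simp: nonneg_rats_def)
  then have "0 \<le> r * s" "x * y = of_rat (r * s)" by (simp_all add: of_rat_mult)
  then show ?thesis unfolding nonneg_rats_def by blast
qed

lemma nonneg_rats_of_rat: "0 \<le> r \<Longrightarrow> of_rat r \<in> nonneg_rats"
  by (auto simp: nonneg_rats_def)

lemma nonneg_rats_of_nat: "of_nat n \<in> nonneg_rats"
  using nonneg_rats_of_rat[of "of_nat n"] by simp

lemma nonneg_rats_0: "0 \<in> nonneg_rats"
  using nonneg_rats_of_nat[of 0] by simp

lemma nonneg_rats_half: assumes "2 * x \<in> nonneg_rats" shows "x \<in> nonneg_rats"
proof -
  obtain r where r: "0 \<le> r" "2 * x = of_rat r" using assms by (auto simp: nonneg_rats_def)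
  then have "x = of_rat (r / 2)" by (simp add: of_rat_divide field_simps)
  then show ?thesis using r nonneg_rats_of_rat[of "r / 2"] by simp
qed

lemma nonneg_rats_sum: "(\<And>i. i \<in> I \<Longrightarrow> f i \<in> nonneg_rats) \<Longrightarrow> sum f I \<in> nonneg_rats"
  by (induction I rule: infinite_finite_induct) (auto simp: nonneg_rats_0 nonneg_rats_add)

lemma nonneg_rats_antisym: assumes "x \<in> nonneg_rats" "- x \<in> nonneg_rats" shows "x = 0"
proof -
  obtain r s where rs: "0 \<le> r" "x = of_rat r" "0 \<le> s" "- x = of_rat s"
    using assms by (auto simp: nonneg_rats_def)
  then have "of_rat (r + s) = (0 :: 'a)" by (metis of_rat_add add.right_inverse)
  then have "r + s = 0" by simp
  then show ?thesis using rs by simp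
qed

lemma nonneg_rats_sum_eq_0:
  assumes "finite I" "\<And>i. i \<in> I \<Longrightarrow> f i \<in> nonneg_rats" "sum f I = 0" "i \<in> I" shows "f i = 0"
proof -
  have "sum f I = f i + sum f (I - {i})" using assms by (simp add: sum.remove)
  then have "- f i = sum f (I - {i})" using assms(3) by (simp add: eq_neg_iff_add_eq_0 add.commute neg_eq_iff_add_eq_0)
  moreover have "sum f (I - {i}) \<in> nonneg_rats" using assms(2) by (intro nonneg_rats_sum) auto
  ultimately show ?thesis using nonneg_rats_antisym[of "f i"] assms by simp
qed

context based_simple_lie_algebra
begin

lemma finite_Pi: "finite \<Pi>"
  using Pi_roots finite_roots by (rule finite_subset)

lemma ht_add: "\<mu> \<in> dual_space H \<Longrightarrow> \<nu> \<in> dual_space H \<Longrightarrow> ht \<beta> (\<mu> + \<nu>) = ht \<beta> \<mu> + ht \<beta> \<nu>"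
  and ht_diff: "\<mu> \<in> dual_space H \<Longrightarrow> \<nu> \<in> dual_space H \<Longrightarrow> ht \<beta> (\<mu> - \<nu>) = ht \<beta> \<mu> - ht \<beta> \<nu>"
  and ht_neg: "\<mu> \<in> dual_space H \<Longrightarrow> ht \<beta> (- \<mu>) = - ht \<beta> \<mu>"
  and ht_zero: "ht \<beta> 0 = 0"
  using Pi_span Pi_independent
  by (simp_all add: ht_def fun_space.representation_add fun_space.representation_diff fun_space.representation_neg
      fun_space.representation_zero)

lemma ht_sum: "(\<And>i. i \<in> I \<Longrightarrow> \<mu> i \<in> dual_space H) \<Longrightarrow> ht \<beta> (\<Sum>i\<in>I. \<mu> i) = (\<Sum>i\<in>I. ht \<beta> (\<mu> i))"
  by (induction I rule: infinite_finite_induct) (auto simp: ht_zero ht_add dual_sum)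

lemma ht_Pi: "\<gamma> \<in> \<Pi> \<Longrightarrow> ht \<beta> \<gamma> = (if \<beta> = \<gamma> then 1 else 0)"
  using Pi_independent by (simp add: ht_def fun_space.representation_basis)

lemma ht_expand: "\<mu> \<in> dual_space H \<Longrightarrow> \<mu> = (\<Sum>\<beta>\<in>\<Pi>. fun_scale (ht \<beta> \<mu>) \<beta>)"
  unfolding ht_def using fun_space.sum_representation_eq[of \<Pi> \<mu> \<Pi>] Pi_span Pi_independent finite_Pi by simp

lemma form_expand:
  assumes "\<mu> \<in> dual_space H" "\<nu> \<in> dual_space H" shows "form \<mu> \<nu> = (\<Sum>\<beta>\<in>\<Pi>. ht \<beta> \<mu> * form \<beta> \<nu>)"
proof -
  have "form \<mu> \<nu> = form (\<Sum>\<beta>\<in>\<Pi>. fun_scale (ht \<beta> \<mu>) \<beta>) \<nu>" using ht_expand[OF assms(1)] by simp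
  also have "\<dots> = (\<Sum>\<beta>\<in>\<Pi>. form (fun_scale (ht \<beta> \<mu>) \<beta>) \<nu>)"
    using assms(2) by (intro form_sum_left) (auto intro: dual_scale Pi_dual)
  also have "\<dots> = (\<Sum>\<beta>\<in>\<Pi>. ht \<beta> \<mu> * form \<beta> \<nu>)"
    using assms(2) by (intro sum.cong refl form_scale_left) (auto intro: Pi_dual)
  finally show ?thesis .
qed

lemma pos_rootsD: "\<gamma> \<in> pos_roots \<Longrightarrow> \<gamma> \<in> roots H" "\<gamma> \<in> pos_roots \<Longrightarrow> \<beta> \<in> \<Pi> \<Longrightarrow> ht \<beta> \<gamma> \<in> \<nat>"
  by (auto simp: pos_roots_def)

lemma root_pos_or_neg: assumes "\<gamma> \<in> roots H" shows "\<gamma> \<in> pos_roots \<or> - \<gamma> \<in> pos_roots"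
proof -
  have "(\<forall>\<beta>\<in>\<Pi>. ht \<beta> \<gamma> \<in> \<nat>) \<or> (\<forall>\<beta>\<in>\<Pi>. - ht \<beta> \<gamma> \<in> \<nat>)"
    using base assms by (simp add: root_base_def ht_def)
  then show ?thesis using assms by (auto simp: pos_roots_def ht_neg roots_dual)
qed

lemma nat_antisym: assumes "x \<in> \<nat>" "- x \<in> \<nat>" shows "x = (0 :: 'k)"
  using assms nonneg_rats_of_nat by (intro nonneg_rats_antisym) (auto elim!: Nats_cases)

lemma pos_roots_neg: assumes "\<gamma> \<in> pos_roots" shows "- \<gamma> \<notin> pos_roots"
proof
  assume "- \<gamma> \<in> pos_roots"
  then have "ht \<beta> \<gamma> = 0" if "\<beta> \<in> \<Pi>" for \<beta>
    using that assms by (intro nat_antisym) (auto simp: pos_roots_def ht_neg roots_dual)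
  then have "\<gamma> = 0"
    using ht_expand[of \<gamma>] assms by (simp add: pos_rootsD roots_dual)
  then show False using assms roots_nonzero pos_rootsD by blast
qed

lemma Pi_pos: "\<beta> \<in> \<Pi> \<Longrightarrow> \<beta> \<in> pos_roots"
  using Pi_roots by (auto simp: pos_roots_def ht_Pi)

definition lattice :: "('v \<Rightarrow> 'k) set" where
  "lattice = {\<mu>\<in>dual_space H. \<forall>\<beta>\<in>\<Pi>. ht \<beta> \<mu> \<in> \<int>}"

text \<open>The sum of the coordinates on the root lattice; elsewhere the value is arbitrary.\<close>
definition iht :: "('v \<Rightarrow> 'k) \<Rightarrow> int" where
  "iht \<mu> = (SOME n. of_int n = (\<Sum>\<beta>\<in>\<Pi>. ht \<beta> \<mu>))"

lemma lattice_dual: "\<mu> \<in> lattice \<Longrightarrow> \<mu> \<in> dual_space H"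
  by (simp add: lattice_def)

lemma lattice_add: "\<mu> \<in> lattice \<Longrightarrow> \<nu> \<in> lattice \<Longrightarrow> \<mu> + \<nu> \<in> lattice"
  by (auto simp: lattice_def ht_add dual_add)

lemma lattice_sum: "(\<And>i. i \<in> I \<Longrightarrow> \<mu> i \<in> lattice) \<Longrightarrow> (\<Sum>i\<in>I. \<mu> i) \<in> lattice"
  by (auto simp: lattice_def ht_sum dual_sum intro!: Ints_sum)

lemma nat_int: "x \<in> \<nat> \<Longrightarrow> x \<in> (\<int> :: 'k set)" using Nats_subset_Ints by blast

lemma roots_lattice: assumes "\<gamma> \<in> roots H" shows "\<gamma> \<in> lattice"
proof -
  have "ht \<beta> \<gamma> \<in> \<int>" if "\<beta> \<in> \<Pi>" for \<beta>
    using root_pos_or_neg[OF assms] nat_int[of "ht \<beta> \<gamma>"] nat_int[of "- ht \<beta> \<gamma>"] that assms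
    by (auto simp: pos_roots_def ht_neg roots_dual)
  then show ?thesis using assms by (simp add: lattice_def roots_dual)
qed

lemma iht: "\<mu> \<in> lattice \<Longrightarrow> of_int (iht \<mu>) = (\<Sum>\<beta>\<in>\<Pi>. ht \<beta> \<mu>)"
  unfolding iht_def
proof (rule someI_ex)
  assume "\<mu> \<in> lattice"
  then have "(\<Sum>\<beta>\<in>\<Pi>. ht \<beta> \<mu>) \<in> \<int>" by (intro Ints_sum) (auto simp: lattice_def)
  then show "\<exists>n. of_int n = (\<Sum>\<beta>\<in>\<Pi>. ht \<beta> \<mu>)" by (metis Ints_cases)
qed

lemma iht_add: assumes "\<mu> \<in> lattice" "\<nu> \<in> lattice" shows "iht (\<mu> + \<nu>) = iht \<mu> + iht \<nu>"
proof -
  have "(of_int (iht (\<mu> + \<nu>)) :: 'k) = of_int (iht \<mu> + iht \<nu>)"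
    using assms by (simp add: iht lattice_add ht_add lattice_dual sum.distrib)
  then show ?thesis by (simp only: of_int_eq_iff)
qed

lemma iht_pos: assumes "\<gamma> \<in> pos_roots" shows "iht \<gamma> > 0"
proof -
  have g: "\<gamma> \<in> roots H" using assms by (rule pos_rootsD)
  have "(\<Sum>\<beta>\<in>\<Pi>. ht \<beta> \<gamma>) \<in> nonneg_rats"
    using assms nonneg_rats_of_nat by (intro nonneg_rats_sum) (auto dest!: pos_rootsD(2) elim!: Nats_cases)
  then obtain r :: rat where r: "0 \<le> r" "of_int (iht \<gamma>) = (of_rat r :: 'k)"
    using iht[OF roots_lattice[OF g]] by (auto simp: nonneg_rats_def)
  then have "of_rat (of_int (iht \<gamma>)) = (of_rat r :: 'k)" by simp
  then have "of_int (iht \<gamma>) = r" by (simp only: of_rat_eq_iff)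
  then have "iht \<gamma> \<ge> 0" using r by simp
  moreover have "iht \<gamma> \<noteq> 0"
  proof
    assume "iht \<gamma> = 0"
    then have 0: "(\<Sum>\<beta>\<in>\<Pi>. ht \<beta> \<gamma>) = 0" using iht[OF roots_lattice[OF g]] by simp
    have "ht \<beta> \<gamma> = 0" if "\<beta> \<in> \<Pi>" for \<beta>
      by (rule nonneg_rats_sum_eq_0[OF finite_Pi _ 0 that])
        (use assms nonneg_rats_of_nat in \<open>auto dest!: pos_rootsD(2) elim!: Nats_cases\<close>)
    then have "\<gamma> = 0" using ht_expand[OF roots_dual[OF g]] by simp
    then show False using roots_nonzero[OF g] by simp
  qed
  ultimately show ?thesis by simp
qed

lemma weights_decompose_ev: "x \<in> span (H \<union> ev ` roots H)"
proof -
  have "proj \<gamma> x \<in> span (H \<union> ev ` roots H)" if "\<gamma> \<in> weights" for \<gamma>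
  proof (cases "\<gamma> = 0")
    case True
    then show ?thesis using proj_in[of 0 x] by (auto simp: G_zero intro: span_base)
  next
    case False
    then have g: "\<gamma> \<in> roots H" using that weights_eq_roots by blast
    have "scale (killing (proj \<gamma> x) (ev (- \<gamma>))) (ev \<gamma>) \<in> span (H \<union> ev ` roots H)"
      using g by (intro span_scale span_base) auto
    then show ?thesis using G_expand[OF g proj_in[of \<gamma> x]] by simp
  qed
  then have "(\<Sum>\<gamma>\<in>weights. proj \<gamma> x) \<in> span (H \<union> ev ` roots H)" by (rule span_sum)
  then show ?thesis by (simp add: proj_sum)
qed

text \<open>They span the submodule of the adjoint module that the negative root vectors generate
  from \<open>e\<^sub>\<theta>\<close>.\<close>
inductive_set lowering_words :: "('v \<Rightarrow> 'k) \<Rightarrow> 'v set" for \<theta> where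
  base: "ev \<theta> \<in> lowering_words \<theta>"
| step: "w \<in> lowering_words \<theta> \<Longrightarrow> \<beta> \<in> pos_roots \<Longrightarrow> br (ev (- \<beta>)) w \<in> lowering_words \<theta>"

text \<open>In \<open>[x, [e\<^sub>-\<^sub>\<beta>, w]] = [[x, e\<^sub>-\<^sub>\<beta>], w] + [e\<^sub>-\<^sub>\<beta>, [x, w]]\<close> the induction hypothesis covers \<open>w\<close>
  with both \<open>[x, e\<^sub>-\<^sub>\<beta>]\<close> and \<open>x\<close>. Only for the word \<open>e\<^sub>\<theta>\<close> itself does the sign of a root matter.\<close>
lemma br_in_span_words:
  assumes \<theta>: "\<theta> \<in> roots H" and top: "\<And>\<beta>. \<beta> \<in> pos_roots \<Longrightarrow> br (ev \<beta>) (ev \<theta>) = 0"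
    and "w \<in> lowering_words \<theta>"
  shows "br x w \<in> span (lowering_words \<theta>)"
  using assms(3)
proof (induction arbitrary: x)
  let ?S = "span (lowering_words \<theta>)"
  have reduce: "br x w \<in> ?S"
    if "\<And>h. h \<in> H \<Longrightarrow> br h w \<in> ?S" "\<And>\<beta>. \<beta> \<in> pos_roots \<Longrightarrow> br (ev \<beta>) w \<in> ?S"
      "\<And>\<beta>. \<beta> \<in> pos_roots \<Longrightarrow> br (ev (- \<beta>)) w \<in> ?S" for x w
  proof -
    have "subspace {x. br x w \<in> ?S}"
      by (auto simp: subspace_def br_linear intro: span_zero span_add span_scale)
    moreover have "H \<union> ev ` roots H \<subseteq> {x. br x w \<in> ?S}"
    proof -
      have "br (ev \<gamma>) w \<in> ?S" if "\<gamma> \<in> roots H" for \<gamma>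
        using root_pos_or_neg[OF that] \<open>\<And>\<beta>. \<beta> \<in> pos_roots \<Longrightarrow> br (ev \<beta>) w \<in> ?S\<close>[of \<gamma>]
          \<open>\<And>\<beta>. \<beta> \<in> pos_roots \<Longrightarrow> br (ev (- \<beta>)) w \<in> ?S\<close>[of "- \<gamma>"] by auto
      then show ?thesis using that(1) by auto
    qed
    ultimately have "span (H \<union> ev ` roots H) \<subseteq> {x. br x w \<in> ?S}" by (intro span_minimal)
    then show ?thesis using weights_decompose_ev by blast
  qed
  {
    case base
    show ?case
    proof (rule reduce)
      show "br h (ev \<theta>) \<in> ?S" if "h \<in> H" for h
        using that \<theta> by (simp add: br_H_ev span_scale span_base lowering_words.base)
      show "br (ev (- \<beta>)) (ev \<theta>) \<in> ?S" if "\<beta> \<in> pos_roots" for \<beta>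
        using that by (intro span_base lowering_words.intros)
    qed (simp add: top span_zero)
  next
    case (step w \<beta>)
    have down: "br (ev (- \<beta>)) v \<in> ?S" if "v \<in> ?S" for v
    proof -
      have "subspace {v. br (ev (- \<beta>)) v \<in> ?S}"
        by (auto simp: subspace_def br_linear intro: span_zero span_add span_scale)
      then have "?S \<subseteq> {v. br (ev (- \<beta>)) v \<in> ?S}"
        using step.hyps(2) by (intro span_minimal) (auto intro: span_base lowering_words.step)
      then show ?thesis using that by blast
    qed
    have "br x (br (ev (- \<beta>)) w) = br (br x (ev (- \<beta>))) w + br (ev (- \<beta>)) (br x w)" by (rule br_br)
    then show ?case using step.IH[of "br x (ev (- \<beta>))"] down[OF step.IH[of x]] by (simp add: span_add)
  }
qed

lemma lowering_words_weight:
  assumes \<theta>: "\<theta> \<in> roots H" and "w \<in> lowering_words \<theta>"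
  shows "\<exists>\<kappa>\<in>dual_space H. w \<in> G \<kappa> \<and> (\<forall>\<beta>\<in>\<Pi>. ht \<beta> \<theta> - ht \<beta> \<kappa> \<in> \<nat>)"
  using assms(2)
proof induction
  case base
  then show ?case using ev_in[OF \<theta>] roots_dual[OF \<theta>] by (intro bexI[of _ \<theta>]) auto
next
  case (step w \<beta>)
  then obtain \<kappa> where k: "\<kappa> \<in> dual_space H" "w \<in> G \<kappa>" "\<forall>\<beta>\<in>\<Pi>. ht \<beta> \<theta> - ht \<beta> \<kappa> \<in> \<nat>" by blast
  have b: "\<beta> \<in> roots H" "\<beta> \<in> dual_space H" using step.hyps(2) pos_rootsD roots_dual by blast+
  have "ht \<beta>' \<theta> - ht \<beta>' (- \<beta> + \<kappa>) \<in> \<nat>" if "\<beta>' \<in> \<Pi>" for \<beta>'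
  proof -
    have "ht \<beta>' \<theta> - ht \<beta>' (- \<beta> + \<kappa>) = (ht \<beta>' \<theta> - ht \<beta>' \<kappa>) + ht \<beta>' \<beta>"
      by (simp only: ht_add[OF dual_neg[OF b(2)] k(1)] ht_neg[OF b(2)]) simp
    then show ?thesis using k(3) that pos_rootsD(2)[OF step.hyps(2) that] Nats_add by metis
  qed
  then show ?case
    using br_G[OF ev_in[OF roots_neg[OF b(1)]] k(2)] dual_add[OF dual_neg[OF b(2)] k(1)] by blast
qed

lemma roots_nonempty: "roots H \<noteq> {}"
proof
  assume e: "roots H = {}"
  have "x \<in> H" for x
    using weights_decompose_ev[of x] e subspace_H by (simp add: span_eq_iff[THEN iffD2])
  then show False using H_abelian non_abelian by blast
qed

text \<open>Positive root vectors kill \<open>e\<^sub>\<theta>\<close> when \<open>\<theta>\<close> has maximal height. So the lowering words of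
  \<open>\<theta>\<close> span a nonzero ideal, which is everything, and their weights are \<open>\<theta>\<close> minus sums of
  positive roots.\<close>
lemma highest_root_exists: "\<exists>\<theta>\<in>roots H. \<forall>\<gamma>\<in>roots H. \<forall>\<beta>\<in>\<Pi>. ht \<beta> \<theta> - ht \<beta> \<gamma> \<in> \<nat>"
proof -
  have "Max (iht ` roots H) \<in> iht ` roots H" using finite_roots roots_nonempty by (intro Max_in) auto
  then obtain \<theta> where "\<theta> \<in> roots H" "iht \<theta> = Max (iht ` roots H)" by auto
  then have \<theta>: "\<theta> \<in> roots H" "\<And>\<gamma>. \<gamma> \<in> roots H \<Longrightarrow> iht \<gamma> \<le> iht \<theta>"
    using finite_roots by auto
  obtain \<gamma>0 where g0: "\<gamma>0 \<in> pos_roots" using roots_nonempty root_pos_or_neg by blast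
  then have t0: "iht \<theta> > 0" using iht_pos[OF g0] \<theta>(2)[OF pos_rootsD(1)[OF g0]] by simp
  have top: "br (ev \<beta>) (ev \<theta>) = 0" if "\<beta> \<in> pos_roots" for \<beta>
  proof (rule br_ev_zero)
    have s: "iht (\<beta> + \<theta>) = iht \<beta> + iht \<theta>"
      using that \<theta>(1) by (simp add: iht_add roots_lattice pos_rootsD)
    show "\<beta> + \<theta> \<notin> roots H" using \<theta>(2)[of "\<beta> + \<theta>"] s iht_pos[OF that] by auto
    show "\<beta> + \<theta> \<noteq> 0"
    proof
      assume "\<beta> + \<theta> = 0"
      then have "iht (\<beta> + \<theta>) = iht (0 + 0)" by simp
      moreover have "iht (0 + 0) = iht 0 + iht 0"
        by (intro iht_add) (simp_all add: lattice_def ht_zero dual_zero)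
      ultimately show False using s t0 iht_pos[OF that] by simp
    qed
  qed (use that \<theta> pos_rootsD in auto)
  let ?S = "span (lowering_words \<theta>)"
  have "ideal ?S"
    unfolding ideal_def
  proof (intro conjI allI ballI)
    fix x y assume "y \<in> ?S"
    moreover have "subspace {v. br x v \<in> ?S}"
      by (auto simp: subspace_def br_linear intro: span_zero span_add span_scale)
    then have "?S \<subseteq> {v. br x v \<in> ?S}"
      using br_in_span_words[OF \<theta>(1) top] by (intro span_minimal) auto
    ultimately show "br x y \<in> ?S" by blast
  qed simp
  moreover have "ev \<theta> \<in> ?S" by (intro span_base lowering_words.base)
  ultimately have S: "?S = UNIV" using no_proper_ideal[of ?S] ev_nonzero[OF \<theta>(1)] by auto
  have "\<forall>\<beta>\<in>\<Pi>. ht \<beta> \<theta> - ht \<beta> \<gamma> \<in> \<nat>" if \<gamma>: "\<gamma> \<in> roots H" for \<gamma>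
  proof (rule ccontr)
    assume neg: "\<not> ?thesis"
    have "proj \<gamma> w = 0" if w: "w \<in> lowering_words \<theta>" for w
    proof -
      obtain \<kappa> where k: "\<kappa> \<in> dual_space H" "w \<in> G \<kappa>" "\<forall>\<beta>\<in>\<Pi>. ht \<beta> \<theta> - ht \<beta> \<kappa> \<in> \<nat>"
        using lowering_words_weight[OF \<theta>(1) w] by blast
      then have "\<gamma> \<noteq> \<kappa>" using neg by auto
      then show ?thesis using proj_on[OF k(2,1)] by simp
    qed
    moreover have "subspace {v. proj \<gamma> v = 0}"
      by (auto simp: subspace_def lin_zero[OF endo_proj] lin_add[OF endo_proj] lin_scale[OF endo_proj])
    ultimately have "?S \<subseteq> {v. proj \<gamma> v = 0}" by (intro span_minimal) auto
    then have "proj \<gamma> (ev \<gamma>) = 0" using S by auto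
    then show False using proj_on[OF ev_in[OF \<gamma>] roots_dual[OF \<gamma>]] ev_nonzero[OF \<gamma>] by simp
  qed
  then show ?thesis using \<theta>(1) by blast
qed

lemma highest_root:
  shows "highest_root \<in> roots H" "\<gamma> \<in> roots H \<Longrightarrow> \<beta> \<in> \<Pi> \<Longrightarrow> ht \<beta> highest_root - ht \<beta> \<gamma> \<in> \<nat>"
proof -
  let ?Q = "\<lambda>\<theta>. \<theta> \<in> roots H \<and> (\<forall>\<gamma>\<in>roots H. \<forall>\<beta>\<in>\<Pi>. ht \<beta> \<theta> - ht \<beta> \<gamma> \<in> \<nat>)"
  have "\<exists>!\<theta>. ?Q \<theta>"
  proof -
    obtain \<theta> where t: "?Q \<theta>" using highest_root_exists by blast
    have "\<theta>' = \<theta>" if t': "?Q \<theta>'" for \<theta>'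
    proof -
      have "ht \<beta> \<theta> - ht \<beta> \<theta>' = 0" if "\<beta> \<in> \<Pi>" for \<beta>
        by (rule nat_antisym) (use t t' that in auto)
      then have "(\<Sum>\<beta>\<in>\<Pi>. fun_scale (ht \<beta> \<theta>) \<beta>) = (\<Sum>\<beta>\<in>\<Pi>. fun_scale (ht \<beta> \<theta>') \<beta>)"
        by (intro sum.cong) auto
      then show ?thesis using ht_expand[of \<theta>] ht_expand[of \<theta>'] t t' roots_dual by metis
    qed
    then show ?thesis using t by blast
  qed
  from theI'[OF this] show "highest_root \<in> roots H" "\<gamma> \<in> roots H \<Longrightarrow> \<beta> \<in> \<Pi> \<Longrightarrow> ht \<beta> highest_root - ht \<beta> \<gamma> \<in> \<nat>"
    unfolding highest_root_def by blast+
qed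

lemma highest_root_top:
  assumes "\<beta> \<in> pos_roots" shows "br (ev \<beta>) (ev highest_root) = 0"
proof (rule br_ev_zero)
  let ?\<theta> = highest_root
  have b: "\<beta> \<in> roots H" "\<beta> \<in> dual_space H" and t: "?\<theta> \<in> roots H" "?\<theta> \<in> dual_space H"
    using assms pos_rootsD highest_root(1) roots_dual by blast+
  show "\<beta> \<in> roots H" "?\<theta> \<in> roots H" using b t by auto
  show n: "\<beta> + ?\<theta> \<notin> roots H"
  proof
    assume "\<beta> + ?\<theta> \<in> roots H"
    then have "- ht \<beta>' \<beta> \<in> \<nat>" if "\<beta>' \<in> \<Pi>" for \<beta>'
      using highest_root(2)[of "\<beta> + ?\<theta>" \<beta>'] that b t by (simp add: ht_add)
    then have "ht \<beta>' \<beta> = 0" if "\<beta>' \<in> \<Pi>" for \<beta>'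
      using that pos_rootsD(2)[OF assms that] by (intro nat_antisym) auto
    then have "\<beta> = 0" using ht_expand[OF b(2)] by simp
    then show False using roots_nonzero b by blast
  qed
  show "\<beta> + ?\<theta> \<noteq> 0"
  proof
    assume "\<beta> + ?\<theta> = 0"
    then have t': "?\<theta> = - \<beta>" by (simp add: eq_neg_iff_add_eq_0 add.commute)
    have "ht \<beta>' \<beta> = 0" if "\<beta>' \<in> \<Pi>" for \<beta>'
    proof (rule nat_antisym)
      show "ht \<beta>' \<beta> \<in> \<nat>" by (rule pos_rootsD(2)[OF assms that])
      have "ht \<beta>' ?\<theta> - ht \<beta>' \<beta> \<in> \<nat>" by (rule highest_root(2)[OF b(1) that])
      then have "- ht \<beta>' \<beta> - ht \<beta>' \<beta> + ht \<beta>' \<beta> \<in> \<nat>"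
        using t' ht_neg[OF b(2)] pos_rootsD(2)[OF assms that] by (simp only: Nats_add)
      then show "- ht \<beta>' \<beta> \<in> \<nat>" by simp
    qed
    then have "\<beta> = 0" using ht_expand[OF b(2)] by simp
    then show False using roots_nonzero b by blast
  qed
qed

section \<open>Signs of structure constants\<close>

lemma form_root_nonneg: "\<beta> \<in> roots H \<Longrightarrow> form \<beta> \<beta> \<in> nonneg_rats"
  using form_root_positive[of \<beta>] by (auto simp: nonneg_rats_def)

text \<open>In the notation of \<open>root_string\<close> the scalar is \<open>q (p + 1) (\<beta>, \<beta>) / 2\<close>.\<close>
lemma cc_nonneg:
  assumes "\<beta> \<in> roots H" "\<gamma> \<in> roots H" "\<gamma> \<noteq> \<beta>" "\<gamma> \<noteq> - \<beta>"
  shows "cc \<beta> \<gamma> \<in> nonneg_rats" "cc \<beta> \<gamma> = 0 \<longleftrightarrow> \<gamma> + \<beta> \<notin> roots H"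
proof -
  obtain p q :: nat where pq: "2 * cc \<beta> \<gamma> = of_nat (q * Suc p) * form \<beta> \<beta>" "q > 0 \<longleftrightarrow> \<gamma> + \<beta> \<in> roots H"
    using root_string[OF assms] by metis
  have "2 * cc \<beta> \<gamma> \<in> nonneg_rats" unfolding pq(1)
    by (intro nonneg_rats_mult nonneg_rats_of_nat form_root_nonneg assms)
  then show "cc \<beta> \<gamma> \<in> nonneg_rats" by (rule nonneg_rats_half)
  have "cc \<beta> \<gamma> = 0 \<longleftrightarrow> 2 * cc \<beta> \<gamma> = 0" by simp
  also have "\<dots> \<longleftrightarrow> of_nat (q * Suc p) = (0::'k)"
    unfolding pq(1) mult_eq_0_iff[of "of_nat (q * Suc p)" "form \<beta> \<beta>"] using form_root_nonzero[OF assms(1)] by blast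
  also have "\<dots> \<longleftrightarrow> q = 0" unfolding of_nat_eq_0_iff by auto
  finally show "cc \<beta> \<gamma> = 0 \<longleftrightarrow> \<gamma> + \<beta> \<notin> roots H" using pq(2) by auto
qed

text \<open>The last hypothesis expresses \<open>(\<gamma>, \<beta>) > 0\<close>. By \<open>root_string\<close> twice this number is
  \<open>(p - q) (\<beta>, \<beta>)\<close>, so \<open>p > 0\<close>.\<close>
lemma root_difference:
  assumes "\<beta> \<in> roots H" "\<gamma> \<in> roots H" "\<gamma> \<noteq> \<beta>" "\<gamma> \<noteq> - \<beta>" "- form \<gamma> \<beta> \<notin> nonneg_rats"
  shows "\<gamma> - \<beta> \<in> roots H"
proof -
  obtain p q :: nat where pq: "2 * form \<gamma> \<beta> = (of_nat p - of_nat q) * form \<beta> \<beta>" "p > 0 \<longleftrightarrow> \<gamma> - \<beta> \<in> roots H"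
    using root_string[OF assms(1-4)] by metis
  have "p \<noteq> 0"
  proof
    assume "p = 0"
    then have "2 * (- form \<gamma> \<beta>) = of_nat q * form \<beta> \<beta>" using pq(1) by simp
    then have "2 * (- form \<gamma> \<beta>) \<in> nonneg_rats" using nonneg_rats_mult[OF nonneg_rats_of_nat form_root_nonneg[OF assms(1)]] by metis
    then show False using assms(5) nonneg_rats_half by blast
  qed
  then show ?thesis using pq(2) by simp
qed

lemma root_integral:
  assumes "\<beta> \<in> roots H" "\<gamma> \<in> roots H" shows "\<exists>n::int. 2 * form \<gamma> \<beta> / form \<beta> \<beta> = of_int n"
proof (cases "\<gamma> = \<beta> \<or> \<gamma> = - \<beta>")
  case True
  then show ?thesis using form_root_nonzero[OF assms(1)] form_neg_left[OF roots_dual roots_dual, OF assms(1) assms(1)]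
    by (auto intro: exI[of _ 2] exI[of _ "-2"])
next
  case False
  then obtain p q :: nat where pq: "2 * form \<gamma> \<beta> = (of_nat p - of_nat q) * form \<beta> \<beta>"
    using root_string[OF assms] by metis
  then have "2 * form \<gamma> \<beta> / form \<beta> \<beta> = of_int (int p - int q)" using form_root_nonzero[OF assms(1)] by simp
  then show ?thesis by blast
qed

lemma br_ev_nonzero:
  assumes "\<beta> \<in> roots H" "\<gamma> \<in> roots H" "\<gamma> \<noteq> \<beta>" "\<gamma> \<noteq> - \<beta>" "\<gamma> + \<beta> \<in> roots H"
  shows "br (ev \<beta>) (ev \<gamma>) \<noteq> 0"
  using cc_nonneg(2)[OF assms(1-4)] assms(5) by (auto simp: cc_def br_linear killing_linear)

end

section \<open>Casimir operators\<close>

text \<open>Bilinearity on a subspace only: the actions that appear below are linear in the acting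
  element only on a subalgebra.\<close>
definition bilin :: "('k \<Rightarrow> 'v \<Rightarrow> 'v) \<Rightarrow> ('k \<Rightarrow> 'w \<Rightarrow> 'w) \<Rightarrow> 'v::ab_group_add set \<Rightarrow> ('v \<Rightarrow> 'v \<Rightarrow> 'w::ab_group_add) \<Rightarrow> bool" where
  "bilin s sW U F \<longleftrightarrow> (\<forall>x\<in>U. \<forall>y\<in>U. \<forall>z\<in>U. F (x + y) z = F x z + F y z \<and> F z (x + y) = F z x + F z y) \<and>
     (\<forall>c. \<forall>x\<in>U. \<forall>z\<in>U. F (s c x) z = sW c (F x z) \<and> F z (s c x) = sW c (F z x))"

lemma bilin_sum:
  fixes s :: "'k::field \<Rightarrow> 'v::ab_group_add \<Rightarrow> 'v" and sW :: "'k \<Rightarrow> 'w::ab_group_add \<Rightarrow> 'w"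
  assumes F: "bilin s sW U F" and s: "vector_space s" and sW: "vector_space sW"
    and U: "module.subspace s U" and u: "\<And>i. i \<in> I \<Longrightarrow> u i \<in> U" and z: "z \<in> U"
  shows "F (\<Sum>i\<in>I. s (c i) (u i)) z = (\<Sum>i\<in>I. sW (c i) (F (u i) z))"
    and "F z (\<Sum>i\<in>I. s (c i) (u i)) = (\<Sum>i\<in>I. sW (c i) (F z (u i)))"
proof -
  interpret S: vector_space s by fact
  interpret W: vector_space sW by fact
  have 0: "F 0 z = 0" "F z 0 = 0"
  proof -
    have "F (s 0 z) z = sW 0 (F z z)" "F z (s 0 z) = sW 0 (F z z)"
      using F z unfolding bilin_def by blast+
    then show "F 0 z = 0" "F z 0 = 0" by simp_all
  qed
  have "F (\<Sum>i\<in>I. s (c i) (u i)) z = (\<Sum>i\<in>I. sW (c i) (F (u i) z)) \<and> F z (\<Sum>i\<in>I. s (c i) (u i)) = (\<Sum>i\<in>I. sW (c i) (F z (u i)))"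
    using u
  proof (induction I rule: infinite_finite_induct)
    case (insert i I)
    have 1: "s (c i) (u i) \<in> U" "(\<Sum>i\<in>I. s (c i) (u i)) \<in> U" "u i \<in> U"
      using insert.prems by (auto intro!: S.subspace_sum[OF U] S.subspace_scale[OF U])
    have "F (s (c i) (u i) + (\<Sum>i\<in>I. s (c i) (u i))) z = sW (c i) (F (u i) z) + F (\<Sum>i\<in>I. s (c i) (u i)) z"
      "F z (s (c i) (u i) + (\<Sum>i\<in>I. s (c i) (u i))) = sW (c i) (F z (u i)) + F z (\<Sum>i\<in>I. s (c i) (u i))"
      using F 1 z unfolding bilin_def by simp_all
    then show ?case using insert by simp
  qed (simp_all add: 0)
  then show "F (\<Sum>i\<in>I. s (c i) (u i)) z = (\<Sum>i\<in>I. sW (c i) (F (u i) z))"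
    "F z (\<Sum>i\<in>I. s (c i) (u i)) = (\<Sum>i\<in>I. sW (c i) (F z (u i)))" by blast+
qed

context simple_lie_algebra
begin

text \<open>Two families that reproduce every vector of \<open>U\<close>, in either order of their roles. The
  Casimir element depends on nothing else, and families indexed by a disjoint sum such as
  \<open>levi_index\<close> fit this definition directly.\<close>
definition dual_family :: "'v set \<Rightarrow> 'i set \<Rightarrow> ('i \<Rightarrow> 'v) \<Rightarrow> ('i \<Rightarrow> 'v) \<Rightarrow> bool" where
  "dual_family U I u u' \<longleftrightarrow> finite I \<and> (\<forall>i\<in>I. u i \<in> U \<and> u' i \<in> U) \<and>
     (\<forall>x\<in>U. (\<Sum>i\<in>I. scale (killing (u' i) x) (u i)) = x) \<and>
     (\<forall>x\<in>U. (\<Sum>i\<in>I. scale (killing (u i) x) (u' i)) = x)"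

text \<open>Expanding \<open>u i\<close> in the second pair and collecting terms shows that the tensors
  \<open>\<Sum> u' i \<otimes> u i\<close> and \<open>\<Sum> v' j \<otimes> v j\<close> agree.\<close>
lemma dual_family_unique:
  assumes sW: "vector_space sW" and F: "bilin scale sW U F" and U: "subspace U"
    and u: "dual_family U I u u'" and v: "dual_family U J v v'"
  shows "(\<Sum>i\<in>I. F (u' i) (u i)) = (\<Sum>j\<in>J. F (v' j) (v j))"
proof -
  have "(\<Sum>i\<in>I. F (u' i) (u i)) = (\<Sum>i\<in>I. F (u' i) (\<Sum>j\<in>J. scale (killing (v' j) (u i)) (v j)))"
    using u v by (intro sum.cong refl) (simp add: dual_family_def)
  also have "\<dots> = (\<Sum>i\<in>I. \<Sum>j\<in>J. sW (killing (v' j) (u i)) (F (u' i) (v j)))"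
    using u v by (intro sum.cong refl bilin_sum(2)[OF F vector_space_axioms sW U]) (auto simp: dual_family_def)
  also have "\<dots> = (\<Sum>j\<in>J. \<Sum>i\<in>I. sW (killing (u i) (v' j)) (F (u' i) (v j)))"
    by (subst sum.swap) (simp add: killing_sym)
  also have "\<dots> = (\<Sum>j\<in>J. F (\<Sum>i\<in>I. scale (killing (u i) (v' j)) (u' i)) (v j))"
    using u v by (intro sum.cong refl bilin_sum(1)[OF F vector_space_axioms sW U, symmetric]) (auto simp: dual_family_def)
  also have "\<dots> = (\<Sum>j\<in>J. F (v' j) (v j))"
    using u v by (intro sum.cong refl) (simp add: dual_family_def)
  finally show ?thesis .
qed

text \<open>The tensor \<open>\<Sum> u' i \<otimes> u i\<close> is killed by \<open>ad x\<close>: expand \<open>[x, u i]\<close> in the family and use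
  the invariance of the Killing form to move \<open>x\<close> to the other factor.\<close>
lemma dual_family_invariant:
  assumes sW: "vector_space sW" and F: "bilin scale sW U F" and U: "subspace U"
    and u: "dual_family U I u u'" and x: "\<And>y. y \<in> U \<Longrightarrow> br x y \<in> U"
  shows "(\<Sum>i\<in>I. F (br x (u' i)) (u i) + F (u' i) (br x (u i))) = 0"
proof -
  interpret W: vector_space sW by fact
  have "(\<Sum>i\<in>I. F (u' i) (br x (u i))) = (\<Sum>i\<in>I. F (u' i) (\<Sum>j\<in>I. scale (killing (u' j) (br x (u i))) (u j)))"
    using u x by (intro sum.cong refl) (simp add: dual_family_def)
  also have "\<dots> = (\<Sum>i\<in>I. \<Sum>j\<in>I. sW (killing (u' j) (br x (u i))) (F (u' i) (u j)))"
    using u by (intro sum.cong refl bilin_sum(2)[OF F vector_space_axioms sW U]) (auto simp: dual_family_def)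
  also have "\<dots> = (\<Sum>j\<in>I. \<Sum>i\<in>I. sW (killing (u i) (br (u' j) x)) (F (u' i) (u j)))"
    by (subst sum.swap) (simp only: killing_invariant[symmetric] killing_sym[of "br _ _" "u _"])
  also have "\<dots> = (\<Sum>j\<in>I. F (\<Sum>i\<in>I. scale (killing (u i) (br (u' j) x)) (u' i)) (u j))"
    using u by (intro sum.cong refl bilin_sum(1)[OF F vector_space_axioms sW U, symmetric]) (auto simp: dual_family_def)
  also have "\<dots> = (\<Sum>j\<in>I. F (br (u' j) x) (u j))"
  proof (intro sum.cong refl)
    fix j assume j: "j \<in> I"
    have "br (u' j) x \<in> U" using subspace_neg[OF U x[of "u' j"]] br_skew[of "u' j" x] u j by (auto simp: dual_family_def)
    then show "F (\<Sum>i\<in>I. scale (killing (u i) (br (u' j) x)) (u' i)) (u j) = F (br (u' j) x) (u j)"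
      using u by (simp add: dual_family_def)
  qed
  also have "\<dots> = (\<Sum>j\<in>I. - F (br x (u' j)) (u j))"
  proof (intro sum.cong refl)
    fix j assume j: "j \<in> I"
    have "F (scale (-1) (br x (u' j))) (u j) = sW (-1) (F (br x (u' j)) (u j))"
      using F x u j unfolding bilin_def dual_family_def by blast
    then show "F (br (u' j) x) (u j) = - F (br x (u' j)) (u j)" using br_skew[of x "u' j"] by simp
  qed
  finally show ?thesis by (simp add: sum.distrib sum_negf)
qed

lemma dual_bases_family: assumes "dual_bases U B d" shows "dual_family U B (\<lambda>b. b) d"
proof -
  have B: "B \<subseteq> U" "independent B" "span B = U" "d ` B \<subseteq> U" "inj_on d B" "independent (d ` B)" "span (d ` B) = U"
    and kd: "\<And>b c. b \<in> B \<Longrightarrow> c \<in> B \<Longrightarrow> killing (d b) c = (if b = c then 1 else 0)"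
    using assms by (auto simp: dual_bases_def)
  have fB: "finite B" by (rule finiteI_independent[OF B(2)])
  have 1: "(\<Sum>b\<in>B. scale (killing (d b) x) b) = x" if x: "x \<in> U" for x
  proof -
    obtain c where c: "x = (\<Sum>b\<in>B. scale (c b) b)" using x span_finite[OF fB] B(3) by auto
    have "killing (d b) x = c b" if "b \<in> B" for b
    proof -
      have "killing (d b) x = (\<Sum>b'\<in>B. if b' = b then c b' else 0)"
        unfolding c killing_linear using kd that by (intro sum.cong) auto
      then show ?thesis using that fB by simp
    qed
    then show ?thesis using c by simp
  qed
  have 2: "(\<Sum>b\<in>B. scale (killing b x) (d b)) = x" if x: "x \<in> U" for x
  proof -
    obtain c where c: "x = (\<Sum>b\<in>B. scale (c b) (d b))"
      using x B(7) span_image_finite[OF fB, of d] by auto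
    have "killing b x = c b" if "b \<in> B" for b
    proof -
      have "killing b x = (\<Sum>b'\<in>B. if b' = b then c b' else 0)"
        unfolding c killing_linear using kd that by (intro sum.cong) (auto simp: killing_sym[of b])
      then show ?thesis using that fB by simp
    qed
    then show ?thesis using c by simp
  qed
  show ?thesis using B fB 1 2 by (auto simp: dual_family_def)
qed

text \<open>A dual pair of families forces the Killing form to be nondegenerate on \<open>U\<close>, so the
  coordinate forms of a basis of \<open>U\<close> are represented by vectors of \<open>U\<close>.\<close>
lemma dual_bases_exist:
  assumes U: "subspace U" and v: "dual_family U J v v'"
  shows "\<exists>B d. dual_bases U B d"
proof -
  have nondeg: "x = 0" if "x \<in> U" "\<And>y. y \<in> U \<Longrightarrow> killing x y = 0" for x
  proof -
    have "x = (\<Sum>j\<in>J. scale (killing (v' j) x) (v j))" using v that(1) by (simp add: dual_family_def)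
    also have "\<dots> = 0" using that(2)[of "v' _"] v killing_sym[of x "v' _"] by (intro sum.neutral) (auto simp: dual_family_def)
    finally show ?thesis .
  qed
  obtain B where B: "B \<subseteq> U" "independent B" "U \<subseteq> span B" using maximal_independent_subset by blast
  have sB: "span B = U" by (rule span_subspace[OF B(1,3) U])
  have fB: "finite B" by (rule finiteI_independent[OF B(2)])
  let ?E = "extend_basis B"
  have E: "independent ?E" "span ?E = UNIV" "B \<subseteq> ?E"
    using independent_extend_basis[OF B(2)] span_extend_basis[OF B(2)] extend_basis_superset[OF B(2)] by auto
  have "\<exists>t\<in>U. \<forall>y\<in>U. killing t y = representation ?E y b" for b
    by (rule riesz_exists[OF U nondeg functional_representation[OF E(1,2)]])
  then obtain d where d: "\<And>b. d b \<in> U" "\<And>b y. y \<in> U \<Longrightarrow> killing (d b) y = representation ?E y b" by metis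
  have kd: "killing (d b) c = (if b = c then 1 else 0)" if "b \<in> B" "c \<in> B" for b c
  proof -
    have "c \<in> U" "c \<in> ?E" using that B(1) E(3) by auto
    then show ?thesis using d(2)[of c b] E(1) by (simp add: representation_basis)
  qed
  have inj: "inj_on d B"
  proof (rule inj_onI)
    fix b c assume *: "b \<in> B" "c \<in> B" "d b = d c"
    show "b = c"
    proof (rule ccontr)
      assume "b \<noteq> c"
      then show False using kd[OF *(1,1)] kd[OF *(2,1)] *(3) by simp
    qed
  qed
  have ind: "independent (d ` B)"
  proof (rule independent_if_scalars_zero)
    fix f x assume f: "(\<Sum>x\<in>d ` B. scale (f x) x) = 0" and x: "x \<in> d ` B"
    then obtain c where c: "c \<in> B" "x = d c" by blast
    have "0 = killing (\<Sum>b\<in>B. scale (f (d b)) (d b)) c"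
      using f inj by (simp add: sum.reindex killing_linear)
    also have "\<dots> = (\<Sum>b\<in>B. if b = c then f (d b) else 0)"
      unfolding killing_linear using kd c(1) by (intro sum.cong) auto
    also have "\<dots> = f x" using c fB by simp
    finally show "f x = 0" by simp
  qed (use fB in simp)
  have "card (d ` B) = dim U" using card_image[OF inj] basis_card_eq_dim[OF B(1,3,2)] by simp
  then have "U \<subseteq> span (d ` B)" using card_eq_dim[of "d ` B" U] d(1) fB ind by auto
  then have "span (d ` B) = U" using d(1) by (intro span_subspace[OF _ _ U]) auto
  then have "dual_bases U B d" using B sB d(1) inj ind kd by (auto simp: dual_bases_def)
  then show ?thesis by blast
qed

text \<open>The Casimir element is defined by an arbitrary choice of dual bases, and
  \<open>dual_family_unique\<close> replaces this choice by any convenient pair.\<close>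
lemma casimir_dual_family:
  assumes sW: "vector_space sW" and F: "bilin scale sW U (\<lambda>x y. \<rho> x (\<rho> y v))" and U: "subspace U"
    and u: "dual_family U I u u'"
  shows "casimir U \<rho> v = (\<Sum>i\<in>I. \<rho> (u' i) (\<rho> (u i) v))"
proof -
  obtain B d where Bd: "(SOME (B, d). dual_bases U B d) = (B, d)" by (meson surj_pair)
  have "\<exists>p. case p of (B, d) \<Rightarrow> dual_bases U B d" using dual_bases_exist[OF U u] by auto
  then have "case (SOME (B, d). dual_bases U B d) of (B, d) \<Rightarrow> dual_bases U B d" by (rule someI_ex)
  then have "dual_bases U B d" unfolding Bd by simp
  then show ?thesis
    using dual_family_unique[OF sW F U dual_bases_family u] by (simp add: casimir_def Bd Let_def)
qed

text \<open>For every \<open>y\<close> the number \<open>\<Sum> \<Phi>([u' i, [u i, x]], y) = \<Sum> \<Phi>(u i, [x, [y, u' i]])\<close> is the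
  trace of \<open>ad x ad y\<close>, that is \<open>\<Phi>(x, y)\<close>.\<close>
lemma casimir_adjoint:
  assumes u: "dual_family UNIV I u u'"
  shows "(\<Sum>i\<in>I. br (u' i) (br (u i) x)) = x"
proof -
  have fI: "finite I" using u by (simp add: dual_family_def)
  have nondeg: "z = 0" if "\<And>y. killing z y = 0" for z
  proof -
    have "z = (\<Sum>i\<in>I. scale (killing (u' i) z) (u i))" using u by (simp add: dual_family_def)
    also have "\<dots> = 0" using that[of "u' _"] killing_sym[of z "u' _"] by simp
    finally show ?thesis .
  qed
  have "killing (\<Sum>i\<in>I. br (u' i) (br (u i) x)) y = killing x y" for y
  proof -
    have "killing x y = (\<Sum>i\<in>I. killing (u i) (br x (br y (u' i))))"
      unfolding killing_def[of x y]
    proof (rule trace_finite_rank[where \<phi> = "\<lambda>i z. killing (u i) z" and v = "\<lambda>i. br x (br y (u' i))", OF fI])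
      fix z
      have "br x (br y z) = br x (br y (\<Sum>i\<in>I. scale (killing (u i) z) (u' i)))"
        using u by (simp add: dual_family_def)
      then show "br x (br y z) = (\<Sum>i\<in>I. scale (killing (u i) z) (br x (br y (u' i))))"
        by (simp add: br_linear)
    qed (rule functional_killing)
    also have "\<dots> = (\<Sum>i\<in>I. killing (br (u' i) (br (u i) x)) y)"
    proof (rule sum.cong[OF refl])
      fix i
      have "killing (u i) (br x (br y (u' i))) = killing (br (u i) x) (br y (u' i))"
        by (rule killing_invariant[symmetric])
      also have "\<dots> = - killing (br (u i) x) (br (u' i) y)"
        by (simp add: br_skew[of "u' i" y] killing_linear)
      also have "\<dots> = killing (br (u' i) (br (u i) x)) y" by (simp add: killing_invariant')
      finally show "killing (u i) (br x (br y (u' i))) = killing (br (u' i) (br (u i) x)) y" .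
    qed
    finally show ?thesis by (simp add: killing_linear)
  qed
  then have "(\<Sum>i\<in>I. br (u' i) (br (u i) x)) - x = 0" by (intro nondeg) (simp add: killing_linear)
  then show ?thesis by simp
qed

end

context based_simple_lie_algebra
begin

definition bH_dual :: "'v \<Rightarrow> 'v" where
  "bH_dual b = riesz (\<lambda>x. if x \<in> H then representation (extend_basis bH) x b else 0)"

lemma extend_bH: "independent (extend_basis bH)" "span (extend_basis bH) = UNIV" "bH \<subseteq> extend_basis bH"
  using independent_extend_basis[OF bH(2)] span_extend_basis[OF bH(2)] extend_basis_superset[OF bH(2)] by auto

lemma bH_dual: "bH_dual b \<in> H" "b' \<in> bH \<Longrightarrow> killing (bH_dual b) b' = (if b = b' then 1 else 0)"
proof -
  have d: "(\<lambda>x. if x \<in> H then representation (extend_basis bH) x b else 0) \<in> dual_space H"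
    by (rule dual_restrict[OF functional_representation[OF extend_bH(1,2)]])
  show "bH_dual b \<in> H" unfolding bH_dual_def by (rule riesz(1)[OF d])
  assume b': "b' \<in> bH"
  then show "killing (bH_dual b) b' = (if b = b' then 1 else 0)"
  proof -
    have "b' \<in> H" "b' \<in> extend_basis bH" using b' bH(1) extend_bH(3) by auto
    then show ?thesis using riesz(2)[OF d, of b'] extend_bH(1) by (simp add: bH_dual_def representation_basis)
  qed
qed

lemma dual_family_H: "dual_family H bH (\<lambda>b. b) bH_dual"
proof -
  have 1: "(\<Sum>b\<in>bH. scale (killing (bH_dual b) x) b) = x" if x: "x \<in> H" for x
  proof -
    obtain c where c: "x = (\<Sum>b\<in>bH. scale (c b) b)" using x span_finite[OF bH(4)] bH(3) by auto
    have "killing (bH_dual b) x = c b" if "b \<in> bH" for b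
    proof -
      have "killing (bH_dual b) x = (\<Sum>b'\<in>bH. if b' = b then c b' else 0)"
        unfolding c killing_linear using bH_dual(2) that by (intro sum.cong) auto
      then show ?thesis using that bH(4) by simp
    qed
    then show ?thesis using c by simp
  qed
  have 2: "(\<Sum>b\<in>bH. scale (killing b x) (bH_dual b)) = x" if x: "x \<in> H" for x
  proof -
    let ?d = "(\<Sum>b\<in>bH. scale (killing b x) (bH_dual b)) - x"
    have "?d = 0"
    proof (rule killing_H_nondegenerate)
      show "?d \<in> H" using bH_dual(1) x by (intro subspace_diff[OF subspace_H] subspace_sum[OF subspace_H] subspace_scale[OF subspace_H])
      fix y assume y: "y \<in> H"
      have "killing (\<Sum>b\<in>bH. scale (killing b x) (bH_dual b)) y = (\<Sum>b\<in>bH. killing (bH_dual b) y * killing b x)"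
        by (simp add: killing_linear mult.commute)
      also have "\<dots> = killing (\<Sum>b\<in>bH. scale (killing (bH_dual b) y) b) x" by (simp add: killing_linear)
      also have "\<dots> = killing x y" using 1[OF y] by (simp add: killing_sym)
      finally show "killing ?d y = 0" by (simp add: killing_linear)
    qed
    then show ?thesis by simp
  qed
  show ?thesis using bH bH_dual(1) 1 2 by (auto simp: dual_family_def)
qed

text \<open>The reductive subalgebra with root system \<open>\<Psi>\<close>. The families \<open>levi_vec\<close> and \<open>levi_dual\<close>
  form a dual pair adapted to the root decomposition: a basis of \<open>H\<close> faces its dual basis, and
  \<open>e\<^sub>\<beta>\<close> faces \<open>e\<^sub>-\<^sub>\<beta>\<close>.\<close>
definition levi :: "('v \<Rightarrow> 'k) set \<Rightarrow> 'v set" where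
  "levi \<Psi> = span (H \<union> ev ` \<Psi>)"

abbreviation levi_index :: "('v \<Rightarrow> 'k) set \<Rightarrow> ('v + ('v \<Rightarrow> 'k)) set" where
  "levi_index \<Psi> \<equiv> bH <+> \<Psi>"

definition levi_vec :: "'v + ('v \<Rightarrow> 'k) \<Rightarrow> 'v" where
  "levi_vec = case_sum (\<lambda>b. b) ev"

definition levi_dual :: "'v + ('v \<Rightarrow> 'k) \<Rightarrow> 'v" where
  "levi_dual = case_sum bH_dual (\<lambda>\<beta>. ev (- \<beta>))"

lemma subspace_levi: "subspace (levi \<Psi>)" and H_levi: "h \<in> H \<Longrightarrow> h \<in> levi \<Psi>"
  and ev_levi: "\<beta> \<in> \<Psi> \<Longrightarrow> ev \<beta> \<in> levi \<Psi>"
  unfolding levi_def by (auto intro: span_base)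

lemma killing_H_ev: "h \<in> H \<Longrightarrow> \<beta> \<in> roots H \<Longrightarrow> killing h (ev \<beta>) = 0" "h \<in> H \<Longrightarrow> \<beta> \<in> roots H \<Longrightarrow> killing (ev \<beta>) h = 0"
proof -
  assume "h \<in> H" "\<beta> \<in> roots H"
  then show 1: "killing h (ev \<beta>) = 0"
    using killing_orthogonal[of h 0 "ev \<beta>" \<beta>] G_zero ev_in dual_zero roots_dual roots_nonzero by simp
  then show "killing (ev \<beta>) h = 0" by (simp add: killing_sym)
qed

lemma killing_ev_ev:
  assumes "\<beta> \<in> roots H" "\<gamma> \<in> roots H" shows "killing (ev \<beta>) (ev \<gamma>) = (if \<gamma> = - \<beta> then 1 else 0)"
proof (cases "\<gamma> = - \<beta>")
  case True then show ?thesis using ev_normalized[OF assms(1)] by simp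
next
  case False
  then have "\<beta> + \<gamma> \<noteq> 0" by (simp add: add_eq_0_iff)
  then show ?thesis using False killing_orthogonal[OF ev_in ev_in roots_dual roots_dual, OF assms assms] by simp
qed

lemma levi_dual_family:
  assumes \<Psi>: "\<Psi> \<subseteq> roots H" "\<And>\<beta>. \<beta> \<in> \<Psi> \<Longrightarrow> - \<beta> \<in> \<Psi>"
  shows "dual_family (levi \<Psi>) (levi_index \<Psi>) levi_vec levi_dual"
proof -
  have f\<Psi>: "finite \<Psi>" using \<Psi>(1) finite_roots by (rule finite_subset)
  have r: "\<beta> \<in> roots H" if "\<beta> \<in> \<Psi>" for \<beta> using that \<Psi>(1) by blast
  have sumI: "(\<Sum>i\<in>levi_index \<Psi>. g i) = (\<Sum>b\<in>bH. g (Inl b)) + (\<Sum>\<beta>\<in>\<Psi>. g (Inr \<beta>))" for g :: "_ \<Rightarrow> 'v"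
    using sum.Plus[OF bH(4) f\<Psi>] by (simp add: comp_def)
  let ?f = "\<lambda>x. \<Sum>i\<in>levi_index \<Psi>. scale (killing (levi_dual i) x) (levi_vec i)"
  let ?g = "\<lambda>x. \<Sum>i\<in>levi_index \<Psi>. scale (killing (levi_vec i) x) (levi_dual i)"
  have ef: "endo ?f" "endo ?g" by (intro endo_sum endo_functional functional_killing)+
  have "subspace {x. ?f x = x \<and> ?g x = x}"
    by (auto simp: subspace_def lin_zero[OF ef(1)] lin_zero[OF ef(2)] lin_add[OF ef(1)] lin_add[OF ef(2)]
        lin_scale[OF ef(1)] lin_scale[OF ef(2)])
  moreover have "h \<in> {x. ?f x = x \<and> ?g x = x}" if h: "h \<in> H" for h
  proof -
    have "(\<Sum>\<beta>\<in>\<Psi>. scale (killing (ev (- \<beta>)) h) (ev \<beta>)) = 0" "(\<Sum>\<beta>\<in>\<Psi>. scale (killing (ev \<beta>) h) (ev (- \<beta>))) = 0"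
      using killing_H_ev(2)[OF h] r by (auto intro!: sum.neutral)
    then show ?thesis using dual_family_H h unfolding sumI by (simp add: levi_vec_def levi_dual_def dual_family_def)
  qed
  moreover have "ev \<gamma> \<in> {x. ?f x = x \<and> ?g x = x}" if g: "\<gamma> \<in> \<Psi>" for \<gamma>
  proof -
    have 0: "(\<Sum>b\<in>bH. scale (killing (bH_dual b) (ev \<gamma>)) b) = 0" "(\<Sum>b\<in>bH. scale (killing b (ev \<gamma>)) (bH_dual b)) = 0"
      using killing_H_ev(1) r[OF g] bH_dual(1) bH(1) by (auto intro!: sum.neutral)
    have "(\<Sum>\<beta>\<in>\<Psi>. scale (killing (ev (- \<beta>)) (ev \<gamma>)) (ev \<beta>)) = (\<Sum>\<beta>\<in>\<Psi>. if \<beta> = \<gamma> then ev \<gamma> else 0)"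
      using r g by (intro sum.cong refl) (auto simp: killing_ev_ev)
    then have 1: "(\<Sum>\<beta>\<in>\<Psi>. scale (killing (ev (- \<beta>)) (ev \<gamma>)) (ev \<beta>)) = ev \<gamma>" using f\<Psi> g by simp
    have "(\<Sum>\<beta>\<in>\<Psi>. scale (killing (ev \<beta>) (ev \<gamma>)) (ev (- \<beta>))) = (\<Sum>\<beta>\<in>\<Psi>. if \<beta> = - \<gamma> then ev \<gamma> else 0)"
      using r g by (intro sum.cong refl) (auto simp: killing_ev_ev)
    then have 2: "(\<Sum>\<beta>\<in>\<Psi>. scale (killing (ev \<beta>) (ev \<gamma>)) (ev (- \<beta>))) = ev \<gamma>" using f\<Psi> g \<Psi>(2) by simp
    show ?thesis unfolding sumI using 0 1 2 by (simp add: levi_vec_def levi_dual_def)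
  qed
  ultimately have "levi \<Psi> \<subseteq> {x. ?f x = x \<and> ?g x = x}" unfolding levi_def by (intro span_minimal) auto
  moreover have "levi_vec i \<in> levi \<Psi> \<and> levi_dual i \<in> levi \<Psi>" if "i \<in> levi_index \<Psi>" for i
    using that bH(1) bH_dual(1) \<Psi>(2) H_levi[of _ \<Psi>] ev_levi[of _ \<Psi>]
    by (auto simp: levi_vec_def levi_dual_def)
  ultimately show ?thesis using bH(4) f\<Psi> by (auto simp: dual_family_def)
qed

lemma levi_br:
  assumes \<Psi>: "\<Psi> \<subseteq> roots H" "\<And>\<beta> \<gamma>. \<beta> \<in> \<Psi> \<Longrightarrow> \<gamma> \<in> \<Psi> \<Longrightarrow> \<beta> + \<gamma> \<in> roots H \<Longrightarrow> \<beta> + \<gamma> \<in> \<Psi>"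
    and x: "x \<in> levi \<Psi>" and y: "y \<in> levi \<Psi>"
  shows "br x y \<in> levi \<Psi>"
proof -
  have ee: "br (ev \<beta>) (ev \<gamma>) \<in> levi \<Psi>" if "\<beta> \<in> \<Psi>" "\<gamma> \<in> \<Psi>" for \<beta> \<gamma>
  proof -
    have r: "\<beta> \<in> roots H" "\<gamma> \<in> roots H" using that \<Psi>(1) by auto
    consider "\<beta> + \<gamma> = 0" | "\<beta> + \<gamma> \<in> roots H" | "\<beta> + \<gamma> \<noteq> 0" "\<beta> + \<gamma> \<notin> roots H" by blast
    then show ?thesis
    proof cases
      case 1
      then have "\<gamma> = - \<beta>" by (simp add: eq_neg_iff_add_eq_0 add.commute)
      then show ?thesis using br_ev_neg[OF r(1)] riesz(1)[OF roots_dual[OF r(1)]] H_levi by simp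
    next
      case 2
      then show ?thesis
        using G_expand[OF 2 br_ev_in[OF r]] ev_levi[OF \<Psi>(2)[OF that 2]] subspace_scale[OF subspace_levi] by metis
    next
      case 3
      then show ?thesis using br_ev_zero[OF r] subspace_0[OF subspace_levi] by simp
    qed
  qed
  have gen: "br a b \<in> levi \<Psi>" if "a \<in> H \<union> ev ` \<Psi>" "b \<in> H \<union> ev ` \<Psi>" for a b
  proof -
    have he: "br h (ev \<beta>) \<in> levi \<Psi>" if "h \<in> H" "\<beta> \<in> \<Psi>" for h \<beta>
      using that \<Psi>(1) br_H_ev[of h \<beta>] ev_levi subspace_scale[OF subspace_levi] by (metis subsetD)
    have eh: "br (ev \<beta>) h \<in> levi \<Psi>" if "h \<in> H" "\<beta> \<in> \<Psi>" for h \<beta>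
      using subspace_neg[OF subspace_levi he[OF that]] br_skew[of "ev \<beta>" h] by simp
    show ?thesis using that ee he eh H_abelian subspace_0[OF subspace_levi] by auto
  qed
  have 1: "br a y \<in> levi \<Psi>" if a: "a \<in> H \<union> ev ` \<Psi>" for a
  proof -
    have "subspace {y. br a y \<in> levi \<Psi>}"
      unfolding levi_def by (auto simp: subspace_def br_linear intro: span_zero span_add span_scale)
    then have "levi \<Psi> \<subseteq> {y. br a y \<in> levi \<Psi>}" unfolding levi_def[of \<Psi>]
      using gen[OF a] by (intro span_minimal) (auto simp: levi_def)
    then show ?thesis using y by blast
  qed
  have "subspace {x. br x y \<in> levi \<Psi>}"
    unfolding levi_def by (auto simp: subspace_def br_linear intro: span_zero span_add span_scale)
  then have "levi \<Psi> \<subseteq> {x. br x y \<in> levi \<Psi>}" unfolding levi_def[of \<Psi>]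
    using 1 by (intro span_minimal) (auto simp: levi_def)
  then show ?thesis using x by blast
qed

end

section \<open>Modules over reductive subalgebras\<close>

text \<open>A module \<open>X\<close> of the subalgebra \<open>levi \<Psi>\<close>. It is a subspace of an ambient space on which
  \<open>\<rho>\<close> may be arbitrary, because exterior powers are realised inside a free vector space.\<close>
locale levi_module = based_simple_lie_algebra scale br H \<Pi> + W: vector_space sW
  for scale :: "'k::{alg_closed_field,field_char_0} \<Rightarrow> 'v::ab_group_add \<Rightarrow> 'v"
    and br :: "'v \<Rightarrow> 'v \<Rightarrow> 'v" and H :: "'v set" and \<Pi> :: "('v \<Rightarrow> 'k) set"
    and sW :: "'k \<Rightarrow> 'w::ab_group_add \<Rightarrow> 'w" +
  fixes \<Psi> :: "('v \<Rightarrow> 'k) set" and X :: "'w set" and \<rho> :: "'v \<Rightarrow> 'w \<Rightarrow> 'w"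
  assumes Psi_roots: "\<Psi> \<subseteq> roots H"
    and Psi_neg: "\<beta> \<in> \<Psi> \<Longrightarrow> - \<beta> \<in> \<Psi>"
    and Psi_closed: "\<beta> \<in> \<Psi> \<Longrightarrow> \<gamma> \<in> \<Psi> \<Longrightarrow> \<beta> + \<gamma> \<in> roots H \<Longrightarrow> \<beta> + \<gamma> \<in> \<Psi>"
    and subspace_X: "W.subspace X"
    and act_in: "x \<in> levi \<Psi> \<Longrightarrow> v \<in> X \<Longrightarrow> \<rho> x v \<in> X"
    and act_add_left: "x \<in> levi \<Psi> \<Longrightarrow> y \<in> levi \<Psi> \<Longrightarrow> v \<in> X \<Longrightarrow> \<rho> (x + y) v = \<rho> x v + \<rho> y v"
    and act_scale_left: "x \<in> levi \<Psi> \<Longrightarrow> v \<in> X \<Longrightarrow> \<rho> (scale c x) v = sW c (\<rho> x v)"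
    and act_add_right: "x \<in> levi \<Psi> \<Longrightarrow> v \<in> X \<Longrightarrow> w \<in> X \<Longrightarrow> \<rho> x (v + w) = \<rho> x v + \<rho> x w"
    and act_scale_right: "x \<in> levi \<Psi> \<Longrightarrow> v \<in> X \<Longrightarrow> \<rho> x (sW c v) = sW c (\<rho> x v)"
    and act_br: "x \<in> levi \<Psi> \<Longrightarrow> y \<in> levi \<Psi> \<Longrightarrow> v \<in> X \<Longrightarrow> \<rho> (br x y) v = \<rho> x (\<rho> y v) - \<rho> y (\<rho> x v)"
begin

lemma finite_Psi: "finite \<Psi>"
  using Psi_roots finite_roots by (rule finite_subset)

lemma Psi_root: "\<beta> \<in> \<Psi> \<Longrightarrow> \<beta> \<in> roots H"
  using Psi_roots by blast

lemma act_zero_right: "x \<in> levi \<Psi> \<Longrightarrow> \<rho> x 0 = 0"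
  using act_scale_right[of x 0 0] W.subspace_0[OF subspace_X] by simp

lemma act_sum_right: "x \<in> levi \<Psi> \<Longrightarrow> (\<And>i. i \<in> I \<Longrightarrow> v i \<in> X) \<Longrightarrow> \<rho> x (\<Sum>i\<in>I. v i) = (\<Sum>i\<in>I. \<rho> x (v i))"
  by (induction I rule: infinite_finite_induct) (auto simp: act_zero_right act_add_right W.subspace_sum[OF subspace_X])

definition cas :: "'w \<Rightarrow> 'w" where
  "cas v = (\<Sum>i\<in>levi_index \<Psi>. \<rho> (levi_dual i) (\<rho> (levi_vec i) v))"

lemma dual_family_Psi: "dual_family (levi \<Psi>) (levi_index \<Psi>) levi_vec levi_dual"
  by (rule levi_dual_family[OF Psi_roots Psi_neg])

lemma levi_index_in: "i \<in> levi_index \<Psi> \<Longrightarrow> levi_vec i \<in> levi \<Psi>" "i \<in> levi_index \<Psi> \<Longrightarrow> levi_dual i \<in> levi \<Psi>"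
  using dual_family_Psi by (auto simp: dual_family_def)

lemma levi_Psi_br: "x \<in> levi \<Psi> \<Longrightarrow> y \<in> levi \<Psi> \<Longrightarrow> br x y \<in> levi \<Psi>"
  by (rule levi_br[OF Psi_roots Psi_closed])

lemma act_act_bilin: "v \<in> X \<Longrightarrow> bilin scale sW (levi \<Psi>) (\<lambda>x y. \<rho> x (\<rho> y v))"
  unfolding bilin_def
  by (auto simp: act_in act_add_left act_add_right act_scale_left act_scale_right)

lemma casimir_eq_cas: "v \<in> X \<Longrightarrow> casimir (levi \<Psi>) \<rho> v = cas v"
  unfolding cas_def
  by (rule casimir_dual_family[OF W.vector_space_axioms act_act_bilin subspace_levi dual_family_Psi])

lemma cas_in: "v \<in> X \<Longrightarrow> cas v \<in> X"
  unfolding cas_def by (intro W.subspace_sum[OF subspace_X] act_in levi_index_in)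

lemma cas_add: "v \<in> X \<Longrightarrow> w \<in> X \<Longrightarrow> cas (v + w) = cas v + cas w"
  unfolding cas_def sum.distrib[symmetric]
  by (intro sum.cong refl) (simp add: act_add_right act_in levi_index_in)

lemma cas_scale: "v \<in> X \<Longrightarrow> cas (sW c v) = sW c (cas v)"
  unfolding cas_def W.scale_sum_right
  by (intro sum.cong refl) (simp add: act_scale_right act_in levi_index_in)

lemma cas_sum: "(\<And>i. i \<in> I \<Longrightarrow> v i \<in> X) \<Longrightarrow> cas (\<Sum>i\<in>I. v i) = (\<Sum>i\<in>I. cas (v i))"
proof (induction I rule: infinite_finite_induct)
  case (insert i I)
  then show ?case by (simp add: cas_add W.subspace_sum[OF subspace_X])
qed (use cas_scale[of 0 0] W.subspace_0[OF subspace_X] in simp_all)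

text \<open>The commutator of \<open>\<rho> x\<close> with \<open>\<Sum> \<rho>(u' i) \<rho>(u i)\<close> is the expression that vanishes by
  \<open>dual_family_invariant\<close>.\<close>
lemma cas_commute:
  assumes x: "x \<in> levi \<Psi>" and v: "v \<in> X" shows "\<rho> x (cas v) = cas (\<rho> x v)"
proof -
  let ?I = "levi_index \<Psi>" and ?u = levi_vec and ?d = levi_dual
  have "\<rho> x (cas v) = (\<Sum>i\<in>?I. \<rho> x (\<rho> (?d i) (\<rho> (?u i) v)))"
    unfolding cas_def using x v by (intro act_sum_right) (auto intro!: act_in levi_index_in)
  also have "\<dots> = (\<Sum>i\<in>?I. (\<rho> (br x (?d i)) (\<rho> (?u i) v) + \<rho> (?d i) (\<rho> (br x (?u i)) v)) + \<rho> (?d i) (\<rho> (?u i) (\<rho> x v)))"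
  proof (rule sum.cong[OF refl])
    fix i assume i: "i \<in> ?I"
    have "\<rho> (?u i) (\<rho> x v) = \<rho> x (\<rho> (?u i) v) + sW (-1) (\<rho> (br x (?u i)) v)"
      using act_br[OF x levi_index_in(1)[OF i] v] by simp
    then have "\<rho> (?d i) (\<rho> (?u i) (\<rho> x v)) = \<rho> (?d i) (\<rho> x (\<rho> (?u i) v)) + sW (-1) (\<rho> (?d i) (\<rho> (br x (?u i)) v))"
      using x v levi_index_in[OF i] levi_Psi_br
      by (simp add: act_add_right act_scale_right act_in W.subspace_scale[OF subspace_X] del: W.scale_minus_left)
    then show "\<rho> x (\<rho> (?d i) (\<rho> (?u i) v))
        = (\<rho> (br x (?d i)) (\<rho> (?u i) v) + \<rho> (?d i) (\<rho> (br x (?u i)) v)) + \<rho> (?d i) (\<rho> (?u i) (\<rho> x v))"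
      using act_br[OF x levi_index_in(2)[OF i] act_in[OF levi_index_in(1)[OF i] v]] by simp
  qed
  also have "\<dots> = (\<Sum>i\<in>?I. \<rho> (br x (?d i)) (\<rho> (?u i) v) + \<rho> (?d i) (\<rho> (br x (?u i)) v)) + cas (\<rho> x v)"
    by (simp add: sum.distrib cas_def)
  also have "(\<Sum>i\<in>?I. \<rho> (br x (?d i)) (\<rho> (?u i) v) + \<rho> (?d i) (\<rho> (br x (?u i)) v)) = 0"
    using dual_family_invariant[OF W.vector_space_axioms act_act_bilin[OF v] subspace_levi dual_family_Psi levi_Psi_br[OF x]] .
  finally show ?thesis by simp
qed

definition weight_vec :: "('v \<Rightarrow> 'k) \<Rightarrow> 'w \<Rightarrow> bool" where
  "weight_vec \<nu> v \<longleftrightarrow> v \<in> X \<and> (\<forall>h\<in>H. \<rho> h v = sW (\<nu> h) v)"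

lemma weight_vec_X: "weight_vec \<nu> v \<Longrightarrow> v \<in> X"
  by (simp add: weight_vec_def)

lemma weight_vec_zero: "weight_vec \<nu> 0"
  by (simp add: weight_vec_def W.subspace_0[OF subspace_X] act_zero_right H_levi)

lemma weight_vec_add: "weight_vec \<nu> v \<Longrightarrow> weight_vec \<nu> w \<Longrightarrow> weight_vec \<nu> (v + w)"
  by (auto simp: weight_vec_def act_add_right H_levi W.scale_right_distrib W.subspace_add[OF subspace_X])

lemma weight_vec_scale: "weight_vec \<nu> v \<Longrightarrow> weight_vec \<nu> (sW c v)"
  by (auto simp: weight_vec_def act_scale_right H_levi W.subspace_scale[OF subspace_X] mult.commute)

lemma weight_vec_diff: "weight_vec \<nu> v \<Longrightarrow> weight_vec \<nu> w \<Longrightarrow> weight_vec \<nu> (v - w)"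
  using weight_vec_add[of \<nu> v "sW (-1) w"] weight_vec_scale[of \<nu> w "-1"] by simp

lemma weight_vec_cas: "weight_vec \<nu> v \<Longrightarrow> weight_vec \<nu> (cas v)"
  using cas_commute[OF H_levi] by (auto simp: weight_vec_def cas_in cas_scale)

lemma weight_vec_raise:
  assumes \<beta>: "\<beta> \<in> \<Psi>" and v: "weight_vec \<nu> v" shows "weight_vec (\<nu> + \<beta>) (\<rho> (ev \<beta>) v)"
  unfolding weight_vec_def
proof (intro conjI ballI)
  have vX: "v \<in> X" using v by (rule weight_vec_X)
  show "\<rho> (ev \<beta>) v \<in> X" by (rule act_in[OF ev_levi[OF \<beta>] vX])
  fix h assume h: "h \<in> H"
  have "\<rho> h (\<rho> (ev \<beta>) v) = \<rho> (br h (ev \<beta>)) v + \<rho> (ev \<beta>) (\<rho> h v)"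
    using act_br[OF H_levi[OF h] ev_levi[OF \<beta>] vX] by simp
  also have "\<dots> = sW (\<beta> h) (\<rho> (ev \<beta>) v) + sW (\<nu> h) (\<rho> (ev \<beta>) v)"
    using v h vX by (simp add: weight_vec_def br_H_ev Psi_root \<beta> act_scale_left act_scale_right ev_levi)
  finally show "\<rho> h (\<rho> (ev \<beta>) v) = sW ((\<nu> + \<beta>) h) (\<rho> (ev \<beta>) v)"
    by (simp add: W.scale_left_distrib add.commute)
qed

lemma weight_vec_indep:
  assumes "finite F" "F \<subseteq> dual_space H" "\<And>\<nu>. \<nu> \<in> F \<Longrightarrow> weight_vec \<nu> (v \<nu>)" "(\<Sum>\<nu>\<in>F. v \<nu>) = 0" "\<nu> \<in> F"
  shows "v \<nu> = 0"
  using assms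
proof (induction F arbitrary: v \<nu> rule: finite_induct)
  case (insert \<delta> F)
  have F0: "v \<epsilon> = 0" if \<epsilon>: "\<epsilon> \<in> F" for \<epsilon>
  proof -
    have "\<epsilon> \<noteq> \<delta>" using \<epsilon> insert.hyps by auto
    then obtain h where h: "h \<in> H" "\<epsilon> h \<noteq> \<delta> h" using dual_eqI[of \<epsilon> \<delta>] insert.prems(1) \<epsilon> by blast
    have X: "v \<gamma> \<in> X" if "\<gamma> \<in> insert \<delta> F" for \<gamma> using insert.prems(2)[OF that] by (rule weight_vec_X)
    have "0 = \<rho> h (\<Sum>\<gamma>\<in>insert \<delta> F. v \<gamma>)" using insert.prems(3) act_zero_right[OF H_levi[OF h(1)]] by simp
    also have "\<dots> = (\<Sum>\<gamma>\<in>insert \<delta> F. sW (\<gamma> h) (v \<gamma>))"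
      using X insert.prems(2) h(1) by (subst act_sum_right[OF H_levi]) (auto intro!: sum.cong simp: weight_vec_def)
    finally have 1: "(\<Sum>\<gamma>\<in>insert \<delta> F. sW (\<gamma> h) (v \<gamma>)) = 0" by simp
    have "(\<Sum>\<gamma>\<in>insert \<delta> F. sW (\<gamma> h - \<delta> h) (v \<gamma>)) = (\<Sum>\<gamma>\<in>insert \<delta> F. sW (\<gamma> h) (v \<gamma>)) - sW (\<delta> h) (\<Sum>\<gamma>\<in>insert \<delta> F. v \<gamma>)"
      by (simp only: W.scale_left_diff_distrib sum_subtractf W.scale_sum_right)
    also have "\<dots> = 0" using 1 insert.prems(3) by simp
    finally have "(\<Sum>\<gamma>\<in>F. sW (\<gamma> h - \<delta> h) (v \<gamma>)) = 0" using insert.hyps by simp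
    then have "sW (\<epsilon> h - \<delta> h) (v \<epsilon>) = 0"
      using insert.prems(1,2) \<epsilon> by (intro insert.IH[of "\<lambda>\<gamma>. sW (\<gamma> h - \<delta> h) (v \<gamma>)"]) (auto intro: weight_vec_scale)
    then show ?thesis using h(2) by simp
  qed
  then have "v \<delta> = 0" using insert.prems(3) insert.hyps by simp
  then show ?case using insert.prems(4) F0 by auto
qed simp

text \<open>A basis of \<open>H\<close> contributes \<open>(\<nu>, \<nu>)\<close>. For \<open>\<beta> \<in> P\<close> the two terms of \<open>\<plusminus>\<beta>\<close> are combined by
  means of \<open>e\<^sub>\<beta> e\<^sub>-\<^sub>\<beta> = e\<^sub>-\<^sub>\<beta> e\<^sub>\<beta> + [e\<^sub>\<beta>, e\<^sub>-\<^sub>\<beta>]\<close>, where the bracket acts by \<open>(\<beta>, \<nu>)\<close>.\<close>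
lemma cas_weight:
  assumes v: "weight_vec \<nu> v" and \<nu>: "\<nu> \<in> dual_space H"
    and P: "\<Psi> = P \<union> uminus ` P" "P \<inter> uminus ` P = {}"
  shows "cas v = sW (form \<nu> \<nu> + (\<Sum>\<beta>\<in>P. form \<beta> \<nu>)) v + sW 2 (\<Sum>\<beta>\<in>P. \<rho> (ev (- \<beta>)) (\<rho> (ev \<beta>) v))"
proof -
  have vX: "v \<in> X" using v by (rule weight_vec_X)
  have vH: "\<rho> h v = sW (\<nu> h) v" if "h \<in> H" for h using v that by (simp add: weight_vec_def)
  have fP: "finite P" using P(1) finite_Psi by (metis finite_Un)
  have PPsi: "\<beta> \<in> \<Psi>" "- \<beta> \<in> \<Psi>" if "\<beta> \<in> P" for \<beta> using that P(1) by auto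
  let ?r = "riesz \<nu>"
  have rH: "?r \<in> H" by (rule riesz(1)[OF \<nu>])
  have "(\<Sum>b\<in>bH. \<rho> (bH_dual b) (\<rho> b v)) = (\<Sum>b\<in>bH. sW (\<nu> (bH_dual b) * \<nu> b) v)"
    using bH(1) bH_dual(1) vX by (intro sum.cong refl) (auto simp: vH act_scale_right H_levi subset_iff mult.commute)
  also have "\<dots> = sW (\<Sum>b\<in>bH. \<nu> (bH_dual b) * \<nu> b) v" by (rule W.scale_sum_left[symmetric])
  also have "(\<Sum>b\<in>bH. \<nu> (bH_dual b) * \<nu> b) = form \<nu> \<nu>"
  proof -
    have "form \<nu> \<nu> = \<nu> ?r" by (rule form_apply[OF \<nu> \<nu>])
    also have "?r = (\<Sum>b\<in>bH. scale (killing b ?r) (bH_dual b))" using dual_family_H rH by (simp add: dual_family_def)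
    also have "\<nu> (\<Sum>b\<in>bH. scale (killing b ?r) (bH_dual b)) = (\<Sum>b\<in>bH. \<nu> (scale (killing b ?r) (bH_dual b)))"
      by (rule dual_apply_sum[OF \<nu>]) (simp add: bH_dual(1) subspace_scale[OF subspace_H])
    also have "\<dots> = (\<Sum>b\<in>bH. \<nu> (bH_dual b) * \<nu> b)"
      using bH(1) by (intro sum.cong refl) (auto simp: dual_apply(2)[OF \<nu> bH_dual(1)] killing_sym[of _ ?r] riesz(2)[OF \<nu>] subset_iff)
    finally show ?thesis by simp
  qed
  finally have 1: "(\<Sum>b\<in>bH. \<rho> (bH_dual b) (\<rho> b v)) = sW (form \<nu> \<nu>) v" .
  have flip: "\<rho> (ev \<beta>) (\<rho> (ev (- \<beta>)) v) = sW (form \<beta> \<nu>) v + \<rho> (ev (- \<beta>)) (\<rho> (ev \<beta>) v)" if "\<beta> \<in> P" for \<beta>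
  proof -
    have b: "\<beta> \<in> roots H" "\<beta> \<in> dual_space H" using PPsi[OF that] Psi_root roots_dual by blast+
    have "\<rho> (br (ev \<beta>) (ev (- \<beta>))) v = sW (form \<beta> \<nu>) v"
      using vH[OF riesz(1)[OF b(2)]] b form_apply[OF \<nu> b(2)] by (simp add: br_ev_neg form_sym[of \<beta>])
    then show ?thesis using act_br[OF ev_levi ev_levi vX, of \<beta> "- \<beta>"] PPsi[OF that] by (simp add: algebra_simps)
  qed
  define f where "f \<beta> = \<rho> (ev (- \<beta>)) (\<rho> (ev \<beta>) v)" for \<beta>
  have "sum f \<Psi> = sum f P + sum f (uminus ` P)"
    unfolding P(1) using fP P(2) by (intro sum.union_disjoint) auto
  also have "sum f (uminus ` P) = (\<Sum>\<beta>\<in>P. f (- \<beta>))"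
    by (subst sum.reindex) (auto simp: inj_on_def)
  also have "\<dots> = (\<Sum>\<beta>\<in>P. sW (form \<beta> \<nu>) v + f \<beta>)"
    by (intro sum.cong refl) (simp add: f_def flip)
  also have "\<dots> = sW (\<Sum>\<beta>\<in>P. form \<beta> \<nu>) v + sum f P"
    by (simp add: sum.distrib W.scale_sum_left)
  finally have 2: "sum f \<Psi> = sW (\<Sum>\<beta>\<in>P. form \<beta> \<nu>) v + sW 2 (sum f P)"
    using W.scale_left_distrib[of 1 1] by (simp add: add.left_commute)
  have "cas v = (\<Sum>b\<in>bH. \<rho> (bH_dual b) (\<rho> b v)) + sum f \<Psi>"
    unfolding cas_def sum.Plus[OF bH(4) finite_Psi] by (simp add: comp_def levi_vec_def levi_dual_def f_def)
  then have "cas v = sW (form \<nu> \<nu> + (\<Sum>\<beta>\<in>P. form \<beta> \<nu>)) v + sW 2 (sum f P)"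
    unfolding 1 2 by (simp add: W.scale_left_distrib)
  moreover have "sum f P = (\<Sum>\<beta>\<in>P. \<rho> (ev (- \<beta>)) (\<rho> (ev \<beta>) v))" by (rule sum.cong[OF refl f_def])
  ultimately show ?thesis by (simp only:)
qed

text \<open>The Casimir operator preserves weights, so some weight component of \<open>p\<close> is an
  eigenvector as well. Among all weights of eigenvectors for \<open>\<mu>\<close> choose one of maximal height.
  The operators \<open>e\<^sub>\<beta>\<close> with \<open>\<beta> \<in> P\<close> commute with the Casimir operator and increase the height,
  so they kill the chosen eigenvector.\<close>
lemma highest_weight_eigenvector:
  assumes L: "finite L" "L \<subseteq> lattice" and XL: "X \<subseteq> W.span {v. \<exists>\<nu>\<in>L. weight_vec \<nu> v}"
    and P: "P \<subseteq> \<Psi>" "P \<subseteq> pos_roots"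
    and p: "p \<in> X" "p \<noteq> 0" "cas p = sW \<mu> p"
  shows "\<exists>\<nu>\<in>L. \<exists>v. weight_vec \<nu> v \<and> v \<noteq> 0 \<and> cas v = sW \<mu> v \<and> (\<forall>\<beta>\<in>P. \<rho> (ev \<beta>) v = 0)"
proof -
  have LD: "L \<subseteq> dual_space H" using L(2) lattice_dual by blast
  have decomp: "\<exists>v. (\<forall>\<nu>\<in>L. weight_vec \<nu> (v \<nu>)) \<and> x = (\<Sum>\<nu>\<in>L. v \<nu>)" if "x \<in> X" for x
  proof -
    have "x \<in> W.span {v. \<exists>\<nu>\<in>L. weight_vec \<nu> v}" using XL that by blast
    then show ?thesis
    proof (induction rule: W.span_induct_alt)
      case base
      then show ?case by (intro exI[of _ "\<lambda>_. 0"]) (simp add: weight_vec_zero)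
    next
      case (step c y z)
      then obtain \<nu> u where u: "\<nu> \<in> L" "weight_vec \<nu> y" "\<forall>\<nu>\<in>L. weight_vec \<nu> (u \<nu>)" "z = (\<Sum>\<nu>\<in>L. u \<nu>)" by auto
      let ?u = "\<lambda>\<epsilon>. (if \<epsilon> = \<nu> then sW c y else 0) + u \<epsilon>"
      have "sW c y + z = (\<Sum>\<nu>\<in>L. ?u \<nu>)" using u L(1) by (simp add: sum.distrib)
      moreover have "\<forall>\<nu>\<in>L. weight_vec \<nu> (?u \<nu>)" using u by (auto intro: weight_vec_add weight_vec_scale)
      ultimately show ?case by (intro exI[of _ ?u] conjI)
    qed
  qed
  have in_L: "\<nu> \<in> L" if v: "weight_vec \<nu> v" "v \<noteq> 0" "\<nu> \<in> dual_space H" for \<nu> v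
  proof (rule ccontr)
    assume n: "\<nu> \<notin> L"
    obtain u where u: "\<forall>\<nu>\<in>L. weight_vec \<nu> (u \<nu>)" "v = (\<Sum>\<nu>\<in>L. u \<nu>)" using decomp[OF weight_vec_X[OF v(1)]] by blast
    let ?w = "\<lambda>\<epsilon>. if \<epsilon> = \<nu> then sW (-1) v else u \<epsilon>"
    have "(\<Sum>\<epsilon>\<in>L. ?w \<epsilon>) = (\<Sum>\<epsilon>\<in>L. u \<epsilon>)" using n by (intro sum.cong) auto
    then have "(\<Sum>\<epsilon>\<in>insert \<nu> L. ?w \<epsilon>) = 0" using L(1) n u(2) by simp
    then have "?w \<nu> = 0"
      using L(1) LD v u(1) by (intro weight_vec_indep[of "insert \<nu> L" ?w \<nu>]) (auto intro: weight_vec_scale simp del: W.scale_minus_left)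
    then show False using v(2) by simp
  qed
  define A where "A = {\<nu>\<in>L. \<exists>v. weight_vec \<nu> v \<and> v \<noteq> 0 \<and> cas v = sW \<mu> v}"
  have "A \<noteq> {}"
  proof -
    obtain u where u: "\<forall>\<nu>\<in>L. weight_vec \<nu> (u \<nu>)" "p = (\<Sum>\<nu>\<in>L. u \<nu>)" using decomp[OF p(1)] by blast
    obtain \<nu> where l: "\<nu> \<in> L" "u \<nu> \<noteq> 0" using p(2) u(2) by (metis sum.neutral)
    have cp: "cas (\<Sum>\<nu>\<in>L. u \<nu>) = (\<Sum>\<nu>\<in>L. cas (u \<nu>))" using u(1) weight_vec_X by (intro cas_sum) blast
    have "(\<Sum>\<nu>\<in>L. cas (u \<nu>) - sW \<mu> (u \<nu>)) = cas p - sW \<mu> p"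
      using cp unfolding u(2) by (simp only: sum_subtractf W.scale_sum_right)
    then have "cas (u \<nu>) - sW \<mu> (u \<nu>) = 0"
      using L(1) LD u(1) p(3) l(1)
      by (intro weight_vec_indep[of L "\<lambda>\<nu>. cas (u \<nu>) - sW \<mu> (u \<nu>)" \<nu>])
        (auto intro: weight_vec_diff weight_vec_cas weight_vec_scale)
    then show ?thesis using l u(1) by (auto simp: A_def)
  qed
  moreover have fA: "finite A" using L(1) by (simp add: A_def)
  ultimately have "Max (iht ` A) \<in> iht ` A" by (intro Max_in) auto
  then obtain \<nu> where l: "\<nu> \<in> A" "iht \<nu> = Max (iht ` A)" by auto
  then have max: "iht \<nu>' \<le> iht \<nu>" if "\<nu>' \<in> A" for \<nu>' using that fA by simp
  obtain v where v: "weight_vec \<nu> v" "v \<noteq> 0" "cas v = sW \<mu> v" and lL: "\<nu> \<in> L" using l(1) by (auto simp: A_def)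
  have "\<rho> (ev \<beta>) v = 0" if \<beta>: "\<beta> \<in> P" for \<beta>
  proof (rule ccontr)
    let ?w = "\<rho> (ev \<beta>) v"
    assume n: "?w \<noteq> 0"
    have bP: "\<beta> \<in> \<Psi>" "\<beta> \<in> pos_roots" using \<beta> P by auto
    have w: "weight_vec (\<nu> + \<beta>) ?w" by (rule weight_vec_raise[OF bP(1) v(1)])
    have lat: "\<nu> \<in> lattice" "\<beta> \<in> lattice" using lL L(2) roots_lattice Psi_root[OF bP(1)] by auto
    have "cas ?w = sW \<mu> ?w"
      using cas_commute[OF ev_levi[OF bP(1)] weight_vec_X[OF v(1)]] v(3)
        act_scale_right[OF ev_levi[OF bP(1)] weight_vec_X[OF v(1)]] by simp
    then have "\<nu> + \<beta> \<in> A" using in_L[OF w n lattice_dual[OF lattice_add[OF lat]]] w n by (auto simp: A_def)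
    then show False using max[of "\<nu> + \<beta>"] iht_add[OF lat] iht_pos[OF bP(2)] by simp
  qed
  then show ?thesis using v lL by blast
qed

end

context based_simple_lie_algebra
begin

lemma adjoint_module:
  assumes "\<Psi> \<subseteq> roots H" "\<And>\<beta>. \<beta> \<in> \<Psi> \<Longrightarrow> - \<beta> \<in> \<Psi>"
    "\<And>\<beta> \<gamma>. \<beta> \<in> \<Psi> \<Longrightarrow> \<gamma> \<in> \<Psi> \<Longrightarrow> \<beta> + \<gamma> \<in> roots H \<Longrightarrow> \<beta> + \<gamma> \<in> \<Psi>"
  shows "levi_module scale br H \<Pi> scale \<Psi> UNIV br"
  by unfold_locales (use assms in \<open>auto simp: br_linear br_br_left\<close>)

lemma pos_roots_split: "roots H = pos_roots \<union> uminus ` pos_roots" "pos_roots \<inter> uminus ` pos_roots = {}"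
proof -
  show "roots H = pos_roots \<union> uminus ` pos_roots"
  proof (intro equalityI subsetI)
    fix \<gamma> assume "\<gamma> \<in> roots H"
    then show "\<gamma> \<in> pos_roots \<union> uminus ` pos_roots"
      using root_pos_or_neg[of \<gamma>] by (metis UnI1 UnI2 image_eqI minus_minus)
  qed (auto dest: pos_rootsD)
  show "pos_roots \<inter> uminus ` pos_roots = {}" using pos_roots_neg by auto
qed

text \<open>In the adjoint module \<open>e\<^sub>\<theta>\<close> is a highest weight vector, so the Casimir element of the
  whole algebra acts on it by \<open>(\<theta>, \<theta> + 2\<rho>)\<close>. By \<open>casimir_adjoint\<close> it acts by \<open>1\<close>.\<close>
lemma form_highest_root:
  "form highest_root highest_root + (\<Sum>\<beta>\<in>pos_roots. form \<beta> highest_root) = 1"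
proof -
  interpret M: levi_module scale br H \<Pi> scale "roots H" UNIV br
    by (rule adjoint_module) auto
  have levi: "levi (roots H) = UNIV" unfolding levi_def using weights_decompose_ev by auto
  let ?\<theta> = highest_root
  have "M.weight_vec ?\<theta> (ev ?\<theta>)" using highest_root(1) by (simp add: M.weight_vec_def br_H_ev)
  then have "M.cas (ev ?\<theta>) = scale (form ?\<theta> ?\<theta> + (\<Sum>\<beta>\<in>pos_roots. form \<beta> ?\<theta>)) (ev ?\<theta>)
      + scale 2 (\<Sum>\<beta>\<in>pos_roots. br (ev (- \<beta>)) (br (ev \<beta>) (ev ?\<theta>)))"
    by (rule M.cas_weight[OF _ roots_dual[OF highest_root(1)] pos_roots_split])
  also have "(\<Sum>\<beta>\<in>pos_roots. br (ev (- \<beta>)) (br (ev \<beta>) (ev ?\<theta>))) = 0"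
    by (intro sum.neutral ballI) (simp add: highest_root_top br_linear)
  finally have "M.cas (ev ?\<theta>) = scale (form ?\<theta> ?\<theta> + (\<Sum>\<beta>\<in>pos_roots. form \<beta> ?\<theta>)) (ev ?\<theta>)" by simp
  moreover have "M.cas (ev ?\<theta>) = ev ?\<theta>"
    unfolding M.cas_def using casimir_adjoint M.dual_family_Psi levi by simp
  ultimately have "scale 1 (ev ?\<theta>) = scale (form ?\<theta> ?\<theta> + (\<Sum>\<beta>\<in>pos_roots. form \<beta> ?\<theta>)) (ev ?\<theta>)" by simp
  then show ?thesis using ev_nonzero[OF highest_root(1)] by (simp only: scale_cancel_right) simp
qed

text \<open>The factor \<open>(\<theta>, \<theta>)\<close> of \<open>r\<^sub>\<alpha>\<close> clears the denominator of \<open>h\<^sup>*\<close>, and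
  \<open>h\<^sup>* (\<theta>, \<theta>) = (\<theta>, \<theta>) + 2 (\<rho>, \<theta>) = 1\<close> by \<open>form_highest_root\<close>.\<close>
lemma dual_coxeter_root_ratio:
  assumes "\<alpha> \<in> roots H" shows "dual_coxeter * root_ratio \<alpha> = 1 / form \<alpha> \<alpha>"
proof -
  have pd: "\<beta> \<in> dual_space H" if "\<beta> \<in> pos_roots" for \<beta> using that pos_rootsD roots_dual by blast
  have td: "highest_root \<in> dual_space H" using highest_root(1) roots_dual by blast
  have "2 * form half_sum highest_root = (\<Sum>\<beta>\<in>pos_roots. form \<beta> highest_root)"
    unfolding half_sum_def using pd td by (simp add: form_scale_left dual_sum form_sum_left)
  then show ?thesis
    using form_highest_root form_root_nonzero[OF highest_root(1)] form_root_nonzero[OF assms]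
    unfolding dual_coxeter_def root_ratio_def by (simp add: field_simps)
qed

end

section \<open>The grading of a simple root\<close>

locale simple_root = based_simple_lie_algebra scale br H \<Pi>
  for scale :: "'k::{alg_closed_field,field_char_0} \<Rightarrow> 'v::ab_group_add \<Rightarrow> 'v"
    and br :: "'v \<Rightarrow> 'v \<Rightarrow> 'v" and H :: "'v set" and \<Pi> :: "('v \<Rightarrow> 'k) set" +
  fixes \<alpha> :: "'v \<Rightarrow> 'k"
  assumes alpha: "\<alpha> \<in> \<Pi>"
begin

abbreviation D0 :: "('v \<Rightarrow> 'k) set" where "D0 \<equiv> roots_of_ht \<alpha> 0"
abbreviation D1 :: "('v \<Rightarrow> 'k) set" where "D1 \<equiv> roots_of_ht \<alpha> 1"

lemma D0_iff: "\<gamma> \<in> D0 \<longleftrightarrow> \<gamma> \<in> roots H \<and> ht \<alpha> \<gamma> = 0"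
  and D1_iff: "\<gamma> \<in> D1 \<longleftrightarrow> \<gamma> \<in> roots H \<and> ht \<alpha> \<gamma> = 1"
  by (auto simp: roots_of_ht_def)

lemma D0_root: "\<gamma> \<in> D0 \<Longrightarrow> \<gamma> \<in> roots H" and D1_root: "\<gamma> \<in> D1 \<Longrightarrow> \<gamma> \<in> roots H"
  by (auto simp: D0_iff D1_iff)

lemma D1_dual: "\<gamma> \<in> D1 \<Longrightarrow> \<gamma> \<in> dual_space H"
  by (simp add: D1_root roots_dual)

lemma D0_dual: "\<gamma> \<in> D0 \<Longrightarrow> \<gamma> \<in> dual_space H"
  by (simp add: D0_root roots_dual)

lemma finite_D0: "finite D0" and finite_D1: "finite D1"
  using finite_roots by (auto simp: roots_of_ht_def)

lemma D0_neg: "\<beta> \<in> D0 \<Longrightarrow> - \<beta> \<in> D0"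
  by (auto simp: D0_iff ht_neg roots_dual)

lemma D0_add: "\<beta> \<in> D0 \<Longrightarrow> \<gamma> \<in> D0 \<Longrightarrow> \<beta> + \<gamma> \<in> roots H \<Longrightarrow> \<beta> + \<gamma> \<in> D0"
  by (auto simp: D0_iff ht_add roots_dual)

lemma D1_add: "\<gamma> \<in> D1 \<Longrightarrow> \<beta> \<in> D0 \<Longrightarrow> \<gamma> + \<beta> \<in> roots H \<Longrightarrow> \<gamma> + \<beta> \<in> D1"
  by (auto simp: D0_iff D1_iff ht_add roots_dual)

lemma D1_diff: "\<gamma> \<in> D1 \<Longrightarrow> \<delta> \<in> D1 \<Longrightarrow> \<gamma> - \<delta> \<in> roots H \<Longrightarrow> \<gamma> - \<delta> \<in> D0"
  by (auto simp: D0_iff D1_iff ht_diff roots_dual)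

lemma alpha_D1: "\<alpha> \<in> D1" and alpha_root: "\<alpha> \<in> roots H"
  using alpha Pi_roots by (auto simp: D1_iff ht_Pi)

lemma D1_D0_neq: assumes "\<gamma> \<in> D1" "\<beta> \<in> D0" shows "\<gamma> \<noteq> \<beta>" "\<gamma> \<noteq> - \<beta>"
  using assms D0_neg[OF assms(2)] by (auto simp: D0_iff D1_iff)

lemma D1_add_nonzero: assumes "\<gamma> \<in> D1" "\<beta> \<in> D0" shows "\<gamma> + \<beta> \<noteq> 0" "\<beta> + \<gamma> \<noteq> 0"
  using D1_D0_neq[OF assms] by (auto simp: eq_neg_iff_add_eq_0 add.commute)

lemma D1_neq_neg: assumes "\<gamma> \<in> D1" "\<delta> \<in> D1" shows "\<gamma> \<noteq> - \<delta>"
proof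
  assume "\<gamma> = - \<delta>"
  then have "(1::'k) = - 1" using assms ht_neg[OF D1_dual[OF assms(2)], of \<alpha>] by (simp add: D1_iff)
  then have "(2::'k) = 0" by (simp add: eq_neg_iff_add_eq_0)
  then show False by simp
qed

lemma D1_pos: assumes "\<gamma> \<in> D1" shows "\<gamma> \<in> pos_roots"
proof (rule ccontr)
  assume "\<gamma> \<notin> pos_roots"
  then have "- \<gamma> \<in> pos_roots" using root_pos_or_neg D1_root[OF assms] by blast
  then have "ht \<alpha> (- \<gamma>) \<in> \<nat>" using alpha by (rule pos_rootsD(2))
  then have "- 1 \<in> (\<nat> :: 'k set)" using ht_neg[OF D1_dual[OF assms]] assms by (simp add: D1_iff)
  then have "(1::'k) = 0" by (intro nat_antisym) auto
  then show False by simp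
qed

abbreviation P0 :: "('v \<Rightarrow> 'k) set" where "P0 \<equiv> D0 \<inter> pos_roots"

text \<open>One root of each pair \<open>\<plusminus>\<beta>\<close>. Lowest weight vectors are treated as highest weight
  vectors for \<open>- P0\<close>, so the eigenvalue formulas are stated for both choices at once.\<close>
definition half_system :: "('v \<Rightarrow> 'k) set \<Rightarrow> bool" where
  "half_system P \<longleftrightarrow> D0 = P \<union> uminus ` P \<and> P \<inter> uminus ` P = {}"

lemma half_system_P0: "half_system P0"
proof -
  have "D0 = P0 \<union> uminus ` P0"
  proof (intro equalityI subsetI)
    fix \<gamma> assume g: "\<gamma> \<in> D0"
    show "\<gamma> \<in> P0 \<union> uminus ` P0"
    proof (cases "\<gamma> \<in> pos_roots")
      case False
      then have "- \<gamma> \<in> P0" using root_pos_or_neg D0_root[OF g] D0_neg[OF g] by blast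
      then show ?thesis by (intro UnI2) (rule image_eqI[of _ _ "- \<gamma>"], simp_all)
    qed (use g in simp)
  qed (auto intro: D0_neg)
  moreover have "P0 \<inter> uminus ` P0 = {}" using pos_roots_neg by auto
  ultimately show ?thesis by (simp add: half_system_def)
qed

lemma half_system_neg: assumes "half_system P" shows "half_system (uminus ` P)"
proof -
  have "uminus ` uminus ` P = P" by (simp add: image_image)
  then show ?thesis using assms by (simp add: half_system_def Un_commute Int_commute)
qed

lemma half_systemD: assumes "half_system P" shows "\<beta> \<in> P \<Longrightarrow> \<beta> \<in> D0" "finite P"
proof -
  show "\<beta> \<in> P \<Longrightarrow> \<beta> \<in> D0" using assms unfolding half_system_def by blast
  show "finite P" using assms finite_D0 unfolding half_system_def by (metis finite_Un)
qed

lemma span_root_spaces: assumes "A \<subseteq> roots H" shows "span (U \<union> (\<Union>\<gamma>\<in>A. root_space H \<gamma>)) = span (U \<union> ev ` A)"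
proof (rule span_eq[THEN iffD2], intro conjI subsetI)
  fix x assume x: "x \<in> U \<union> (\<Union>\<gamma>\<in>A. root_space H \<gamma>)"
  show "x \<in> span (U \<union> ev ` A)"
  proof (cases "x \<in> U")
    case False
    then obtain \<gamma> where g: "\<gamma> \<in> A" "x \<in> root_space H \<gamma>" using x by blast
    then have r: "\<gamma> \<in> roots H" using assms by blast
    then have "x = scale (killing x (ev (- \<gamma>))) (ev \<gamma>)" using g(2) G_expand root_space_eq_G roots_dual by blast
    moreover have "ev \<gamma> \<in> span (U \<union> ev ` A)" using g(1) by (auto intro: span_base)
    ultimately show ?thesis by (metis span_scale)
  qed (auto intro: span_base)
next
  fix x assume "x \<in> U \<union> ev ` A"
  then show "x \<in> span (U \<union> (\<Union>\<gamma>\<in>A. root_space H \<gamma>))"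
    using assms ev_in root_space_eq_G roots_dual by (intro span_base) blast
qed

lemma grading_0: "grading \<alpha> 0 = levi D0"
  unfolding grading_def levi_def using span_root_spaces[of D0 H] D0_root by auto

lemma grading_1: "grading \<alpha> 1 = span (ev ` D1)"
  unfolding grading_def using span_root_spaces[of D1 "{}"] D1_root by auto

sublocale adj: levi_module scale br H \<Pi> scale "roots_of_ht \<alpha> 0" UNIV br
  by (rule adjoint_module) (auto intro: D0_neg D0_add dest: D0_root)

lemma adj_cas_ev:
  assumes \<gamma>: "\<gamma> \<in> D1" and P: "half_system P"
  shows "adj.cas (ev \<gamma>) = scale (form \<gamma> \<gamma> + (\<Sum>\<beta>\<in>P. form \<beta> \<gamma>) + 2 * (\<Sum>\<beta>\<in>P. cc \<beta> \<gamma>)) (ev \<gamma>)"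
proof -
  have "adj.weight_vec \<gamma> (ev \<gamma>)" using D1_root[OF \<gamma>] by (simp add: adj.weight_vec_def br_H_ev)
  then have "adj.cas (ev \<gamma>) = scale (form \<gamma> \<gamma> + (\<Sum>\<beta>\<in>P. form \<beta> \<gamma>)) (ev \<gamma>)
      + scale 2 (\<Sum>\<beta>\<in>P. br (ev (- \<beta>)) (br (ev \<beta>) (ev \<gamma>)))"
    using P by (intro adj.cas_weight D1_dual[OF \<gamma>]) (auto simp: half_system_def)
  also have "(\<Sum>\<beta>\<in>P. br (ev (- \<beta>)) (br (ev \<beta>) (ev \<gamma>))) = (\<Sum>\<beta>\<in>P. scale (cc \<beta> \<gamma>) (ev \<gamma>))"
    using half_systemD[OF P] D0_root D1_root[OF \<gamma>] by (intro sum.cong refl cc) auto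
  finally show ?thesis by (simp add: scale_sum_left[symmetric] scale_left_distrib)
qed

text \<open>Since \<open>(\<gamma>, \<gamma>) = \<Sum> ht \<beta> \<gamma> (\<beta>, \<gamma>)\<close> is positive, some simple root \<open>\<beta>\<close> that occurs in \<open>\<gamma>\<close>
  satisfies \<open>(\<gamma>, \<beta>) > 0\<close>, and \<open>\<gamma> - \<beta>\<close> is a root. If \<open>\<beta> \<noteq> \<alpha>\<close>, then \<open>\<gamma> - \<beta>\<close> is the predecessor.
  If \<open>\<beta> = \<alpha>\<close>, then \<open>\<gamma> - \<alpha>\<close> is a positive root of \<open>\<alpha>\<close>-height zero and \<open>\<alpha>\<close> is the predecessor.\<close>
lemma D1_predecessor:
  assumes \<gamma>: "\<gamma> \<in> D1" "\<gamma> \<noteq> \<alpha>"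
  shows "\<exists>\<delta>\<in>D1. \<exists>\<beta>\<in>D0. \<gamma> = \<delta> + \<beta> \<and> iht \<delta> < iht \<gamma>"
proof -
  have gr: "\<gamma> \<in> roots H" and gd: "\<gamma> \<in> dual_space H" using \<gamma> D1_root D1_dual by auto
  have "\<exists>\<beta>\<in>\<Pi>. - (ht \<beta> \<gamma> * form \<beta> \<gamma>) \<notin> nonneg_rats"
  proof (rule ccontr)
    assume "\<not> ?thesis"
    then have "(\<Sum>\<beta>\<in>\<Pi>. - (ht \<beta> \<gamma> * form \<beta> \<gamma>)) \<in> nonneg_rats" by (intro nonneg_rats_sum) auto
    then have "- form \<gamma> \<gamma> \<in> nonneg_rats" using form_expand[OF gd gd] by (simp add: sum_negf)
    then have "form \<gamma> \<gamma> = 0" using form_root_nonneg[OF gr] by (intro nonneg_rats_antisym)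
    then show False using form_root_nonzero[OF gr] by simp
  qed
  then obtain \<beta> where b: "\<beta> \<in> \<Pi>" "- (ht \<beta> \<gamma> * form \<beta> \<gamma>) \<notin> nonneg_rats" by blast
  have br': "\<beta> \<in> roots H" using b(1) Pi_roots by blast
  obtain n :: nat where n: "ht \<beta> \<gamma> = of_nat n" using pos_rootsD(2)[OF D1_pos[OF \<gamma>(1)] b(1)] by (auto elim: Nats_cases)
  have f: "- form \<gamma> \<beta> \<notin> nonneg_rats"
  proof
    assume "- form \<gamma> \<beta> \<in> nonneg_rats"
    then have "of_nat n * (- form \<beta> \<gamma>) \<in> nonneg_rats" by (intro nonneg_rats_mult nonneg_rats_of_nat) (simp add: form_sym)
    then show False using b(2) n by simp
  qed
  show ?thesis
  proof (cases "\<beta> = \<alpha>")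
    case True
    have "\<gamma> - \<alpha> \<in> roots H"
      using root_difference[OF alpha_root gr \<gamma>(2) D1_neq_neg[OF \<gamma>(1) alpha_D1]] f True by simp
    then have d: "\<gamma> - \<alpha> \<in> D0" by (rule D1_diff[OF \<gamma>(1) alpha_D1])
    have "ht \<beta>' (\<gamma> - \<alpha>) \<in> \<nat>" if "\<beta>' \<in> \<Pi>" for \<beta>'
    proof (cases "\<beta>' = \<alpha>")
      case True then show ?thesis using d by (simp add: D0_iff)
    next
      case False
      then show ?thesis
        using pos_rootsD(2)[OF D1_pos[OF \<gamma>(1)] that] ht_Pi[OF alpha, of \<beta>'] by (simp add: ht_diff gd D1_dual[OF alpha_D1])
    qed
    then have "\<gamma> - \<alpha> \<in> pos_roots" using D0_root[OF d] by (simp add: pos_roots_def)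
    then have "iht (\<gamma> - \<alpha>) > 0" by (rule iht_pos)
    moreover have "iht \<gamma> = iht \<alpha> + iht (\<gamma> - \<alpha>)"
      using iht_add[OF roots_lattice[OF alpha_root] roots_lattice[OF D0_root[OF d]]] by simp
    ultimately show ?thesis using d alpha_D1 by (intro bexI[of _ \<alpha>] bexI[of _ "\<gamma> - \<alpha>"]) auto
  next
    case False
    then have bD: "\<beta> \<in> D0" using b(1) br' by (simp add: D0_iff ht_Pi)
    have "\<gamma> - \<beta> \<in> roots H"
      by (rule root_difference[OF br' gr D1_D0_neq[OF \<gamma>(1) bD] f])
    then have d: "\<gamma> - \<beta> \<in> D1" using D1_add[OF \<gamma>(1) D0_neg[OF bD]] by simp
    have "iht \<gamma> = iht (\<gamma> - \<beta>) + iht \<beta>"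
      using iht_add[OF roots_lattice[OF D1_root[OF d]] roots_lattice[OF br']] by simp
    moreover have "iht \<beta> > 0" by (rule iht_pos[OF Pi_pos[OF b(1)]])
    ultimately show ?thesis using d bD by (intro bexI[of _ "\<gamma> - \<beta>"] bexI[of _ \<beta>]) auto
  qed
qed

text \<open>The Casimir operator commutes with the root vectors of height zero, and by
  \<open>D1_predecessor\<close> these lead from \<open>e\<^sub>\<alpha>\<close> to every root vector of height one.\<close>
lemma adj_cas_constant:
  "\<exists>c. \<forall>\<gamma>\<in>D1. adj.cas (ev \<gamma>) = scale c (ev \<gamma>)"
proof -
  obtain c where c: "adj.cas (ev \<alpha>) = scale c (ev \<alpha>)" using adj_cas_ev[OF alpha_D1 half_system_P0] by blast
  have "adj.cas (ev \<gamma>) = scale c (ev \<gamma>)" if "\<gamma> \<in> D1" for \<gamma>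
    using that
  proof (induction "nat (iht \<gamma>)" arbitrary: \<gamma> rule: less_induct)
    case less
    show ?case
    proof (cases "\<gamma> = \<alpha>")
      case False
      then obtain \<delta> \<beta> where d: "\<delta> \<in> D1" "\<beta> \<in> D0" "\<gamma> = \<delta> + \<beta>" "iht \<delta> < iht \<gamma>"
        using D1_predecessor[OF less.prems] by blast
      have r: "\<delta> \<in> roots H" "\<beta> \<in> roots H" "\<gamma> \<in> roots H" using d less.prems D1_root D0_root by auto
      have "iht \<delta> > 0" using iht_pos[OF D1_pos[OF d(1)]] .
      then have IH: "adj.cas (ev \<delta>) = scale c (ev \<delta>)" using less.hyps[of \<delta>] d by simp
      let ?b = "br (ev \<beta>) (ev \<delta>)"
      have n: "?b \<noteq> 0" using br_ev_nonzero[OF r(2,1) D1_D0_neq[OF d(1,2)]] r(3) d(3) by simp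
      have "?b \<in> G \<gamma>" using br_ev_in[OF r(2,1)] d(3) by (simp add: add.commute)
      then obtain N where N: "?b = scale N (ev \<gamma>)" using G_expand[OF r(3)] by blast
      have "scale N (adj.cas (ev \<gamma>)) = adj.cas ?b" unfolding N by (simp add: adj.cas_scale)
      also have "\<dots> = br (ev \<beta>) (adj.cas (ev \<delta>))" using adj.cas_commute[OF ev_levi[OF d(2)]] by simp
      also have "\<dots> = scale N (scale c (ev \<gamma>))" unfolding IH br_scale_right N by (rule scale_left_commute)
      finally show ?thesis using n N by (auto simp del: scale_scale)
    qed (use c in simp)
  qed
  then show ?thesis by blast
qed

lemma gamma1: "\<gamma> \<in> D1 \<Longrightarrow> adj.cas (ev \<gamma>) = scale (gamma1 \<alpha>) (ev \<gamma>)"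
proof -
  obtain c where c: "\<And>\<gamma>. \<gamma> \<in> D1 \<Longrightarrow> adj.cas (ev \<gamma>) = scale c (ev \<gamma>)" using adj_cas_constant by blast
  have "adj.cas x = scale c x" if "x \<in> span (ev ` D1)" for x
    using that by (induction rule: span_induct_alt)
      (use adj.cas_scale[of 0 0] in \<open>auto simp: adj.cas_add adj.cas_scale c scale_right_distrib mult.commute\<close>)
  then have 1: "\<forall>x\<in>grading \<alpha> 1. casimir (grading \<alpha> 0) br x = scale c x"
    unfolding grading_0 grading_1 by (simp add: adj.casimir_eq_cas)
  have "gamma1 \<alpha> = c"
    unfolding gamma1_def
  proof (rule the_equality)
    show "\<forall>x\<in>grading \<alpha> 1. casimir (grading \<alpha> 0) br x = scale c x" by (rule 1)
    fix d assume "\<forall>x\<in>grading \<alpha> 1. casimir (grading \<alpha> 0) br x = scale d x"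
    moreover have "ev \<alpha> \<in> grading \<alpha> 1" unfolding grading_1 using alpha_D1 by (auto intro: span_base)
    ultimately have "scale d (ev \<alpha>) = scale c (ev \<alpha>)" using 1 by metis
    then show "d = c" using ev_nonzero[OF alpha_root] by simp
  qed
  then show "\<gamma> \<in> D1 \<Longrightarrow> adj.cas (ev \<gamma>) = scale (gamma1 \<alpha>) (ev \<gamma>)" using c by simp
qed

lemma adj_cas_V: "x \<in> span (ev ` D1) \<Longrightarrow> adj.cas x = scale (gamma1 \<alpha>) x"
  by (induction rule: span_induct_alt)
    (use adj.cas_scale[of 0 0] in \<open>auto simp: adj.cas_add adj.cas_scale gamma1 scale_right_distrib mult.commute\<close>)

lemma gamma1_formula:
  assumes "\<gamma> \<in> D1" "half_system P"
  shows "gamma1 \<alpha> = form \<gamma> \<gamma> + (\<Sum>\<beta>\<in>P. form \<beta> \<gamma>) + 2 * (\<Sum>\<beta>\<in>P. cc \<beta> \<gamma>)"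
proof -
  have "scale (gamma1 \<alpha>) (ev \<gamma>) = scale (form \<gamma> \<gamma> + (\<Sum>\<beta>\<in>P. form \<beta> \<gamma>) + 2 * (\<Sum>\<beta>\<in>P. cc \<beta> \<gamma>)) (ev \<gamma>)"
    by (rule trans[OF gamma1[OF assms(1), symmetric] adj_cas_ev[OF assms]])
  then show ?thesis using ev_nonzero[OF D1_root[OF assms(1)]] by (simp only: scale_cancel_right) blast
qed

section \<open>Casimir eigenvalues and sets of roots\<close>

text \<open>The value \<open>(\<nu>, \<nu> + 2\<rho>\<^sub>P)\<close> for \<open>\<nu> = \<Sum>S\<close> and \<open>2\<rho>\<^sub>P = \<Sum>P\<close>, which is the Casimir eigenvalue
  of a vector of weight \<open>\<nu>\<close> that is killed by \<open>e\<^sub>\<beta>\<close> for all \<open>\<beta> \<in> P\<close>.\<close>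
definition eigen :: "('v \<Rightarrow> 'k) set \<Rightarrow> ('v \<Rightarrow> 'k) set \<Rightarrow> 'k" where
  "eigen P S = form (\<Sum>S) (\<Sum>S) + (\<Sum>\<beta>\<in>P. form \<beta> (\<Sum>S))"

text \<open>Only pairs whose difference is a root contribute. The scalar \<open>cc (- \<delta>) \<gamma>\<close> is symmetric
  in \<open>\<gamma>\<close> and \<open>\<delta>\<close>, so the sum is twice the sum over the pairs with \<open>\<gamma> - \<delta> = \<beta> \<in> P\<close>, for which
  the scalar is \<open>cc \<beta> \<delta>\<close>.\<close>
lemma pair_sum:
  assumes P: "half_system P" and S: "S \<subseteq> D1"
  shows "(\<Sum>\<gamma>\<in>S. \<Sum>\<delta>\<in>S - {\<gamma>}. cc (- \<delta>) \<gamma>) = 2 * (\<Sum>\<gamma>\<in>S. \<Sum>\<beta>\<in>{\<beta>\<in>P. \<gamma> + \<beta> \<in> S}. cc \<beta> \<gamma>)"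
proof -
  have fS: "finite S" using S finite_D1 by (rule finite_subset)
  have fP: "finite P" using half_systemD[OF P] by blast
  have P0: "0 \<notin> P" using half_systemD(1)[OF P] D0_root roots_nonzero by blast
  define f where "f = (\<lambda>(\<gamma>, \<delta>). cc (- \<delta>) \<gamma>)"
  define A where "A = {(\<gamma>, \<delta>)\<in>S \<times> S. \<gamma> - \<delta> \<in> P}"
  define B where "B = {(\<gamma>, \<delta>)\<in>S \<times> S. \<delta> - \<gamma> \<in> P}"
  have fAB: "finite A" "finite B" unfolding A_def B_def using fS by (auto intro: finite_subset[of _ "S \<times> S"])
  have disj: "A \<inter> B = {}"
  proof -
    have "\<delta> - \<gamma> \<notin> P" if "\<gamma> - \<delta> \<in> P" for \<gamma> \<delta>
    proof
      assume "\<delta> - \<gamma> \<in> P"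
      then have "- (\<delta> - \<gamma>) \<in> uminus ` P" by blast
      then show False using that P unfolding half_system_def by auto
    qed
    then show ?thesis by (auto simp: A_def B_def)
  qed
  have sub: "A \<union> B \<subseteq> (SIGMA \<gamma>:S. S - {\<gamma>})" using P0 by (auto simp: A_def B_def)
  have zero: "f p = 0" if pp: "p \<in> (SIGMA \<gamma>:S. S - {\<gamma>}) - (A \<union> B)" for p
  proof -
    obtain \<gamma> \<delta> where p: "p = (\<gamma>, \<delta>)" "\<gamma> \<in> S" "\<delta> \<in> S" "\<delta> \<noteq> \<gamma>" "\<gamma> - \<delta> \<notin> P" "\<delta> - \<gamma> \<notin> P"
      using pp by (cases p) (auto simp: A_def B_def)
    have D: "\<gamma> \<in> D1" "\<delta> \<in> D1" using p S by auto
    have "\<gamma> - \<delta> \<notin> D0"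
    proof
      assume "\<gamma> - \<delta> \<in> D0"
      then have "\<gamma> - \<delta> \<in> uminus ` P" using p(5) P by (auto simp: half_system_def)
      then obtain \<epsilon> where e: "\<epsilon> \<in> P" "\<gamma> - \<delta> = - \<epsilon>" by blast
      then have "\<delta> - \<gamma> = \<epsilon>" by (metis minus_diff_eq minus_minus)
      then show False using p(6) e(1) by simp
    qed
    then have "\<gamma> - \<delta> \<notin> roots H" using D1_diff[OF D] by blast
    then have "cc (- \<delta>) \<gamma> = 0"
      using p(4) by (intro cc_zero roots_neg D1_root D) (simp_all add: eq_neg_iff_add_eq_0)
    then show ?thesis by (simp add: f_def p)
  qed
  have "(\<Sum>\<gamma>\<in>S. \<Sum>\<delta>\<in>S - {\<gamma>}. cc (- \<delta>) \<gamma>) = sum f (SIGMA \<gamma>:S. S - {\<gamma>})"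
    unfolding f_def using fS by (subst sum.Sigma) auto
  also have "\<dots> = sum f (A \<union> B)"
    using fS sub zero by (intro sum.mono_neutral_right) auto
  also have "\<dots> = sum f A + sum f B" using fAB disj by (intro sum.union_disjoint)
  also have "sum f B = sum f A"
  proof (rule sum.reindex_bij_witness[of _ prod.swap prod.swap])
    fix p assume "p \<in> B"
    then obtain \<gamma> \<delta> where p: "p = (\<gamma>, \<delta>)" "\<gamma> \<in> S" "\<delta> \<in> S" "\<delta> - \<gamma> \<in> P" by (auto simp: B_def)
    let ?\<beta> = "\<delta> - \<gamma>"
    have r: "?\<beta> \<in> roots H" "\<gamma> \<in> roots H" "\<delta> \<in> roots H"
      using p S half_systemD(1)[OF P] D0_root D1_root by blast+
    have m: "\<gamma> - \<delta> = - ?\<beta>" by simp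
    have "cc (- \<delta>) \<gamma> = cc (\<gamma> - \<delta>) \<delta>" using cc_difference[OF r(2,3)] roots_neg[OF r(1)] by simp
    also have "\<dots> = cc ?\<beta> (\<delta> - ?\<beta>)" unfolding m using r by (intro cc_shift) simp_all
    also have "\<dots> = cc (- \<gamma>) \<delta>" using cc_difference[OF r(3,2,1)] by simp
    finally show "f (prod.swap p) = f p" by (simp add: f_def p)
  qed (auto simp: A_def B_def)
  also have "sum f A = (\<Sum>\<gamma>\<in>S. \<Sum>\<beta>\<in>{\<beta>\<in>P. \<gamma> + \<beta> \<in> S}. cc \<beta> \<gamma>)"
  proof -
    have "sum f A = (\<Sum>(\<gamma>, \<beta>)\<in>(SIGMA \<gamma>:S. {\<beta>\<in>P. \<gamma> + \<beta> \<in> S}). cc \<beta> \<gamma>)"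
    proof (rule sum.reindex_bij_witness[of _ "\<lambda>(\<gamma>, \<beta>). (\<gamma> + \<beta>, \<gamma>)" "\<lambda>(\<gamma>, \<delta>). (\<delta>, \<gamma> - \<delta>)"])
      fix p assume "p \<in> A"
      then obtain \<gamma> \<delta> where p: "p = (\<gamma>, \<delta>)" "\<gamma> \<in> S" "\<delta> \<in> S" "\<gamma> - \<delta> \<in> P" by (auto simp: A_def)
      have r: "\<gamma> - \<delta> \<in> roots H" "\<gamma> \<in> roots H" "\<delta> \<in> roots H"
        using p S half_systemD(1)[OF P] D0_root D1_root by blast+
      show "(case (case p of (\<gamma>, \<delta>) \<Rightarrow> (\<delta>, \<gamma> - \<delta>)) of (\<gamma>, \<beta>) \<Rightarrow> cc \<beta> \<gamma>) = f p"
        using cc_difference[OF r(2,3,1)] by (simp add: p f_def)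
    qed (auto simp: A_def)
    then show ?thesis using fS fP by (simp add: sum.Sigma)
  qed
  finally show ?thesis by (simp only: mult_2)
qed

text \<open>Expand \<open>(\<nu>, \<nu>)\<close> into the terms \<open>(\<gamma>, \<gamma>)\<close> and \<open>(\<gamma>, \<delta>) = cc (- \<delta>) \<gamma> - cc \<delta> \<gamma>\<close>, and
  subtract the result from the sum of \<open>gamma1_formula\<close> over \<open>S\<close>. By \<open>pair_sum\<close> the terms
  \<open>cc \<beta> \<gamma>\<close> with \<open>\<gamma> + \<beta> \<in> S\<close> cancel.\<close>
lemma eigen_defect:
  assumes P: "half_system P" and S: "S \<subseteq> D1"
  shows "of_nat (card S) * gamma1 \<alpha> = eigen P S
    + (2 * (\<Sum>\<gamma>\<in>S. \<Sum>\<beta>\<in>{\<beta>\<in>P. \<gamma> + \<beta> \<notin> S}. cc \<beta> \<gamma>) + (\<Sum>\<gamma>\<in>S. \<Sum>\<delta>\<in>S - {\<gamma>}. cc \<delta> \<gamma>))"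
proof -
  have fS: "finite S" using S finite_D1 by (rule finite_subset)
  have fP: "finite P" using half_systemD[OF P] by blast
  have SD: "\<gamma> \<in> dual_space H" "\<gamma> \<in> roots H" if "\<gamma> \<in> S" for \<gamma> using that S D1_root D1_dual by auto
  have PD: "\<beta> \<in> dual_space H" if "\<beta> \<in> P" for \<beta> using half_systemD(1)[OF P that] by (rule D0_dual)
  have sd: "\<Sum>S \<in> dual_space H" by (rule dual_sum) (rule SD)
  have "form (\<Sum>S) (\<Sum>S) = (\<Sum>\<gamma>\<in>S. form \<gamma> (\<Sum>S))"
    using SD sd by (intro form_sum_left)
  also have "\<dots> = (\<Sum>\<gamma>\<in>S. \<Sum>\<delta>\<in>S. form \<gamma> \<delta>)"
    using SD by (intro sum.cong refl form_sum_right) auto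
  also have "\<dots> = (\<Sum>\<gamma>\<in>S. form \<gamma> \<gamma> + (\<Sum>\<delta>\<in>S - {\<gamma>}. form \<gamma> \<delta>))"
    using fS by (intro sum.cong refl) (simp add: sum.remove)
  also have "\<dots> = (\<Sum>\<gamma>\<in>S. form \<gamma> \<gamma>) + (\<Sum>\<gamma>\<in>S. \<Sum>\<delta>\<in>S - {\<gamma>}. cc (- \<delta>) \<gamma> - cc \<delta> \<gamma>)"
    unfolding sum.distrib using SD by (intro arg_cong2[where f = "(+)"] sum.cong refl) (auto simp: cc_neg_left)
  also have "\<dots> = (\<Sum>\<gamma>\<in>S. form \<gamma> \<gamma>) + 2 * (\<Sum>\<gamma>\<in>S. \<Sum>\<beta>\<in>{\<beta>\<in>P. \<gamma> + \<beta> \<in> S}. cc \<beta> \<gamma>)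
      - (\<Sum>\<gamma>\<in>S. \<Sum>\<delta>\<in>S - {\<gamma>}. cc \<delta> \<gamma>)"
    by (simp only: sum_subtractf pair_sum[OF P S] add_diff_eq)
  finally have 1: "form (\<Sum>S) (\<Sum>S) = \<dots>" .
  have 2: "(\<Sum>\<beta>\<in>P. form \<beta> (\<Sum>S)) = (\<Sum>\<gamma>\<in>S. \<Sum>\<beta>\<in>P. form \<beta> \<gamma>)"
    using SD PD by (subst sum.swap) (simp add: form_sum_right)
  have "of_nat (card S) * gamma1 \<alpha> = (\<Sum>\<gamma>\<in>S. gamma1 \<alpha>)" by simp
  also have "\<dots> = (\<Sum>\<gamma>\<in>S. form \<gamma> \<gamma> + (\<Sum>\<beta>\<in>P. form \<beta> \<gamma>) + 2 * (\<Sum>\<beta>\<in>P. cc \<beta> \<gamma>))"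
    using S P by (intro sum.cong refl gamma1_formula) auto
  also have "\<dots> = (\<Sum>\<gamma>\<in>S. form \<gamma> \<gamma>) + (\<Sum>\<gamma>\<in>S. \<Sum>\<beta>\<in>P. form \<beta> \<gamma>) + 2 * (\<Sum>\<gamma>\<in>S. \<Sum>\<beta>\<in>P. cc \<beta> \<gamma>)"
    by (simp add: sum.distrib sum_distrib_left)
  also have "(\<Sum>\<gamma>\<in>S. \<Sum>\<beta>\<in>P. cc \<beta> \<gamma>)
      = (\<Sum>\<gamma>\<in>S. \<Sum>\<beta>\<in>{\<beta>\<in>P. \<gamma> + \<beta> \<in> S}. cc \<beta> \<gamma>) + (\<Sum>\<gamma>\<in>S. \<Sum>\<beta>\<in>{\<beta>\<in>P. \<gamma> + \<beta> \<notin> S}. cc \<beta> \<gamma>)"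
    unfolding sum.distrib[symmetric]
  proof (rule sum.cong[OF refl])
    fix \<gamma>
    have "P = {\<beta>\<in>P. \<gamma> + \<beta> \<in> S} \<union> {\<beta>\<in>P. \<gamma> + \<beta> \<notin> S}" by blast
    then show "(\<Sum>\<beta>\<in>P. cc \<beta> \<gamma>) = (\<Sum>\<beta>\<in>{\<beta>\<in>P. \<gamma> + \<beta> \<in> S}. cc \<beta> \<gamma>) + (\<Sum>\<beta>\<in>{\<beta>\<in>P. \<gamma> + \<beta> \<notin> S}. cc \<beta> \<gamma>)"
      using fP by (subst sum.union_disjoint[symmetric]) auto
  qed
  finally show ?thesis unfolding eigen_def 1 2 by (simp add: algebra_simps)
qed

lemma cc_D0_D1: assumes "\<beta> \<in> D0" "\<gamma> \<in> D1"
  shows "cc \<beta> \<gamma> \<in> nonneg_rats" "cc \<beta> \<gamma> = 0 \<longleftrightarrow> \<gamma> + \<beta> \<notin> roots H"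
  using cc_nonneg[OF D0_root D1_root D1_D0_neq, OF assms(1,2,2,1,2,1)] by auto

lemma cc_D1_D1: assumes "\<delta> \<in> D1" "\<gamma> \<in> D1" "\<gamma> \<noteq> \<delta>" shows "cc \<delta> \<gamma> \<in> nonneg_rats"
  using cc_nonneg(1)[OF D1_root D1_root _ D1_neq_neg, OF assms(1,2,3,2,1)] .

lemma defect_nonneg:
  assumes P: "half_system P" and S: "S \<subseteq> D1"
  shows "2 * (\<Sum>\<gamma>\<in>S. \<Sum>\<beta>\<in>{\<beta>\<in>P. \<gamma> + \<beta> \<notin> S}. cc \<beta> \<gamma>) \<in> nonneg_rats"
    "(\<Sum>\<gamma>\<in>S. \<Sum>\<delta>\<in>S - {\<gamma>}. cc \<delta> \<gamma>) \<in> nonneg_rats"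
proof -
  have "2 \<in> nonneg_rats" using nonneg_rats_of_nat[of 2] by simp
  then show "2 * (\<Sum>\<gamma>\<in>S. \<Sum>\<beta>\<in>{\<beta>\<in>P. \<gamma> + \<beta> \<notin> S}. cc \<beta> \<gamma>) \<in> nonneg_rats"
    using half_systemD(1)[OF P] S by (intro nonneg_rats_mult nonneg_rats_sum cc_D0_D1) auto
  show "(\<Sum>\<gamma>\<in>S. \<Sum>\<delta>\<in>S - {\<gamma>}. cc \<delta> \<gamma>) \<in> nonneg_rats"
    using S by (intro nonneg_rats_sum cc_D1_D1) auto
qed

lemma eigen_bound:
  assumes P: "half_system P" and S: "S \<subseteq> D1"
  shows "of_nat (card S) * gamma1 \<alpha> - eigen P S \<in> nonneg_rats"
  using nonneg_rats_add[OF defect_nonneg[OF P S]] eigen_defect[OF P S] by simp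

text \<open>In the extremal case each of the nonnegative terms of \<open>eigen_defect\<close> is zero, and
  \<open>cc \<beta> \<gamma> = 0\<close> only if \<open>\<gamma> + \<beta>\<close> is not a root.\<close>
lemma eigen_extremal:
  assumes P: "half_system P" and S: "S \<subseteq> D1" and eq: "eigen P S = of_nat (card S) * gamma1 \<alpha>"
    and \<gamma>: "\<gamma> \<in> S" and \<beta>: "\<beta> \<in> P" and r: "\<gamma> + \<beta> \<in> roots H"
  shows "\<gamma> + \<beta> \<in> S"
proof (rule ccontr)
  assume n: "\<gamma> + \<beta> \<notin> S"
  have fS: "finite S" using S finite_D1 by (rule finite_subset)
  have fP: "finite P" using half_systemD[OF P] by blast
  let ?A = "\<Sum>\<gamma>\<in>S. \<Sum>\<beta>\<in>{\<beta>\<in>P. \<gamma> + \<beta> \<notin> S}. cc \<beta> \<gamma>"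
  have s0: "2 * ?A + (\<Sum>\<gamma>\<in>S. \<Sum>\<delta>\<in>S - {\<gamma>}. cc \<delta> \<gamma>) = 0" using eigen_defect[OF P S] eq by simp
  then have "- (2 * ?A) = (\<Sum>\<gamma>\<in>S. \<Sum>\<delta>\<in>S - {\<gamma>}. cc \<delta> \<gamma>)" by (simp add: neg_eq_iff_add_eq_0)
  then have "2 * ?A = 0" using defect_nonneg[OF P S] by (intro nonneg_rats_antisym) auto
  then have A0: "?A = 0" by simp
  have cn: "cc \<beta> \<gamma> \<in> nonneg_rats" if "\<gamma> \<in> S" "\<beta> \<in> P" for \<beta> \<gamma>
    using that S half_systemD(1)[OF P] by (intro cc_D0_D1) auto
  have "(\<Sum>\<beta>\<in>{\<beta>\<in>P. \<gamma> + \<beta> \<notin> S}. cc \<beta> \<gamma>) = 0"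
    using cn by (intro nonneg_rats_sum_eq_0[OF fS _ A0 \<gamma>] nonneg_rats_sum) auto
  then have "cc \<beta> \<gamma> = 0"
    using cn[OF \<gamma>] fP \<beta> n by (intro nonneg_rats_sum_eq_0[of "{\<beta>\<in>P. \<gamma> + \<beta> \<notin> S}" "\<lambda>\<beta>. cc \<beta> \<gamma>"]) auto
  then show False using cc_D0_D1(2)[of \<beta> \<gamma>] half_systemD(1)[OF P \<beta>] S \<gamma> r by auto
qed

section \<open>The sum of the roots of height one\<close>

text \<open>The set \<open>D1\<close> is closed under adding and subtracting the root \<open>\<beta>\<close> of height zero, so by
  \<open>weights_closed_trace\<close> the vector that represents \<open>\<beta>\<close> has trace zero on the degree one part.\<close>
lemma form_sum_D1_Pi:
  assumes "\<beta> \<in> \<Pi>" "\<beta> \<noteq> \<alpha>" shows "form (\<Sum>D1) \<beta> = 0"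
proof -
  have b: "\<beta> \<in> roots H" "\<beta> \<in> D0" "\<beta> \<in> dual_space H"
    using assms Pi_roots by (auto simp: D0_iff ht_Pi Pi_dual)
  have "(\<Sum>\<epsilon>\<in>D1. of_nat (dim (G \<epsilon>)) * \<epsilon> (br (ev \<beta>) (ev (- \<beta>)))) = 0"
  proof (rule weights_closed_trace[OF _ b(3) ev_in[OF b(1)] ev_in[OF roots_neg[OF b(1)]]])
    show "D1 \<subseteq> weights" using D1_root roots_weights by blast
    have wr: "\<epsilon> + \<delta> \<in> D1" if "\<epsilon> \<in> D1" "\<delta> \<in> D0" "\<epsilon> + \<delta> \<in> weights" for \<epsilon> \<delta>
      using that D1_add_nonzero[OF that(1,2)] weights_eq_roots D1_add by blast
    show "\<epsilon> + \<beta> \<in> D1" if "\<epsilon> \<in> D1" "\<epsilon> + \<beta> \<in> weights" for \<epsilon> using wr[OF that(1) b(2) that(2)] .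
    show "\<epsilon> - \<beta> \<in> D1" if "\<epsilon> \<in> D1" "\<epsilon> - \<beta> \<in> weights" for \<epsilon>
      using wr[OF that(1) D0_neg[OF b(2)]] that(2) by simp
  qed
  also have "(\<Sum>\<epsilon>\<in>D1. of_nat (dim (G \<epsilon>)) * \<epsilon> (br (ev \<beta>) (ev (- \<beta>)))) = (\<Sum>\<epsilon>\<in>D1. form \<epsilon> \<beta>)"
    using root_multiples(1)[OF D1_root] b(3) by (intro sum.cong refl) (simp add: br_ev_neg[OF b(1)] form_apply D1_dual)
  finally show ?thesis using b(3) D1_dual by (simp add: form_sum_left)
qed

lemma sum_D1_dual: "\<Sum>D1 \<in> dual_space H"
  by (rule dual_sum) (rule D1_dual)

lemma form_sum_D1:
  assumes "\<mu> \<in> dual_space H" shows "form (\<Sum>D1) \<mu> = ht \<alpha> \<mu> * form (\<Sum>D1) \<alpha>"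
proof -
  have "form (\<Sum>D1) \<mu> = (\<Sum>\<beta>\<in>\<Pi>. ht \<beta> \<mu> * form (\<Sum>D1) \<beta>)"
    using form_expand[OF assms sum_D1_dual] by (simp add: form_sym)
  also have "\<dots> = (\<Sum>\<beta>\<in>{\<alpha>}. ht \<beta> \<mu> * form (\<Sum>D1) \<beta>)"
    using alpha finite_Pi form_sum_D1_Pi by (intro sum.mono_neutral_right) auto
  finally show ?thesis by simp
qed

lemma ht_sum_D1: assumes "S \<subseteq> D1" shows "ht \<alpha> (\<Sum>S) = of_nat (card S)"
proof -
  have "ht \<alpha> (\<Sum>S) = (\<Sum>\<gamma>\<in>S. ht \<alpha> \<gamma>)" using assms D1_dual by (intro ht_sum) auto
  also have "\<dots> = (\<Sum>\<gamma>\<in>S. 1)" using assms by (intro sum.cong refl) (auto simp: D1_iff)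
  finally show ?thesis by simp
qed

text \<open>With \<open>\<sigma> = \<Sum>D1\<close> the complement has the sum \<open>\<sigma> - \<nu>\<close>. The linear terms agree because \<open>\<sigma>\<close>
  is orthogonal to the roots of height zero. The quadratic terms differ by
  \<open>(\<sigma>, \<sigma>) - 2 (\<sigma>, \<nu>)\<close>, and \<open>(\<sigma>, \<mu>)\<close> is the \<open>\<alpha>\<close>-height of \<open>\<mu>\<close> times \<open>(\<sigma>, \<alpha>)\<close>.\<close>
lemma eigen_complement:
  assumes P: "half_system P" and S: "S \<subseteq> D1"
  shows "eigen (uminus ` P) (D1 - S)
    = eigen P S + (of_nat (card D1) - 2 * of_nat (card S)) * form (\<Sum>D1) \<alpha>"
proof -
  let ?\<sigma> = "\<Sum>D1" and ?\<nu> = "\<Sum>S"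
  have \<nu>: "?\<nu> \<in> dual_space H" using S D1_dual by (intro dual_sum) auto
  note \<sigma> = sum_D1_dual
  have T: "\<Sum>(D1 - S) = ?\<sigma> - ?\<nu>" using finite_D1 S by (rule sum_diff)
  have PD: "\<beta> \<in> dual_space H" "ht \<alpha> \<beta> = 0" if "\<beta> \<in> P" for \<beta>
    using half_systemD(1)[OF P that] D0_dual by (auto simp: D0_iff)
  have "(\<Sum>\<beta>\<in>uminus ` P. form \<beta> (?\<sigma> - ?\<nu>)) = (\<Sum>\<beta>\<in>P. form (- \<beta>) (?\<sigma> - ?\<nu>))"
    by (subst sum.reindex) (auto simp: inj_on_def)
  also have "\<dots> = (\<Sum>\<beta>\<in>P. form \<beta> ?\<nu>)"
    using PD form_sum_D1 by (intro sum.cong refl) (simp add: form_neg_left form_diff_right dual_diff \<sigma> \<nu> form_sym[of _ ?\<sigma>])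
  finally have 1: "(\<Sum>\<beta>\<in>uminus ` P. form \<beta> (?\<sigma> - ?\<nu>)) = (\<Sum>\<beta>\<in>P. form \<beta> ?\<nu>)" .
  have "form (?\<sigma> - ?\<nu>) (?\<sigma> - ?\<nu>) = form ?\<nu> ?\<nu> + (form ?\<sigma> ?\<sigma> - 2 * form ?\<sigma> ?\<nu>)"
    using \<sigma> \<nu> by (simp add: form_diff_left form_diff_right dual_diff form_sym[of ?\<nu> ?\<sigma>])
  also have "form ?\<sigma> ?\<sigma> = of_nat (card D1) * form ?\<sigma> \<alpha>" using form_sum_D1[OF \<sigma>] ht_sum_D1[of D1] by simp
  also have "form ?\<sigma> ?\<nu> = of_nat (card S) * form ?\<sigma> \<alpha>" using form_sum_D1[OF \<nu>] ht_sum_D1[OF S] by simp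
  finally have 2: "form (?\<sigma> - ?\<nu>) (?\<sigma> - ?\<nu>) = form ?\<nu> ?\<nu>
      + (of_nat (card D1) * form ?\<sigma> \<alpha> - 2 * (of_nat (card S) * form ?\<sigma> \<alpha>))" .
  show ?thesis unfolding eigen_def T 1 2 by (simp add: ring_distribs)
qed

text \<open>Otherwise the sum would be orthogonal to the base and hence zero, but its \<open>\<alpha>\<close>-height
  is the number of roots in \<open>D1\<close>.\<close>
lemma form_sum_D1_alpha_nonzero: "form (\<Sum>D1) \<alpha> \<noteq> 0"
proof
  assume "form (\<Sum>D1) \<alpha> = 0"
  then have "\<Sum>D1 = 0"
    using form_sum_D1[OF Pi_dual] by (intro form_nondegenerate[OF sum_D1_dual]) simp
  then have "of_nat (card D1) = (0::'k)" using ht_sum_D1[of D1] ht_zero by simp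
  then show False using alpha_D1 finite_D1 by auto
qed

text \<open>The sum of \<open>D1\<close> is orthogonal to the simple roots other than \<open>\<alpha>\<close>, so it is
  proportional to the fundamental weight.\<close>
lemma fund_weight: "fund_weight \<alpha> = fun_scale (form \<alpha> \<alpha> / (2 * form (\<Sum>D1) \<alpha>)) (\<Sum>D1)"
  (is "_ = ?\<phi>")
  unfolding fund_weight_def
proof (rule the_equality)
  have d: "?\<phi> \<in> dual_space H" by (rule dual_scale[OF sum_D1_dual])
  have f: "2 * form ?\<phi> \<beta> / form \<beta> \<beta> = (if \<beta> = \<alpha> then 1 else 0)" if "\<beta> \<in> \<Pi>" for \<beta>
  proof -
    have "form ?\<phi> \<beta> = form \<alpha> \<alpha> / (2 * form (\<Sum>D1) \<alpha>) * form (\<Sum>D1) \<beta>"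
      by (rule form_scale_left[OF sum_D1_dual Pi_dual[OF that]])
    then show ?thesis
      using form_sum_D1_alpha_nonzero form_root_nonzero[OF alpha_root] form_sum_D1_Pi[OF that] by auto
  qed
  show "?\<phi> \<in> dual_space H \<and> (\<forall>\<beta>\<in>\<Pi>. 2 * form ?\<phi> \<beta> / form \<beta> \<beta> = (if \<beta> = \<alpha> then 1 else 0))" using d f by blast
  fix \<psi> assume p: "\<psi> \<in> dual_space H \<and> (\<forall>\<beta>\<in>\<Pi>. 2 * form \<psi> \<beta> / form \<beta> \<beta> = (if \<beta> = \<alpha> then 1 else 0))"
  have "\<psi> - ?\<phi> = 0"
  proof (rule form_nondegenerate)
    show "\<psi> - ?\<phi> \<in> dual_space H" using p d dual_diff by blast
    fix \<beta> assume b: "\<beta> \<in> \<Pi>"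
    have n: "form \<beta> \<beta> \<noteq> 0" using form_root_nonzero b Pi_roots by blast
    have "2 * form \<psi> \<beta> / form \<beta> \<beta> = 2 * form ?\<phi> \<beta> / form \<beta> \<beta>" using p f[OF b] b by simp
    then have "form \<psi> \<beta> = form ?\<phi> \<beta>" using n by simp
    then show "form (\<psi> - ?\<phi>) \<beta> = 0" using form_diff_left[of \<psi> ?\<phi> \<beta>] p d Pi_dual[OF b] by simp
  qed
  then show "\<psi> = ?\<phi>" by simp
qed

text \<open>The numbers \<open>2 (\<gamma>, \<alpha>) / (\<alpha>, \<alpha>)\<close> are integers, so their sum over \<open>D1\<close> is the integer
  that the definition of \<open>q1\<close> describes.\<close>
lemma q1: "of_int (q1 \<alpha>) = 2 * form (\<Sum>D1) \<alpha> / form \<alpha> \<alpha>"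
proof -
  let ?s = "form (\<Sum>D1) \<alpha>" and ?a = "form \<alpha> \<alpha>"
  have n: "?s \<noteq> 0" "?a \<noteq> 0" using form_sum_D1_alpha_nonzero form_root_nonzero[OF alpha_root] by auto
  have "\<forall>\<gamma>\<in>D1. \<exists>n::int. 2 * form \<gamma> \<alpha> / ?a = of_int n" using root_integral[OF alpha_root D1_root] by blast
  from bchoice[OF this] obtain z :: "('v \<Rightarrow> 'k) \<Rightarrow> int" where z: "\<And>\<gamma>. \<gamma> \<in> D1 \<Longrightarrow> 2 * form \<gamma> \<alpha> / ?a = of_int (z \<gamma>)" by blast
  have "2 * ?s / ?a = (\<Sum>\<gamma>\<in>D1. 2 * form \<gamma> \<alpha> / ?a)"
    using D1_dual alpha_root roots_dual by (simp add: form_sum_left sum_distrib_left sum_divide_distrib)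
  also have "\<dots> = of_int (\<Sum>\<gamma>\<in>D1. z \<gamma>)" by (simp add: z)
  finally have s: "2 * ?s / ?a = of_int (\<Sum>\<gamma>\<in>D1. z \<gamma>)" .
  have sc: "fun_scale c (fund_weight \<alpha>) = fun_scale (c * ?a / (2 * ?s)) (\<Sum>D1)" for c
    unfolding fund_weight by (simp add: fun_scale_def mult.assoc)
  have s1: "fun_scale 1 (\<Sum>D1) = \<Sum>D1" by (simp add: fun_scale_def)
  have ne: "\<exists>h. (\<Sum>D1) h \<noteq> 0"
  proof (rule ccontr)
    assume "\<not> ?thesis"
    then have "\<Sum>D1 = 0" by (simp add: fun_eq_iff)
    then show False using n(1) form_zero_left[OF roots_dual[OF alpha_root]] by simp
  qed
  have "q1 \<alpha> = (\<Sum>\<gamma>\<in>D1. z \<gamma>)"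
    unfolding q1_def
  proof (rule the_equality)
    have "of_int (\<Sum>\<gamma>\<in>D1. z \<gamma>) * ?a / (2 * ?s) = 1" using n by (simp add: s[symmetric] del: of_int_sum)
    then show "\<Sum>D1 = fun_scale (of_int (\<Sum>\<gamma>\<in>D1. z \<gamma>)) (fund_weight \<alpha>)" unfolding sc using s1 by simp
    fix q assume q: "\<Sum>D1 = fun_scale (of_int q) (fund_weight \<alpha>)"
    obtain h where h: "(\<Sum>D1) h \<noteq> 0" using ne by blast
    have "(\<Sum>D1) h = of_int q * ?a / (2 * ?s) * (\<Sum>D1) h" using q unfolding sc by (metis fun_scale_def)
    then have "of_int q * ?a / (2 * ?s) = 1" using h n by (cases "q = 0") (simp_all add: field_simps)
    then have "of_int q = 2 * ?s / ?a" using n by (simp add: field_simps)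
    then show "q = (\<Sum>\<gamma>\<in>D1. z \<gamma>)" unfolding s by (simp only: of_int_eq_iff)
  qed
  then show ?thesis using s by simp
qed

lemma q1_constant: "of_int (q1 \<alpha>) / (2 * dual_coxeter * root_ratio \<alpha>) = form (\<Sum>D1) \<alpha>"
proof -
  have "2 * dual_coxeter * root_ratio \<alpha> = 2 / form \<alpha> \<alpha>"
    using dual_coxeter_root_ratio[OF alpha_root] by (simp add: mult.assoc)
  then show ?thesis using form_root_nonzero[OF alpha_root] by (simp add: q1)
qed

end

section \<open>Exterior powers\<close>

lemma free_extend_superset:
  fixes p :: "'v list \<Rightarrow>\<^sub>0 'k::field"
  assumes "finite A" "Poly_Mapping.keys p \<subseteq> A"
  shows "free_extend g p = (\<Sum>w\<in>A. free_scale (Poly_Mapping.lookup p w) (g w))"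
  unfolding free_extend_def using assms
  by (intro sum.mono_neutral_left) (auto simp: in_keys_iff)

lemma free_extend_linear:
  fixes g :: "'v list \<Rightarrow> ('v list \<Rightarrow>\<^sub>0 'k::field)"
  shows "Vector_Spaces.linear free_scale free_scale (free_extend g)"
proof (rule linI)
  show "vector_space free_scale" "vector_space free_scale" by (rule free_space.vector_space_axioms)+
  fix p q :: "'v list \<Rightarrow>\<^sub>0 'k" and c :: 'k
  let ?A = "Poly_Mapping.keys p \<union> Poly_Mapping.keys q"
  have "Poly_Mapping.keys (p + q) \<subseteq> ?A" by (rule Poly_Mapping.keys_add)
  then show "free_extend g (p + q) = free_extend g p + free_extend g q"
    by (simp add: free_extend_superset[of ?A] Poly_Mapping.lookup_add free_space.scale_left_distrib sum.distrib)
  have "Poly_Mapping.keys (free_scale c p) \<subseteq> Poly_Mapping.keys p"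
    by (auto simp: in_keys_iff lookup_free_scale)
  then show "free_extend g (free_scale c p) = free_scale c (free_extend g p)"
    by (simp add: free_extend_superset[of "Poly_Mapping.keys p"] lookup_free_scale free_space.scale_sum_right)
qed

lemma free_extend_word: "free_extend g (word w) = (g w :: 'v list \<Rightarrow>\<^sub>0 'k::field)"
  by (simp add: free_extend_superset[of "{w}"])

lemma distinct_update_nth: "i < length w \<Longrightarrow> j < length w \<Longrightarrow> i \<noteq> j \<Longrightarrow> \<not> distinct (w[i := a, j := a])"
  by (simp add: distinct_conv_nth) (metis length_list_update nth_list_update)

context lie_algebra
begin

lemma tuples_update: "w \<in> tuples k V \<Longrightarrow> a \<in> V \<Longrightarrow> w[i := a] \<in> tuples k V"
  by (auto simp: tuples_def dest: set_update_subset_insert[THEN subsetD])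

lemma tuples_nth: "w \<in> tuples k V \<Longrightarrow> i < k \<Longrightarrow> w ! i \<in> V"
  by (auto simp: tuples_def)

lemma tuples_length: "w \<in> tuples k V \<Longrightarrow> length w = k"
  by (simp add: tuples_def)

end

text \<open>The quotient \<open>\<Lambda>\<^sup>kV\<close> is realised inside the free vector space as the image \<open>X\<close> of a
  linear projection \<open>cl\<close> whose kernel consists of the relations. The class of a word \<open>w\<close> is
  \<open>om w\<close>, and \<open>rho x\<close> is the induced action of \<open>x\<close>.\<close>
locale exterior_power = lie_algebra scale br
  for scale :: "'k::field_char_0 \<Rightarrow> 'v::ab_group_add \<Rightarrow> 'v" and br :: "'v \<Rightarrow> 'v \<Rightarrow> 'v" +
  fixes V :: "'v set" and k :: nat
  assumes subspace_V: "subspace V"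
begin

definition rel_proj :: "('v list \<Rightarrow>\<^sub>0 'k) \<Rightarrow> ('v list \<Rightarrow>\<^sub>0 'k)" where
  "rel_proj = (SOME P. Vector_Spaces.linear free_scale free_scale P \<and> (\<forall>p. P p \<in> wedge_rel k V) \<and>
     (\<forall>p\<in>wedge_rel k V. P p = p))"

definition cl :: "('v list \<Rightarrow>\<^sub>0 'k) \<Rightarrow> ('v list \<Rightarrow>\<^sub>0 'k)" where
  "cl p = p - rel_proj p"

definition om :: "'v list \<Rightarrow> ('v list \<Rightarrow>\<^sub>0 'k)" where
  "om w = cl (word w)"

definition rho :: "'v \<Rightarrow> ('v list \<Rightarrow>\<^sub>0 'k) \<Rightarrow> ('v list \<Rightarrow>\<^sub>0 'k)" where
  "rho x v = cl (wedge_act x v)"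

definition X :: "('v list \<Rightarrow>\<^sub>0 'k) set" where
  "X = free_space.span (om ` tuples k V)"

definition stabilizer :: "'v set" where
  "stabilizer = {x. \<forall>v\<in>V. br x v \<in> V}"

lemma subspace_rel: "free_space.subspace (wedge_rel k V)"
  unfolding wedge_rel_def by (rule free_space.subspace_span)

lemma rel_proj: "Vector_Spaces.linear free_scale free_scale rel_proj" "rel_proj p \<in> wedge_rel k V"
  "p \<in> wedge_rel k V \<Longrightarrow> rel_proj p = p"
proof -
  have "\<exists>P. Vector_Spaces.linear free_scale free_scale P \<and> (\<forall>p. P p \<in> wedge_rel k V) \<and> (\<forall>p\<in>wedge_rel k V. P p = p)"
    using free_space.subspace_projection[OF subspace_rel] by metis
  from someI_ex[OF this, folded rel_proj_def]
  show "Vector_Spaces.linear free_scale free_scale rel_proj" "rel_proj p \<in> wedge_rel k V"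
    "p \<in> wedge_rel k V \<Longrightarrow> rel_proj p = p" by blast+
qed

lemma cl_linear: "Vector_Spaces.linear free_scale free_scale cl"
  by (rule linI) (auto simp: cl_def lin_add[OF rel_proj(1)] lin_scale[OF rel_proj(1)] free_space.scale_right_diff_distrib
      intro: free_space.vector_space_axioms)

lemma cl_eq_0_iff: "cl p = 0 \<longleftrightarrow> p \<in> wedge_rel k V"
  using rel_proj(2)[of p] rel_proj(3)[of p] by (auto simp: cl_def)

lemma diff_cl_rel: "p - cl p \<in> wedge_rel k V"
  using rel_proj(2)[of p] by (simp add: cl_def)

lemma om_add: "w \<in> tuples k V \<Longrightarrow> i < k \<Longrightarrow> a \<in> V \<Longrightarrow> b \<in> V \<Longrightarrow> om (w[i := a + b]) = om (w[i := a]) + om (w[i := b])"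
proof -
  assume "w \<in> tuples k V" "i < k" "a \<in> V" "b \<in> V"
  then have "word (w[i := a + b]) - word (w[i := a]) - word (w[i := b]) \<in> wedge_rel k V"
    unfolding wedge_rel_def by (intro free_space.span_base) blast
  then have "cl (word (w[i := a + b]) - word (w[i := a]) - word (w[i := b])) = 0" by (simp add: cl_eq_0_iff)
  then show ?thesis unfolding om_def lin_diff[OF cl_linear] by (simp add: algebra_simps)
qed

lemma om_scale: "w \<in> tuples k V \<Longrightarrow> i < k \<Longrightarrow> a \<in> V \<Longrightarrow> om (w[i := scale c a]) = free_scale c (om (w[i := a]))"
proof -
  assume "w \<in> tuples k V" "i < k" "a \<in> V"
  then have "word (w[i := scale c a]) - free_scale c (word (w[i := a])) \<in> wedge_rel k V"
    unfolding wedge_rel_def by (intro free_space.span_base) blast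
  then have "cl (word (w[i := scale c a]) - free_scale c (word (w[i := a]))) = 0" by (simp add: cl_eq_0_iff)
  then show ?thesis by (simp add: om_def lin_diff[OF cl_linear] lin_scale[OF cl_linear])
qed

lemma om_not_distinct: "w \<in> tuples k V \<Longrightarrow> \<not> distinct w \<Longrightarrow> om w = 0"
  unfolding om_def cl_eq_0_iff wedge_rel_def by (rule free_space.span_base) blast

lemma om_zero: "w \<in> tuples k V \<Longrightarrow> i < k \<Longrightarrow> om (w[i := 0]) = 0"
  using om_scale[of w i 0 0] subspace_0[OF subspace_V] by simp

lemma om_sum:
  assumes w: "w \<in> tuples k V" "i < k" and f: "\<And>j. j \<in> J \<Longrightarrow> f j \<in> V"
  shows "om (w[i := \<Sum>j\<in>J. f j]) = (\<Sum>j\<in>J. om (w[i := f j]))"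
  using f
proof (induction J rule: infinite_finite_induct)
  case (insert j J)
  then have "f j \<in> V" "sum f J \<in> V" by (auto intro: subspace_sum[OF subspace_V])
  then show ?case using om_add[OF w, of "f j" "sum f J"] insert by simp
qed (simp_all add: om_zero w)

lemma om_swap:
  assumes w: "w \<in> tuples k V" and ij: "i < k" "j < k" "i \<noteq> j" and ab: "a \<in> V" "b \<in> V"
  shows "om (w[i := a, j := b]) = - om (w[i := b, j := a])"
proof -
  have l: "length w = k" using w by (rule tuples_length)
  have z: "om (w[i := c, j := c]) = 0" if "c \<in> V" for c
    using that w ij l by (intro om_not_distinct tuples_update distinct_update_nth) auto
  have abV: "a + b \<in> V" using ab subspace_V by (rule_tac subspace_add)
  have j1: "om (w[i := c, j := a + b]) = om (w[i := c, j := a]) + om (w[i := c, j := b])" if "c \<in> V" for c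
    using that w ij ab by (intro om_add tuples_update)
  have i1: "om (w[i := a + b, j := c]) = om (w[i := a, j := c]) + om (w[i := b, j := c])" if "c \<in> V" for c
    using om_add[OF tuples_update[OF w that, of j] ij(1) ab] ij(3) by (simp add: list_update_swap)
  have "0 = om (w[i := a + b, j := a + b])" using z[OF abV] by simp
  also have "\<dots> = om (w[i := a, j := a + b]) + om (w[i := b, j := a + b])" by (rule i1[OF abV])
  also have "\<dots> = om (w[i := a, j := b]) + om (w[i := b, j := a])"
    unfolding j1[OF ab(1)] j1[OF ab(2)] z[OF ab(1)] z[OF ab(2)] by simp
  finally show ?thesis by (simp add: eq_neg_iff_add_eq_0)
qed

lemma wedge_act_linear: "Vector_Spaces.linear free_scale free_scale (wedge_act x)"
  unfolding wedge_act_def by (rule free_extend_linear)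

lemma cl_act_word:
  "w \<in> tuples k V \<Longrightarrow> cl (wedge_act x (word w)) = (\<Sum>i<k. om (w[i := br x (w ! i)]))"
  by (simp add: wedge_act_def free_extend_word tuples_length lin_sum[OF cl_linear] om_def)

lemma cl_act_update:
  assumes w: "w \<in> tuples k V" "i < k" and a: "a \<in> V"
  shows "cl (wedge_act x (word (w[i := a])))
    = om (w[i := br x a]) + (\<Sum>j\<in>{..<k} - {i}. om (w[j := br x (w ! j), i := a]))"
proof -
  have l: "length w = k" using w(1) by (rule tuples_length)
  have "cl (wedge_act x (word (w[i := a]))) = (\<Sum>j<k. om (w[i := a, j := br x (w[i := a] ! j)]))"
    by (rule cl_act_word[OF tuples_update[OF w(1) a]])
  also have "\<dots> = om (w[i := a, i := br x (w[i := a] ! i)]) + (\<Sum>j\<in>{..<k} - {i}. om (w[i := a, j := br x (w[i := a] ! j)]))"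
    using w(2) by (intro sum.remove) auto
  also have "w[i := a, i := br x (w[i := a] ! i)] = w[i := br x a]" using w(2) l by simp
  also have "(\<Sum>j\<in>{..<k} - {i}. om (w[i := a, j := br x (w[i := a] ! j)]))
      = (\<Sum>j\<in>{..<k} - {i}. om (w[j := br x (w ! j), i := a]))"
    by (intro sum.cong refl) (auto simp: list_update_swap)
  finally show ?thesis .
qed

text \<open>The three kinds of relations are treated separately. For a word with equal entries at
  the positions \<open>p\<close> and \<open>q\<close> only the terms in which \<open>x\<close> acts at \<open>p\<close> or at \<open>q\<close> survive, and
  these two cancel by \<open>om_swap\<close>.\<close>
lemma act_rel:
  assumes x: "x \<in> stabilizer" and p: "p \<in> wedge_rel k V" shows "cl (wedge_act x p) = 0"
proof -
  have xV: "br x v \<in> V" if "v \<in> V" for v using x that by (simp add: stabilizer_def)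
  let ?A = "\<lambda>p. cl (wedge_act x p)"
  have A: "Vector_Spaces.linear free_scale free_scale ?A" by (rule lin_comp[OF wedge_act_linear cl_linear])
  have sub: "free_space.subspace {p. ?A p = 0}"
    by (auto simp: free_space.subspace_def lin_zero[OF A] lin_add[OF A] lin_scale[OF A])
  have up: "w[j := br x (w ! j)] \<in> tuples k V" if "w \<in> tuples k V" "j < k" for w j
    using that by (intro tuples_update xV tuples_nth)
  have g1: "?A (word (w[i := a + b]) - word (w[i := a]) - word (w[i := b])) = 0"
    if w: "w \<in> tuples k V" "i < k" "a \<in> V" "b \<in> V" for w i a b
  proof -
    have ab: "a + b \<in> V" using w subspace_V by (auto intro: subspace_add)
    have "(\<Sum>j\<in>{..<k} - {i}. om (w[j := br x (w ! j), i := a + b]))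
      = (\<Sum>j\<in>{..<k} - {i}. om (w[j := br x (w ! j), i := a])) + (\<Sum>j\<in>{..<k} - {i}. om (w[j := br x (w ! j), i := b]))"
      unfolding sum.distrib[symmetric] using w up by (intro sum.cong refl om_add) auto
    moreover have "om (w[i := br x (a + b)]) = om (w[i := br x a]) + om (w[i := br x b])"
      unfolding br_add_right using w xV by (intro om_add)
    ultimately show ?thesis
      unfolding lin_diff[OF A] cl_act_update[OF w(1,2,3)] cl_act_update[OF w(1,2,4)] cl_act_update[OF w(1,2) ab] by simp
  qed
  have g2: "?A (word (w[i := scale c a]) - free_scale c (word (w[i := a]))) = 0"
    if w: "w \<in> tuples k V" "i < k" "a \<in> V" for w i a c
  proof -
    have ca: "scale c a \<in> V" using w subspace_V by (auto intro: subspace_scale)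
    have "(\<Sum>j\<in>{..<k} - {i}. om (w[j := br x (w ! j), i := scale c a]))
      = free_scale c (\<Sum>j\<in>{..<k} - {i}. om (w[j := br x (w ! j), i := a]))"
      unfolding free_space.scale_sum_right using w up by (intro sum.cong refl om_scale) auto
    moreover have "om (w[i := br x (scale c a)]) = free_scale c (om (w[i := br x a]))"
      unfolding br_scale_right using w xV by (intro om_scale)
    ultimately show ?thesis
      unfolding lin_diff[OF A] lin_scale[OF A] cl_act_update[OF w(1,2,3)] cl_act_update[OF w(1,2) ca]
      by (simp add: free_space.scale_right_distrib)
  qed
  have g3: "?A (word w) = 0" if w: "w \<in> tuples k V" "\<not> distinct w" for w
  proof -
    have l: "length w = k" using w(1) by (rule tuples_length)
    then obtain p q where pq: "p < k" "q < k" "p \<noteq> q" "w ! p = w ! q" using w(2) by (auto simp: distinct_conv_nth)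
    have "om (w[j := br x (w ! j)]) = 0" if j: "j < k" "j \<noteq> p" "j \<noteq> q" for j
    proof (rule om_not_distinct[OF up[OF w(1) j(1)]])
      have "w[j := br x (w ! j)] ! p = w[j := br x (w ! j)] ! q" using j pq by simp
      then show "\<not> distinct (w[j := br x (w ! j)])" using pq(1-3) l by (auto simp: distinct_conv_nth)
    qed
    then have "?A (word w) = (\<Sum>j\<in>{p, q}. om (w[j := br x (w ! j)]))"
      unfolding cl_act_word[OF w(1)] using pq by (intro sum.mono_neutral_right) auto
    also have "\<dots> = om (w[p := br x (w ! p)]) + om (w[q := br x (w ! p)])" using pq by simp
    also have "w[q := br x (w ! p)] = w[p := w ! p, q := br x (w ! p)]" by simp
    also have "om \<dots> = - om (w[p := br x (w ! p), q := w ! p])"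
      by (rule om_swap[OF w(1) pq(1-3) tuples_nth[OF w(1) pq(1)] xV[OF tuples_nth[OF w(1) pq(1)]]])
    also have "w[p := br x (w ! p), q := w ! p] = w[p := br x (w ! p)]"
      using pq by (simp add: list_update_swap)
    finally show ?thesis by simp
  qed
  have "wedge_rel k V \<subseteq> {p. ?A p = 0}"
    unfolding wedge_rel_def using g1 g2 g3 by (intro free_space.span_minimal[OF _ sub]) auto
  then show ?thesis using p by blast
qed

lemma rho_cl: "x \<in> stabilizer \<Longrightarrow> rho x (cl p) = cl (wedge_act x p)"
proof -
  assume "x \<in> stabilizer"
  then have "cl (wedge_act x (p - cl p)) = 0" using diff_cl_rel by (rule act_rel)
  then show ?thesis by (simp add: rho_def lin_diff[OF wedge_act_linear] lin_diff[OF cl_linear])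
qed

lemma rho_om: "x \<in> stabilizer \<Longrightarrow> w \<in> tuples k V \<Longrightarrow> rho x (om w) = (\<Sum>i<k. om (w[i := br x (w ! i)]))"
  unfolding om_def[of w] by (simp add: rho_cl cl_act_word)

lemma rho_linear: "Vector_Spaces.linear free_scale free_scale (rho x)"
  unfolding rho_def[abs_def] by (rule lin_comp[OF wedge_act_linear cl_linear])

lemma subspace_X: "free_space.subspace X"
  unfolding X_def by (rule free_space.subspace_span)

lemma om_X: "w \<in> tuples k V \<Longrightarrow> om w \<in> X"
  unfolding X_def by (rule free_space.span_base) blast

lemma X_eq: "X = cl ` wedge_free k V"
proof -
  have "om ` tuples k V = cl ` (word ` tuples k V)" by (auto simp: om_def image_image)
  then show ?thesis
    unfolding X_def wedge_free_def
    using module_hom.span_image[OF iffD2[OF module_hom_iff_linear cl_linear]] by simp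
qed

lemma linear_eq_on_X:
  assumes "Vector_Spaces.linear free_scale free_scale f" "Vector_Spaces.linear free_scale free_scale g"
    "\<And>w. w \<in> tuples k V \<Longrightarrow> f (om w) = g (om w)" "v \<in> X"
  shows "f v = g v"
proof -
  have "free_space.subspace {v. f v = g v}"
    by (auto simp: free_space.subspace_def lin_zero[OF assms(1)] lin_zero[OF assms(2)] lin_add[OF assms(1)]
        lin_add[OF assms(2)] lin_scale[OF assms(1)] lin_scale[OF assms(2)])
  then have "X \<subseteq> {v. f v = g v}" unfolding X_def using assms(3) by (intro free_space.span_minimal) auto
  then show ?thesis using assms(4) by blast
qed

lemma stabilizer_nth: "x \<in> stabilizer \<Longrightarrow> w \<in> tuples k V \<Longrightarrow> i < k \<Longrightarrow> br x (w ! i) \<in> V"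
  using tuples_nth by (auto simp: stabilizer_def)

lemma rho_X: assumes "x \<in> stabilizer" "v \<in> X" shows "rho x v \<in> X"
proof -
  have "free_space.subspace {v. rho x v \<in> X}"
    using subspace_X by (auto simp: free_space.subspace_def lin_zero[OF rho_linear] lin_add[OF rho_linear] lin_scale[OF rho_linear])
  moreover have "rho x (om w) \<in> X" if "w \<in> tuples k V" for w
    unfolding rho_om[OF assms(1) that] using that assms(1)
    by (intro free_space.subspace_sum[OF subspace_X] om_X tuples_update stabilizer_nth) auto
  ultimately have "X \<subseteq> {v. rho x v \<in> X}" unfolding X_def[of]
    by (intro free_space.span_minimal) (auto simp: X_def[symmetric])
  then show ?thesis using assms(2) by blast
qed

lemma stabilizer_closed:
  "x \<in> stabilizer \<Longrightarrow> y \<in> stabilizer \<Longrightarrow> x + y \<in> stabilizer" "x \<in> stabilizer \<Longrightarrow> scale c x \<in> stabilizer"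
  "x \<in> stabilizer \<Longrightarrow> y \<in> stabilizer \<Longrightarrow> br x y \<in> stabilizer" "0 \<in> stabilizer"
  using subspace_V
  by (auto simp: stabilizer_def br_linear br_br_left subspace_0 intro: subspace_add subspace_scale subspace_diff)

lemma rho_add_left:
  assumes "x \<in> stabilizer" "y \<in> stabilizer" "v \<in> X" shows "rho (x + y) v = rho x v + rho y v"
proof (rule linear_eq_on_X[OF rho_linear _ _ assms(3)])
  show "Vector_Spaces.linear free_scale free_scale (\<lambda>v. rho x v + rho y v)"
    by (rule linI) (auto simp: lin_add[OF rho_linear] lin_scale[OF rho_linear] free_space.scale_right_distrib intro: free_space.vector_space_axioms)
  fix w assume w: "w \<in> tuples k V"
  show "rho (x + y) (om w) = rho x (om w) + rho y (om w)"
    unfolding rho_om[OF assms(1) w] rho_om[OF assms(2) w] rho_om[OF stabilizer_closed(1)[OF assms(1,2)] w] sum.distrib[symmetric]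
    using w assms stabilizer_nth by (intro sum.cong refl) (simp add: br_add_left om_add)
qed

lemma rho_scale_left:
  assumes "x \<in> stabilizer" "v \<in> X" shows "rho (scale c x) v = free_scale c (rho x v)"
proof (rule linear_eq_on_X[OF rho_linear _ _ assms(2)])
  show "Vector_Spaces.linear free_scale free_scale (\<lambda>v. free_scale c (rho x v))"
    by (rule linI) (auto simp: lin_add[OF rho_linear] lin_scale[OF rho_linear] free_space.scale_right_distrib mult.commute intro: free_space.vector_space_axioms)
  fix w assume w: "w \<in> tuples k V"
  show "rho (scale c x) (om w) = free_scale c (rho x (om w))"
    unfolding rho_om[OF assms(1) w] rho_om[OF stabilizer_closed(2)[OF assms(1)] w] free_space.scale_sum_right
    using w assms stabilizer_nth by (intro sum.cong refl) (simp add: br_scale_left om_scale)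
qed

text \<open>The first sum collects the terms in which both elements act on the same factor, the
  second one the mixed terms.\<close>
lemma rho_rho_om:
  assumes x: "x \<in> stabilizer" and y: "y \<in> stabilizer" and w: "w \<in> tuples k V"
  shows "rho x (rho y (om w)) = (\<Sum>i<k. om (w[i := br x (br y (w ! i))]))
    + (\<Sum>i<k. \<Sum>j\<in>{..<k} - {i}. om (w[i := br y (w ! i), j := br x (w ! j)]))"
proof -
  have l: "length w = k" using w by (rule tuples_length)
  have "rho x (rho y (om w)) = (\<Sum>i<k. rho x (om (w[i := br y (w ! i)])))"
    unfolding rho_om[OF y w] by (rule lin_sum[OF rho_linear])
  also have "\<dots> = (\<Sum>i<k. om (w[i := br x (br y (w ! i))])
      + (\<Sum>j\<in>{..<k} - {i}. om (w[i := br y (w ! i), j := br x (w ! j)])))"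
  proof (rule sum.cong[OF refl])
    fix i assume i: "i \<in> {..<k}"
    let ?w = "w[i := br y (w ! i)]"
    have t: "?w \<in> tuples k V" using w y i by (intro tuples_update stabilizer_nth) auto
    have "rho x (om ?w) = (\<Sum>j<k. om (?w[j := br x (?w ! j)]))" by (rule rho_om[OF x t])
    also have "\<dots> = om (?w[i := br x (?w ! i)]) + (\<Sum>j\<in>{..<k} - {i}. om (?w[j := br x (?w ! j)]))"
      using i by (intro sum.remove) auto
    also have "?w[i := br x (?w ! i)] = w[i := br x (br y (w ! i))]" using i l by simp
    also have "(\<Sum>j\<in>{..<k} - {i}. om (?w[j := br x (?w ! j)]))
        = (\<Sum>j\<in>{..<k} - {i}. om (w[i := br y (w ! i), j := br x (w ! j)]))"
      by (intro sum.cong refl) auto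
    finally show "rho x (om ?w) = om (w[i := br x (br y (w ! i))])
      + (\<Sum>j\<in>{..<k} - {i}. om (w[i := br y (w ! i), j := br x (w ! j)]))" .
  qed
  finally show ?thesis by (simp add: sum.distrib)
qed

text \<open>The mixed terms of \<open>rho_rho_om\<close> are symmetric in \<open>x\<close> and \<open>y\<close> and cancel in the
  commutator.\<close>
lemma rho_br:
  assumes x: "x \<in> stabilizer" and y: "y \<in> stabilizer" and v: "v \<in> X"
  shows "rho (br x y) v = rho x (rho y v) - rho y (rho x v)"
proof (rule linear_eq_on_X[OF rho_linear _ _ v])
  show "Vector_Spaces.linear free_scale free_scale (\<lambda>v. rho x (rho y v) - rho y (rho x v))"
    by (rule linI) (auto simp: lin_add[OF rho_linear] lin_scale[OF rho_linear] free_space.scale_right_diff_distrib intro: free_space.vector_space_axioms)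
  fix w assume w: "w \<in> tuples k V"
  have "(\<Sum>i<k. \<Sum>j\<in>{..<k} - {i}. om (w[i := br y (w ! i), j := br x (w ! j)]))
      = (\<Sum>(i, j)\<in>(SIGMA i:{..<k}. {..<k} - {i}). om (w[i := br y (w ! i), j := br x (w ! j)]))"
    by (simp add: sum.Sigma)
  also have "\<dots> = (\<Sum>(i, j)\<in>(SIGMA i:{..<k}. {..<k} - {i}). om (w[i := br x (w ! i), j := br y (w ! j)]))"
    by (rule sum.reindex_bij_witness[of _ prod.swap prod.swap]) (auto intro!: arg_cong[where f = om] list_update_swap)
  also have "\<dots> = (\<Sum>i<k. \<Sum>j\<in>{..<k} - {i}. om (w[i := br x (w ! i), j := br y (w ! j)]))"
    by (simp add: sum.Sigma)
  finally have cross: "(\<Sum>i<k. \<Sum>j\<in>{..<k} - {i}. om (w[i := br y (w ! i), j := br x (w ! j)]))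
      = (\<Sum>i<k. \<Sum>j\<in>{..<k} - {i}. om (w[i := br x (w ! i), j := br y (w ! j)]))" .
  have "rho (br x y) (om w) = (\<Sum>i<k. om (w[i := br x (br y (w ! i)) - br y (br x (w ! i))]))"
    unfolding rho_om[OF stabilizer_closed(3)[OF x y] w] br_br_left ..
  also have "\<dots> = (\<Sum>i<k. om (w[i := br x (br y (w ! i))]) - om (w[i := br y (br x (w ! i))]))"
  proof (rule sum.cong[OF refl])
    fix i assume i: "i \<in> {..<k}"
    have ab: "br x (br y (w ! i)) \<in> V" "br y (br x (w ! i)) \<in> V"
      using x y stabilizer_nth[OF x w] stabilizer_nth[OF y w] i by (auto simp: stabilizer_def)
    have "om (w[i := (br x (br y (w ! i)) - br y (br x (w ! i))) + br y (br x (w ! i))])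
        = om (w[i := br x (br y (w ! i)) - br y (br x (w ! i))]) + om (w[i := br y (br x (w ! i))])"
      using w i ab subspace_V by (intro om_add subspace_diff) auto
    then show "om (w[i := br x (br y (w ! i)) - br y (br x (w ! i))]) = om (w[i := br x (br y (w ! i))]) - om (w[i := br y (br x (w ! i))])"
      by simp
  qed
  finally show "rho (br x y) (om w) = rho x (rho y (om w)) - rho y (rho x (om w))"
    unfolding rho_rho_om[OF x y w] rho_rho_om[OF y x w] cross by (simp add: sum_subtractf)
qed

text \<open>Multilinearity replaces the entries of a word by elements of \<open>E\<close> one position at a
  time.\<close>
lemma X_spanned:
  assumes E: "V = span E"
  shows "X = free_space.span (om ` tuples k E)"
proof
  have EV: "E \<subseteq> V" using E span_superset by blast
  then have "tuples k E \<subseteq> tuples k V" by (auto simp: tuples_def)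
  then show "free_space.span (om ` tuples k E) \<subseteq> X" unfolding X_def by (intro free_space.span_mono image_mono)
  let ?Z = "free_space.span (om ` tuples k E)"
  have "om w \<in> ?Z" if "w \<in> tuples k V" "\<forall>i<k. n \<le> i \<longrightarrow> w ! i \<in> E" "n \<le> k" for w n
    using that
  proof (induction n arbitrary: w)
    case 0
    then have "w \<in> tuples k E" by (auto simp: tuples_def in_set_conv_nth)
    then show ?case by (intro free_space.span_base) blast
  next
    case (Suc n)
    have n: "n < k" using Suc.prems by simp
    have "a \<in> V \<and> om (w[n := a]) \<in> ?Z" if "a \<in> span E" for a
      using that
    proof (induction rule: span_induct_alt)
      case base
      then show ?case using om_zero[OF Suc.prems(1) n] subspace_0[OF subspace_V] free_space.span_zero by simp
    next
      case (step c x y)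
      have xV: "x \<in> V" "scale c x \<in> V" using step(1) EV subspace_V by (auto intro: subspace_scale)
      have "om (w[n := x]) \<in> ?Z"
      proof (rule Suc.IH)
        show "w[n := x] \<in> tuples k V" using Suc.prems(1) xV by (intro tuples_update)
        show "\<forall>i<k. n \<le> i \<longrightarrow> w[n := x] ! i \<in> E"
          using Suc.prems step(1) n tuples_length[OF Suc.prems(1)] by (auto simp: nth_list_update)
      qed (use n in simp)
      then have "free_scale c (om (w[n := x])) + om (w[n := y]) \<in> ?Z"
        using step by (intro free_space.span_add free_space.span_scale) auto
      then show ?case
        using om_add[OF Suc.prems(1) n xV(2)] om_scale[OF Suc.prems(1) n xV(1)] step xV subspace_V
        by (auto intro: subspace_add)
    qed
    then have "om (w[n := w ! n]) \<in> ?Z" using tuples_nth[OF Suc.prems(1) n] E by blast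
    then show ?case by simp
  qed
  from this[of _ k] show "X \<subseteq> ?Z" unfolding X_def by (intro free_space.span_minimal) auto
qed

text \<open>A product of independent vectors is nonzero because an alternating multilinear form,
  the determinant, does not vanish on it. The determinant is built by multiplication in an
  exterior algebra on vectors \<open>e\<^sub>i\<close>. An element of this algebra is represented by its
  coefficients \<open>f S\<close> at the ordered products \<open>e\<^sub>S\<close>, left multiplication by \<open>\<Sum> \<phi>\<^sub>i(v) e\<^sub>i\<close> is
  \<open>eps \<phi> v\<close>, and \<open>det_form\<close> is the coefficient at the product of all \<open>e\<^sub>i\<close> with \<open>i < k\<close>.\<close>
definition sgn_at :: "nat \<Rightarrow> nat set \<Rightarrow> 'k" where
  "sgn_at i S = (- 1) ^ card {j\<in>S. j < i}"

definition eps :: "(nat \<Rightarrow> 'v \<Rightarrow> 'k) \<Rightarrow> 'v \<Rightarrow> (nat set \<Rightarrow> 'k) \<Rightarrow> (nat set \<Rightarrow> 'k)" where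
  "eps \<phi> v f = (\<lambda>S. \<Sum>i\<in>S. sgn_at i S * \<phi> i v * f (S - {i}))"

definition ext_one :: "nat set \<Rightarrow> 'k" where
  "ext_one S = (if S = {} then 1 else 0)"

definition det_form :: "(nat \<Rightarrow> 'v \<Rightarrow> 'k) \<Rightarrow> 'v list \<Rightarrow> 'k" where
  "det_form \<phi> u = foldr (eps \<phi>) u ext_one {..<k}"

lemma eps_lin: "eps \<phi> v (\<lambda>S. f S + g S) = (\<lambda>S. eps \<phi> v f S + eps \<phi> v g S)"
  "eps \<phi> v (\<lambda>S. c * f S) = (\<lambda>S. c * eps \<phi> v f S)"
  by (auto simp: eps_def fun_eq_iff sum.distrib sum_distrib_left algebra_simps)

lemma foldr_eps_lin: "foldr (eps \<phi>) xs (\<lambda>S. f S + g S) = (\<lambda>S. foldr (eps \<phi>) xs f S + foldr (eps \<phi>) xs g S)"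
  "foldr (eps \<phi>) xs (\<lambda>S. c * f S) = (\<lambda>S. c * foldr (eps \<phi>) xs f S)"
  by (induction xs) (simp_all add: eps_lin)

lemma eps_arg:
  assumes "\<And>i. functional (\<phi> i)"
  shows "eps \<phi> (a + b) f = (\<lambda>S. eps \<phi> a f S + eps \<phi> b f S)" "eps \<phi> (scale c a) f = (\<lambda>S. c * eps \<phi> a f S)"
  using lin_add[OF assms] lin_scale[OF assms]
  by (auto simp: eps_def fun_eq_iff sum.distrib sum_distrib_left algebra_simps)

text \<open>Taking away the smaller index moves the larger one by one position, taking away the
  larger index does not move the smaller one.\<close>
lemma sgn_at_swap:
  assumes S: "finite S" "i \<in> S" "j \<in> S" "i \<noteq> j"
  shows "sgn_at i S * sgn_at j (S - {i}) = - (sgn_at j S * sgn_at i (S - {j}))"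
proof -
  have *: "sgn_at i S * sgn_at j (S - {i}) = - (sgn_at j S * sgn_at i (S - {j}))"
    if ij: "i \<in> S" "j \<in> S" "j < i" for i j
  proof -
    have "{l\<in>S - {i}. l < j} = {l\<in>S. l < j}" using ij(3) by auto
    then have 1: "sgn_at j (S - {i}) = sgn_at j S" by (simp add: sgn_at_def)
    have "{l\<in>S. l < i} = insert j {l\<in>S - {j}. l < i}" using ij by auto
    then have "card {l\<in>S. l < i} = Suc (card {l\<in>S - {j}. l < i})" using S(1) by simp
    then have "sgn_at i S = - sgn_at i (S - {j})" by (simp add: sgn_at_def)
    then show ?thesis using 1 by simp
  qed
  show ?thesis
  proof (cases "j < i")
    case True then show ?thesis using * S by blast
  next
    case False
    then have "i < j" using S(4) by simp
    then show ?thesis using *[of j i] S by simp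
  qed
qed

lemma eps_square: "eps \<phi> v (eps \<phi> v f) = (\<lambda>S. 0)"
proof
  fix S
  show "eps \<phi> v (eps \<phi> v f) S = 0"
  proof (cases "finite S")
    case False then show ?thesis by (simp add: eps_def)
  next
    case fin: True
    let ?h = "\<lambda>i j. sgn_at i S * sgn_at j (S - {i}) * (\<phi> i v * \<phi> j v * f (S - {i} - {j}))"
    have "eps \<phi> v (eps \<phi> v f) S = (\<Sum>i\<in>S. \<Sum>j\<in>S - {i}. ?h i j)"
      by (simp add: eps_def sum_distrib_left mult_ac)
    also have "\<dots> = (\<Sum>(i, j)\<in>(SIGMA i:S. S - {i}). ?h i j)" using fin by (simp add: sum.Sigma)
    finally have 1: "eps \<phi> v (eps \<phi> v f) S = (\<Sum>(i, j)\<in>(SIGMA i:S. S - {i}). ?h i j)" .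
    also have "\<dots> = (\<Sum>(i, j)\<in>(SIGMA i:S. S - {i}). - ?h i j)"
    proof (rule sum.reindex_bij_witness[of _ prod.swap prod.swap])
      fix p assume "p \<in> (SIGMA i:S. S - {i})"
      then obtain i j where p: "p = (i, j)" "i \<in> S" "j \<in> S" "i \<noteq> j" by auto
      have "S - {i} - {j} = S - {j} - {i}" by blast
      then have "- ?h j i = ?h i j" unfolding sgn_at_swap[OF fin p(2,3,4)] by (simp add: mult_ac)
      then show "(case prod.swap p of (i, j) \<Rightarrow> - ?h i j) = (case p of (i, j) \<Rightarrow> ?h i j)" by (simp add: p(1))
    qed auto
    also have "\<dots> = - eps \<phi> v (eps \<phi> v f) S" unfolding 1 by (simp add: sum_negf case_prod_unfold)
    finally have "2 * eps \<phi> v (eps \<phi> v f) S = 0" by (simp add: eq_neg_iff_add_eq_0)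
    then show ?thesis by simp
  qed
qed

text \<open>This is the polarisation of \<open>eps_square\<close>.\<close>
lemma eps_anticommute:
  assumes "\<And>i. functional (\<phi> i)" shows "eps \<phi> v (eps \<phi> w f) = (\<lambda>S. - 1 * eps \<phi> w (eps \<phi> v f) S)"
proof
  fix S
  have "eps \<phi> (v + w) (eps \<phi> (v + w) f) S = 0" by (simp add: eps_square)
  then have "eps \<phi> v (eps \<phi> w f) S + eps \<phi> w (eps \<phi> v f) S = 0"
    by (simp add: eps_arg[OF assms] eps_lin eps_square add.commute)
  then show "eps \<phi> v (eps \<phi> w f) S = - 1 * eps \<phi> w (eps \<phi> v f) S" by (simp add: eq_neg_iff_add_eq_0)
qed

lemma eps_repeated:
  assumes "\<And>i. functional (\<phi> i)" shows "eps \<phi> v (foldr (eps \<phi>) ys (eps \<phi> v f)) = (\<lambda>S. 0)"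
proof (induction ys)
  case Nil
  then show ?case by (simp add: eps_square)
next
  case (Cons y ys)
  have "eps \<phi> y (\<lambda>S. 0) = (\<lambda>S. 0)" by (simp add: eps_def)
  moreover have "eps \<phi> v (eps \<phi> y (foldr (eps \<phi>) ys (eps \<phi> v f))) = (\<lambda>S. - 1 * eps \<phi> y (\<lambda>S. 0) S)"
    unfolding eps_anticommute[where \<phi> = \<phi> and v = v and w = y, OF assms] Cons ..
  ultimately show ?case by simp
qed

lemma det_form_alternating:
  assumes "\<And>i. functional (\<phi> i)" "\<not> distinct u" shows "det_form \<phi> u = 0"
proof -
  obtain xs ys zs y where u: "u = xs @ [y] @ ys @ [y] @ zs" using not_distinct_decomp[OF assms(2)] by blast
  have "foldr (eps \<phi>) u ext_one = foldr (eps \<phi>) xs (\<lambda>S. 0 * ext_one S)"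
    unfolding u using eps_repeated[OF assms(1)] by simp
  then show ?thesis unfolding foldr_eps_lin by (simp add: det_form_def)
qed

lemma det_form_update:
  assumes "\<And>i. functional (\<phi> i)" "j < length u"
  shows "det_form \<phi> (u[j := a + b]) = det_form \<phi> (u[j := a]) + det_form \<phi> (u[j := b])"
    "det_form \<phi> (u[j := scale c a]) = c * det_form \<phi> (u[j := a])"
  using assms(2) by (simp_all add: det_form_def upd_conv_take_nth_drop eps_arg[OF assms(1)] foldr_eps_lin)

definition free_eval :: "('v list \<Rightarrow> 'k) \<Rightarrow> ('v list \<Rightarrow>\<^sub>0 'k) \<Rightarrow> 'k" where
  "free_eval F p = (\<Sum>w\<in>Poly_Mapping.keys p. Poly_Mapping.lookup p w * F w)"

lemma free_eval_superset:
  "finite A \<Longrightarrow> Poly_Mapping.keys p \<subseteq> A \<Longrightarrow> free_eval F p = (\<Sum>w\<in>A. Poly_Mapping.lookup p w * F w)"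
  unfolding free_eval_def by (intro sum.mono_neutral_left) (auto simp: in_keys_iff)

lemma free_eval_linear: "Vector_Spaces.linear free_scale (*) (free_eval F)"
proof (rule linI)
  fix p q :: "'v list \<Rightarrow>\<^sub>0 'k" and c :: 'k
  let ?A = "Poly_Mapping.keys p \<union> Poly_Mapping.keys q"
  have "Poly_Mapping.keys (p + q) \<subseteq> ?A" by (rule Poly_Mapping.keys_add)
  then show "free_eval F (p + q) = free_eval F p + free_eval F q"
    by (simp add: free_eval_superset[of ?A] Poly_Mapping.lookup_add distrib_right sum.distrib)
  have "Poly_Mapping.keys (free_scale c p) \<subseteq> Poly_Mapping.keys p"
    by (auto simp: in_keys_iff lookup_free_scale)
  then show "free_eval F (free_scale c p) = c * free_eval F p"
    by (simp add: free_eval_superset[of "Poly_Mapping.keys p"] lookup_free_scale sum_distrib_left mult.assoc)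
qed (auto intro: free_space.vector_space_axioms vector_space_field)

lemma free_eval_word: "free_eval F (word w) = F w"
  by (simp add: free_eval_superset[of "{w}"])

lemma det_form_rel:
  assumes \<phi>: "\<And>i. functional (\<phi> i)" and p: "p \<in> wedge_rel k V"
  shows "free_eval (det_form \<phi>) p = 0"
proof -
  let ?F = "free_eval (det_form \<phi>)"
  note lin = free_eval_linear[of "det_form \<phi>"]
  have "?F (word (w[i := a + b]) - word (w[i := a]) - word (w[i := b])) = 0" if "w \<in> tuples k V" "i < k" for w i a b
    using that tuples_length by (simp add: lin_diff[OF lin] free_eval_word det_form_update[OF \<phi>])
  moreover have "?F (word (w[i := scale c a]) - free_scale c (word (w[i := a]))) = 0" if "w \<in> tuples k V" "i < k" for w i a c
    using that tuples_length by (simp add: lin_diff[OF lin] lin_scale[OF lin] free_eval_word det_form_update[OF \<phi>])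
  moreover have "?F (word w) = 0" if "\<not> distinct w" for w
    using det_form_alternating[OF \<phi> that] by (simp add: free_eval_word)
  moreover have "free_space.subspace {p. ?F p = 0}"
    by (auto simp: free_space.subspace_def lin_zero[OF lin] lin_add[OF lin] lin_scale[OF lin])
  ultimately have "wedge_rel k V \<subseteq> {p. ?F p = 0}"
    unfolding wedge_rel_def by (intro free_space.span_minimal) auto
  then show ?thesis using p by blast
qed

text \<open>The determinant in coordinates dual to the given vectors is \<open>1\<close> on them.\<close>
lemma om_nonzero:
  assumes w: "w \<in> tuples k V" "distinct w" and ind: "independent (set w)"
  shows "om w \<noteq> 0"
proof
  assume "om w = 0"
  then have rel: "word w \<in> wedge_rel k V" by (simp add: om_def cl_eq_0_iff)
  have l: "length w = k" using w(1) by (rule tuples_length)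
  let ?B = "extend_basis (set w)"
  have B: "independent ?B" "span ?B = UNIV" "set w \<subseteq> ?B"
    using independent_extend_basis[OF ind] span_extend_basis[OF ind] extend_basis_superset[OF ind] by auto
  define \<phi> where "\<phi> i x = representation ?B x (w ! i)" for i x
  have \<phi>: "functional (\<phi> i)" for i
    using functional_representation[OF B(1,2)] by (simp add: \<phi>_def[abs_def])
  have 0: "det_form \<phi> w = 0" using det_form_rel[OF \<phi> rel] by (simp add: free_eval_word)
  have dual: "\<phi> i (w ! j) = (if i = j then 1 else 0)" if "i < k" "j < k" for i j
  proof -
    have "w ! j \<in> ?B" using B(3) l that by auto
    then show ?thesis using that l nth_eq_iff_index_eq[OF w(2), of i j] by (simp add: \<phi>_def representation_basis[OF B(1)])
  qed
  \<comment> \<open>The matrix \<open>\<phi> i (w ! j)\<close> is the identity, so each step keeps only the smallest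
    index, whose sign is \<open>1\<close>.\<close>
  have "foldr (eps \<phi>) (drop n w) ext_one {n..<k} = 1" if "n \<le> k" for n
    using that
  proof (induction n rule: inc_induct)
    case base
    then show ?case using l by (simp add: ext_one_def)
  next
    case (step n)
    let ?f = "foldr (eps \<phi>) (drop (Suc n) w) ext_one"
    have "foldr (eps \<phi>) (drop n w) ext_one {n..<k} = (\<Sum>i\<in>{n..<k}. sgn_at i {n..<k} * \<phi> i (w ! n) * ?f ({n..<k} - {i}))"
      using step l by (simp add: Cons_nth_drop_Suc[symmetric] eps_def)
    also have "\<dots> = (\<Sum>i\<in>{n..<k}. if i = n then sgn_at n {n..<k} * ?f ({n..<k} - {n}) else 0)"
      using step by (intro sum.cong refl) (auto simp: dual)
    also have "\<dots> = sgn_at n {n..<k} * ?f ({n..<k} - {n})" using step by simp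
    also have "{n..<k} - {n} = {Suc n..<k}" by auto
    finally have 1: "foldr (eps \<phi>) (drop n w) ext_one {n..<k} = sgn_at n {n..<k} * ?f {Suc n..<k}" .
    have e: "{j\<in>{n..<k}. j < n} = {}" by auto
    have "sgn_at n {n..<k} = 1" unfolding sgn_at_def e by simp
    then show ?case using 1 step by simp
  qed
  from this[of 0] have "det_form \<phi> w = 1" by (simp add: det_form_def atLeast0LessThan)
  then show False using 0 by simp
qed

end

section \<open>The Casimir operator on exterior powers of the degree one part\<close>

context simple_root
begin

abbreviation V1 :: "'v set" where "V1 \<equiv> span (ev ` D1)"

lemma levi_V1: assumes "x \<in> levi D0" "v \<in> V1" shows "br x v \<in> V1"
proof -
  have gen: "br a (ev \<gamma>) \<in> V1" if a: "a \<in> H \<union> ev ` D0" and g: "\<gamma> \<in> D1" for a \<gamma>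
  proof (cases "a \<in> H")
    case True
    then show ?thesis using br_H_ev[OF True D1_root[OF g]] g by (simp add: span_scale span_base)
  next
    case False
    then obtain \<beta> where b: "\<beta> \<in> D0" "a = ev \<beta>" using a by blast
    note r = D0_root[OF b(1)] D1_root[OF g]
    show ?thesis
    proof (cases "\<beta> + \<gamma> \<in> roots H")
      case True
      then have "\<beta> + \<gamma> \<in> D1" using D1_add[OF g b(1)] by (simp add: add.commute)
      then have "scale c (ev (\<beta> + \<gamma>)) \<in> V1" for c by (intro span_scale span_base) blast
      then show ?thesis using G_expand[OF True br_ev_in[OF r]] b(2) by metis
    next
      case False
      then show ?thesis using br_ev_zero[OF r False D1_add_nonzero(2)[OF g b(1)]] b(2) by (simp add: span_zero)
    qed
  qed
  have 1: "br a v \<in> V1" if a: "a \<in> H \<union> ev ` D0" for a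
  proof -
    have "subspace {v. br a v \<in> V1}" by (auto simp: subspace_def br_linear intro: span_zero span_add span_scale)
    then have "V1 \<subseteq> {v. br a v \<in> V1}" using gen[OF a] by (intro span_minimal) auto
    then show ?thesis using assms(2) by blast
  qed
  have "subspace {x. br x v \<in> V1}" by (auto simp: subspace_def br_linear intro: span_zero span_add span_scale)
  then have "levi D0 \<subseteq> {x. br x v \<in> V1}" unfolding levi_def using 1 by (intro span_minimal) auto
  then show ?thesis using assms(1) by blast
qed

lemma br_neg_V1: assumes "\<delta> \<in> D1" "v \<in> V1" shows "br (ev (- \<delta>)) v \<in> levi D0"
proof -
  have gen: "br (ev (- \<delta>)) (ev \<gamma>) \<in> levi D0" if "\<gamma> \<in> D1" for \<gamma>
  proof -
    note r = roots_neg[OF D1_root[OF assms(1)]] D1_root[OF that]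
    consider "\<gamma> = \<delta>" | "- \<delta> + \<gamma> \<in> roots H" | "\<gamma> \<noteq> \<delta>" "- \<delta> + \<gamma> \<notin> roots H" by blast
    then show ?thesis
    proof cases
      case 1
      have "br (ev (- \<delta>)) (ev \<delta>) = riesz (- \<delta>)" using br_ev_neg[OF r(1)] by simp
      then show ?thesis using 1 riesz(1)[OF roots_dual[OF r(1)]] H_levi by simp
    next
      case 2
      then have "- \<delta> + \<gamma> \<in> D0" using D1_diff[OF that assms(1)] by simp
      then show ?thesis using G_expand[OF 2 br_ev_in[OF r]] ev_levi subspace_scale[OF subspace_levi] by metis
    next
      case 3
      then have "- \<delta> + \<gamma> \<noteq> 0" by simp
      then show ?thesis using br_ev_zero[OF r 3(2)] subspace_0[OF subspace_levi] by simp
    qed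
  qed
  have "subspace {v. br (ev (- \<delta>)) v \<in> levi D0}"
    unfolding levi_def by (auto simp: subspace_def br_linear intro: span_zero span_add span_scale)
  then have "V1 \<subseteq> {v. br (ev (- \<delta>)) v \<in> levi D0}" using gen by (intro span_minimal) auto
  then show ?thesis using assms(2) by blast
qed

lemma V1_expand: assumes "v \<in> V1" shows "v = (\<Sum>\<gamma>\<in>D1. scale (killing (ev (- \<gamma>)) v) (ev \<gamma>))"
proof -
  let ?f = "\<lambda>v. \<Sum>\<gamma>\<in>D1. scale (killing (ev (- \<gamma>)) v) (ev \<gamma>)"
  have f: "endo ?f" by (intro endo_sum endo_functional functional_killing)
  have "subspace {v. v = ?f v}"
    unfolding subspace_def by (simp only: mem_Collect_eq lin_zero[OF f] lin_add[OF f] lin_scale[OF f]) auto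
  moreover have "ev \<delta> = ?f (ev \<delta>)" if "\<delta> \<in> D1" for \<delta>
  proof -
    have "?f (ev \<delta>) = (\<Sum>\<gamma>\<in>D1. if \<gamma> = \<delta> then ev \<delta> else 0)"
      using that D1_root by (intro sum.cong refl) (auto simp: killing_ev_ev)
    then show ?thesis using that finite_D1 by simp
  qed
  ultimately have "V1 \<subseteq> {v. v = ?f v}" by (intro span_minimal) auto
  then show ?thesis using assms by blast
qed

lemma ev_inj: "inj_on ev D1"
proof (rule inj_onI)
  fix \<gamma> \<delta> assume *: "\<gamma> \<in> D1" "\<delta> \<in> D1" "ev \<gamma> = ev \<delta>"
  show "\<gamma> = \<delta>"
  proof (rule ccontr)
    assume "\<gamma> \<noteq> \<delta>"
    then show False
      using killing_ev_ev[OF roots_neg[OF D1_root[OF *(1)]] D1_root[OF *(1)]]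
        killing_ev_ev[OF roots_neg[OF D1_root[OF *(1)]] D1_root[OF *(2)]] *(3) by simp
  qed
qed

lemma ev_independent: "independent (ev ` D1)"
proof (rule independent_if_scalars_zero)
  fix f x assume f: "(\<Sum>x\<in>ev ` D1. scale (f x) x) = 0" and x: "x \<in> ev ` D1"
  then obtain \<delta> where d: "\<delta> \<in> D1" "x = ev \<delta>" by blast
  have "0 = killing (ev (- \<delta>)) (\<Sum>\<gamma>\<in>D1. scale (f (ev \<gamma>)) (ev \<gamma>))"
    using f ev_inj by (simp add: sum.reindex killing_linear)
  also have "\<dots> = (\<Sum>\<gamma>\<in>D1. if \<gamma> = \<delta> then f (ev \<delta>) else 0)"
    unfolding killing_linear using d D1_root by (intro sum.cong refl) (auto simp: killing_ev_ev)
  finally show "f x = 0" using d finite_D1 by simp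
qed (use finite_D1 in simp)

lemma dim_V1: "dim V1 = card D1"
  using ev_independent ev_inj by (simp add: dim_eq_card_independent card_image)

end

locale simple_root_power = simple_root scale br H \<Pi> \<alpha>
  for scale :: "'k::{alg_closed_field,field_char_0} \<Rightarrow> 'v::ab_group_add \<Rightarrow> 'v"
    and br :: "'v \<Rightarrow> 'v \<Rightarrow> 'v" and H :: "'v set" and \<Pi> :: "('v \<Rightarrow> 'k) set" and \<alpha> :: "'v \<Rightarrow> 'k" +
  fixes k :: nat
begin

sublocale E: exterior_power scale br "span (ev ` roots_of_ht \<alpha> 1)" k
  by unfold_locales simp

lemma levi_stabilizer: "x \<in> levi D0 \<Longrightarrow> x \<in> E.stabilizer"
  using levi_V1 by (auto simp: E.stabilizer_def)

sublocale M: levi_module scale br H \<Pi> free_scale "roots_of_ht \<alpha> 0" E.X E.rho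
proof (intro levi_module.intro levi_module_axioms.intro)
  show "based_simple_lie_algebra scale br H \<Pi>" by (rule based_simple_lie_algebra_axioms)
  show "vector_space free_scale" by (rule free_space.vector_space_axioms)
qed (auto intro: D0_neg D0_add E.subspace_X E.rho_X E.rho_add_left E.rho_scale_left E.rho_br levi_stabilizer
    simp: lin_add[OF E.rho_linear] lin_scale[OF E.rho_linear] dest: D0_root)

text \<open>The projection \<open>cl\<close> intertwines the action on representatives with \<open>rho\<close>, so
  eigenvectors modulo the relations become eigenvectors in the module \<open>E.X\<close>.\<close>
lemma wedge_eigenvalues_iff:
  "\<mu> \<in> wedge_eigenvalues (grading \<alpha> 0) k (grading \<alpha> 1) \<longleftrightarrow> (\<exists>v\<in>E.X. v \<noteq> 0 \<and> M.cas v = free_scale \<mu> v)"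
proof -
  obtain B d where Bd: "(SOME (B, d). dual_bases (levi D0) B d) = (B, d)" by (meson surj_pair)
  have "\<exists>p. case p of (B, d) \<Rightarrow> dual_bases (levi D0) B d"
    using dual_bases_exist[OF subspace_levi M.dual_family_Psi] by auto
  then have "case (SOME (B, d). dual_bases (levi D0) B d) of (B, d) \<Rightarrow> dual_bases (levi D0) B d" by (rule someI_ex)
  then have db: "dual_bases (levi D0) B d" unfolding Bd by simp
  have in_stab: "b \<in> E.stabilizer" "d b \<in> E.stabilizer" if "b \<in> B" for b
    using db that levi_stabilizer by (auto simp: dual_bases_def)
  have "E.cl (casimir (levi D0) wedge_act p) = casimir (levi D0) E.rho (E.cl p)" for p
  proof -
    have "E.cl (casimir (levi D0) wedge_act p) = (\<Sum>b\<in>B. E.cl (wedge_act (d b) (wedge_act b p)))"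
      by (simp add: casimir_def Bd Let_def lin_sum[OF E.cl_linear])
    also have "\<dots> = (\<Sum>b\<in>B. E.rho (d b) (E.rho b (E.cl p)))"
      by (intro sum.cong refl) (simp add: E.rho_cl in_stab)
    finally show ?thesis by (simp add: casimir_def Bd Let_def)
  qed
  then have cas: "E.cl (casimir (levi D0) wedge_act p) = M.cas (E.cl p)" if "p \<in> wedge_free k V1" for p
    using M.casimir_eq_cas[of "E.cl p"] that E.X_eq by auto
  have "\<mu> \<in> wedge_eigenvalues (levi D0) k V1
      \<longleftrightarrow> (\<exists>p\<in>wedge_free k V1. E.cl p \<noteq> 0 \<and> E.cl (casimir (levi D0) wedge_act p - free_scale \<mu> p) = 0)"
    by (simp add: wedge_eigenvalues_def E.cl_eq_0_iff)
  also have "\<dots> \<longleftrightarrow> (\<exists>p\<in>wedge_free k V1. E.cl p \<noteq> 0 \<and> M.cas (E.cl p) = free_scale \<mu> (E.cl p))"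
    by (intro bex_cong refl) (simp add: lin_diff[OF E.cl_linear] lin_scale[OF E.cl_linear] cas)
  also have "\<dots> \<longleftrightarrow> (\<exists>v\<in>E.X. v \<noteq> 0 \<and> M.cas v = free_scale \<mu> v)" unfolding E.X_eq by blast
  finally show ?thesis by (simp only: grading_0 grading_1)
qed

lemma word_weight:
  assumes g: "set gs \<subseteq> D1" "length gs = k" "distinct gs"
  shows "M.weight_vec (\<Sum>(set gs)) (E.om (map ev gs))"
  unfolding M.weight_vec_def
proof (intro conjI ballI)
  have t: "map ev gs \<in> tuples k V1" using g by (auto simp: tuples_def intro: span_base)
  show "E.om (map ev gs) \<in> E.X" by (rule E.om_X[OF t])
  fix h assume h: "h \<in> H"
  have "E.rho h (E.om (map ev gs)) = (\<Sum>i<k. E.om ((map ev gs)[i := br h (map ev gs ! i)]))"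
    by (rule E.rho_om[OF levi_stabilizer[OF H_levi[OF h]] t])
  also have "\<dots> = (\<Sum>i<k. free_scale ((gs ! i) h) (E.om (map ev gs)))"
  proof (rule sum.cong[OF refl])
    fix i assume i: "i \<in> {..<k}"
    then have gi: "gs ! i \<in> D1" using g by auto
    have "br h (map ev gs ! i) = scale ((gs ! i) h) (map ev gs ! i)" using i g gi h by (simp add: br_H_ev D1_root)
    then show "E.om ((map ev gs)[i := br h (map ev gs ! i)]) = free_scale ((gs ! i) h) (E.om (map ev gs))"
      using E.om_scale[OF t, of i "map ev gs ! i"] i tuples_nth[OF t] by simp
  qed
  also have "\<dots> = free_scale (\<Sum>i<k. (gs ! i) h) (E.om (map ev gs))"
    by (rule free_space.scale_sum_left[symmetric])
  also have "(\<Sum>i<k. (gs ! i) h) = (\<Sum>(set gs)) h"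
  proof -
    have "(\<Sum>A) h = (\<Sum>\<gamma>\<in>A. \<gamma> h)" for A :: "('v \<Rightarrow> 'k) set"
      by (induction A rule: infinite_finite_induct) simp_all
    then have "(\<Sum>(set gs)) h = (\<Sum>\<gamma>\<in>set gs. \<gamma> h)" .
    also have "\<dots> = sum_list (map (\<lambda>\<gamma>. \<gamma> h) gs)" using g(3) by (simp add: sum_list_distinct_conv_sum_set)
    also have "\<dots> = (\<Sum>i<k. (gs ! i) h)" using g(2) by (simp add: sum_list_sum_nth atLeast0LessThan)
    finally show ?thesis by simp
  qed
  finally show "E.rho h (E.om (map ev gs)) = free_scale ((\<Sum>(set gs)) h) (E.om (map ev gs))" .
qed

text \<open>Products of root vectors span the exterior power, so its weights are the sums of
  \<open>k\<close>-element subsets of \<open>D1\<close>. By \<open>highest_weight_eigenvector\<close> the eigenvalue occurs on a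
  vector killed by \<open>e\<^sub>\<beta>\<close> for all \<open>\<beta> \<in> P0\<close>, where \<open>cas_weight\<close> evaluates it.\<close>
lemma eigenvalue_root_set:
  assumes "\<mu> \<in> wedge_eigenvalues (grading \<alpha> 0) k (grading \<alpha> 1)"
  shows "\<exists>S\<subseteq>D1. card S = k \<and> \<mu> = eigen P0 S"
proof -
  obtain p where p: "p \<in> E.X" "p \<noteq> 0" "M.cas p = free_scale \<mu> p" using assms wedge_eigenvalues_iff by blast
  define L where "L = (\<lambda>S. \<Sum>S) ` {S. S \<subseteq> D1 \<and> card S = k}"
  have "finite {S. S \<subseteq> D1 \<and> card S = k}" by (rule finite_subset[of _ "Pow D1"]) (use finite_D1 in auto)
  then have fL: "finite L" unfolding L_def by (rule finite_imageI)
  have L: "L \<subseteq> lattice" unfolding L_def using D1_root roots_lattice by (auto intro!: lattice_sum)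
  have "E.om w \<in> free_space.span {v. \<exists>\<nu>\<in>L. M.weight_vec \<nu> v}" if w: "w \<in> tuples k (ev ` D1)" for w
  proof (cases "distinct w")
    case False
    have "w \<in> tuples k V1" using w by (auto simp: tuples_def intro: span_base)
    then show ?thesis using E.om_not_distinct[OF _ False] free_space.span_zero by simp
  next
    case True
    have "w \<in> lists (ev ` D1)" using w by (auto simp: tuples_def)
    then obtain gs where gs: "w = map ev gs" "set gs \<subseteq> D1" by (auto simp: lists_image)
    then have d: "distinct gs" "length gs = k" using True w by (auto simp: distinct_map tuples_def)
    have "\<Sum>(set gs) \<in> L" unfolding L_def using gs d distinct_card[OF d(1)] by blast
    then show ?thesis using word_weight[OF gs(2) d(2,1)] gs(1) by (intro free_space.span_base) blast
  qed
  then have XL: "E.X \<subseteq> free_space.span {v. \<exists>\<nu>\<in>L. M.weight_vec \<nu> v}"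
    unfolding E.X_spanned[OF refl] by (intro free_space.span_minimal) auto
  obtain \<nu> v where v: "\<nu> \<in> L" "M.weight_vec \<nu> v" "v \<noteq> 0" "M.cas v = free_scale \<mu> v" "\<forall>\<beta>\<in>P0. E.rho (ev \<beta>) v = 0"
    using M.highest_weight_eigenvector[OF fL L XL _ _ p, of P0] by auto
  have "M.cas v = free_scale (form \<nu> \<nu> + (\<Sum>\<beta>\<in>P0. form \<beta> \<nu>)) v + free_scale 2 (\<Sum>\<beta>\<in>P0. E.rho (ev (- \<beta>)) (E.rho (ev \<beta>) v))"
    using half_system_P0 v(1) L lattice_dual by (intro M.cas_weight[OF v(2)]) (auto simp: half_system_def)
  also have "(\<Sum>\<beta>\<in>P0. E.rho (ev (- \<beta>)) (E.rho (ev \<beta>) v)) = 0"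
    using v(5) by (intro sum.neutral ballI) (simp add: lin_zero[OF E.rho_linear])
  finally have "free_scale \<mu> v = free_scale (form \<nu> \<nu> + (\<Sum>\<beta>\<in>P0. form \<beta> \<nu>)) v" using v(4) by simp
  then have "\<mu> = form \<nu> \<nu> + (\<Sum>\<beta>\<in>P0. form \<beta> \<nu>)"
    unfolding free_space.scale_cancel_right using v(3) by blast
  then show ?thesis using v(1) unfolding L_def eigen_def by blast
qed

text \<open>Take the product of the root vectors of \<open>T\<close>. When \<open>e\<^sub>\<beta>\<close> acts on one of the factors, the
  result is zero or a multiple of another factor, because \<open>T\<close> is closed. So \<open>e\<^sub>\<beta>\<close> kills the
  product, and \<open>cas_weight\<close> gives the eigenvalue.\<close>
lemma closed_set_eigenvalue:
  assumes T: "T \<subseteq> D1" "card T = k" and P: "half_system P"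
    and closed: "\<And>\<gamma> \<beta>. \<gamma> \<in> T \<Longrightarrow> \<beta> \<in> P \<Longrightarrow> \<gamma> + \<beta> \<in> roots H \<Longrightarrow> \<gamma> + \<beta> \<in> T"
  shows "eigen P T \<in> wedge_eigenvalues (grading \<alpha> 0) k (grading \<alpha> 1)"
proof -
  have fT: "finite T" using T(1) finite_D1 by (rule finite_subset)
  obtain gs where gs: "set gs = T" "distinct gs" using finite_distinct_list[OF fT] by blast
  have lk: "length gs = k" using gs T(2) distinct_card by fastforce
  let ?w = "map ev gs" and ?v = "E.om (map ev gs)"
  have t: "?w \<in> tuples k V1" using gs T lk by (auto simp: tuples_def intro: span_base)
  have wt: "M.weight_vec (\<Sum>T) ?v" using word_weight[of gs] gs T lk by simp
  have "E.rho (ev \<beta>) ?v = 0" if b: "\<beta> \<in> P" for \<beta>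
  proof -
    have bD: "\<beta> \<in> D0" by (rule half_systemD(1)[OF P b])
    have "E.om (?w[i := br (ev \<beta>) (?w ! i)]) = 0" if i: "i < k" for i
    proof -
      have gi: "gs ! i \<in> T" "gs ! i \<in> D1" using i gs lk T by auto
      have wi: "?w ! i = ev (gs ! i)" using i lk by simp
      note r = D0_root[OF bD] D1_root[OF gi(2)]
      show ?thesis
      proof (cases "\<beta> + gs ! i \<in> roots H")
        case False
        then have "br (ev \<beta>) (?w ! i) = 0" unfolding wi using br_ev_zero[OF r] D1_add_nonzero[OF gi(2) bD] by blast
        then show ?thesis using E.om_zero[OF t i] by simp
      next
        case True
        then have g': "\<beta> + gs ! i \<in> T" using closed[OF gi(1) b] by (simp add: add.commute)
        then obtain j where j: "j < k" "gs ! j = \<beta> + gs ! i" using gs(1) lk by (metis in_set_conv_nth)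
        have "j \<noteq> i" using j(2) roots_nonzero[OF r(1)] by auto
        have wj: "?w ! j = ev (\<beta> + gs ! i)" using j lk by simp
        have "?w[i := ?w ! j] \<in> tuples k V1" using t j by (intro tuples_update tuples_nth)
        moreover have "\<not> distinct (?w[i := ?w ! j])"
        proof -
          have "?w[i := ?w ! j] = ?w[i := ?w ! j, j := ?w ! j]"
            using list_update_id[of "?w[i := ?w ! j]" j] \<open>j \<noteq> i\<close> by simp
          then show ?thesis using \<open>j \<noteq> i\<close> i j lk distinct_update_nth[of i ?w j "?w ! j"] by (simp only: length_map) blast
        qed
        ultimately have "E.om (?w[i := ?w ! j]) = 0" by (rule E.om_not_distinct)
        then have "E.om (?w[i := scale c (?w ! j)]) = 0" for c
          using E.om_scale[OF t i tuples_nth[OF t j(1)]] by simp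
        moreover obtain c where "br (ev \<beta>) (?w ! i) = scale c (?w ! j)"
          unfolding wi wj using G_expand[OF True br_ev_in[OF r]] by blast
        ultimately show ?thesis by simp
      qed
    qed
    then show ?thesis using E.rho_om[OF levi_stabilizer[OF ev_levi[OF bD]] t] by simp
  qed
  then have z: "(\<Sum>\<beta>\<in>P. E.rho (ev (- \<beta>)) (E.rho (ev \<beta>) ?v)) = 0"
    by (intro sum.neutral ballI) (simp add: lin_zero[OF E.rho_linear])
  have "\<Sum>T \<in> dual_space H" using T(1) D1_dual by (intro dual_sum) auto
  then have "M.cas ?v = free_scale (form (\<Sum>T) (\<Sum>T) + (\<Sum>\<beta>\<in>P. form \<beta> (\<Sum>T))) ?v
      + free_scale 2 (\<Sum>\<beta>\<in>P. E.rho (ev (- \<beta>)) (E.rho (ev \<beta>) ?v))"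
    using P by (intro M.cas_weight[OF wt]) (auto simp: half_system_def)
  then have "M.cas ?v = free_scale (eigen P T) ?v" unfolding z eigen_def by simp
  moreover have "?v \<noteq> 0"
  proof (rule E.om_nonzero[OF t])
    show "distinct ?w" using gs T(1) ev_inj by (auto simp: distinct_map intro: inj_on_subset)
    show "independent (set ?w)" using gs(1) T(1) by (intro independent_mono[OF ev_independent]) auto
  qed
  ultimately show ?thesis using wedge_eigenvalues_iff E.om_X[OF t] by blast
qed

text \<open>Let \<open>Q(x, y)\<close> be the sum. Its coefficients with respect to root vectors are the
  numbers \<open>\<Phi>([e\<^sub>-\<^sub>\<gamma>, x], [e\<^sub>-\<^sub>\<delta>, y])\<close>. By invariance and the Jacobi identity, exchanging \<open>x\<close> and
  \<open>y\<close> does not change them when \<open>[x, y] = 0\<close>, so \<open>Q(x, y) = Q(y, x)\<close>. On the other hand the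
  two families of a dual pair may trade places and the factors at \<open>i\<close> and \<open>j\<close> anticommute, so
  \<open>Q(x, y) = - Q(y, x)\<close>.\<close>
lemma mixed_terms_vanish:
  assumes w: "w \<in> tuples k V1" and ij: "i < k" "j < k" "i \<noteq> j" and xy: "x \<in> V1" "y \<in> V1" "br x y = 0"
  shows "(\<Sum>l\<in>levi_index D0. E.om (w[i := br (levi_vec l) x, j := br (levi_dual l) y])) = 0"
proof -
  let ?I = "levi_index D0" and ?u = levi_vec and ?d = levi_dual
  define F where "F a b = E.om (w[i := a, j := b])" for a b
  have F_add1: "F (a + a') b = F a b + F a' b" if "a \<in> V1" "a' \<in> V1" "b \<in> V1" for a a' b
    using E.om_add[OF tuples_update[OF w that(3), of j] ij(1) that(1,2)] ij(3) by (simp add: F_def list_update_swap)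
  have F_add2: "F b (a + a') = F b a + F b a'" if "a \<in> V1" "a' \<in> V1" "b \<in> V1" for a a' b
    using E.om_add[OF tuples_update[OF w that(3), of i] ij(2) that(1,2)] by (simp add: F_def)
  have F_scale1: "F (scale c a) b = free_scale c (F a b)" if "a \<in> V1" "b \<in> V1" for a b c
    using E.om_scale[OF tuples_update[OF w that(2), of j] ij(1) that(1)] ij(3) by (simp add: F_def list_update_swap)
  have F_scale2: "F b (scale c a) = free_scale c (F b a)" if "a \<in> V1" "b \<in> V1" for a b c
    using E.om_scale[OF tuples_update[OF w that(2), of i] ij(2) that(1)] by (simp add: F_def)
  have F: "bilin scale free_scale V1 F"
    unfolding bilin_def using F_add1 F_add2 F_scale1 F_scale2 by blast
  have F_swap: "F a b = - F b a" if "a \<in> V1" "b \<in> V1" for a b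
    unfolding F_def by (rule E.om_swap[OF w ij that])
  have evV: "ev \<gamma> \<in> V1" if "\<gamma> \<in> D1" for \<gamma> using that by (auto intro: span_base)
  have ud: "?u l \<in> levi D0" "?d l \<in> levi D0" if "l \<in> ?I" for l using M.levi_index_in[OF that] by auto
  define Q where "Q x y = (\<Sum>l\<in>?I. F (br (?u l) x) (br (?d l) y))" for x y
  have Q_expand: "Q x y = (\<Sum>\<gamma>\<in>D1. \<Sum>\<delta>\<in>D1. free_scale (killing (br (ev (- \<gamma>)) x) (br (ev (- \<delta>)) y)) (F (ev \<gamma>) (ev \<delta>)))"
    if xy: "x \<in> V1" "y \<in> V1" for x y
  proof -
    have "F (br (?u l) x) (br (?d l) y) = (\<Sum>\<gamma>\<in>D1. \<Sum>\<delta>\<in>D1.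
        free_scale (killing (ev (- \<gamma>)) (br (?u l) x) * killing (ev (- \<delta>)) (br (?d l) y)) (F (ev \<gamma>) (ev \<delta>)))"
      if l: "l \<in> ?I" for l
    proof -
      have a: "br (?u l) x \<in> V1" "br (?d l) y \<in> V1" using ud[OF l] xy by (auto intro: levi_V1)
      have "F (br (?u l) x) (br (?d l) y)
          = F (\<Sum>\<gamma>\<in>D1. scale (killing (ev (- \<gamma>)) (br (?u l) x)) (ev \<gamma>)) (br (?d l) y)"
        using V1_expand[OF a(1)] by simp
      also have "\<dots> = (\<Sum>\<gamma>\<in>D1. free_scale (killing (ev (- \<gamma>)) (br (?u l) x)) (F (ev \<gamma>) (br (?d l) y)))"
        using evV a by (intro bilin_sum(1)[OF F vector_space_axioms free_space.vector_space_axioms subspace_span])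
      also have "\<dots> = (\<Sum>\<gamma>\<in>D1. free_scale (killing (ev (- \<gamma>)) (br (?u l) x))
          (\<Sum>\<delta>\<in>D1. free_scale (killing (ev (- \<delta>)) (br (?d l) y)) (F (ev \<gamma>) (ev \<delta>))))"
      proof (rule sum.cong[OF refl])
        fix \<gamma> assume g: "\<gamma> \<in> D1"
        have "F (ev \<gamma>) (br (?d l) y) = F (ev \<gamma>) (\<Sum>\<delta>\<in>D1. scale (killing (ev (- \<delta>)) (br (?d l) y)) (ev \<delta>))"
          using V1_expand[OF a(2)] by simp
        also have "\<dots> = (\<Sum>\<delta>\<in>D1. free_scale (killing (ev (- \<delta>)) (br (?d l) y)) (F (ev \<gamma>) (ev \<delta>)))"
          using evV g by (intro bilin_sum(2)[OF F vector_space_axioms free_space.vector_space_axioms subspace_span])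
        finally show "free_scale (killing (ev (- \<gamma>)) (br (?u l) x)) (F (ev \<gamma>) (br (?d l) y))
          = free_scale (killing (ev (- \<gamma>)) (br (?u l) x))
              (\<Sum>\<delta>\<in>D1. free_scale (killing (ev (- \<delta>)) (br (?d l) y)) (F (ev \<gamma>) (ev \<delta>)))" by simp
      qed
      finally show ?thesis by (simp add: free_space.scale_sum_right)
    qed
    then have "Q x y = (\<Sum>l\<in>?I. \<Sum>\<gamma>\<in>D1. \<Sum>\<delta>\<in>D1.
        free_scale (killing (ev (- \<gamma>)) (br (?u l) x) * killing (ev (- \<delta>)) (br (?d l) y)) (F (ev \<gamma>) (ev \<delta>)))"
      unfolding Q_def by (intro sum.cong refl)
    also have "\<dots> = (\<Sum>\<gamma>\<in>D1. \<Sum>\<delta>\<in>D1. \<Sum>l\<in>?I.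
        free_scale (killing (ev (- \<gamma>)) (br (?u l) x) * killing (ev (- \<delta>)) (br (?d l) y)) (F (ev \<gamma>) (ev \<delta>)))"
      by (subst sum.swap, intro sum.cong refl, rule sum.swap)
    also have "\<dots> = (\<Sum>\<gamma>\<in>D1. \<Sum>\<delta>\<in>D1. free_scale (killing (br (ev (- \<gamma>)) x) (br (ev (- \<delta>)) y)) (F (ev \<gamma>) (ev \<delta>)))"
    proof (intro sum.cong refl)
      fix \<gamma> \<delta> assume g: "\<gamma> \<in> D1" "\<delta> \<in> D1"
      let ?a = "br (ev (- \<gamma>)) x" and ?b = "br (ev (- \<delta>)) y"
      have kk: "killing a (br z u) = - killing z (br a u)" for a z u
        using killing_invariant'[of z a u] killing_invariant[of z a u] by simp
      have "?b \<in> levi D0" by (rule br_neg_V1[OF g(2) xy(2)])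
      then have b: "(\<Sum>l\<in>?I. scale (killing (?d l) ?b) (?u l)) = ?b" using M.dual_family_Psi by (simp add: dual_family_def)
      have "(\<Sum>l\<in>?I. killing (ev (- \<gamma>)) (br (?u l) x) * killing (ev (- \<delta>)) (br (?d l) y))
          = (\<Sum>l\<in>?I. killing (?d l) ?b * killing (?u l) ?a)"
      proof (rule sum.cong[OF refl])
        fix l
        show "killing (ev (- \<gamma>)) (br (?u l) x) * killing (ev (- \<delta>)) (br (?d l) y) = killing (?d l) ?b * killing (?u l) ?a"
          unfolding kk[of "ev (- \<gamma>)" "?u l" x] kk[of "ev (- \<delta>)" "?d l" y] by (simp only: minus_mult_minus mult.commute)
      qed
      also have "\<dots> = killing (\<Sum>l\<in>?I. scale (killing (?d l) ?b) (?u l)) ?a" by (simp only: killing_linear)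
      also have "\<dots> = killing ?b ?a" by (simp only: b)
      finally have "(\<Sum>l\<in>?I. killing (ev (- \<gamma>)) (br (?u l) x) * killing (ev (- \<delta>)) (br (?d l) y)) = killing ?a ?b"
        by (simp add: killing_sym)
      then show "(\<Sum>l\<in>?I. free_scale (killing (ev (- \<gamma>)) (br (?u l) x) * killing (ev (- \<delta>)) (br (?d l) y)) (F (ev \<gamma>) (ev \<delta>)))
          = free_scale (killing ?a ?b) (F (ev \<gamma>) (ev \<delta>))"
        by (simp only: free_space.scale_sum_left[symmetric])
    qed
    finally show ?thesis .
  qed
  have Q_sym: "Q x y = Q y x"
  proof -
    have "killing (br a x) (br b y) = killing (br a y) (br b x)" for a b
    proof -
      have "br x (br b y) = br (br x b) y" using br_br[of x b y] xy(3) by (simp add: br_linear)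
      also have "\<dots> = br y (br b x)" using br_skew[of "br x b" y] br_skew[of x b] by (simp add: br_linear)
      finally show ?thesis by (simp add: killing_invariant)
    qed
    then show ?thesis unfolding Q_expand[OF xy(1,2)] Q_expand[OF xy(2,1)] by simp
  qed
  have "Q x y = (\<Sum>l\<in>?I. F (br (?d l) x) (br (?u l) y))"
  proof -
    let ?T = "\<lambda>a b. F (br b x) (br a y)"
    have T: "bilin scale free_scale (levi D0) ?T"
      unfolding bilin_def
      using xy levi_V1 by (auto simp: br_add_left br_scale_left F_add1 F_add2 F_scale1 F_scale2)
    have d2: "dual_family (levi D0) ?I ?d ?u" using M.dual_family_Psi by (auto simp: dual_family_def)
    show ?thesis
      unfolding Q_def by (rule dual_family_unique[OF free_space.vector_space_axioms T subspace_levi M.dual_family_Psi d2])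
  qed
  also have "\<dots> = (\<Sum>l\<in>?I. - F (br (?u l) y) (br (?d l) x))"
    using ud xy by (intro sum.cong refl F_swap levi_V1) auto
  also have "\<dots> = - Q y x" by (simp add: Q_def sum_negf)
  finally have "Q x y = - Q x y" using Q_sym by simp
  then have "free_scale 2 (Q x y) = 0" using free_space.scale_left_distrib[of 1 1 "Q x y"] by (metis add.right_inverse free_space.scale_one one_add_one)
  then have "Q x y = 0" by simp
  then show ?thesis by (simp add: Q_def F_def)
qed

text \<open>In \<open>rho_rho_om\<close> the first sum is \<open>\<gamma>\<^sub>\<alpha>(1)\<close> for each of the \<open>k\<close> factors, and the mixed
  terms vanish.\<close>
lemma abelian_eigenvalue:
  assumes w: "w \<in> tuples k V1" "distinct w" "independent (set w)"
    and ab: "\<And>x y. x \<in> set w \<Longrightarrow> y \<in> set w \<Longrightarrow> br x y = 0"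
  shows "of_nat k * gamma1 \<alpha> \<in> wedge_eigenvalues (grading \<alpha> 0) k (grading \<alpha> 1)"
proof -
  let ?I = "levi_index D0" and ?u = levi_vec and ?d = levi_dual
  have l: "length w = k" using w(1) by (rule tuples_length)
  have ud: "?u l \<in> levi D0" "?d l \<in> levi D0" if "l \<in> ?I" for l using M.levi_index_in[OF that] by auto
  have wV: "w ! i \<in> V1" if "i < k" for i using tuples_nth[OF w(1) that] .
  have diag: "(\<Sum>l\<in>?I. E.om (w[i := br (?d l) (br (?u l) (w ! i))])) = free_scale (gamma1 \<alpha>) (E.om w)" if i: "i < k" for i
  proof -
    have "(\<Sum>l\<in>?I. E.om (w[i := br (?d l) (br (?u l) (w ! i))])) = E.om (w[i := \<Sum>l\<in>?I. br (?d l) (br (?u l) (w ! i))])"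
      using ud wV[OF i] levi_V1 by (intro E.om_sum[OF w(1) i, symmetric]) auto
    also have "(\<Sum>l\<in>?I. br (?d l) (br (?u l) (w ! i))) = scale (gamma1 \<alpha>) (w ! i)"
      using adj_cas_V[OF wV[OF i]] by (simp add: adj.cas_def)
    finally show ?thesis using E.om_scale[OF w(1) i wV[OF i]] by simp
  qed
  have "M.cas (E.om w) = (\<Sum>l\<in>?I. (\<Sum>i<k. E.om (w[i := br (?d l) (br (?u l) (w ! i))]))
      + (\<Sum>i<k. \<Sum>j\<in>{..<k} - {i}. E.om (w[i := br (?u l) (w ! i), j := br (?d l) (w ! j)])))"
    unfolding M.cas_def using ud levi_stabilizer w(1) by (intro sum.cong refl E.rho_rho_om) auto
  also have "\<dots> = (\<Sum>i<k. \<Sum>l\<in>?I. E.om (w[i := br (?d l) (br (?u l) (w ! i))]))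
      + (\<Sum>i<k. \<Sum>j\<in>{..<k} - {i}. \<Sum>l\<in>?I. E.om (w[i := br (?u l) (w ! i), j := br (?d l) (w ! j)]))"
  proof -
    have "(\<Sum>l\<in>?I. \<Sum>i<k. \<Sum>j\<in>{..<k} - {i}. E.om (w[i := br (?u l) (w ! i), j := br (?d l) (w ! j)]))
        = (\<Sum>i<k. \<Sum>j\<in>{..<k} - {i}. \<Sum>l\<in>?I. E.om (w[i := br (?u l) (w ! i), j := br (?d l) (w ! j)]))"
      by (subst sum.swap, intro sum.cong refl, rule sum.swap)
    moreover have "(\<Sum>l\<in>?I. \<Sum>i<k. E.om (w[i := br (?d l) (br (?u l) (w ! i))]))
        = (\<Sum>i<k. \<Sum>l\<in>?I. E.om (w[i := br (?d l) (br (?u l) (w ! i))]))" by (rule sum.swap)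
    ultimately show ?thesis by (simp only: sum.distrib)
  qed
  also have "(\<Sum>i<k. \<Sum>l\<in>?I. E.om (w[i := br (?d l) (br (?u l) (w ! i))])) = (\<Sum>i<k. free_scale (gamma1 \<alpha>) (E.om w))"
    using diag by (intro sum.cong refl) auto
  also have "\<dots> = free_scale (of_nat k * gamma1 \<alpha>) (E.om w)"
    by (simp add: free_space.sum_constant_scale)
  also have "(\<Sum>i<k. \<Sum>j\<in>{..<k} - {i}. \<Sum>l\<in>?I. E.om (w[i := br (?u l) (w ! i), j := br (?d l) (w ! j)])) = 0"
    using wV ab l by (intro sum.neutral ballI mixed_terms_vanish[OF w(1)]) auto
  finally have "M.cas (E.om w) = free_scale (of_nat k * gamma1 \<alpha>) (E.om w)" by simp
  then show ?thesis using wedge_eigenvalues_iff E.om_X[OF w(1)] E.om_nonzero[OF w] by blast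
qed

lemma delta_eqI:
  assumes "c \<in> wedge_eigenvalues (grading \<alpha> 0) k (grading \<alpha> 1)"
    "\<And>\<mu>. \<mu> \<in> wedge_eigenvalues (grading \<alpha> 0) k (grading \<alpha> 1) \<Longrightarrow> c - \<mu> \<in> nonneg_rats"
  shows "delta \<alpha> k = c"
proof -
  have iff: "(\<exists>r::rat. 0 \<le> r \<and> d = \<mu> + of_rat r) \<longleftrightarrow> d - \<mu> \<in> nonneg_rats" for d \<mu> :: 'k
    by (auto simp: nonneg_rats_def algebra_simps)
  show ?thesis
    unfolding delta_def iff
  proof (rule the_equality)
    show "c \<in> wedge_eigenvalues (grading \<alpha> 0) k (grading \<alpha> 1) \<and>
      (\<forall>\<mu>\<in>wedge_eigenvalues (grading \<alpha> 0) k (grading \<alpha> 1). c - \<mu> \<in> nonneg_rats)" using assms by blast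
    fix d assume d: "d \<in> wedge_eigenvalues (grading \<alpha> 0) k (grading \<alpha> 1) \<and>
      (\<forall>\<mu>\<in>wedge_eigenvalues (grading \<alpha> 0) k (grading \<alpha> 1). d - \<mu> \<in> nonneg_rats)"
    have "d - c \<in> nonneg_rats" "- (d - c) \<in> nonneg_rats" using d assms by auto
    then have "d - c = 0" by (rule nonneg_rats_antisym)
    then show "d = c" by simp
  qed
qed

end

context simple_root
begin

text \<open>In degree \<open>m - k\<close> the value is attained on the complement of a set that is extremal
  for \<open>P0\<close>, and the bound comes from the bound in degree \<open>k\<close> for the half system \<open>- P0\<close>.\<close>
lemma delta_values:
  assumes \<aa>: "subspace \<aa>" "\<aa> \<subseteq> grading \<alpha> 1" "\<And>x y. x \<in> \<aa> \<Longrightarrow> y \<in> \<aa> \<Longrightarrow> br x y = 0" "k \<le> dim \<aa>"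
    and k: "2 * k \<le> card D1"
  shows "delta \<alpha> k = of_nat k * gamma1 \<alpha>"
    and "delta \<alpha> (card D1 - k) = of_nat k * gamma1 \<alpha> + of_nat (card D1 - 2 * k) * form (\<Sum>D1) \<alpha>"
proof -
  let ?m = "card D1" and ?s = "form (\<Sum>D1) \<alpha>"
  interpret A: simple_root_power scale br H \<Pi> \<alpha> k by unfold_locales
  interpret B: simple_root_power scale br H \<Pi> \<alpha> "card D1 - k" by unfold_locales
  obtain B0 where B0: "B0 \<subseteq> \<aa>" "independent B0" "\<aa> \<subseteq> span B0" "card B0 = dim \<aa>" using basis_exists by blast
  have "finite B0" using B0(2) by (rule finiteI_independent)
  then obtain B1 where B1: "B1 \<subseteq> B0" "card B1 = k" "finite B1"
    using obtain_subset_with_card_n[of k B0] \<aa>(4) B0(4) by metis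
  obtain w where w: "set w = B1" "distinct w" using finite_distinct_list[OF B1(3)] by blast
  have ev_k: "of_nat k * gamma1 \<alpha> \<in> wedge_eigenvalues (grading \<alpha> 0) k (grading \<alpha> 1)"
  proof (rule A.abelian_eigenvalue[OF _ w(2)])
    show "w \<in> tuples k V1"
      using w B1 B0(1) \<aa>(2) distinct_card[OF w(2)] by (auto simp: tuples_def grading_1[symmetric])
    show "independent (set w)" using w(1) B1(1) independent_mono[OF B0(2)] by simp
    show "br x y = 0" if "x \<in> set w" "y \<in> set w" for x y using that w(1) B1(1) B0(1) \<aa>(3) by blast
  qed
  show "delta \<alpha> k = of_nat k * gamma1 \<alpha>"
  proof (rule A.delta_eqI[OF ev_k])
    fix \<mu> assume "\<mu> \<in> wedge_eigenvalues (grading \<alpha> 0) k (grading \<alpha> 1)"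
    then obtain S where "S \<subseteq> D1" "card S = k" "\<mu> = eigen P0 S" using A.eigenvalue_root_set by blast
    then show "of_nat k * gamma1 \<alpha> - \<mu> \<in> nonneg_rats" using eigen_bound[OF half_system_P0] by blast
  qed
  let ?N = "uminus ` P0"
  have N: "half_system ?N" by (rule half_system_neg[OF half_system_P0])
  have NN: "uminus ` ?N = P0" by (simp add: image_image)
  have of_m: "of_nat ?m - 2 * of_nat k = (of_nat (?m - 2 * k) :: 'k)" using k by (simp add: of_nat_diff)
  \<comment> \<open>The set \<open>S\<close> comes from a highest weight vector with the extremal eigenvalue, not
    directly from the abelian subspace.\<close>
  obtain S where S: "S \<subseteq> D1" "card S = k" "eigen P0 S = of_nat k * gamma1 \<alpha>"
    using A.eigenvalue_root_set[OF ev_k] by metis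
  have closed: "\<gamma> + \<beta> \<in> S" if "\<gamma> \<in> S" "\<beta> \<in> P0" "\<gamma> + \<beta> \<in> roots H" for \<gamma> \<beta>
    using eigen_extremal[OF half_system_P0 S(1) _ that] S(2,3) by simp
  have cT: "card (D1 - S) = ?m - k" using S finite_D1 by (simp add: card_Diff_subset finite_subset)
  have "eigen ?N (D1 - S) \<in> wedge_eigenvalues (grading \<alpha> 0) (?m - k) (grading \<alpha> 1)"
  proof (rule B.closed_set_eigenvalue[OF _ cT N])
    fix \<gamma> \<beta> assume g: "\<gamma> \<in> D1 - S" and b: "\<beta> \<in> ?N" and r: "\<gamma> + \<beta> \<in> roots H"
    have bD: "\<beta> \<in> D0" "- \<beta> \<in> P0" using b by (auto intro: D0_neg)
    have "\<gamma> + \<beta> \<in> D1" using D1_add[OF _ bD(1) r] g by blast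
    moreover have "\<gamma> + \<beta> \<notin> S"
    proof
      assume s: "\<gamma> + \<beta> \<in> S"
      have "(\<gamma> + \<beta>) + (- \<beta>) \<in> S" using closed[OF s bD(2)] g D1_root by simp
      then show False using g by simp
    qed
    ultimately show "\<gamma> + \<beta> \<in> D1 - S" by blast
  qed simp
  moreover have "eigen ?N (D1 - S) = of_nat k * gamma1 \<alpha> + of_nat (?m - 2 * k) * ?s"
    unfolding eigen_complement[OF half_system_P0 S(1)] S(2,3) of_m ..
  ultimately have ev_m: "of_nat k * gamma1 \<alpha> + of_nat (?m - 2 * k) * ?s
      \<in> wedge_eigenvalues (grading \<alpha> 0) (?m - k) (grading \<alpha> 1)" by simp
  show "delta \<alpha> (?m - k) = of_nat k * gamma1 \<alpha> + of_nat (?m - 2 * k) * ?s"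
  proof (rule B.delta_eqI[OF ev_m])
    fix \<mu> assume "\<mu> \<in> wedge_eigenvalues (grading \<alpha> 0) (?m - k) (grading \<alpha> 1)"
    then obtain T where T: "T \<subseteq> D1" "card T = ?m - k" "\<mu> = eigen P0 T" using B.eigenvalue_root_set by blast
    have cS: "card (D1 - T) = k" using T finite_D1 k by (simp add: card_Diff_subset finite_subset)
    have "D1 - (D1 - T) = T" using T(1) by blast
    then have "\<mu> = eigen ?N (D1 - T) + of_nat (?m - 2 * k) * ?s"
      using eigen_complement[OF N, of "D1 - T"] T(3) cS of_m by (simp add: NN)
    moreover have "of_nat k * gamma1 \<alpha> - eigen ?N (D1 - T) \<in> nonneg_rats"
      using eigen_bound[OF N, of "D1 - T"] cS by simp
    ultimately show "of_nat k * gamma1 \<alpha> + of_nat (?m - 2 * k) * ?s - \<mu> \<in> nonneg_rats" by simp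
  qed
qed

end

theorem proposition5p1:
  fixes scale :: "'k::{alg_closed_field,field_char_0} \<Rightarrow> 'v::ab_group_add \<Rightarrow> 'v"
    and br :: "'v \<Rightarrow> 'v \<Rightarrow> 'v"
    and H :: "'v set"
    and \<Pi> :: "('v \<Rightarrow> 'k) set"
    and \<alpha> :: "'v \<Rightarrow> 'k"
    and m k :: nat
  assumes "based_simple_lie_algebra scale br H \<Pi>"
    and "\<alpha> \<in> \<Pi>"
    and "m = vector_space.dim scale (based_simple_lie_algebra.grading scale br H \<Pi> \<alpha> 1)"
    and "\<exists>\<aa>. module.subspace scale \<aa> \<and> \<aa> \<subseteq> based_simple_lie_algebra.grading scale br H \<Pi> \<alpha> 1 \<and>
           (\<forall>x\<in>\<aa>. \<forall>y\<in>\<aa>. br x y = 0) \<and> 2 * vector_space.dim scale \<aa> = m"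
    and "2 * k \<le> m"
  shows "based_simple_lie_algebra.delta scale br H \<Pi> \<alpha> k =
           of_nat k * based_simple_lie_algebra.gamma1 scale br H \<Pi> \<alpha> \<and>
         based_simple_lie_algebra.delta scale br H \<Pi> \<alpha> (m - k) =
           of_nat k * based_simple_lie_algebra.gamma1 scale br H \<Pi> \<alpha> +
           of_nat (m - 2 * k) *
             (of_int (based_simple_lie_algebra.q1 scale br H \<Pi> \<alpha>) /
              (2 * based_simple_lie_algebra.dual_coxeter scale br H \<Pi> *
               based_simple_lie_algebra.root_ratio scale br H \<Pi> \<alpha>))"
proof -
  interpret based_simple_lie_algebra scale br H \<Pi> by (rule assms(1))
  interpret simple_root scale br H \<Pi> \<alpha> by unfold_locales (rule assms(2))
  have m: "m = card D1" using assms(3) dim_V1 by (simp only: grading_1)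
  obtain \<aa> where \<aa>: "subspace \<aa>" "\<aa> \<subseteq> grading \<alpha> 1" "\<And>x y. x \<in> \<aa> \<Longrightarrow> y \<in> \<aa> \<Longrightarrow> br x y = 0" "2 * dim \<aa> = m"
    using assms(4) by blast
  have "k \<le> dim \<aa>" "2 * k \<le> card D1" using \<aa>(4) assms(5) m by auto
  from delta_values[OF \<aa>(1-3) this] show ?thesis unfolding q1_constant m by blast
qed

end
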